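(* Let $\Omega\subset\mathbb{R}^d$, $d\in\mathbb{N}$, be a nonempty, open, bounded set, let $\psi\colon\Omega\to[-\infty,\infty]$ be measurable, and assume that $K:=\{v\in H_0^1(\Omega)\mid \psi\le v \text{ a.e. in }\Omega\}$ is nonempty. Let $S\colon H^{-1}(\Omega)\to H_0^1(\Omega)$, $u\mapsto y$, be the solution map of the unilateral obstacle problem: $y\in K$, $\langle -\Delta y-u,v-y\rangle_{H_0^1(\Omega)}\ge 0$ for all $v\in K$. Then for all $p$ with $\max(1,2d/(d+2))<p\le\infty$, the map $S$ is Newton differentiable as a function $S\colon L^p(\Omega)\to H_0^1(\Omega)$ with Newton derivative $DS:=\partial_B^{sw}S$, where $\partial_B^{sw}S$ is the strong-weak Bouligand differential of $S\colon H^{-1}(\Omega)\to H_0^1(\Omega)$.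
   Context: $H_0^1(\Omega)$ is the closure of $C_c^\infty(\Omega)$ in $H^1(\Omega)$, with inner product $(v,w)_{H_0^1(\Omega)}=\int_\Omega\nabla v\cdot\nabla w\,dx$ and the induced norm; $H^{-1}(\Omega)$ is its topological dual, $\langle\cdot,\cdot\rangle_{H_0^1(\Omega)}$ the dual pairing, and $-\Delta\colon H_0^1(\Omega)\to H^{-1}(\Omega)$ is given by $\langle-\Delta v,w\rangle_{H_0^1(\Omega)}=(v,w)_{H_0^1(\Omega)}$. For every $u\in H^{-1}(\Omega)$ the variational inequality has a unique solution $y=S(u)$. For $p>\max(1,2d/(d+2))$, $L^p(\Omega)$ embeds (compactly) into $H^{-1}(\Omega)$ via $f\mapsto(v\mapsto\int_\Omega fv\,dx)$; $S$ on $L^p(\Omega)$ is the restriction along this embedding, and operators in $\mathcal{L}(H^{-1}(\Omega),H_0^1(\Omega))$ are likewise regarded as operators on $L^p(\Omega)$. $\mathcal{L}(X,Y)$ denotes the continuous linear operators between normed spaces $X$ and $Y$. For $F\colon X\to Y$, $x$ is a Gâteaux point if $F$ is directionally differentiable at $x$ and $h\mapsto F'(x;h)$ belongs to $\mathcal{L}(X,Y)$; this operator is denoted $F'(x)$, and $\mathcal{D}_F$ is the set of Gâteaux points. The strong-weak Bouligand differential is $$\partial_B^{sw}F(x):=\{G\in\mathcal{L}(X,Y)\mid \exists\{x_n\}\subset\mathcal{D}_F:\ x_n\to x \text{ in }X,\ F'(x_n)h\rightharpoonup Gh \text{ weakly in }Y\ \forall h\in X\}.$$ A function $F\colon X\to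 Y$ equipped with a set-valued map $DF\colon X\rightrightarrows\mathcal{L}(X,Y)$ with $DF(x)\ne\emptyset$ for all $x\in X$ is Newton differentiable with Newton derivative $DF$ if for all $x\in X$ $$\sup_{G\in DF(x+h)}\frac{\|F(x+h)-F(x)-Gh\|_Y}{\|h\|_X}\to0\quad\text{for }0<\|h\|_X\to0.$$ *)

theory Defs
  imports
    "HOL-Analysis.Analysis"
    "HOL-Library.Function_Algebras"
    "HOL-Probability.Essential_Supremum"
begin

section \<open>Function-valued vector spaces\<close>

instantiation "fun" :: (type, real_vector) real_vector
begin

definition scaleR_fun_def: "scaleR c f = (\<lambda>x. c *\<^sub>R f x)"

instance
  by standard (simp_all add: scaleR_fun_def fun_eq_iff algebra_simps)

end


section \<open>Normed spaces on carrier sets\<close>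

text \<open>
  The spaces below depend on the domain, so they cannot be types. A normed space is given by
  a set of vectors in a type of class \<^class>\<open>real_vector\<close>, together with a norm that is only
  meaningful on that set. Operators are extended by zero outside the carrier of their source;
  with this convention operators that agree on the carrier are equal, and the
  operators between two spaces are closed under the pointwise operations.
\<close>

record 'v normed_sp =
  pts :: "'v set"
  nrm :: "'v \<Rightarrow> real"

definition real_sp :: "real normed_sp"
  where "real_sp = \<lparr>pts = UNIV, nrm = norm\<rparr>"

definition zero_ext :: "'x normed_sp \<Rightarrow> ('x \<Rightarrow> 'y::zero) \<Rightarrow> 'x \<Rightarrow> 'y"
  where "zero_ext X G = (\<lambda>x. if x \<in> pts X then G x else 0)"

definition bounded_ops ::
    "'x::real_vector normed_sp \<Rightarrow> 'y::real_vector normed_sp \<Rightarrow> ('x \<Rightarrow> 'y) set"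
  where "bounded_ops X Y = {G.
     (\<forall>x\<in>pts X. G x \<in> pts Y) \<and>
     (\<forall>x\<in>pts X. \<forall>y\<in>pts X. G (x + y) = G x + G y) \<and>
     (\<forall>c. \<forall>x\<in>pts X. G (c *\<^sub>R x) = c *\<^sub>R G x) \<and>
     (\<exists>C. \<forall>x\<in>pts X. nrm Y (G x) \<le> C * nrm X x) \<and>
     (\<forall>x. x \<notin> pts X \<longrightarrow> G x = 0)}"

definition op_norm :: "'x normed_sp \<Rightarrow> 'y normed_sp \<Rightarrow> ('x \<Rightarrow> 'y) \<Rightarrow> real"
  where "op_norm X Y G = Sup {nrm Y (G x) | x. x \<in> pts X \<and> nrm X x \<le> 1}"

definition dual_sp :: "'x::real_vector normed_sp \<Rightarrow> ('x \<Rightarrow> real) normed_sp"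
  where "dual_sp X = \<lparr>pts = bounded_ops X real_sp, nrm = op_norm X real_sp\<rparr>"

definition strong_lim :: "'x::real_vector normed_sp \<Rightarrow> (nat \<Rightarrow> 'x) \<Rightarrow> 'x \<Rightarrow> bool"
  where "strong_lim X xs x \<longleftrightarrow> (\<lambda>n. nrm X (xs n - x)) \<longlonglongrightarrow> 0"

definition weak_lim :: "'x::real_vector normed_sp \<Rightarrow> (nat \<Rightarrow> 'x) \<Rightarrow> 'x \<Rightarrow> bool"
  where "weak_lim X xs x \<longleftrightarrow> (\<forall>l\<in>pts (dual_sp X). (\<lambda>n. l (xs n)) \<longlonglongrightarrow> l x)"


section \<open>Generalized differentiability\<close>

definition has_dir_deriv ::
    "'x::real_vector normed_sp \<Rightarrow> 'y::real_vector normed_sp \<Rightarrow> ('x \<Rightarrow> 'y) \<Rightarrow> 'x \<Rightarrow> 'x \<Rightarrow> 'y \<Rightarrow> bool"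
  where "has_dir_deriv X Y F x h d \<longleftrightarrow> d \<in> pts Y \<and>
     ((\<lambda>t. nrm Y ((1 / t) *\<^sub>R (F (x + t *\<^sub>R h) - F x) - d)) \<longlongrightarrow> 0) (at_right 0)"

definition dir_deriv ::
    "'x::real_vector normed_sp \<Rightarrow> 'y::real_vector normed_sp \<Rightarrow> ('x \<Rightarrow> 'y) \<Rightarrow> 'x \<Rightarrow> 'x \<Rightarrow> 'y"
  where "dir_deriv X Y F x h = (THE d. has_dir_deriv X Y F x h d)"

definition gateaux_deriv ::
    "'x::real_vector normed_sp \<Rightarrow> 'y::real_vector normed_sp \<Rightarrow> ('x \<Rightarrow> 'y) \<Rightarrow> 'x \<Rightarrow> 'x \<Rightarrow> 'y"
  where "gateaux_deriv X Y F x = zero_ext X (dir_deriv X Y F x)"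

definition gateaux_points ::
    "'x::real_vector normed_sp \<Rightarrow> 'y::real_vector normed_sp \<Rightarrow> ('x \<Rightarrow> 'y) \<Rightarrow> 'x set"
  where "gateaux_points X Y F = {x \<in> pts X.
     (\<forall>h\<in>pts X. \<exists>d. has_dir_deriv X Y F x h d) \<and> gateaux_deriv X Y F x \<in> bounded_ops X Y}"

definition bouligand_sw ::
    "'x::real_vector normed_sp \<Rightarrow> 'y::real_vector normed_sp \<Rightarrow> ('x \<Rightarrow> 'y) \<Rightarrow> 'x \<Rightarrow> ('x \<Rightarrow> 'y) set"
  where "bouligand_sw X Y F x = {G \<in> bounded_ops X Y.
     \<exists>xs. (\<forall>n. xs n \<in> gateaux_points X Y F) \<and> strong_lim X xs x \<and>
       (\<forall>h\<in>pts X. weak_lim Y (\<lambda>n. gateaux_deriv X Y F (xs n) h) (G h))}"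

text \<open>The filter encodes \<open>0 < \<parallel>h\<parallel> \<rightarrow> 0\<close> for \<open>h\<close> in the carrier.\<close>

definition newton_differentiable ::
    "'x::real_vector normed_sp \<Rightarrow> 'y::real_vector normed_sp \<Rightarrow> ('x \<Rightarrow> 'y) \<Rightarrow> ('x \<Rightarrow> ('x \<Rightarrow> 'y) set) \<Rightarrow> bool"
  where "newton_differentiable X Y F DF \<longleftrightarrow>
     (\<forall>x\<in>pts X. F x \<in> pts Y) \<and>
     (\<forall>x\<in>pts X. DF x \<noteq> {} \<and> DF x \<subseteq> bounded_ops X Y) \<and>
     (\<forall>x\<in>pts X.
        ((\<lambda>h. SUP G\<in>DF (x + h). ereal (nrm Y (F (x + h) - F x - G h) / nrm X h)) \<longlongrightarrow> 0)
          (inf (filtercomap (nrm X) (at_right 0)) (principal (pts X))))"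


section \<open>Lebesgue and Sobolev spaces\<close>

text \<open>
  Lebesgue measurable functions on the whole space modulo equality almost everywhere. A class of
  functions on \<open>\<Omega>\<close> is represented by its extension by zero to the whole space.
\<close>

quotient_type (overloaded) 'a L0 = "'a::euclidean_space \<Rightarrow> real" / partial:
  "\<lambda>f g. f \<in> borel_measurable lebesgue \<and> g \<in> borel_measurable lebesgue \<and>
         (AE x in lebesgue. f x = g x)"
proof (rule part_equivpI)
  show "\<exists>f::'a \<Rightarrow> real. f \<in> borel_measurable lebesgue \<and> f \<in> borel_measurable lebesgue \<and>
         (AE x in lebesgue. f x = f x)"
    by (intro exI[of _ "\<lambda>_. 0"]) simp
  show "symp (\<lambda>f g::'a \<Rightarrow> real. f \<in> borel_measurable lebesgue \<and> g \<in> borel_measurable lebesgue \<and>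
         (AE x in lebesgue. f x = g x))"
    by (rule sympI) (auto elim: eventually_mono)
  show "transp (\<lambda>f g::'a \<Rightarrow> real. f \<in> borel_measurable lebesgue \<and> g \<in> borel_measurable lebesgue \<and>
         (AE x in lebesgue. f x = g x))"
    by (rule transpI) (auto elim: eventually_elim2)
qed

instantiation L0 :: (euclidean_space) real_vector
begin

lift_definition zero_L0 :: "'a L0" is "\<lambda>_. 0" by simp

lift_definition plus_L0 :: "'a L0 \<Rightarrow> 'a L0 \<Rightarrow> 'a L0" is "\<lambda>f g x. f x + g x"
  by (auto elim: eventually_elim2)

lift_definition minus_L0 :: "'a L0 \<Rightarrow> 'a L0 \<Rightarrow> 'a L0" is "\<lambda>f g x. f x - g x"
  by (auto elim: eventually_elim2)

lift_definition uminus_L0 :: "'a L0 \<Rightarrow> 'a L0" is "\<lambda>f x. - f x"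
  by (auto elim: eventually_mono)

lift_definition scaleR_L0 :: "real \<Rightarrow> 'a L0 \<Rightarrow> 'a L0" is "\<lambda>c f x. c *\<^sub>R f x"
  by (auto elim: eventually_mono)

instance
  by standard (transfer; simp add: algebra_simps)+

end

definition Lp :: "'a::euclidean_space set \<Rightarrow> ereal \<Rightarrow> 'a L0 normed_sp"
  where "Lp \<Omega> p = \<lparr>
     pts = {f. (AE x in lebesgue. x \<notin> \<Omega> \<longrightarrow> rep_L0 f x = 0) \<and>
       (if p = \<infinity> then \<exists>C. AE x in lebesgue_on \<Omega>. \<bar>rep_L0 f x\<bar> \<le> C
        else integrable (lebesgue_on \<Omega>) (\<lambda>x. \<bar>rep_L0 f x\<bar> powr real_of_ereal p))},
     nrm = (\<lambda>f. if p = \<infinity> then real_of_ereal (esssup (lebesgue_on \<Omega>) (\<lambda>x. ereal \<bar>rep_L0 f x\<bar>))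
        else (LINT x|lebesgue_on \<Omega>. \<bar>rep_L0 f x\<bar> powr real_of_ereal p) powr (1 / real_of_ereal p))\<rparr>"

definition partial_deriv :: "'a::euclidean_space \<Rightarrow> ('a \<Rightarrow> real) \<Rightarrow> 'a \<Rightarrow> real"
  where "partial_deriv i f x = frechet_derivative f (at x) i"

primrec Ck :: "nat \<Rightarrow> ('a::euclidean_space \<Rightarrow> real) \<Rightarrow> bool"
  where
    "Ck 0 f \<longleftrightarrow> continuous_on UNIV f"
  | "Ck (Suc k) f \<longleftrightarrow> f differentiable_on UNIV \<and> (\<forall>i\<in>Basis. Ck k (partial_deriv i f))"

definition test_functions :: "'a::euclidean_space set \<Rightarrow> ('a \<Rightarrow> real) set"
  where "test_functions \<Omega> =
     {\<phi>. (\<forall>k. Ck k \<phi>) \<and> compact (closure {x. \<phi> x \<noteq> 0}) \<and> closure {x. \<phi> x \<noteq> 0} \<subseteq> \<Omega>}"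

definition has_weak_deriv ::
    "'a::euclidean_space set \<Rightarrow> 'a \<Rightarrow> 'a L0 \<Rightarrow> 'a L0 \<Rightarrow> bool"
  where "has_weak_deriv \<Omega> i v g \<longleftrightarrow> g \<in> pts (Lp \<Omega> 2) \<and>
     (\<forall>\<phi>\<in>test_functions \<Omega>.
        (LINT x|lebesgue_on \<Omega>. rep_L0 v x * partial_deriv i \<phi> x) =
        - (LINT x|lebesgue_on \<Omega>. rep_L0 g x * \<phi> x))"

definition weak_deriv :: "'a::euclidean_space set \<Rightarrow> 'a \<Rightarrow> 'a L0 \<Rightarrow> 'a L0"
  where "weak_deriv \<Omega> i v = (THE g. has_weak_deriv \<Omega> i v g)"

definition H1 :: "'a::euclidean_space set \<Rightarrow> 'a L0 normed_sp"
  where "H1 \<Omega> = \<lparr>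
     pts = {v \<in> pts (Lp \<Omega> 2). \<forall>i\<in>Basis. \<exists>g. has_weak_deriv \<Omega> i v g},
     nrm = (\<lambda>v. sqrt ((nrm (Lp \<Omega> 2) v)\<^sup>2 + (\<Sum>i\<in>Basis. (nrm (Lp \<Omega> 2) (weak_deriv \<Omega> i v))\<^sup>2)))\<rparr>"

definition H10_inner :: "'a::euclidean_space set \<Rightarrow> 'a L0 \<Rightarrow> 'a L0 \<Rightarrow> real"
  where "H10_inner \<Omega> v w =
     (LINT x|lebesgue_on \<Omega>. (\<Sum>i\<in>Basis. rep_L0 (weak_deriv \<Omega> i v) x * rep_L0 (weak_deriv \<Omega> i w) x))"

definition H10 :: "'a::euclidean_space set \<Rightarrow> 'a L0 normed_sp"
  where "H10 \<Omega> = \<lparr>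
     pts = {v \<in> pts (H1 \<Omega>).
       \<exists>\<phi>. (\<forall>n. \<phi> n \<in> test_functions \<Omega>) \<and> strong_lim (H1 \<Omega>) (\<lambda>n. abs_L0 (\<phi> n)) v},
     nrm = (\<lambda>v. sqrt (H10_inner \<Omega> v v))\<rparr>"

definition Hm1 :: "'a::euclidean_space set \<Rightarrow> ('a L0 \<Rightarrow> real) normed_sp"
  where "Hm1 \<Omega> = dual_sp (H10 \<Omega>)"

definition neg_Laplace :: "'a::euclidean_space set \<Rightarrow> 'a L0 \<Rightarrow> 'a L0 \<Rightarrow> real"
  where "neg_Laplace \<Omega> v = zero_ext (H10 \<Omega>) (\<lambda>w. H10_inner \<Omega> v w)"

definition Lp_embed :: "'a::euclidean_space set \<Rightarrow> 'a L0 \<Rightarrow> 'a L0 \<Rightarrow> real"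
  where "Lp_embed \<Omega> f =
     zero_ext (H10 \<Omega>) (\<lambda>v. LINT x|lebesgue_on \<Omega>. rep_L0 f x * rep_L0 v x)"


section \<open>The unilateral obstacle problem\<close>

definition obstacle_set :: "'a::euclidean_space set \<Rightarrow> ('a \<Rightarrow> ereal) \<Rightarrow> 'a L0 set"
  where "obstacle_set \<Omega> \<psi> =
     {v \<in> pts (H10 \<Omega>). AE x in lebesgue_on \<Omega>. \<psi> x \<le> ereal (rep_L0 v x)}"

definition obstacle_VI ::
    "'a::euclidean_space set \<Rightarrow> ('a \<Rightarrow> ereal) \<Rightarrow> ('a L0 \<Rightarrow> real) \<Rightarrow> 'a L0 \<Rightarrow> bool"
  where "obstacle_VI \<Omega> \<psi> u y \<longleftrightarrow> y \<in> obstacle_set \<Omega> \<psi> \<and>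
     (\<forall>v\<in>obstacle_set \<Omega> \<psi>. (neg_Laplace \<Omega> y - u) (v - y) \<ge> 0)"

definition obstacle_S ::
    "'a::euclidean_space set \<Rightarrow> ('a \<Rightarrow> ereal) \<Rightarrow> ('a L0 \<Rightarrow> real) \<Rightarrow> 'a L0"
  where "obstacle_S \<Omega> \<psi> u = (THE y. obstacle_VI \<Omega> \<psi> u y)"

definition obstacle_S_Lp :: "'a::euclidean_space set \<Rightarrow> ('a \<Rightarrow> ereal) \<Rightarrow> 'a L0 \<Rightarrow> 'a L0"
  where "obstacle_S_Lp \<Omega> \<psi> f = obstacle_S \<Omega> \<psi> (Lp_embed \<Omega> f)"

text \<open>Operators on the dual space are regarded as operators on \<open>L\<^sup>p\<close> by composition with
  the embedding.\<close>

definition obstacle_DS ::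
    "'a::euclidean_space set \<Rightarrow> ('a \<Rightarrow> ereal) \<Rightarrow> ereal \<Rightarrow> 'a L0 \<Rightarrow> ('a L0 \<Rightarrow> 'a L0) set"
  where "obstacle_DS \<Omega> \<psi> p f =
     (\<lambda>G. zero_ext (Lp \<Omega> p) (\<lambda>h. G (Lp_embed \<Omega> h))) `
       bouligand_sw (Hm1 \<Omega>) (H10 \<Omega>) (obstacle_S \<Omega> \<psi>) (Lp_embed \<Omega> f)"

end

theory Submission
  imports Defs "HOL-Library.Diagonal_Subsequence" "HOL-Library.Lattice_Algebras"
begin

text \<open>
  By the Riesz isomorphism \<open>- \<Delta>\<close>, the solution map becomes the metric projection \<open>P\<close> onto \<open>K\<close>
  in \<open>H\<^sub>0\<^sup>1\<close>. Its difference quotients converge strongly, also along strongly convergent directions,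
  to the projection onto a critical cone. Since \<open>K\<close> is stable under increase and under infima, \<open>P\<close> is
  convex with respect to the pointwise order, and hence every Bouligand derivative \<open>G\<close> at \<open>x\<close>
  satisfies \<open>G (z - x) \<le> P z - P x\<close>. At the point \<open>x + h\<close> this gives
  \<open>P (x + h) - P x \<le> G h \<le> P (x + 2 h) - P (x + h)\<close>. If \<open>h \<rightarrow> 0\<close> and \<open>h / t\<close> converges strongly in
  \<open>H\<^sup>-\<^sup>1\<close>, where \<open>t\<close> is the norm of \<open>h\<close> in \<open>L\<^sup>p\<close>, both bounds divided by \<open>t\<close> tend to the same directional
  derivative, so \<open>G h / t\<close> converges to it as well, first weakly and then strongly because
  \<open>\<parallel>G h\<parallel>\<^sup>2 \<le> (h, G h)\<close>. Strong convergence of \<open>h / t\<close> along subsequences is the compactness of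
  \<open>L\<^sup>p \<subseteq> H\<^sup>-\<^sup>1\<close>. It is obtained from oscillation estimates on cubes, which also yield all
  subcritical Sobolev embeddings. The Bouligand differential is nonempty because \<open>P\<close> is
  Gateaux differentiable at the points \<open>x - c \<mu>\<close>, \<open>c > 0\<close>, for a suitable \<open>\<mu>\<close>.
\<close>

subsection \<open>Hilbert spaces on a subspace of a type\<close>

text \<open>The difficulty is that the derivative operator belongs to the moving point
  \<open>x + h\<close> and is only a weak limit of Gateaux derivatives, so it has no usable
  description relative to \<open>x\<close>. Convexity of \<open>P\<close> supplies what survives: an
  affine minorant with slope G that touches \<open>P\<close> at \<open>x + h\<close>. Evaluated at
  \<open>x\<close> and at \<open>x + 2 h\<close> it gives the two-sided bound, and since directional
  derivatives are positively homogeneous, the upper quotient tends to \<open>2 d - d = d\<close>.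
  Convexity in turn rests on the two stability properties of K: stability under increase makes the
  residual \<open>P u - u\<close> a nonnegative functional, and stability under infima makes
  truncations admissible competitors. Order and topology are linked by one functional, the mass of
  the absolute value, which tends to zero along weakly null sequences. It takes the place of
  capacities and quasi-continuous representatives: the critical cone is built from weak limits, and
  neither the contact set nor the contact force is described pointwise.\<close>

lemma tendsto_if_subseq:
  fixes a :: "nat \<Rightarrow> real"
  assumes "\<And>r. strict_mono (r :: nat \<Rightarrow> nat) \<Longrightarrow> \<exists>s. strict_mono (s :: nat \<Rightarrow> nat) \<and> (\<lambda>n. a (r (s n))) \<longlonglongrightarrow> L"
  shows "a \<longlonglongrightarrow> L"
proof (rule ccontr)
  assume "\<not> a \<longlonglongrightarrow> L"
  then obtain \<epsilon> where e: "\<epsilon> > 0" "\<And>N. \<exists>n\<ge>N. \<bar>a n - L\<bar> \<ge> \<epsilon>"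
    unfolding LIMSEQ_iff real_norm_def by (metis not_less)
  then have "infinite {n. \<bar>a n - L\<bar> \<ge> \<epsilon>}"
    unfolding infinite_nat_iff_unbounded_le by blast
  then obtain r :: "nat \<Rightarrow> nat" where r: "strict_mono r" "\<And>n. \<bar>a (r n) - L\<bar> \<ge> \<epsilon>"
    using infinite_enumerate[of "{n. \<bar>a n - L\<bar> \<ge> \<epsilon>}"] by auto
  obtain s :: "nat \<Rightarrow> nat" where s: "(\<lambda>n. a (r (s n))) \<longlonglongrightarrow> L" using assms[OF r(1)] by blast
  then obtain n where "\<bar>a (r (s n)) - L\<bar> < \<epsilon>"
    using e(1) unfolding LIMSEQ_iff real_norm_def by blast
  with r(2)[of "s n"] show False by simp
qed

text \<open>Definiteness is kept apart: the forms are total functions on a type of vectors and are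
  required to separate points only on the carrier introduced in \<open>hilbert\<close>.\<close>

locale semi_inner =
  fixes ip :: "'v::real_vector \<Rightarrow> 'v \<Rightarrow> real"
  assumes ip_commute: "ip x y = ip y x"
    and ip_add_left: "ip (x + y) z = ip x z + ip y z"
    and ip_scale_left: "ip (c *\<^sub>R x) y = c * ip x y"
    and ip_nonneg: "0 \<le> ip x x"
begin

lemma ip_add_right: "ip z (x + y) = ip z x + ip z y"
  by (metis ip_add_left ip_commute)

lemma ip_scale_right: "ip y (c *\<^sub>R x) = c * ip y x"
  by (metis ip_scale_left ip_commute)

lemma ip_minus_left: "ip (- x) y = - ip x y"
  using ip_scale_left[of "-1" x y] by simp

lemma ip_minus_right: "ip y (- x) = - ip y x"
  by (metis ip_minus_left ip_commute)

lemma ip_diff_left: "ip (x - y) z = ip x z - ip y z"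
  using ip_add_left[of x "-y" z] by (simp add: ip_minus_left)

lemma ip_diff_right: "ip z (x - y) = ip z x - ip z y"
  by (metis ip_diff_left ip_commute)

lemma ip_zero_left [simp]: "ip 0 y = 0"
  using ip_scale_left[of 0 0 y] by simp

lemma ip_zero_right [simp]: "ip y 0 = 0"
  by (metis ip_zero_left ip_commute)

lemmas ip_simps = ip_add_left ip_add_right ip_diff_left ip_diff_right
  ip_minus_left ip_minus_right ip_scale_left ip_scale_right

definition nr :: "'v \<Rightarrow> real" where "nr x = sqrt (ip x x)"

lemma nr_nonneg [simp]: "0 \<le> nr x"
  by (simp add: nr_def ip_nonneg)

lemma nr_zero [simp]: "nr 0 = 0"
  by (simp add: nr_def)

lemma nr_square: "(nr x)\<^sup>2 = ip x x"
  by (simp add: nr_def ip_nonneg)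

lemma nr_scale: "nr (c *\<^sub>R x) = \<bar>c\<bar> * nr x"
  by (simp add: nr_def ip_simps real_sqrt_mult flip: mult.assoc power2_eq_square)

lemma nr_minus [simp]: "nr (- x) = nr x"
  by (simp add: nr_def ip_simps)

lemma nr_commute: "nr (x - y) = nr (y - x)"
  using nr_minus[of "x - y"] by simp

lemma Cauchy_Schwarz: "\<bar>ip x y\<bar> \<le> nr x * nr y"
proof -
  have "(ip x y)\<^sup>2 \<le> ip x x * ip y y"
  proof (cases "ip y y = 0")
    case True
    have "0 \<le> ip x x - 2 * t * ip x y" for t
      using ip_nonneg[of "x - t *\<^sub>R y"] True ip_commute[of x y] by (simp add: ip_simps)
    \<comment> \<open>If y has length zero, the square is affine in t; at this t it would equal -1
      unless \<open>ip x y\<close> vanishes.\<close>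
    from this[of "(ip x x + 1) / (2 * ip x y)"] have "ip x y = 0"
      by (cases "ip x y = 0") auto
    then show ?thesis using True by simp
  next
    case False
    then have pos: "ip y y > 0" using ip_nonneg[of y] by simp
    have "0 \<le> ip x x - (ip x y)\<^sup>2 / ip y y"
      using ip_nonneg[of "x - (ip x y / ip y y) *\<^sub>R y"] pos ip_commute[of x y]
      by (simp add: ip_simps power2_eq_square)
    then show ?thesis using pos by (simp add: field_simps)
  qed
  then have "sqrt ((ip x y)\<^sup>2) \<le> sqrt (ip x x * ip y y)"
    by (rule real_sqrt_le_mono)
  then show ?thesis by (simp add: nr_def real_sqrt_mult)
qed

lemma ip_le: "ip x y \<le> nr x * nr y"
  using Cauchy_Schwarz[of x y] by simp

lemma nr_triangle: "nr (x + y) \<le> nr x + nr y"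
proof (rule power2_le_imp_le)
  show "(nr (x + y))\<^sup>2 \<le> (nr x + nr y)\<^sup>2"
    using ip_le[of x y] by (simp add: power2_sum nr_square ip_simps ip_commute[of y x])
qed simp

lemma nr_diff_triangle: "nr (x - z) \<le> nr (x - y) + nr (y - z)"
  using nr_triangle[of "x - y" "y - z"] by simp

lemma nr_reverse_triangle: "\<bar>nr x - nr y\<bar> \<le> nr (x - y)"
  using nr_triangle[of "x - y" y] nr_triangle[of "y - x" x] nr_commute[of x y] by simp

lemma nr_tendsto_0_iff: "((\<lambda>n. nr (xs n)) \<longlongrightarrow> 0) F \<longleftrightarrow> ((\<lambda>n. ip (xs n) (xs n)) \<longlongrightarrow> 0) F"
proof
  assume "((\<lambda>n. nr (xs n)) \<longlongrightarrow> 0) F"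
  then show "((\<lambda>n. ip (xs n) (xs n)) \<longlongrightarrow> 0) F"
    using tendsto_power[of "\<lambda>n. nr (xs n)" 0 F 2] by (simp add: nr_square)
next
  assume "((\<lambda>n. ip (xs n) (xs n)) \<longlongrightarrow> 0) F"
  then show "((\<lambda>n. nr (xs n)) \<longlongrightarrow> 0) F"
    using tendsto_real_sqrt[of "\<lambda>n. ip (xs n) (xs n)" 0 F] by (simp add: nr_def)
qed

definition sconv :: "(nat \<Rightarrow> 'v) \<Rightarrow> 'v \<Rightarrow> bool"
  where "sconv xs x \<longleftrightarrow> (\<lambda>n. nr (xs n - x)) \<longlonglongrightarrow> 0"

lemma sconv_const: "sconv (\<lambda>n. x) x"
  by (simp add: sconv_def)

lemma sconv_add: "sconv xs x \<Longrightarrow> sconv ys y \<Longrightarrow> sconv (\<lambda>n. xs n + ys n) (x + y)"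
  unfolding sconv_def
  by (rule tendsto_sandwich[of "\<lambda>_. 0" _ _ "\<lambda>n. nr (xs n - x) + nr (ys n - y)"])
     (auto intro!: always_eventually order_trans[OF _ nr_triangle] tendsto_add_zero simp: algebra_simps)

lemma sconv_scale: "sconv xs x \<Longrightarrow> sconv (\<lambda>n. c *\<^sub>R xs n) (c *\<^sub>R x)"
  unfolding sconv_def
  by (simp add: nr_scale tendsto_mult_right_zero flip: scaleR_right_diff_distrib)

lemma sconv_diff: "sconv xs x \<Longrightarrow> sconv ys y \<Longrightarrow> sconv (\<lambda>n. xs n - ys n) (x - y)"
  using sconv_add[of xs x "\<lambda>n. (-1) *\<^sub>R ys n" "(-1) *\<^sub>R y"] sconv_scale[of ys y "-1"] by simp

lemma sconv_subseq: "sconv xs x \<Longrightarrow> strict_mono r \<Longrightarrow> sconv (\<lambda>n. xs (r n)) x"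
  unfolding sconv_def using LIMSEQ_subseq_LIMSEQ[of "\<lambda>n. nr (xs n - x)" 0 r] by (simp add: o_def)

lemma sconv_nr: "sconv xs x \<Longrightarrow> (\<lambda>n. nr (xs n)) \<longlonglongrightarrow> nr x"
  unfolding sconv_def
  by (rule LIM_zero_cancel, rule tendsto_rabs_zero_cancel,
      rule tendsto_sandwich[of "\<lambda>_. 0" _ _ "\<lambda>n. nr (xs n - x)"])
     (auto simp: nr_reverse_triangle)

lemma sconv_ip_self: "sconv xs x \<Longrightarrow> (\<lambda>n. ip (xs n) (xs n)) \<longlonglongrightarrow> ip x x"
  using tendsto_power[OF sconv_nr, of xs x 2] by (simp add: nr_square)

lemma sconv_bounded: "sconv xs x \<Longrightarrow> \<exists>C. \<forall>n. nr (xs n) \<le> C"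
  using convergent_imp_Bseq[OF convergentI[OF sconv_nr, of xs x]] by (auto simp: Bseq_def)

end

locale hilbert = semi_inner ip
  for ip :: "'v::real_vector \<Rightarrow> 'v \<Rightarrow> real" +
  fixes H :: "'v set"
  assumes subspace_H: "subspace H"
    and ip_definite: "x \<in> H \<Longrightarrow> ip x x = 0 \<Longrightarrow> x = 0"
    and H_complete: "\<And>xs. (\<And>n. xs n \<in> H) \<Longrightarrow>
       (\<And>\<epsilon>. \<epsilon> > 0 \<Longrightarrow> \<exists>N. \<forall>m\<ge>N. \<forall>n\<ge>N. nr (xs m - xs n) < \<epsilon>) \<Longrightarrow> \<exists>x\<in>H. sconv xs x"
begin

lemma H_zero [simp]: "0 \<in> H" and H_add [simp]: "x \<in> H \<Longrightarrow> y \<in> H \<Longrightarrow> x + y \<in> H"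
  and H_scale [simp]: "x \<in> H \<Longrightarrow> c *\<^sub>R x \<in> H"
  and H_diff [simp]: "x \<in> H \<Longrightarrow> y \<in> H \<Longrightarrow> x - y \<in> H"
  and H_minus [simp]: "x \<in> H \<Longrightarrow> - x \<in> H"
  using subspace_H by (auto simp: subspace_0 subspace_add subspace_scale subspace_diff subspace_neg)

lemma nr_eq_0D: "x \<in> H \<Longrightarrow> nr x = 0 \<Longrightarrow> x = 0"
  using ip_definite[of x] nr_square[of x] by simp

lemma eqI_nr: "x \<in> H \<Longrightarrow> y \<in> H \<Longrightarrow> ip (x - y) (x - y) \<le> 0 \<Longrightarrow> x = y"
  using ip_definite[of "x - y"] ip_nonneg[of "x - y"] by simp

definition sclosed :: "'v set \<Rightarrow> bool"
  where "sclosed K \<longleftrightarrow> (\<forall>xs x. (\<forall>n. xs n \<in> K) \<longrightarrow> x \<in> H \<longrightarrow> sconv xs x \<longrightarrow> x \<in> K)"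

text \<open>The quadratic energy \<open>J\<close> is minimised over K: convexity makes minimising
  sequences Cauchy, and the inequality is the first-order condition at the minimiser. The functional
  u is a general bounded linear one, so that a single proof serves the Riesz representation,
  orthogonal projections onto closed subspaces and the obstacle problem.\<close>

lemma variational_ineq_exists:
  assumes K: "K \<subseteq> H" "convex K" "sclosed K" "K \<noteq> {}"
    and add: "\<And>v w. v \<in> H \<Longrightarrow> w \<in> H \<Longrightarrow> u (v + w) = u v + u w"
    and scale: "\<And>c v. v \<in> H \<Longrightarrow> u (c *\<^sub>R v) = c * u v"
    and bdd: "\<And>v. v \<in> H \<Longrightarrow> \<bar>u v\<bar> \<le> C * nr v"
  shows "\<exists>y\<in>K. \<forall>v\<in>K. u (v - y) \<le> ip y (v - y)"
proof -
  define J where "J v = ip v v / 2 - u v" for v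
  have u_diff: "u (v - w) = u v - u w" if "v \<in> H" "w \<in> H" for v w
    using add[of v "(-1) *\<^sub>R w"] scale[of w "-1"] that by simp
  have J_lower: "- C\<^sup>2 / 2 \<le> J v" if "v \<in> H" for v
  proof -
    have "0 \<le> (nr v - C)\<^sup>2" by simp
    then show ?thesis
      using bdd[OF that] by (simp add: J_def power2_diff nr_square mult.commute)
  qed
  define m where "m = Inf (J ` K)"
  have bb: "bdd_below (J ` K)" using J_lower K(1) by (auto intro!: bdd_belowI2)
  have m_le: "m \<le> J v" if "v \<in> K" for v
    unfolding m_def using that bb by (simp add: cInf_lower)
  have "\<exists>v\<in>K. J v < m + 1 / real (Suc n)" for n
    using cInf_lessD[of "J ` K" "m + 1 / real (Suc n)"] K(4) by (auto simp: m_def)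
  then obtain vs where vs: "\<And>n. vs n \<in> K" "\<And>n. J (vs n) < m + 1 / real (Suc n)"
    by metis
  have vsH: "vs n \<in> H" for n using vs K by blast
  \<comment> \<open>The parallelogram identity; the midpoint belongs to K and therefore has energy
    at least m.\<close>
  have par: "ip (v - w) (v - w) \<le> 4 * (J v + J w - 2 * m)" if "v \<in> K" "w \<in> K" for v w
  proof -
    have mid: "(1/2) *\<^sub>R v + (1/2) *\<^sub>R w \<in> K"
      using convexD[OF K(2) that, of "1/2" "1/2"] by simp
    have "v \<in> H" "w \<in> H" using that K by auto
    then have uu: "u ((1/2) *\<^sub>R v + (1/2) *\<^sub>R w) = u v / 2 + u w / 2"
      by (simp add: add scale)
    have "ip (v - w) (v - w) / 4 = J v + J w - 2 * J ((1/2) *\<^sub>R v + (1/2) *\<^sub>R w)"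
      unfolding J_def uu by (simp add: ip_simps ip_commute[of w v] field_simps)
    then show ?thesis using m_le[OF mid] by simp
  qed
  have "\<exists>y\<in>H. sconv vs y"
  proof (rule H_complete[OF vsH])
    fix \<epsilon> :: real assume e: "\<epsilon> > 0"
    obtain N where N: "1 / real (Suc N) < \<epsilon>\<^sup>2 / 8"
      using nat_approx_posE[of "\<epsilon>\<^sup>2 / 8"] e by auto
    show "\<exists>N. \<forall>m\<ge>N. \<forall>n\<ge>N. nr (vs m - vs n) < \<epsilon>"
    proof (intro exI allI impI)
      fix a b assume ab: "a \<ge> N" "b \<ge> N"
      have i: "1 / real (Suc k) \<le> 1 / real (Suc N)" if "k \<ge> N" for k
        using that by (simp add: frac_le)
      have "ip (vs a - vs b) (vs a - vs b) < \<epsilon>\<^sup>2"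
        using par[OF vs(1)[of a] vs(1)[of b]] vs(2)[of a] vs(2)[of b] i[OF ab(1)] i[OF ab(2)] N by simp
      then show "nr (vs a - vs b) < \<epsilon>"
        using e by (simp add: nr_def real_less_lsqrt ip_nonneg)
    qed
  qed
  then obtain y where y: "y \<in> H" "sconv vs y" by blast
  have yK: "y \<in> K" using K(3) vs(1) y unfolding sclosed_def by blast
  have "(\<lambda>n. u (vs n - y)) \<longlonglongrightarrow> 0"
  proof (rule tendsto_rabs_zero_cancel, rule tendsto_sandwich[of "\<lambda>_. 0" _ _ "\<lambda>n. C * nr (vs n - y)"])
    show "(\<lambda>n. C * nr (vs n - y)) \<longlonglongrightarrow> 0"
      using y(2) unfolding sconv_def by (rule tendsto_mult_right_zero)
  qed (use bdd vsH y in auto)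
  then have "(\<lambda>n. u (vs n)) \<longlonglongrightarrow> u y"
    using u_diff[OF vsH y(1)] by (simp add: LIM_zero_iff)
  then have "(\<lambda>n. J (vs n)) \<longlonglongrightarrow> J y"
    unfolding J_def by (intro tendsto_diff tendsto_divide sconv_ip_self y(2)) auto
  moreover have "(\<lambda>n. m + 1 / real (Suc n)) \<longlonglongrightarrow> m + 0"
    by (intro tendsto_add tendsto_const LIMSEQ_Suc[OF lim_1_over_n])
  ultimately have Jy: "J y \<le> m"
    using LIMSEQ_le[of "\<lambda>n. J (vs n)" "J y" "\<lambda>n. m + 1 / real (Suc n)" "m + 0"] vs(2)
    by (simp add: less_imp_le)
  have "u (v - y) \<le> ip y (v - y)" if v: "v \<in> K" for v
  proof -
    have vH: "v \<in> H" using v K by blast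
    \<comment> \<open>Optimality along the segment from y to v, divided by the parameter s; letting
      s tend to 0 removes the quadratic term.\<close>
    have main: "0 \<le> (ip y (v - y) - u (v - y)) + s * (ip (v - y) (v - y) / 2)" if s: "0 < s" "s < 1" for s
    proof -
      have eq: "y + s *\<^sub>R (v - y) = (1 - s) *\<^sub>R y + s *\<^sub>R v" by (simp add: algebra_simps)
      have "y + s *\<^sub>R (v - y) \<in> K"
        unfolding eq using convexD[OF K(2) yK v, of "1 - s" s] s by simp
      from m_le[OF this] Jy have "J y \<le> J (y + s *\<^sub>R (v - y))" by simp
      also have "\<dots> = J y + s * ((ip y (v - y) - u (v - y)) + s * (ip (v - y) (v - y) / 2))"
        unfolding J_def using vH y(1)
        by (simp add: add scale) (simp add: ip_simps ip_commute[of v y] field_simps)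
      finally show ?thesis using s by (simp add: zero_le_mult_iff)
    qed
    have "((\<lambda>s. (ip y (v - y) - u (v - y)) + s * (ip (v - y) (v - y) / 2)) \<longlongrightarrow>
       (ip y (v - y) - u (v - y)) + 0 * (ip (v - y) (v - y) / 2)) (at_right 0)"
      by (intro tendsto_intros)
    moreover have "\<forall>\<^sub>F s in at_right (0::real). 0 \<le> (ip y (v - y) - u (v - y)) + s * (ip (v - y) (v - y) / 2)"
      by (rule eventually_at_rightI[of 0 1]) (use main in auto)
    ultimately have "0 \<le> (ip y (v - y) - u (v - y)) + 0 * (ip (v - y) (v - y) / 2)"
      by (rule tendsto_lowerbound) simp
    then show ?thesis by simp
  qed
  then show ?thesis using yK by blast
qed

text \<open>H itself is an admissible convex set. Since competitors may be shifted by y and may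
  change sign, the variational inequality becomes an equality.\<close>

lemma Riesz:
  assumes "\<And>v w. v \<in> H \<Longrightarrow> w \<in> H \<Longrightarrow> u (v + w) = u v + u w"
    and "\<And>c v. v \<in> H \<Longrightarrow> u (c *\<^sub>R v) = c * u v"
    and "\<And>v. v \<in> H \<Longrightarrow> \<bar>u v\<bar> \<le> C * nr v"
  shows "\<exists>y\<in>H. \<forall>v\<in>H. u v = ip y v"
proof -
  have "sclosed H" "convex H"
    using subspace_H by (auto simp: sclosed_def subspace_imp_convex)
  from variational_ineq_exists[OF order_refl this(2,1) _ assms]
  obtain y where y: "y \<in> H" "\<And>v. v \<in> H \<Longrightarrow> u (v - y) \<le> ip y (v - y)"
    using H_zero by blast
  have "u v \<le> ip y v" if "v \<in> H" for v using y(2)[of "v + y"] y(1) that by simp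
  note le = this
  have "u v = ip y v" if "v \<in> H" for v
    using that assms(2)[of v "-1"] le[of v] le[of "- v"] by (simp add: ip_simps)
  then show ?thesis using y(1) by blast
qed

text \<open>Membership and boundedness are built in, so that weak limits combine directly with norm
  estimates; boundedness takes the place of the uniform boundedness principle.\<close>

definition wconv :: "(nat \<Rightarrow> 'v) \<Rightarrow> 'v \<Rightarrow> bool"
  where "wconv xs x \<longleftrightarrow> (\<forall>n. xs n \<in> H) \<and> x \<in> H \<and> (\<exists>C. \<forall>n. nr (xs n) \<le> C) \<and>
     (\<forall>w\<in>H. (\<lambda>n. ip (xs n) w) \<longlonglongrightarrow> ip x w)"

lemma wconvD: "wconv xs x \<Longrightarrow> w \<in> H \<Longrightarrow> (\<lambda>n. ip (xs n) w) \<longlonglongrightarrow> ip x w"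
  and wconvD': "wconv xs x \<Longrightarrow> w \<in> H \<Longrightarrow> (\<lambda>n. ip w (xs n)) \<longlonglongrightarrow> ip w x"
  by (auto simp: wconv_def ip_commute[of w])

lemma wconv_mem: "wconv xs x \<Longrightarrow> xs n \<in> H" and wconv_lim: "wconv xs x \<Longrightarrow> x \<in> H"
  and wconv_bdd: "wconv xs x \<Longrightarrow> \<exists>C. \<forall>n. nr (xs n) \<le> C"
  by (auto simp: wconv_def)

lemma wconv_add:
  assumes "wconv xs x" "wconv ys y" shows "wconv (\<lambda>n. xs n + ys n) (x + y)"
proof -
  obtain C D where "\<And>n. nr (xs n) \<le> C" "\<And>n. nr (ys n) \<le> D" using assms by (auto simp: wconv_def)
  then have "nr (xs n + ys n) \<le> C + D" for n
    using nr_triangle[of "xs n" "ys n"] by (meson add_mono order_trans)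
  then show ?thesis using assms by (auto simp: wconv_def ip_add_left intro!: tendsto_add)
qed

lemma wconv_scale:
  assumes "wconv xs x" shows "wconv (\<lambda>n. c *\<^sub>R xs n) (c *\<^sub>R x)"
proof -
  obtain C where "\<And>n. nr (xs n) \<le> C" using assms by (auto simp: wconv_def)
  then have "nr (c *\<^sub>R xs n) \<le> \<bar>c\<bar> * C" for n by (simp add: nr_scale mult_left_mono)
  then show ?thesis using assms by (auto simp: wconv_def ip_scale_left intro!: tendsto_mult)
qed

lemma wconv_minus: "wconv xs x \<Longrightarrow> wconv (\<lambda>n. - xs n) (- x)"
  using wconv_scale[of xs x "-1"] by simp

lemma wconv_diff: "wconv xs x \<Longrightarrow> wconv ys y \<Longrightarrow> wconv (\<lambda>n. xs n - ys n) (x - y)"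
  using wconv_add[OF _ wconv_minus, of xs x ys y] by simp

lemma sconv_imp_wconv: assumes "sconv xs x" "\<And>n. xs n \<in> H" "x \<in> H" shows "wconv xs x"
proof -
  have "(\<lambda>n. ip (xs n) w) \<longlonglongrightarrow> ip x w" for w
  proof (rule LIM_zero_cancel, rule tendsto_rabs_zero_cancel,
      rule tendsto_sandwich[of "\<lambda>_. 0" _ _ "\<lambda>n. nr (xs n - x) * nr w"])
    show "(\<lambda>n. nr (xs n - x) * nr w) \<longlonglongrightarrow> 0"
      using assms(1) unfolding sconv_def by (rule tendsto_mult_left_zero)
    show "\<forall>\<^sub>F n in sequentially. \<bar>ip (xs n) w - ip x w\<bar> \<le> nr (xs n - x) * nr w"
      using Cauchy_Schwarz[of "xs _ - x" w] by (simp add: ip_diff_left)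
  qed auto
  then show ?thesis using assms sconv_bounded[OF assms(1)] by (auto simp: wconv_def)
qed

lemma wconv_const: "x \<in> H \<Longrightarrow> wconv (\<lambda>n. x) x"
  by (simp add: sconv_imp_wconv sconv_const)

lemma sconv_wconv_ip:
  assumes "sconv xs x" "x \<in> H" "wconv ys y" shows "(\<lambda>n. ip (xs n) (ys n)) \<longlonglongrightarrow> ip x y"
proof -
  obtain C where C: "\<And>n. nr (ys n) \<le> C" using assms by (auto simp: wconv_def)
  have "(\<lambda>n. ip (xs n - x) (ys n)) \<longlonglongrightarrow> 0"
  proof (rule tendsto_rabs_zero_cancel, rule tendsto_sandwich[of "\<lambda>_. 0" _ _ "\<lambda>n. nr (xs n - x) * C"])
    show "(\<lambda>n. nr (xs n - x) * C) \<longlonglongrightarrow> 0"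
      using assms(1) unfolding sconv_def by (rule tendsto_mult_left_zero)
    show "\<forall>\<^sub>F n in sequentially. \<bar>ip (xs n - x) (ys n)\<bar> \<le> nr (xs n - x) * C"
      using order_trans[OF Cauchy_Schwarz mult_left_mono[OF C nr_nonneg]] by simp
  qed auto
  from tendsto_add[OF this wconvD'[OF assms(3,2)]] show ?thesis by (simp add: ip_diff_left)
qed

text \<open>Expanding the nonnegative \<open>ip (xs n - x) (xs n - x)\<close> gives a linear
  minorant of the squared norms, to which weak convergence applies.\<close>

lemma wconv_nr_le:
  assumes "wconv xs x" and "(\<lambda>n. a n) \<longlonglongrightarrow> L" and "\<And>n. ip (xs n) (xs n) \<le> a n"
  shows "ip x x \<le> L"
proof -
  have x: "x \<in> H" using assms(1) by (rule wconv_lim)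
  have "(\<lambda>n. 2 * ip (xs n) x - ip x x) \<longlonglongrightarrow> 2 * ip x x - ip x x"
    by (intro tendsto_diff tendsto_mult tendsto_const wconvD[OF assms(1) x])
  moreover have "2 * ip (xs n) x - ip x x \<le> a n" for n
    using ip_nonneg[of "xs n - x"] assms(3)[of n] by (simp add: ip_simps ip_commute[of x "xs n"])
  ultimately show ?thesis using LIMSEQ_le[OF _ assms(2)] by fastforce
qed

text \<open>A Radon-Riesz argument with a majorant a in place of the squared norms: for the Newton
  derivatives these are controlled by pairings with a strongly convergent direction, whose limit is
  known.\<close>

lemma sconv_if_wconv:
  assumes "wconv xs x" and "(\<lambda>n. a n) \<longlonglongrightarrow> ip x x" and "\<And>n. ip (xs n) (xs n) \<le> a n"
  shows "sconv xs x"
proof -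
  have x: "x \<in> H" using assms(1) by (rule wconv_lim)
  have "(\<lambda>n. a n - 2 * ip (xs n) x + ip x x) \<longlonglongrightarrow> ip x x - 2 * ip x x + ip x x"
    by (intro tendsto_diff tendsto_add tendsto_mult tendsto_const wconvD[OF assms(1) x] assms(2))
  then have lim: "(\<lambda>n. a n - 2 * ip (xs n) x + ip x x) \<longlonglongrightarrow> 0" by simp
  have "(\<lambda>n. ip (xs n - x) (xs n - x)) \<longlonglongrightarrow> 0"
  proof (rule tendsto_sandwich[OF _ _ tendsto_const lim])
    have "ip (xs n - x) (xs n - x) \<le> a n - 2 * ip (xs n) x + ip x x" for n
      using assms(3)[of n] by (simp add: ip_simps ip_commute[of x "xs n"])
    then show "\<forall>\<^sub>F n in sequentially. ip (xs n - x) (xs n - x) \<le> a n - 2 * ip (xs n) x + ip x x"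
      by simp
  qed (simp add: ip_nonneg)
  then show ?thesis by (simp add: sconv_def nr_tendsto_0_iff)
qed

text \<open>A diagonal subsequence makes the pairings with each member of the sequence converge. The
  vectors with convergent pairings form a closed subspace W containing the sequence; a vector
  orthogonal to W has zero pairings and so lies in W itself, whence W is all of H. The limit
  functional is then represented by a vector.\<close>

lemma weak_compactness:
  fixes xs :: "nat \<Rightarrow> 'v"
  assumes H: "\<And>n. xs n \<in> H" and bdd: "\<And>n. nr (xs n) \<le> C"
  shows "\<exists>r x. strict_mono (r :: nat \<Rightarrow> nat) \<and> wconv (\<lambda>n. xs (r n)) x"
proof -
  interpret subseqs "\<lambda>k r. convergent (\<lambda>n. ip (xs (r n)) (xs k))"
  proof
    fix k and s :: "nat \<Rightarrow> nat"
    have "Bseq (\<lambda>n. ip (xs (s n)) (xs k))"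
      using order_trans[OF Cauchy_Schwarz mult_mono[OF bdd order_refl]] order_trans[OF nr_nonneg bdd]
      by (auto intro!: BseqI'[of _ "C * nr (xs k)"])
    then have "bounded (range (\<lambda>n. ip (xs (s n)) (xs k)))" by (simp add: Bseq_eq_bounded)
    from bounded_imp_convergent_subsequence[OF this]
    show "\<exists>r'. strict_mono r' \<and> convergent (\<lambda>n. ip (xs ((s \<circ> r') n)) (xs k))"
      by (auto simp: convergent_def o_def)
  qed
  define ys where "ys n = xs (diagseq n)" for n
  have ysH: "ys n \<in> H" for n by (simp add: ys_def H)
  have diag: "convergent (\<lambda>n. ip (xs ((diagseq \<circ> (+) (Suc k)) n)) (xs k))" for k
  proof (rule diagseq_holds)
    fix r s :: "nat \<Rightarrow> nat" and n assume "strict_mono r" "convergent (\<lambda>na. ip (xs (s na)) (xs n))"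
    then show "convergent (\<lambda>na. ip (xs ((s \<circ> r) na)) (xs n))"
      using convergent_subseq_convergent[of "\<lambda>na. ip (xs (s na)) (xs n)" r] by (simp add: o_def)
  qed
  have conv: "convergent (\<lambda>n. ip (ys n) (xs k))" for k
    using convergent_ignore_initial_segment[of "\<lambda>n. ip (ys n) (xs k)" "Suc k"] diag[of k]
    by (simp add: ys_def o_def add.commute[of k])
  define W where "W = {v \<in> H. convergent (\<lambda>n. ip (ys n) v)}"
  have W_H: "W \<subseteq> H" by (auto simp: W_def)
  have sub: "subspace W"
    unfolding subspace_def W_def
    by (auto simp: ip_simps convergent_const intro: convergent_add convergent_mult)
  have clo: "sclosed W"
    unfolding sclosed_def
  proof (intro allI impI)
    fix vs v assume vs: "\<forall>n. vs n \<in> W" and v: "v \<in> H" "sconv vs v"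
    have "Cauchy (\<lambda>n. ip (ys n) v)"
    proof (rule metric_CauchyI)
      fix \<epsilon> :: real assume e: "\<epsilon> > 0"
      have C0: "C \<ge> 0" using bdd[of 0] nr_nonneg[of "xs 0"] by linarith
      have "(\<lambda>n. (C + 1) * nr (vs n - v)) \<longlonglongrightarrow> 0"
        using v(2) unfolding sconv_def by (rule tendsto_mult_right_zero)
      from order_tendstoD(2)[OF this, of "\<epsilon> / 3"] e obtain k where k: "(C + 1) * nr (vs k - v) < \<epsilon> / 3"
        by (auto simp: eventually_sequentially)
      have *: "\<bar>ip (ys n) v - ip (ys n) (vs k)\<bar> < \<epsilon> / 3" for n
      proof -
        have "\<bar>ip (ys n) v - ip (ys n) (vs k)\<bar> \<le> nr (ys n) * nr (v - vs k)"
          using Cauchy_Schwarz[of "ys n" "v - vs k"] by (simp add: ip_simps)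
        also have "\<dots> \<le> (C + 1) * nr (vs k - v)"
          using bdd[of "diagseq n"] by (simp add: ys_def nr_commute[of v] mult_right_mono)
        finally show ?thesis using k by simp
      qed
      have "Cauchy (\<lambda>n. ip (ys n) (vs k))"
        using vs by (auto simp: W_def Cauchy_convergent_iff)
      then obtain M where M: "\<And>m n. m \<ge> M \<Longrightarrow> n \<ge> M \<Longrightarrow> \<bar>ip (ys m) (vs k) - ip (ys n) (vs k)\<bar> < \<epsilon> / 3"
        using e unfolding Cauchy_def dist_real_def by (metis divide_pos_pos zero_less_numeral)
      show "\<exists>M. \<forall>m\<ge>M. \<forall>n\<ge>M. dist (ip (ys m) v) (ip (ys n) v) < \<epsilon>"
      proof (intro exI allI impI)
        fix m n assume "M \<le> m" "M \<le> n"
        then show "dist (ip (ys m) v) (ip (ys n) v) < \<epsilon>"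
          using M[of m n] *[of m] *[of n] unfolding dist_real_def abs_less_iff by auto
      qed
    qed
    then show "v \<in> W" using v by (simp add: W_def Cauchy_convergent_iff)
  qed
  have "v \<in> W" if v: "v \<in> H" for v
  proof -
    have "\<bar>ip v w\<bar> \<le> nr v * nr w" for w by (rule Cauchy_Schwarz)
    \<comment> \<open>With the functional \<open>ip v\<close> the solution p is the orthogonal
      projection of v onto W.\<close>
    from variational_ineq_exists[OF W_H subspace_imp_convex[OF sub] clo _ _ _ this]
    obtain p where p: "p \<in> W" "\<And>w. w \<in> W \<Longrightarrow> ip v (w - p) \<le> ip p (w - p)"
      using subspace_0[OF sub] by (auto simp: ip_simps)
    have le: "ip (v - p) w \<le> 0" if "w \<in> W" for w
      using p(2)[of "w + p"] subspace_add[OF sub that p(1)] by (simp add: ip_simps)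
    have orth: "ip (v - p) w = 0" if "w \<in> W" for w
      using le[OF that] le[OF subspace_neg[OF sub that]] by (simp add: ip_simps)
    have "ip (ys n) (v - p) = 0" for n
    proof -
      have "xs (diagseq n) \<in> W" using H conv by (simp add: W_def)
      from orth[OF this] show ?thesis by (simp add: ys_def ip_commute)
    qed
    then have "v - p \<in> W" using v p(1) W_H by (auto simp: W_def convergent_const)
    from subspace_add[OF sub this p(1)] show ?thesis by simp
  qed
  then have lim: "(\<lambda>n. ip (ys n) v) \<longlonglongrightarrow> lim (\<lambda>n. ip (ys n) v)" if "v \<in> H" for v
    using that by (auto simp: W_def convergent_LIMSEQ_iff)
  have "\<exists>y\<in>H. \<forall>v\<in>H. lim (\<lambda>n. ip (ys n) v) = ip y v"
  proof (rule Riesz)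
    fix v w assume "v \<in> H" "w \<in> H"
    then show "lim (\<lambda>n. ip (ys n) (v + w)) = lim (\<lambda>n. ip (ys n) v) + lim (\<lambda>n. ip (ys n) w)"
      using tendsto_add[OF lim lim] by (auto simp: ip_simps intro!: limI)
  next
    fix c v assume "v \<in> H"
    then show "lim (\<lambda>n. ip (ys n) (c *\<^sub>R v)) = c * lim (\<lambda>n. ip (ys n) v)"
      using tendsto_mult[OF tendsto_const lim] by (auto simp: ip_simps intro!: limI)
  next
    fix v assume v: "v \<in> H"
    have "\<bar>ip (ys n) v\<bar> \<le> C * nr v" for n
      using order_trans[OF Cauchy_Schwarz mult_right_mono[OF bdd nr_nonneg]] by (simp add: ys_def)
    then show "\<bar>lim (\<lambda>n. ip (ys n) v)\<bar> \<le> C * nr v"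
      using LIMSEQ_le_const2[OF tendsto_rabs[OF lim[OF v]]] by blast
  qed
  then obtain y where "y \<in> H" "\<And>v. v \<in> H \<Longrightarrow> lim (\<lambda>n. ip (ys n) v) = ip y v" by blast
  then have "wconv ys y" using lim ysH bdd by (auto simp: wconv_def ys_def intro!: exI[of _ C])
  then show ?thesis using subseq_diagseq by (auto simp: ys_def[abs_def])
qed

lemma wconv_if_subseq:
  fixes xs :: "nat \<Rightarrow> 'v"
  assumes H: "\<And>n. xs n \<in> H" "x \<in> H" and bdd: "\<And>n. nr (xs n) \<le> C"
    and lim: "\<And>r z. strict_mono (r :: nat \<Rightarrow> nat) \<Longrightarrow> wconv (\<lambda>n. xs (r n)) z \<Longrightarrow> z = x"
  shows "wconv xs x"
  unfolding wconv_def
proof (intro conjI ballI)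
  fix w assume w: "w \<in> H"
  show "(\<lambda>n. ip (xs n) w) \<longlonglongrightarrow> ip x w"
  proof (rule tendsto_if_subseq)
    fix r :: "nat \<Rightarrow> nat" assume r: "strict_mono r"
    from weak_compactness[of "\<lambda>n. xs (r n)", OF H(1) bdd] obtain s z
      where s: "strict_mono s" "wconv (\<lambda>n. xs (r (s n))) z" by auto
    have "z = x" using lim[OF strict_mono_o[OF r s(1)], of z] s(2) by (simp add: o_def)
    then show "\<exists>s. strict_mono s \<and> (\<lambda>n. ip (xs (r (s n))) w) \<longlonglongrightarrow> ip x w"
      using s wconvD[OF s(2) w] by auto
  qed
qed (use H bdd in auto)

end

subsection \<open>The abstract unilateral obstacle problem\<close>

lemma pprt_minus_pprt: "pprt a - pprt (- a) = (a :: 'v::lattice_ab_group_add)"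
  using prts[of a] by (simp add: pprt_neg)

lemma abs_pprt: "\<bar>a\<bar> = pprt a + pprt (- (a :: 'v::lattice_ab_group_add_abs))"
  by (simp add: abs_prts pprt_neg)

lemma pprt_le_iff: "pprt a \<le> b \<longleftrightarrow> a \<le> b \<and> 0 \<le> (b :: 'v::lattice_ab_group_add)"
  by (simp add: pprt_def)

lemma le_pprt: "a \<le> pprt (a :: 'v::lattice_ab_group_add)"
  by (simp add: pprt_def)

lemma abs_pprt_diff_le: "\<bar>pprt a - pprt b\<bar> \<le> \<bar>a - (b :: 'v::lattice_ab_group_add_abs)\<bar>"
proof -
  have *: "pprt a \<le> pprt b + \<bar>a - b\<bar>" for a b :: 'v
  proof -
    have "a \<le> pprt b + \<bar>a - b\<bar>"
      using add_mono[OF le_pprt[of b] abs_ge_self[of "a - b"]] by simp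
    then show ?thesis by (simp add: pprt_le_iff)
  qed
  show ?thesis
    using *[of a b] *[of b a] by (intro abs_leI) (simp_all add: diff_le_eq add.commute abs_minus_commute)
qed

text \<open>Positive parts are the only lattice operation under which H will be assumed closed;
  infima are reached through this formula.\<close>

lemma inf_pprt: "inf a b = a - pprt (a - (b :: 'v::lattice_ab_group_add))"
  unfolding pprt_def diff_sup_eq_inf by (simp add: add_inf_distrib_left inf.commute)

lemma pprt_scaleR:
  assumes "s > 0"
  shows "pprt (s *\<^sub>R x) = s *\<^sub>R pprt (x :: 'v::{ordered_real_vector,lattice_ab_group_add})"
proof (rule antisym)
  show "pprt (s *\<^sub>R x) \<le> s *\<^sub>R pprt x"
    using assms by (simp add: pprt_le_iff scaleR_left_mono le_pprt scaleR_nonneg_nonneg)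
  have "pprt x \<le> (1 / s) *\<^sub>R pprt (s *\<^sub>R x)"
    using assms scaleR_left_mono[OF le_pprt[of "s *\<^sub>R x"], of "1 / s"]
    by (simp add: pprt_le_iff scaleR_nonneg_nonneg)
  from scaleR_left_mono[OF this, of s] assms show "s *\<^sub>R pprt x \<le> pprt (s *\<^sub>R x)" by simp
qed

text \<open>The contraction estimates for positive parts, for the projection and for its derivatives
  all arise in the form \<open>ip x x \<le> ip y x\<close>, which carries more information than the
  norm bound extracted here.\<close>

lemma (in semi_inner) nr_le_if_ip_le:
  assumes "ip x x \<le> ip y x" shows "nr x \<le> nr y"
proof (cases "nr x = 0")
  case False
  then have "nr x > 0" using nr_nonneg[of x] by linarith
  moreover have "nr x * nr x \<le> nr y * nr x"
    using assms ip_le[of y x] nr_square[of x] by (simp add: power2_eq_square)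
  ultimately show ?thesis by simp
qed simp

text \<open>
  In the application \<open>\<eta>\<close> represents \<open>v \<mapsto> \<integral> v\<close>, so that \<open>ip \<eta> \<bar>v\<bar>\<close> is the \<open>L\<^sup>1\<close> norm: it links the
  order to convergence.
\<close>

locale obstacle_hilbert = hilbert ip H
  for ip :: "'v::{ordered_real_vector,lattice_ab_group_add_abs} \<Rightarrow> 'v \<Rightarrow> real" and H +
  fixes \<eta> :: 'v and K :: "'v set"
  assumes pprt_H [simp]: "v \<in> H \<Longrightarrow> pprt v \<in> H"
    and pprt_ip: "v \<in> H \<Longrightarrow> ip (pprt v) (pprt v) \<le> ip v (pprt v)"
    and eta_H [simp]: "\<eta> \<in> H"
    and eta_nonneg: "v \<in> H \<Longrightarrow> 0 \<le> v \<Longrightarrow> 0 \<le> ip \<eta> v"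
    and eta_definite: "v \<in> H \<Longrightarrow> 0 \<le> v \<Longrightarrow> ip \<eta> v = 0 \<Longrightarrow> v = 0"
    and eta_compact: "wconv xs 0 \<Longrightarrow> (\<lambda>n. ip \<eta> \<bar>xs n\<bar>) \<longlonglongrightarrow> 0"
    and K_sub: "K \<subseteq> H" and K_convex: "convex K" and K_closed: "sclosed K" and K_nonempty: "K \<noteq> {}"
    and K_up: "v \<in> K \<Longrightarrow> w \<in> H \<Longrightarrow> v \<le> w \<Longrightarrow> w \<in> K"
    and K_inf: "v \<in> K \<Longrightarrow> w \<in> K \<Longrightarrow> inf v w \<in> K"
begin

lemma K_H: "v \<in> K \<Longrightarrow> v \<in> H"
  using K_sub by blast

lemma abs_H [simp]: "v \<in> H \<Longrightarrow> \<bar>v\<bar> \<in> H"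
  by (simp add: abs_pprt)

lemma eta_mono: "v \<in> H \<Longrightarrow> w \<in> H \<Longrightarrow> v \<le> w \<Longrightarrow> ip \<eta> v \<le> ip \<eta> w"
  using eta_nonneg[of "w - v"] by (simp add: ip_simps)

lemma pprt_nr: "v \<in> H \<Longrightarrow> nr (pprt v) \<le> nr v"
  by (rule nr_le_if_ip_le[OF pprt_ip])

lemma eta_abs_wconv: "wconv xs x \<Longrightarrow> (\<lambda>n. ip \<eta> \<bar>xs n - x\<bar>) \<longlonglongrightarrow> 0"
  using eta_compact[of "\<lambda>n. xs n - x"] wconv_diff[of xs x "\<lambda>_. x" x] wconv_const[of x]
  by (simp add: wconv_lim)

lemma eta_squeeze:
  assumes "v \<in> H" "0 \<le> v" "(\<lambda>n. ip \<eta> (ws n)) \<longlonglongrightarrow> 0" "\<And>n. ws n \<in> H" "\<And>n. v \<le> ws n"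
  shows "v = 0"
proof -
  have "ip \<eta> v \<le> ip \<eta> (ws n)" for n
    using assms eta_mono by blast
  then have "ip \<eta> v \<le> 0" using LIMSEQ_le_const[OF assms(3)] by blast
  then show ?thesis using eta_nonneg[of v] eta_definite[of v] assms by simp
qed

text \<open>The negative part of x is dominated by \<open>\<bar>xs n - x\<bar>\<close>, whose mass
  tends to zero.\<close>

lemma wconv_nonneg:
  assumes "wconv xs x" "\<And>n. 0 \<le> xs n" shows "0 \<le> x"
proof -
  note H = wconv_lim[OF assms(1)] wconv_mem[OF assms(1)]
  have "- x \<le> \<bar>xs n - x\<bar>" for n
  proof -
    have "- x \<le> xs n - x" using assms(2)[of n] by simp
    then show ?thesis by (rule order_trans[OF _ abs_ge_self])
  qed
  then have "pprt (- x) = 0"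
    by (intro eta_squeeze[OF _ _ eta_abs_wconv[OF assms(1)]]) (simp_all add: H pprt_le_iff)
  then show ?thesis by (simp flip: le_zero_iff_zero_pprt)
qed

text \<open>The norm bound provides weak cluster points z, and \<open>\<eta>\<close> identifies
  them: \<open>\<bar>z - x\<bar>\<close> is bounded by two absolute values of vanishing mass. This
  is how order estimates are turned into weak convergence.\<close>

lemma wconv_if_eta:
  assumes "\<And>n. xs n \<in> H" "x \<in> H" "\<And>n. nr (xs n) \<le> C" "(\<lambda>n. ip \<eta> \<bar>xs n - x\<bar>) \<longlonglongrightarrow> 0"
  shows "wconv xs x"
proof (rule wconv_if_subseq[OF assms(1-3)])
  fix r :: "nat \<Rightarrow> nat" and z assume r: "strict_mono r" "wconv (\<lambda>n. xs (r n)) z"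
  have "\<bar>z - x\<bar> = 0"
  proof (rule eta_squeeze)
    show "(\<lambda>n. ip \<eta> (\<bar>xs (r n) - z\<bar> + \<bar>xs (r n) - x\<bar>)) \<longlonglongrightarrow> 0"
      using tendsto_add[OF eta_abs_wconv[OF r(2)] LIMSEQ_subseq_LIMSEQ[OF assms(4) r(1)]]
      by (simp add: ip_simps o_def)
    show "\<bar>z - x\<bar> \<le> \<bar>xs (r n) - z\<bar> + \<bar>xs (r n) - x\<bar>" for n
      using abs_triangle_ineq4[of "xs (r n) - x" "xs (r n) - z"] by (simp add: add.commute)
  qed (use wconv_lim[OF r(2)] assms(1,2) in auto)
  then show "z = x" by simp
qed

text \<open>The nonlinear map \<open>pprt\<close> respects weak limits because it contracts absolute
  differences and because weak convergence implies convergence in mass.\<close>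

lemma wconv_pprt:
  assumes "wconv xs x" shows "wconv (\<lambda>n. pprt (xs n)) (pprt x)"
proof -
  note H = wconv_lim[OF assms(1)] wconv_mem[OF assms(1)]
  obtain C where C: "\<And>n. nr (xs n) \<le> C" using wconv_bdd[OF assms] by blast
  have "nr (pprt (xs n)) \<le> C" for n using pprt_nr[OF H(2)] C order_trans by blast
  then show ?thesis
  proof (rule wconv_if_eta[rotated 2])
    show "(\<lambda>n. ip \<eta> \<bar>pprt (xs n) - pprt x\<bar>) \<longlonglongrightarrow> 0"
    proof (rule tendsto_sandwich[OF _ _ tendsto_const eta_abs_wconv[OF assms]])
      show "\<forall>\<^sub>F n in sequentially. 0 \<le> ip \<eta> \<bar>pprt (xs n) - pprt x\<bar>"
        by (intro always_eventually allI eta_nonneg) (simp_all add: H)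
      show "\<forall>\<^sub>F n in sequentially. ip \<eta> \<bar>pprt (xs n) - pprt x\<bar> \<le> ip \<eta> \<bar>xs n - x\<bar>"
        by (intro always_eventually allI eta_mono abs_pprt_diff_le) (simp_all add: H)
    qed
  qed (simp_all add: H)
qed

section \<open>The projection onto K and its convexity\<close>

definition solves :: "'v \<Rightarrow> 'v \<Rightarrow> bool"
  where "solves u y \<longleftrightarrow> y \<in> K \<and> (\<forall>v\<in>K. 0 \<le> ip (y - u) (v - y))"

definition P :: "'v \<Rightarrow> 'v" where "P u = (THE y. solves u y)"

text \<open>Each solution serves as a competitor for the other. The resulting firm nonexpansiveness
  yields uniqueness and later the Lipschitz bound.\<close>

lemma solves_ip:
  assumes "solves u y" "solves v z" shows "ip (y - z) (y - z) \<le> ip (u - v) (y - z)"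
proof -
  have "0 \<le> ip (y - u) (z - y)" "0 \<le> ip (z - v) (y - z)"
    using assms unfolding solves_def by blast+
  then show ?thesis by (simp add: ip_simps ip_commute[of z y])
qed

lemma solves_unique: "solves u y \<Longrightarrow> solves u z \<Longrightarrow> y = z"
  using solves_ip[of u y u z] by (auto intro: eqI_nr K_H simp: solves_def)

lemma solves_P: "solves u (P u)"
proof -
  have "\<exists>y\<in>K. \<forall>v\<in>K. ip u (v - y) \<le> ip y (v - y)"
    by (rule variational_ineq_exists[OF K_sub K_convex K_closed K_nonempty _ _ Cauchy_Schwarz])
       (simp_all add: ip_simps)
  then obtain y where "y \<in> K" "\<And>v. v \<in> K \<Longrightarrow> ip u (v - y) \<le> ip y (v - y)" by blast
  then have "solves u y" by (simp add: solves_def ip_diff_left)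
  then show ?thesis unfolding P_def by (rule theI) (rule solves_unique[OF _ \<open>solves u y\<close>])
qed

lemma P_eqI: "solves u y \<Longrightarrow> P u = y"
  by (rule solves_unique[OF solves_P])

lemma P_K: "P u \<in> K" and P_VI: "v \<in> K \<Longrightarrow> 0 \<le> ip (P u - u) (v - P u)"
  using solves_P[of u] unfolding solves_def by blast+

lemma P_H [simp]: "P u \<in> H"
  by (rule K_H[OF P_K])

lemma P_ip: "ip (P u - P v) (P u - P v) \<le> ip (u - v) (P u - P v)"
  by (rule solves_ip[OF solves_P solves_P])

lemma P_lipschitz: "nr (P u - P v) \<le> nr (u - v)"
  by (rule nr_le_if_ip_le[OF P_ip])

text \<open>\<open>P u + v\<close> is a competitor by stability under increase, so the residual acts
  as a nonnegative contact force.\<close>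

lemma residual_nonneg: "v \<in> H \<Longrightarrow> 0 \<le> v \<Longrightarrow> 0 \<le> ip (P u - u) v"
  using P_VI[OF K_up[OF P_K, of "P u + v" u], of u] by simp

text \<open>A comparison argument in which the convex combination z plays the role of a
  supersolution. Lowering y by \<open>d = pprt (y - z)\<close> gives \<open>inf y z\<close>, which
  is admissible, while the residuals at u and v are nonnegative on d. Together they force
  \<open>ip (y - z) d \<le> 0\<close>, and \<open>pprt_ip\<close> turns this into
  \<open>d = 0\<close>.\<close>

lemma P_convex:
  assumes "u \<in> H" "v \<in> H" "0 \<le> t" "t \<le> 1"
  shows "P ((1 - t) *\<^sub>R u + t *\<^sub>R v) \<le> (1 - t) *\<^sub>R P u + t *\<^sub>R P v"
proof -
  define y z where "y = P ((1 - t) *\<^sub>R u + t *\<^sub>R v)" and "z = (1 - t) *\<^sub>R P u + t *\<^sub>R P v"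
  have z: "z \<in> K" unfolding z_def using convexD[OF K_convex P_K P_K, of "1 - t" t u v] assms by simp
  have H: "y \<in> H" "z \<in> H" by (simp_all add: y_def z_def)
  define d where "d = pprt (y - z)"
  have d: "d \<in> H" "0 \<le> d" using H by (simp_all add: d_def)
  have "y - d \<in> K" using K_inf[OF P_K z] by (simp add: d_def inf_pprt y_def)
  from P_VI[OF this, of "(1 - t) *\<^sub>R u + t *\<^sub>R v", folded y_def]
  have 1: "ip (y - ((1 - t) *\<^sub>R u + t *\<^sub>R v)) d \<le> 0" by (simp add: ip_simps)
  have 2: "0 \<le> (1 - t) * ip (P u - u) d + t * ip (P v - v) d"
    using residual_nonneg[OF d, of u] residual_nonneg[OF d, of v] assms by simp
  from 1 2 have "ip (y - z) d \<le> 0" by (simp add: z_def ip_simps algebra_simps)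
  with pprt_ip[of "y - z"] H have "ip d d \<le> 0" by (simp add: d_def)
  then have "d = 0" using ip_definite[OF d(1)] ip_nonneg[of d] by simp
  then show ?thesis
    using le_zero_iff_zero_pprt[of "y - z"] by (simp add: d_def y_def z_def)
qed

section \<open>Radial cone, critical cone and directional derivatives\<close>

definition radial :: "'v \<Rightarrow> 'v set"
  where "radial y = {w \<in> H. \<exists>s>0. y + s *\<^sub>R w \<in> K}"

lemma radial_small:
  assumes "y \<in> K" "w \<in> radial y"
  shows "\<exists>s>0. \<forall>t. 0 \<le> t \<longrightarrow> t \<le> s \<longrightarrow> y + t *\<^sub>R w \<in> K"
proof -
  obtain s where s: "s > 0" "y + s *\<^sub>R w \<in> K" using assms by (auto simp: radial_def)
  have "y + t *\<^sub>R w \<in> K" if "0 \<le> t" "t \<le> s" for t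
  proof -
    have "y + t *\<^sub>R w = (1 - t / s) *\<^sub>R y + (t / s) *\<^sub>R (y + s *\<^sub>R w)"
      using s by (simp add: algebra_simps)
    then show ?thesis
      using convexD[OF K_convex assms(1) s(2), of "1 - t / s" "t / s"] s that by simp
  qed
  then show ?thesis using s by blast
qed

lemma radial_scale: "y \<in> K \<Longrightarrow> w \<in> radial y \<Longrightarrow> 0 \<le> c \<Longrightarrow> c *\<^sub>R w \<in> radial y"
proof (cases "c = 0")
  case False
  assume "y \<in> K" "w \<in> radial y" "0 \<le> c"
  then obtain s where s: "w \<in> H" "s > 0" "y + s *\<^sub>R w \<in> K" by (auto simp: radial_def)
  with False \<open>0 \<le> c\<close> have "s / c > 0" "y + (s / c) *\<^sub>R (c *\<^sub>R w) \<in> K" by auto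
  then show ?thesis using s(1) by (auto simp: radial_def)
qed (auto simp: radial_def intro: exI[of _ 1])

lemma radial_add:
  assumes "y \<in> K" "v \<in> radial y" "w \<in> radial y" shows "v + w \<in> radial y"
proof -
  obtain s t where "s > 0" "\<And>r. 0 \<le> r \<Longrightarrow> r \<le> s \<Longrightarrow> y + r *\<^sub>R v \<in> K"
    "t > 0" "\<And>r. 0 \<le> r \<Longrightarrow> r \<le> t \<Longrightarrow> y + r *\<^sub>R w \<in> K"
    using radial_small[OF assms(1,2)] radial_small[OF assms(1,3)] by blast
  then have k: "y + min s t *\<^sub>R v \<in> K" "y + min s t *\<^sub>R w \<in> K" "min s t / 2 > 0"
    by simp_all
  have half: "(1/2) *\<^sub>R y + (1/2) *\<^sub>R y = y"
    by (simp flip: scaleR_add_left)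
  have "(1/2) *\<^sub>R (y + min s t *\<^sub>R v) + (1/2) *\<^sub>R (y + min s t *\<^sub>R w) =
      ((1/2) *\<^sub>R y + (1/2) *\<^sub>R y) + (min s t / 2) *\<^sub>R (v + w)"
    by (simp add: scaleR_add_right ac_simps)
  then have eq: "y + (min s t / 2) *\<^sub>R (v + w) = (1/2) *\<^sub>R (y + min s t *\<^sub>R v) + (1/2) *\<^sub>R (y + min s t *\<^sub>R w)"
    by (simp only: half)
  have "y + (min s t / 2) *\<^sub>R (v + w) \<in> K"
    unfolding eq using convexD[OF K_convex k(1,2), of "1/2" "1/2"] by simp
  moreover have "v + w \<in> H" using assms by (simp add: radial_def)
  ultimately show ?thesis using k(3) unfolding radial_def by blast
qed

lemma radial_H: "w \<in> radial y \<Longrightarrow> w \<in> H"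
  by (simp add: radial_def)

lemma radial_up:
  assumes "y \<in> H" "w \<in> radial y" "v \<in> H" "w \<le> v" shows "v \<in> radial y"
proof -
  obtain s where s: "s > 0" "y + s *\<^sub>R w \<in> K" using assms by (auto simp: radial_def)
  have "y + s *\<^sub>R v \<in> K"
    using s assms by (intro K_up[OF s(2)]) (simp_all add: scaleR_left_mono)
  then show ?thesis using s assms by (auto simp: radial_def)
qed

text \<open>A step s along \<open>- pprt (- w)\<close> leads from y to the infimum of y and
  \<open>y + s *\<^sub>R w\<close>, which stays in K.\<close>

lemma radial_neg:
  assumes "y \<in> K" "w \<in> radial y" shows "- pprt (- w) \<in> radial y"
proof -
  obtain s where s: "w \<in> H" "s > 0" "y + s *\<^sub>R w \<in> K" using assms by (auto simp: radial_def)
  have "y + s *\<^sub>R (- pprt (- w)) = inf y (y + s *\<^sub>R w)"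
    using pprt_scaleR[OF s(2), of "- w"] by (simp add: inf_pprt)
  then show ?thesis using K_inf[OF assms(1) s(3)] s by (auto simp: radial_def)
qed

lemma residual_radial: assumes "w \<in> radial (P u)" shows "0 \<le> ip (P u - u) w"
proof -
  obtain s where s: "s > 0" "P u + s *\<^sub>R w \<in> K" using assms by (auto simp: radial_def)
  from P_VI[OF s(2), of u] s(1) show ?thesis by (simp add: ip_scale_right zero_le_mult_iff)
qed

text \<open>Directions are restricted to the annihilator of the residual before weak limits are
  taken, which builds polyhedricity into the cone. That it is still large enough is seen in
  \<open>weak_quotient_limit\<close>, where limits of difference quotients are shown to lie in
  it.\<close>

definition crit :: "'v \<Rightarrow> 'v set"
  where "crit u = {w. \<exists>ws. (\<forall>n. ws n \<in> radial (P u) \<and> ip (P u - u) (ws n) = 0) \<and> wconv ws w}"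

text \<open>Directional derivatives are the projections onto the critical cone.\<close>

definition has_deriv :: "'v \<Rightarrow> 'v \<Rightarrow> 'v \<Rightarrow> bool"
  where "has_deriv u h d \<longleftrightarrow> d \<in> crit u \<and> (\<forall>w\<in>crit u. 0 \<le> ip (d - h) (w - d))"

lemma crit_H: "w \<in> crit u \<Longrightarrow> w \<in> H"
  by (auto simp: crit_def dest: wconv_lim)

lemma crit_I: "w \<in> radial (P u) \<Longrightarrow> ip (P u - u) w = 0 \<Longrightarrow> w \<in> crit u"
  unfolding crit_def using wconv_const[OF radial_H] by (intro CollectI exI[of _ "\<lambda>_. w"]) auto

lemma crit_scale: "w \<in> crit u \<Longrightarrow> 0 \<le> c \<Longrightarrow> c *\<^sub>R w \<in> crit u"
  unfolding crit_def
  by (clarsimp, rule_tac x = "\<lambda>n. c *\<^sub>R ws n" in exI)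
     (auto intro!: radial_scale wconv_scale simp: P_K ip_scale_right)

lemma crit_add: "v \<in> crit u \<Longrightarrow> w \<in> crit u \<Longrightarrow> v + w \<in> crit u"
  unfolding crit_def
  by (clarsimp, rule_tac x = "\<lambda>n. ws n + wsa n" in exI)
     (auto intro!: radial_add wconv_add simp: P_K ip_add_right)

lemma has_deriv_unique: "has_deriv u h d \<Longrightarrow> has_deriv u h e \<Longrightarrow> d = e"
proof -
  assume a: "has_deriv u h d" "has_deriv u h e"
  then have "0 \<le> ip (d - h) (e - d)" "0 \<le> ip (e - h) (d - e)" by (auto simp: has_deriv_def)
  then have "ip (d - e) (d - e) \<le> 0" by (simp add: ip_simps ip_commute[of e d])
  with a show ?thesis by (intro eqI_nr) (auto simp: has_deriv_def crit_H)
qed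

lemma has_deriv_H: "has_deriv u h d \<Longrightarrow> d \<in> H"
  using crit_H by (auto simp: has_deriv_def)

lemma has_deriv_ip: "has_deriv u h d \<Longrightarrow> ip d d = ip h d"
proof -
  assume "has_deriv u h d"
  then have d: "d \<in> crit u" "\<And>w. w \<in> crit u \<Longrightarrow> 0 \<le> ip (d - h) (w - d)" by (auto simp: has_deriv_def)
  have "0 \<in> crit u" "d + d \<in> crit u" using d(1) crit_scale[OF d(1), of 0] crit_add by auto
  from d(2)[OF this(1)] d(2)[OF this(2)] show ?thesis by (simp add: ip_simps)
qed

lemma has_deriv_orth: "has_deriv u h d \<Longrightarrow> w \<in> crit u \<Longrightarrow> 0 \<le> ip (d - h) w"
  unfolding has_deriv_def using crit_add[of d u w] by (auto dest!: bspec[of _ _ "d + w"])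

text \<open>The residual vanishes on the negative parts of the quotients, and in the limit also on
  d. Hence \<open>pprt d - pprt (- ds n)\<close> consists of admissible directions annihilated by
  the residual and converges weakly to d, which puts d into the critical cone. The variational
  inequality tested with critical directions then bounds the norms of the quotients from above; this
  gives both the characterisation of d and strong convergence.\<close>

lemma weak_quotient_limit:
  assumes u: "u \<in> H" and h: "\<And>n. hs n \<in> H" "h \<in> H" "sconv hs h"
    and t: "\<And>n. 0 < t n" "t \<longlonglongrightarrow> 0"
    and d: "\<And>n. ds n = (1 / t n) *\<^sub>R (P (u + t n *\<^sub>R hs n) - P u)" "wconv ds d"
  shows "has_deriv u h d \<and> sconv ds d"
proof -
  define \<xi> where "\<xi> = P u - u"
  have dH: "d \<in> H" "\<And>n. ds n \<in> H" using d(2) wconv_lim wconv_mem by blast+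
  have xiH: "\<xi> \<in> H" using u by (simp add: \<xi>_def)
  have y: "P (u + t n *\<^sub>R hs n) = P u + t n *\<^sub>R ds n" for n
    using t(1)[of n] by (simp add: d(1))
  have dr: "ds n \<in> radial (P u)" for n
    using t(1)[of n] P_K[of "u + t n *\<^sub>R hs n"] dH by (auto simp: radial_def y)
  have xi_ds: "0 \<le> ip \<xi> (ds n)" for n
    using residual_radial[OF dr] by (simp add: \<xi>_def)
  \<comment> \<open>The residual at the perturbed point is \<open>\<xi>\<close> plus
    \<open>t n\<close> times \<open>ds n - hs n\<close>, since solution and datum move by
    \<open>t n\<close> times these vectors.\<close>
  have VI: "t n * ip (ds n - hs n) (v - P u - t n *\<^sub>R ds n) + ip \<xi> (v - P u - t n *\<^sub>R ds n) \<ge> 0"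
    if "v \<in> K" for v n
    using P_VI[OF that, of "u + t n *\<^sub>R hs n"] unfolding y \<xi>_def by (simp add: ip_simps algebra_simps)
  obtain C where C: "\<And>n. nr (ds n) \<le> C" using wconv_bdd[OF d(2)] by blast
  obtain D where D: "\<And>n. nr (hs n) \<le> D" using sconv_bounded[OF h(3)] by blast
  have hd: "(\<lambda>n. ip (hs n) (ds n)) \<longlonglongrightarrow> ip h d"
    by (rule sconv_wconv_ip[OF h(3,2) d(2)])
  have xi_le: "ip \<xi> (ds n) \<le> t n * ip (hs n) (ds n)" for n
  proof -
    have "t n * (t n * ip (ds n - hs n) (ds n) + ip \<xi> (ds n)) \<le> 0"
      using VI[OF P_K[of u], of n] by (simp add: ip_simps algebra_simps)
    then have "t n * ip (ds n - hs n) (ds n) + ip \<xi> (ds n) \<le> 0"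
      using t(1)[of n] by (simp add: mult_le_0_iff)
    moreover have "0 \<le> t n * ip (ds n) (ds n)" using t(1)[of n] by (simp add: ip_nonneg)
    ultimately show ?thesis by (simp add: ip_simps algebra_simps)
  qed
  have "ip \<xi> d = 0"
  proof (rule LIMSEQ_unique[OF wconvD'[OF d(2) xiH]], rule tendsto_sandwich[OF _ _ tendsto_const])
    show "(\<lambda>n. t n * ip (hs n) (ds n)) \<longlonglongrightarrow> 0" using tendsto_mult[OF t(2) hd] by simp
  qed (use xi_ds xi_le in auto)
  \<comment> \<open>\<open>- pprt (- ds n)\<close> is an admissible direction, so the residual is
    nonnegative on it as well as on the nonnegative vector \<open>pprt (- ds n)\<close>.\<close>
  moreover have neg0: "ip \<xi> (pprt (- ds n)) = 0" for n
    using residual_radial[OF radial_neg[OF P_K dr], of n] residual_nonneg[of "pprt (- ds n)" u] dH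
    by (simp add: \<xi>_def ip_minus_right)
  then have "ip \<xi> (pprt (- d)) = 0"
    using LIMSEQ_unique[OF wconvD'[OF wconv_pprt[OF wconv_minus[OF d(2)]] xiH]] by simp
  ultimately have pos0: "ip \<xi> (pprt d) = 0"
    using pprt_minus_pprt[of d] ip_diff_right[of \<xi> "pprt d" "pprt (- d)"] by simp
  have dcrit: "d \<in> crit u"
    unfolding crit_def mem_Collect_eq
  proof (intro exI conjI allI)
    show "wconv (\<lambda>n. pprt d - pprt (- ds n)) d"
      using wconv_diff[OF wconv_const[of "pprt d"] wconv_pprt[OF wconv_minus[OF d(2)]]] dH
      by (simp add: pprt_minus_pprt)
    show "pprt d - pprt (- ds n) \<in> radial (P u)" for n
      by (rule radial_up[OF P_H radial_neg[OF P_K dr, of n]]) (simp_all add: dH)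
    show "ip (P u - u) (pprt d - pprt (- ds n)) = 0" for n
      using neg0[of n] pos0 by (simp add: ip_diff_right \<xi>_def)
  qed
  \<comment> \<open>\<open>F w\<close> is the limit of the bound for \<open>ip (ds n) (ds n)\<close>
    that comes from the competitor \<open>P u + t n *\<^sub>R w\<close>. At \<open>w = d\<close> it
    equals \<open>ip d d\<close>, which is what strong convergence requires.\<close>
  define F where "F w = ip d w - ip h w + ip h d" for w
  have lim: "\<forall>\<^sub>F n in sequentially. ip (ds n) (ds n) \<le> F w + \<epsilon>"
    if w: "w \<in> radial (P u)" "ip \<xi> w = 0" and e: "\<epsilon> > 0" for w \<epsilon>
  proof -
    have wH: "w \<in> H" using w by (simp add: radial_H)
    obtain s where s: "s > 0" "\<And>t. 0 \<le> t \<Longrightarrow> t \<le> s \<Longrightarrow> P u + t *\<^sub>R w \<in> K"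
      using radial_small[OF P_K w(1)] by blast
    have "\<forall>\<^sub>F n in sequentially. t n < s" using order_tendstoD(2)[OF t(2) s(1)] .
    moreover have "(\<lambda>n. ip (ds n) w - ip (hs n) w + ip (hs n) (ds n)) \<longlonglongrightarrow> F w"
      unfolding F_def
      by (intro tendsto_add tendsto_diff hd wconvD[OF d(2) wH] wconvD[OF sconv_imp_wconv[OF h(3,1,2)] wH])
    then have "\<forall>\<^sub>F n in sequentially. ip (ds n) w - ip (hs n) w + ip (hs n) (ds n) < F w + \<epsilon>"
      by (rule order_tendstoD) (simp add: e)
    ultimately show ?thesis
    proof eventually_elim
      case (elim n)
      have "P u + t n *\<^sub>R w \<in> K" using s(2)[of "t n"] t(1)[of n] elim by simp
      from VI[OF this, of n] have "0 \<le> t n * (t n * ip (ds n - hs n) (w - ds n) + ip \<xi> (w - ds n))"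
        by (simp add: ip_simps algebra_simps)
      then have "0 \<le> t n * ip (ds n - hs n) (w - ds n) + ip \<xi> (w - ds n)"
        using t(1)[of n] by (simp add: zero_le_mult_iff)
      moreover have "ip \<xi> (w - ds n) \<le> 0" using w(2) xi_ds[of n] by (simp add: ip_simps)
      ultimately have "0 \<le> t n * ip (ds n - hs n) (w - ds n)" by simp
      then have "0 \<le> ip (ds n - hs n) (w - ds n)" using t(1)[of n] by (simp add: zero_le_mult_iff)
      then show ?case using elim by (simp add: ip_simps)
    qed
  qed
  have lim': "\<forall>\<^sub>F n in sequentially. ip (ds n) (ds n) \<le> F w + \<epsilon>" if w: "w \<in> crit u" and e: "\<epsilon> > 0" for w \<epsilon>
  proof -
    obtain ws where ws: "\<And>k. ws k \<in> radial (P u)" "\<And>k. ip \<xi> (ws k) = 0" "wconv ws w"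
      using w by (auto simp: crit_def \<xi>_def)
    have "(\<lambda>k. F (ws k)) \<longlonglongrightarrow> F w"
      unfolding F_def by (intro tendsto_add tendsto_diff wconvD' ws dH h tendsto_const)
    from order_tendstoD(2)[OF this, of "F w + \<epsilon> / 2"] e obtain k where "F (ws k) < F w + \<epsilon> / 2"
      by (auto simp: eventually_sequentially)
    moreover have "\<forall>\<^sub>F n in sequentially. ip (ds n) (ds n) \<le> F (ws k) + \<epsilon> / 2"
      using lim[OF ws(1,2)] e by simp
    ultimately show ?thesis by (auto elim!: eventually_mono)
  qed
  have "(\<lambda>n. ip (ds n - d) (ds n - d)) \<longlonglongrightarrow> 0"
  proof (rule order_tendstoI)
    fix a :: real assume "a < 0"
    then show "\<forall>\<^sub>F n in sequentially. a < ip (ds n - d) (ds n - d)"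
      using ip_nonneg by (intro always_eventually) (auto intro: less_le_trans)
  next
    fix a :: real assume a: "0 < a"
    have "(\<lambda>n. 2 * ip (ds n) d) \<longlonglongrightarrow> 2 * ip d d"
      by (intro tendsto_mult tendsto_const wconvD[OF d(2)] dH)
    from order_tendstoD(1)[OF this, of "2 * ip d d - a / 2"] a
    have "\<forall>\<^sub>F n in sequentially. 2 * ip d d - a / 2 < 2 * ip (ds n) d" by simp
    moreover have "\<forall>\<^sub>F n in sequentially. ip (ds n) (ds n) \<le> F d + a / 2" using lim'[OF dcrit] a by simp
    ultimately show "\<forall>\<^sub>F n in sequentially. ip (ds n - d) (ds n - d) < a"
      by eventually_elim (simp add: F_def ip_simps ip_commute[of d "ds _"])
  qed
  then have sc: "sconv ds d" by (simp add: sconv_def nr_tendsto_0_iff)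
  have "0 \<le> ip (d - h) (w - d)" if "w \<in> crit u" for w
  proof -
    have "ip d d \<le> F w"
    proof (rule field_le_epsilon)
      fix \<epsilon> :: real assume "\<epsilon> > 0"
      from tendsto_upperbound[OF sconv_ip_self[OF sc] lim'[OF that this]]
      show "ip d d \<le> F w + \<epsilon>" by simp
    qed
    then show ?thesis by (simp add: F_def ip_simps)
  qed
  then show ?thesis using dcrit sc by (simp add: has_deriv_def)
qed

lemma quotient_bounded:
  assumes "0 < t" shows "nr ((1 / t) *\<^sub>R (P (u + t *\<^sub>R h) - P u)) \<le> nr h"
  unfolding nr_scale using P_lipschitz[of "u + t *\<^sub>R h" u] assms by (simp add: nr_scale field_simps)

text \<open>Every weak cluster point of the quotients satisfies \<open>has_deriv\<close>, which
  determines it, so the whole sequence converges. Directions may vary with n (Hadamard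
  differentiability), because in the Newton quotient the direction \<open>h / t\<close> is only
  convergent.\<close>

lemma quotient_tendsto:
  assumes u: "u \<in> H" and h: "\<And>n. hs n \<in> H" "h \<in> H" "sconv hs h"
    and t: "\<And>n. 0 < t n" "t \<longlonglongrightarrow> 0"
  shows "\<exists>d. has_deriv u h d \<and> sconv (\<lambda>n. (1 / t n) *\<^sub>R (P (u + t n *\<^sub>R hs n) - P u)) d"
proof -
  define ds where "ds n = (1 / t n) *\<^sub>R (P (u + t n *\<^sub>R hs n) - P u)" for n
  have dsH: "ds n \<in> H" for n by (simp add: ds_def)
  obtain D where D: "\<And>n. nr (hs n) \<le> D" using sconv_bounded[OF h(3)] by blast
  have dsD: "nr (ds n) \<le> D" for n
    unfolding ds_def by (rule order_trans[OF quotient_bounded[OF t(1)] D])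
  have sub: "\<exists>s d. strict_mono s \<and> has_deriv u h d \<and> sconv (\<lambda>n. ds (r (s n))) d"
    if r: "strict_mono r" for r :: "nat \<Rightarrow> nat"
  proof -
    from weak_compactness[of "\<lambda>n. ds (r n)", OF dsH dsD] obtain s d
      where s: "strict_mono s" "wconv (\<lambda>n. ds (r (s n))) d" by blast
    have rs: "strict_mono (\<lambda>n. r (s n))" using strict_mono_o[OF r s(1)] by (simp add: o_def)
    have "has_deriv u h d \<and> sconv (\<lambda>n. ds (r (s n))) d"
      by (rule weak_quotient_limit[OF u _ h(2) sconv_subseq[OF h(3) rs] _ _ _ s(2), where t = "\<lambda>n. t (r (s n))"])
         (use h t LIMSEQ_subseq_LIMSEQ[OF t(2) rs] in \<open>auto simp: ds_def o_def\<close>)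
    then show ?thesis using s(1) by blast
  qed
  obtain d where d: "has_deriv u h d" using sub[of "\<lambda>n. n"] by (auto simp: strict_mono_def)
  have "sconv ds d"
    unfolding sconv_def
  proof (rule tendsto_if_subseq)
    fix r :: "nat \<Rightarrow> nat" assume "strict_mono r"
    from sub[OF this] obtain s d' where s: "strict_mono s" "has_deriv u h d'" "sconv (\<lambda>n. ds (r (s n))) d'"
      by blast
    with has_deriv_unique[OF d s(2)] show "\<exists>s. strict_mono s \<and> (\<lambda>n. nr (ds (r (s n)) - d)) \<longlonglongrightarrow> 0"
      by (auto simp: sconv_def)
  qed
  then show ?thesis using d by (auto simp: ds_def[abs_def])
qed

lemma has_deriv_exists: "u \<in> H \<Longrightarrow> h \<in> H \<Longrightarrow> \<exists>d. has_deriv u h d"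
  using quotient_tendsto[of u "\<lambda>_. h" h "\<lambda>n. 1 / real (Suc n)"] LIMSEQ_Suc[OF lim_1_over_n]
  by (auto simp: sconv_const)

lemma quotient_sconv:
  assumes "has_deriv u h d" "u \<in> H" "\<And>n. hs n \<in> H" "h \<in> H" "sconv hs h" "\<And>n. 0 < t n" "t \<longlonglongrightarrow> 0"
  shows "sconv (\<lambda>n. (1 / t n) *\<^sub>R (P (u + t n *\<^sub>R hs n) - P u)) d"
  using quotient_tendsto[of u hs h t] assms has_deriv_unique by blast

text \<open>Difference quotients of the convex map \<open>P\<close> with step at most 1 lie below
  the one with step 1, and the order is preserved by weak limits.\<close>

lemma has_deriv_le:
  assumes "has_deriv u h d" "u \<in> H" "h \<in> H" shows "d \<le> P (u + h) - P u"
proof -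
  define t where "t n = 1 / real (Suc n)" for n
  define ds where "ds n = (1 / t n) *\<^sub>R (P (u + t n *\<^sub>R h) - P u)" for n
  have sc: "sconv ds d"
    unfolding ds_def
    by (rule quotient_sconv[OF assms(1,2) _ assms(3) sconv_const])
       (use assms LIMSEQ_Suc[OF lim_1_over_n] in \<open>auto simp: t_def\<close>)
  have "ds n \<le> P (u + h) - P u" for n
  proof -
    have t: "0 < t n" "t n \<le> 1" by (auto simp: t_def)
    have "u + t n *\<^sub>R h = (1 - t n) *\<^sub>R u + t n *\<^sub>R (u + h)" by (simp add: algebra_simps)
    then have "P (u + t n *\<^sub>R h) - P u \<le> t n *\<^sub>R (P (u + h) - P u)"
      using P_convex[of u "u + h" "t n"] assms t by (simp add: algebra_simps diff_le_eq)
    from scaleR_left_mono[OF this, of "1 / t n"] t show ?thesis by (simp add: ds_def)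
  qed
  then have "0 \<le> (P (u + h) - P u) - d"
    by (intro wconv_nonneg[OF wconv_diff[OF wconv_const sconv_imp_wconv[OF sc]]])
       (auto simp: ds_def has_deriv_H[OF assms(1)])
  then show ?thesis by simp
qed

section \<open>Newton remainder, Bouligand limits and points of Gateaux differentiability\<close>

lemma has_deriv_nr: "has_deriv u h d \<Longrightarrow> nr d \<le> nr h"
  by (rule nr_le_if_ip_le) (simp add: has_deriv_ip)

lemma crit_cong:
  assumes "P u = P v" and "\<And>w. w \<in> radial (P u) \<Longrightarrow> ip (P u - u) w = 0 \<longleftrightarrow> ip (P v - v) w = 0"
  shows "crit u = crit v"
  using assms unfolding crit_def by fastforce

text \<open>The doubled increment is a quotient with step \<open>2 * t n\<close> in the same
  direction, so \<open>ds\<close> and \<open>es\<close> share the limit d, and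
  \<open>gs n - ds n\<close> is trapped between 0 and \<open>2 *\<^sub>R (es n - ds n)\<close>,
  which tends to zero.\<close>

lemma Newton_remainder:
  assumes u: "u \<in> H" and h: "\<And>n. hs n \<in> H" "k \<in> H" "sconv (\<lambda>n. (1 / t n) *\<^sub>R hs n) k"
    and t: "\<And>n. 0 < t n" "t \<longlonglongrightarrow> 0"
    and g: "\<And>n. g n \<in> H" "\<And>n. P (u + hs n) - P u \<le> g n"
      "\<And>n. g n \<le> P (u + 2 *\<^sub>R hs n) - P (u + hs n)" "\<And>n. ip (g n) (g n) \<le> ip (hs n) (g n)"
  shows "(\<lambda>n. nr (P (u + hs n) - P u - g n) / t n) \<longlonglongrightarrow> 0"
proof -
  define ks where "ks n = (1 / t n) *\<^sub>R hs n" for n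
  define ds where "ds n = (1 / t n) *\<^sub>R (P (u + hs n) - P u)" for n
  define es where "es n = (1 / (2 * t n)) *\<^sub>R (P (u + 2 *\<^sub>R hs n) - P u)" for n
  define gs where "gs n = (1 / t n) *\<^sub>R g n" for n
  have t0: "t n \<noteq> 0" for n using t(1)[of n] by simp
  have H: "ks n \<in> H" "ds n \<in> H" "es n \<in> H" "gs n \<in> H" for n
    using h g by (simp_all add: ks_def ds_def es_def gs_def)
  have ks: "sconv ks k" using h(3) by (simp add: ks_def[abs_def])
  obtain d where d: "has_deriv u k d" using has_deriv_exists u h by blast
  have dH: "d \<in> H" using has_deriv_H[OF d] .
  have ds: "sconv ds d"
    using quotient_sconv[OF d u H(1) h(2) ks t] t0 by (simp add: ks_def ds_def[abs_def])
  have es: "sconv es d"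
    using quotient_sconv[OF d u H(1) h(2) ks, of "\<lambda>n. 2 * t n"] t0 t tendsto_mult_right_zero[OF t(2), of 2]
    by (simp add: ks_def es_def[abs_def])
  have up: "gs n - ds n \<le> 2 *\<^sub>R (es n - ds n)" for n
  proof -
    have "g n - (P (u + hs n) - P u) \<le> (P (u + 2 *\<^sub>R hs n) - P u) - 2 *\<^sub>R (P (u + hs n) - P u)"
      using g(3)[of n] by (simp add: algebra_simps scaleR_2)
    from scaleR_left_mono[OF this, of "1 / t n"] t(1)[of n] show ?thesis
      by (simp add: gs_def ds_def es_def scaleR_right_diff_distrib)
  qed
  have lo: "0 \<le> gs n - ds n" for n
    using g(2)[of n] t(1)[of n]
    by (simp add: gs_def ds_def scaleR_left_mono)
  have gg: "ip (gs n) (gs n) \<le> ip (ks n) (gs n)" for n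
    using g(4)[of n] t(1)[of n] by (simp add: gs_def ks_def ip_simps divide_right_mono)
  obtain C where C: "\<And>n. nr (ks n) \<le> C" using sconv_bounded[OF ks] by blast
  have gsC: "nr (gs n) \<le> C" for n
    using nr_le_if_ip_le[OF gg] C order_trans by blast
  have "(\<lambda>n. ip \<eta> \<bar>gs n - d\<bar>) \<longlonglongrightarrow> 0"
  proof (rule tendsto_sandwich[OF _ _ tendsto_const])
    have "(\<lambda>n. 2 * ip \<eta> (es n - ds n) + ip \<eta> \<bar>ds n - d\<bar>) \<longlonglongrightarrow> 2 * ip \<eta> (d - d) + 0"
      by (intro tendsto_add tendsto_mult tendsto_const eta_abs_wconv wconvD'[OF _ eta_H]
          sconv_imp_wconv[OF sconv_diff[OF es ds]] sconv_imp_wconv[OF ds]) (simp_all add: H dH)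
    then show "(\<lambda>n. 2 * ip \<eta> (es n - ds n) + ip \<eta> \<bar>ds n - d\<bar>) \<longlonglongrightarrow> 0" by simp
    have "ip \<eta> \<bar>gs n - d\<bar> \<le> 2 * ip \<eta> (es n - ds n) + ip \<eta> \<bar>ds n - d\<bar>" for n
    proof -
      have "\<bar>gs n - d\<bar> \<le> \<bar>gs n - ds n\<bar> + \<bar>ds n - d\<bar>"
        using abs_triangle_ineq[of "gs n - ds n" "ds n - d"] by simp
      also have "\<dots> \<le> 2 *\<^sub>R (es n - ds n) + \<bar>ds n - d\<bar>"
        using up lo by (simp add: abs_of_nonneg)
      finally have "ip \<eta> \<bar>gs n - d\<bar> \<le> ip \<eta> (2 *\<^sub>R (es n - ds n) + \<bar>ds n - d\<bar>)"
        by (rule eta_mono[rotated 2]) (simp_all add: H dH)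
      then show ?thesis by (simp add: ip_simps)
    qed
    then show "\<forall>\<^sub>F n in sequentially. ip \<eta> \<bar>gs n - d\<bar> \<le> 2 * ip \<eta> (es n - ds n) + ip \<eta> \<bar>ds n - d\<bar>"
      by simp
    show "\<forall>\<^sub>F n in sequentially. 0 \<le> ip \<eta> \<bar>gs n - d\<bar>"
      by (intro always_eventually allI eta_nonneg) (simp_all add: H dH)
  qed
  from wconv_if_eta[OF H(4) dH gsC this] have gw: "wconv gs d" .
  \<comment> \<open>The energy inequality bounds the squared norm by a pairing of a strongly with a
    weakly convergent sequence; its limit \<open>ip k d\<close> is \<open>ip d d\<close>.\<close>
  have "(\<lambda>n. ip (ks n) (gs n)) \<longlonglongrightarrow> ip d d"
    using sconv_wconv_ip[OF ks h(2) gw] has_deriv_ip[OF d] by simp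
  from sconv_if_wconv[OF gw this gg] have "sconv gs d" .
  from sconv_diff[OF ds this] have "(\<lambda>n. nr (ds n - gs n)) \<longlonglongrightarrow> 0"
    by (simp add: sconv_def)
  moreover have "nr (ds n - gs n) = nr (P (u + hs n) - P u - g n) / t n" for n
    using t(1)[of n] by (simp add: ds_def gs_def nr_scale flip: scaleR_right_diff_distrib)
  ultimately show ?thesis by simp
qed

text \<open>At each approximating point the derivative lies below the increment of \<open>P\<close>.
  Linearity moves the base point from \<open>xs n\<close> to x at the cost of
  \<open>Gs n (x - xs n)\<close>, which vanishes by the uniform norm bound, and the remaining
  inequality is stable under weak limits. The energy estimate is lower semicontinuity of the
  norm.\<close>

lemma Bouligand_limit:
  assumes x: "\<And>n. xs n \<in> H" "sconv xs x" "x \<in> H"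
    and G: "\<And>n h. h \<in> H \<Longrightarrow> has_deriv (xs n) h (Gs n h)"
      "\<And>n h k. h \<in> H \<Longrightarrow> k \<in> H \<Longrightarrow> Gs n (h + k) = Gs n h + Gs n k"
    and lim: "\<And>h. h \<in> H \<Longrightarrow> wconv (\<lambda>n. Gs n h) (G h)"
  shows "z \<in> H \<Longrightarrow> G (z - x) \<le> P z - P x" and "h \<in> H \<Longrightarrow> ip (G h) (G h) \<le> ip h (G h)"
proof -
  assume z: "z \<in> H"
  have GH: "Gs n h \<in> H" if "h \<in> H" for n h using has_deriv_H G that by blast
  have le: "Gs n (z - x) + Gs n (x - xs n) \<le> P z - P (xs n)" for n
    using has_deriv_le[OF G(1), of "z - xs n" n] z x G(2)[of "z - x" "x - xs n" n] by simp
  have s0: "sconv (\<lambda>n. Gs n (x - xs n)) 0"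
    unfolding sconv_def
  proof (rule tendsto_sandwich[OF _ _ tendsto_const])
    show "(\<lambda>n. nr (x - xs n)) \<longlonglongrightarrow> 0" using x(2) by (simp add: sconv_def nr_commute)
    show "\<forall>\<^sub>F n in sequentially. nr (Gs n (x - xs n) - 0) \<le> nr (x - xs n)"
      using has_deriv_nr[OF G(1)] x by simp
  qed simp
  have sP: "sconv (\<lambda>n. P (xs n)) (P x)"
    unfolding sconv_def
  proof (rule tendsto_sandwich[OF _ _ tendsto_const])
    show "(\<lambda>n. nr (xs n - x)) \<longlonglongrightarrow> 0" using x(2) by (simp add: sconv_def)
    show "\<forall>\<^sub>F n in sequentially. nr (P (xs n) - P x) \<le> nr (xs n - x)"
      using P_lipschitz by simp
  qed simp
  have "wconv (\<lambda>n. P z - P (xs n) - (Gs n (z - x) + Gs n (x - xs n))) (P z - P x - (G (z - x) + 0))"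
    by (intro wconv_diff wconv_const wconv_add lim sconv_imp_wconv[OF sP] sconv_imp_wconv[OF s0])
       (simp_all add: GH x z)
  then have "0 \<le> P z - P x - (G (z - x) + 0)"
    by (rule wconv_nonneg) (use le in simp)
  then show "G (z - x) \<le> P z - P x" by simp
next
  assume h: "h \<in> H"
  show "ip (G h) (G h) \<le> ip h (G h)"
    by (rule wconv_nr_le[OF lim[OF h] wconvD'[OF lim[OF h] h]])
       (simp add: has_deriv_ip[OF G(1)[OF h]])
qed

text \<open>
  Subtracting a multiple of a suitable \<open>\<mu>\<close> from \<open>u\<close> produces strict complementarity without
  moving the solution: \<open>z\<close> is the response of \<open>y = P u\<close> to the strictly negative force \<open>- \<eta>\<close>,
  \<open>z\<close> is negative off the contact set, and \<open>\<mu> = z + \<eta>\<close> is the contact force. If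
  \<open>w \<ge> 0\<close> and \<open>\<mu>\<close> vanishes on \<open>w\<close>, then \<open>w\<close> is the weak limit of \<open>inf w (- k z)\<close>, so \<open>- w\<close> is
  critical as well.
\<close>

lemma regular_perturbation:
  assumes u: "u \<in> H"
  shows "\<exists>\<mu>\<in>H. (\<forall>c>0. \<forall>c'>0. crit (u - c *\<^sub>R \<mu>) = crit (u - c' *\<^sub>R \<mu>)) \<and>
    (\<forall>c>0. \<forall>h\<in>H. \<forall>d w. has_deriv (u - c *\<^sub>R \<mu>) h d \<longrightarrow> w \<in> crit (u - c *\<^sub>R \<mu>) \<longrightarrow> ip (d - h) w = 0)"
proof -
  define y where "y = P u"
  define \<xi> where "\<xi> = P u - u"
  have yH: "y \<in> H" and yK: "y \<in> K" by (simp_all add: y_def P_K)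
  \<comment> \<open>As an element of K, y is its own projection with zero residual, so every radial
    direction at y is critical there.\<close>
  have Py: "P y = y" by (rule P_eqI) (simp add: solves_def yK)
  define t where "t n = 1 / real (Suc n)" for n
  have t: "0 < t n" "t \<longlonglongrightarrow> 0" for n
    using LIMSEQ_Suc[OF lim_1_over_n] by (auto simp: t_def[abs_def])
  define rs where "rs n = (1 / t n) *\<^sub>R (P (y + t n *\<^sub>R (- \<eta>)) - P y)" for n
  obtain z where z: "has_deriv y (- \<eta>) z" "sconv rs z"
    using quotient_tendsto[OF yH, of "\<lambda>_. - \<eta>" "- \<eta>" t] t
    by (auto simp: sconv_const rs_def[abs_def])
  have zH: "z \<in> H" using has_deriv_H[OF z(1)] .
  have rsr: "rs n \<in> radial y" for n
    using t(1)[of n] P_K yH by (auto simp: radial_def rs_def Py intro!: exI[of _ "t n"])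
  have rsH: "rs n \<in> H" for n using radial_H[OF rsr] .
  have rsw: "wconv rs z" by (rule sconv_imp_wconv[OF z(2) rsH zH])
  define \<mu> where "\<mu> = z + \<eta>"
  have muH: "\<mu> \<in> H" using zH by (simp add: \<mu>_def)
  have rad_crit: "w \<in> crit y" if "w \<in> radial y" for w
    by (rule crit_I) (simp_all add: Py that)
  have mu_rad: "0 \<le> ip \<mu> w" if "w \<in> radial y" for w
    using has_deriv_orth[OF z(1) rad_crit[OF that]] by (simp add: \<mu>_def)
  have pos_rad: "w \<in> radial y" if "w \<in> H" "0 \<le> w" for w
    by (rule radial_up[OF yH _ that]) (auto simp: radial_def yK intro!: exI[of _ 1])
  \<comment> \<open>Dropping the positive part of z keeps it critical, and the variational
    inequality penalises that positive part through both z and \<open>\<eta>\<close>.\<close>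
  have z_neg: "pprt z = 0"
  proof -
    have "- pprt (- z) \<in> crit y"
      unfolding crit_def mem_Collect_eq
    proof (intro exI conjI allI)
      show "wconv (\<lambda>n. - pprt (- rs n)) (- pprt (- z))"
        by (intro wconv_minus wconv_pprt rsw)
      show "- pprt (- rs n) \<in> radial (P y)" for n by (simp add: Py radial_neg[OF yK rsr])
    qed (simp add: Py)
    then have "0 \<le> ip (z + \<eta>) (- pprt (- z) - z)"
      using z(1) unfolding has_deriv_def by (auto dest!: bspec[of _ _ "- pprt (- z)"])
    moreover have "- pprt (- z) - z = - pprt z"
      using pprt_minus_pprt[of z] by (simp add: algebra_simps)
    ultimately have "ip z (pprt z) + ip \<eta> (pprt z) \<le> 0" by (simp add: ip_simps)
    with pprt_ip[OF zH] eta_nonneg[of "pprt z"] zH have "ip (pprt z) (pprt z) \<le> 0" by simp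
    with ip_definite[of "pprt z"] ip_nonneg[of "pprt z"] zH show ?thesis by simp
  qed
  have "- pprt (- z) = z" using pprt_minus_pprt[of z] z_neg by simp
  then have nz: "pprt (- z) = - z" by (metis minus_minus)
  \<comment> \<open>\<open>\<mu>\<close> is nonnegative on admissible directions at y, so adding a
    positive multiple of it to the residual preserves the variational inequality.\<close>
  have shift: "P (u - c *\<^sub>R \<mu>) = y" if "c > 0" for c
  proof (rule P_eqI)
    show "solves (u - c *\<^sub>R \<mu>) y"
      unfolding solves_def
    proof (intro conjI ballI yK)
      fix v assume v: "v \<in> K"
      then have "v - y \<in> radial y" using yH K_H by (auto simp: radial_def intro!: exI[of _ 1])
      from mult_nonneg_nonneg[OF less_imp_le[OF that] mu_rad[OF this]] P_VI[OF v, of u] show "0 \<le> ip (y - (u - c *\<^sub>R \<mu>)) (v - y)"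
        by (simp add: y_def ip_diff_left ip_add_left ip_scale_left)
    qed
  qed
  have xi_rad: "0 \<le> ip \<xi> w" if "w \<in> radial y" for w
    using residual_radial[of w u] that by (simp add: \<xi>_def y_def)
  have res: "ip (P (u - c *\<^sub>R \<mu>) - (u - c *\<^sub>R \<mu>)) w = ip \<xi> w + c * ip \<mu> w" if "c > 0" for c w
    by (simp add: shift[OF that]) (simp add: \<xi>_def y_def ip_diff_left ip_scale_left)
  \<comment> \<open>Both summands of the new residual are nonnegative on radial directions; the
    weight c therefore does not affect where their sum vanishes.\<close>
  have res0: "ip (P (u - c *\<^sub>R \<mu>) - (u - c *\<^sub>R \<mu>)) w = 0 \<longleftrightarrow> ip \<xi> w = 0 \<and> ip \<mu> w = 0"
    if c: "c > 0" and w: "w \<in> radial y" for c w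
    unfolding res[OF c] using c xi_rad[OF w] mu_rad[OF w] by (simp add: add_nonneg_eq_0_iff)
  have crit_eq: "crit (u - c *\<^sub>R \<mu>) = crit (u - c' *\<^sub>R \<mu>)" if "c > 0" "c' > 0" for c c'
    by (rule crit_cong) (use that res0 shift in auto)
  have orth: "ip (d - h) w = 0"
    if c: "c > 0" and h: "h \<in> H" and d: "has_deriv (u - c *\<^sub>R \<mu>) h d" and w: "w \<in> crit (u - c *\<^sub>R \<mu>)" for c h d w
  proof -
    define a where "a = d - h"
    have aH: "a \<in> H" using has_deriv_H[OF d] h by (simp add: a_def)
    have a_crit: "0 \<le> ip a w" if "w \<in> radial y" "ip \<xi> w = 0" "ip \<mu> w = 0" for w
      unfolding a_def
      by (rule has_deriv_orth[OF d crit_I]) (simp_all add: that shift[OF c] res0[OF c, simplified shift[OF c]])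
    have main: "ip a w = 0" if w: "w \<in> radial y" "ip \<xi> w = 0" "ip \<mu> w = 0" for w
    proof -
      have wH: "w \<in> H" using radial_H w(1) .
      define p q where "p = pprt w" and "q = pprt (- w)"
      have pq: "p \<in> H" "q \<in> H" "0 \<le> p" "0 \<le> q"
        using wH by (simp_all add: p_def q_def)
      have w_eq: "w = p - q" by (simp add: p_def q_def pprt_minus_pprt)
      have rpq: "p \<in> radial y" "q \<in> radial y" "- q \<in> radial y"
        using pos_rad[OF pq(1,3)] pos_rad[OF pq(2,4)] radial_neg[OF yK w(1)] by (simp_all add: q_def)
      have q0: "ip \<xi> q = 0" "ip \<mu> q = 0"
        using xi_rad[OF rpq(2)] xi_rad[OF rpq(3)] mu_rad[OF rpq(2)] mu_rad[OF rpq(3)]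
        by (simp_all add: ip_minus_right)
      have p0: "ip \<xi> p = 0" "ip \<mu> p = 0"
        using w(2,3) q0 by (simp_all add: w_eq ip_diff_right)
      have dom: "ip \<xi> m = 0 \<and> ip \<mu> m = 0" if m: "m \<in> H" "0 \<le> m" "m \<le> p" for m
        using xi_rad[OF pos_rad[OF m(1,2)]] mu_rad[OF pos_rad[OF m(1,2)]]
          xi_rad[OF pos_rad[of "p - m"]] mu_rad[OF pos_rad[of "p - m"]] m pq p0
        by (simp add: ip_diff_right)
      \<comment> \<open>The argument of \<open>ip a\<close> is the infimum of p and
        \<open>- (k *\<^sub>R z)\<close>. Its approximations m, built from \<open>rs j\<close> in
        place of z, lie between 0 and p, so both forces vanish on them, and \<open>- m\<close>
        dominates an admissible direction. Thus \<open>- m\<close> is critical, and a is nonpositive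
        on m.\<close>
      have step: "ip a (p - pprt (p + k *\<^sub>R z)) \<le> 0" if k: "k > 0" for k
      proof -
        have "ip a (p - pprt (p - k *\<^sub>R pprt (- rs j))) \<le> 0" for j
        proof -
          define m where "m = inf p (k *\<^sub>R pprt (- rs j))"
          have m_eq: "m = p - pprt (p - k *\<^sub>R pprt (- rs j))" by (simp add: m_def inf_pprt)
          have mH: "m \<in> H" using pq rsH by (simp add: m_eq)
          have m: "0 \<le> m" "m \<le> p" "m \<le> k *\<^sub>R pprt (- rs j)"
            using pq k by (simp_all add: m_def scaleR_nonneg_nonneg)
          have "k *\<^sub>R (- pprt (- rs j)) \<in> radial y"
            using radial_scale[OF yK radial_neg[OF yK rsr]] k by simp
          from radial_up[OF yH this, of "- m"] m(3) mH have "- m \<in> radial y" by simp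
          from a_crit[OF this] dom[OF mH m(1,2)] show ?thesis
            by (simp add: ip_minus_right flip: m_eq)
        qed
        moreover have "wconv (\<lambda>j. p - pprt (p - k *\<^sub>R pprt (- rs j))) (p - pprt (p - k *\<^sub>R pprt (- z)))"
          by (intro wconv_diff wconv_const wconv_pprt wconv_scale wconv_minus rsw pq)
        ultimately have "ip a (p - pprt (p - k *\<^sub>R pprt (- z))) \<le> 0"
          using LIMSEQ_le_const2[OF wconvD'[OF _ aH]] by blast
        then show ?thesis by (simp add: nz)
      qed
      \<comment> \<open>What truncation by multiples of \<open>- z\<close> misses of p. Since
        \<open>\<mu> = z + \<eta>\<close> vanishes on it, z acts there as \<open>- \<eta>\<close>,
        and the energy inequality for positive parts bounds \<open>Suc n\<close> times its
        mass.\<close>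
      define qs where "qs n = pprt (p + real (Suc n) *\<^sub>R z)" for n
      have qsH: "qs n \<in> H" "0 \<le> qs n" for n using pq zH by (simp_all add: qs_def)
      have qs_le: "qs n \<le> p" for n
      proof -
        have "0 \<le> - z" using nz zero_le_pprt[of "- z"] by simp
        then have "real (Suc n) *\<^sub>R z \<le> 0" by (simp add: scaleR_nonneg_nonpos del: of_nat_Suc)
        then show ?thesis using pq(3) by (simp add: qs_def pprt_le_iff add_increasing2 del: of_nat_Suc)
      qed
      have qs_ip: "ip (qs n) (qs n) \<le> ip p (qs n) - real (Suc n) * ip \<eta> (qs n)" for n
      proof -
        have "ip z (qs n) = - ip \<eta> (qs n)"
          using dom[OF qsH qs_le, of n] by (simp add: \<mu>_def ip_add_left)
        then show ?thesis
          using pprt_ip[of "p + real (Suc n) *\<^sub>R z"] pq zH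
          by (simp add: ip_add_left ip_scale_left del: of_nat_Suc flip: qs_def)
      qed
      have eta0: "0 \<le> ip \<eta> (qs n)" for n by (rule eta_nonneg[OF qsH])
      have "ip (qs n) (qs n) \<le> ip p (qs n)" for n
        using qs_ip[of n] mult_nonneg_nonneg[OF of_nat_0_le_iff eta0, of "Suc n" n] by linarith
      from nr_le_if_ip_le[OF this] have qs_nr: "nr (qs n) \<le> nr p" for n .
      have eta_le: "ip \<eta> (qs n) \<le> (nr p * nr p) * (1 / real (Suc n))" for n
      proof -
        have "real (Suc n) * ip \<eta> (qs n) \<le> ip p (qs n)"
          using qs_ip[of n] ip_nonneg[of "qs n"] by linarith
        also have "\<dots> \<le> nr p * nr p"
          using ip_le[of p "qs n"] mult_left_mono[OF qs_nr[of n] nr_nonneg[of p]] by simp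
        finally show ?thesis by (simp add: field_simps del: of_nat_Suc)
      qed
      have "wconv qs 0"
      proof (rule wconv_if_eta[OF qsH(1) H_zero qs_nr], rule tendsto_sandwich[OF _ _ tendsto_const])
        show "(\<lambda>n. (nr p * nr p) * (1 / real (Suc n))) \<longlonglongrightarrow> 0"
          by (intro tendsto_mult_right_zero LIMSEQ_Suc[OF lim_1_over_n])
        show "\<forall>\<^sub>F n in sequentially. 0 \<le> ip \<eta> \<bar>qs n - 0\<bar>"
          using eta0 qsH by (simp add: abs_of_nonneg)
        show "\<forall>\<^sub>F n in sequentially. ip \<eta> \<bar>qs n - 0\<bar> \<le> (nr p * nr p) * (1 / real (Suc n))"
          using eta_le qsH by (simp add: abs_of_nonneg del: of_nat_Suc)
      qed
      from wconvD'[OF wconv_diff[OF wconv_const[OF pq(1)] this] aH]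
      have "(\<lambda>n. ip a (p - qs n)) \<longlonglongrightarrow> ip a p" by simp
      then have "ip a p \<le> 0"
        by (rule LIMSEQ_le_const2) (use step in \<open>auto simp: qs_def simp del: of_nat_Suc\<close>)
      moreover have "0 \<le> ip a q" using a_crit[OF rpq(2) q0] .
      moreover have "0 \<le> ip a w" using a_crit[OF w] .
      ultimately show ?thesis by (simp add: w_eq ip_diff_right)
    qed
    obtain ws where ws: "\<And>n. ws n \<in> radial y" "\<And>n. ip \<xi> (ws n) = 0 \<and> ip \<mu> (ws n) = 0" "wconv ws w"
      using w unfolding crit_def shift[OF c] using res0[OF c] shift[OF c] by auto
    have "(\<lambda>n. ip a (ws n)) \<longlonglongrightarrow> 0" using main ws by simp
    with wconvD'[OF ws(3) aH] have "ip a w = 0" by (rule LIMSEQ_unique)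
    then show ?thesis by (simp add: a_def)
  qed
  show ?thesis
  proof (intro bexI[OF _ muH] conjI allI impI ballI)
    show "crit (u - c *\<^sub>R \<mu>) = crit (u - c' *\<^sub>R \<mu>)" if "c > 0" "c' > 0" for c c'
      using crit_eq[OF that] .
    show "ip (d - h) w = 0" if "c > 0" "h \<in> H" "has_deriv (u - c *\<^sub>R \<mu>) h d" "w \<in> crit (u - c *\<^sub>R \<mu>)" for c h d w
      using orth[OF that] .
  qed
qed

text \<open>With orthogonality to the critical cone in place of a one-sided inequality the
  derivative is linear: the defect of additivity is orthogonal to the cone and is combined from its
  elements. Because the cone does not depend on c, one operator G works at all perturbed
  points.\<close>

lemma regular_points:
  assumes u: "u \<in> H"
  shows "\<exists>\<mu>\<in>H. \<exists>G. (\<forall>c>0. \<forall>h\<in>H. has_deriv (u - c *\<^sub>R \<mu>) h (G h)) \<and>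
    (\<forall>h\<in>H. \<forall>k\<in>H. G (h + k) = G h + G k) \<and> (\<forall>c. \<forall>h\<in>H. G (c *\<^sub>R h) = c *\<^sub>R G h)"
proof -
  obtain \<mu> where mu: "\<mu> \<in> H" "\<And>c c'. c > 0 \<Longrightarrow> c' > 0 \<Longrightarrow> crit (u - c *\<^sub>R \<mu>) = crit (u - c' *\<^sub>R \<mu>)"
    "\<And>c h d w. c > 0 \<Longrightarrow> h \<in> H \<Longrightarrow> has_deriv (u - c *\<^sub>R \<mu>) h d \<Longrightarrow> w \<in> crit (u - c *\<^sub>R \<mu>) \<Longrightarrow> ip (d - h) w = 0"
    using regular_perturbation[OF u] by blast
  define v where "v = u - 1 *\<^sub>R \<mu>"
  have vH: "v \<in> H" using u mu(1) by (simp add: v_def)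
  define G where "G h = (THE d. has_deriv v h d)" for h
  have G: "has_deriv v h (G h)" if h: "h \<in> H" for h
  proof -
    obtain d where "has_deriv v h d" using has_deriv_exists[OF vH h] by blast
    then show ?thesis unfolding G_def by (rule theI) (rule has_deriv_unique[OF _ \<open>has_deriv v h d\<close>])
  qed
  have GH: "G h \<in> H" if "h \<in> H" for h using has_deriv_H[OF G[OF that]] .
  have Gc: "G h \<in> crit v" if "h \<in> H" for h using G[OF that] by (simp add: has_deriv_def)
  have orth: "ip (G h) w = ip h w" if "h \<in> H" "w \<in> crit v" for h w
    using mu(3)[of 1 h "G h" w] that G[OF that(1)] by (simp add: v_def ip_diff_left)
  have "has_deriv (u - c *\<^sub>R \<mu>) h (G h)" if "c > 0" "h \<in> H" for c h
    using G[OF that(2)] mu(2)[OF that(1), of 1] unfolding has_deriv_def v_def by simp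
  moreover have "G (h + k) = G h + G k" if "h \<in> H" "k \<in> H" for h k
  proof (rule eqI_nr)
    have "ip (G (h + k) - (G h + G k)) w = 0" if "w \<in> crit v" for w
      using orth[OF _ that] \<open>h \<in> H\<close> \<open>k \<in> H\<close> by (simp add: ip_simps)
    then show "ip (G (h + k) - (G h + G k)) (G (h + k) - (G h + G k)) \<le> 0"
      using Gc that by (simp add: ip_diff_right ip_add_right)
  qed (simp_all add: GH that)
  moreover have "G (c *\<^sub>R h) = c *\<^sub>R G h" if "h \<in> H" for c h
  proof (rule eqI_nr)
    have "ip (G (c *\<^sub>R h) - c *\<^sub>R G h) w = 0" if "w \<in> crit v" for w
      using orth[OF _ that] \<open>h \<in> H\<close> by (simp add: ip_simps)
    then show "ip (G (c *\<^sub>R h) - c *\<^sub>R G h) (G (c *\<^sub>R h) - c *\<^sub>R G h) \<le> 0"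
      using Gc that by (simp add: ip_diff_right ip_scale_right)
  qed (simp_all add: GH that)
  ultimately show ?thesis using mu(1) by blast
qed

end

subsection \<open>Classes of measurable functions\<close>

text \<open>
  The locales take forms on the whole type, whereas \<open>L\<^sup>2\<close> and \<open>H\<^sub>0\<^sup>1\<close> products are bilinear on
  subspaces only. Projecting along a complement extends them.
\<close>

lemma ex_semi_inner:
  fixes W :: "'v::real_vector set" and b :: "'v \<Rightarrow> 'v \<Rightarrow> real"
  assumes W: "subspace W"
    and comm: "\<And>x y. x \<in> W \<Longrightarrow> y \<in> W \<Longrightarrow> b x y = b y x"
    and add: "\<And>x y z. x \<in> W \<Longrightarrow> y \<in> W \<Longrightarrow> z \<in> W \<Longrightarrow> b (x + y) z = b x z + b y z"
    and scale: "\<And>c x y. x \<in> W \<Longrightarrow> y \<in> W \<Longrightarrow> b (c *\<^sub>R x) y = c * b x y"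
    and nonneg: "\<And>x. x \<in> W \<Longrightarrow> 0 \<le> b x x"
  shows "\<exists>ip. semi_inner ip \<and> (\<forall>x\<in>W. \<forall>y\<in>W. ip x y = b x y)"
proof -
  have "linear (\<lambda>x::'v. x)" by (rule linearI) auto
  from linear_exists_left_inverse_on[OF this W] obtain g :: "'v \<Rightarrow> 'v"
    where g: "range g \<subseteq> W" "linear g" "\<And>v. v \<in> W \<Longrightarrow> g v = v" by auto
  have gW: "g x \<in> W" for x using g(1) by auto
  have "semi_inner (\<lambda>x y. b (g x) (g y))"
    by unfold_locales
       (simp_all add: linear_add[OF g(2)] linear_scale[OF g(2)] add scale nonneg gW comm[OF gW gW])
  then show ?thesis using g(3) by (intro exI[of _ "\<lambda>x y. b (g x) (g y)"]) auto
qed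

lemma Fatou_bound:
  fixes g :: "'a \<Rightarrow> real"
  assumes int: "\<And>n. integrable M (gs n)" and nonneg: "\<And>n x. 0 \<le> gs n x"
    and meas: "g \<in> borel_measurable M" and conv: "AE x in M. (\<lambda>n. gs n x) \<longlonglongrightarrow> g x"
    and bound: "\<And>n. integral\<^sup>L M (gs n) \<le> C"
  shows "integrable M g" and "integral\<^sup>L M g \<le> C"
proof -
  have "0 \<le> integral\<^sup>L M (gs 0)" by (rule integral_nonneg_AE) (simp add: nonneg)
  with bound[of 0] have C: "0 \<le> C" by simp
  have g0: "AE x in M. 0 \<le> g x"
    using conv by eventually_elim (rule LIMSEQ_le_const, assumption, simp add: nonneg)
  have "(\<integral>\<^sup>+x. ennreal (g x) \<partial>M) = (\<integral>\<^sup>+x. liminf (\<lambda>n. ennreal (gs n x)) \<partial>M)"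
  proof (rule nn_integral_cong_AE, use conv in eventually_elim)
    case (elim x)
    from lim_imp_Liminf[OF _ tendsto_ennrealI[OF this]] show ?case by simp
  qed
  also have "\<dots> \<le> liminf (\<lambda>n. \<integral>\<^sup>+x. ennreal (gs n x) \<partial>M)"
    using int by (intro nn_integral_liminf) auto
  also have "\<dots> \<le> limsup (\<lambda>n. \<integral>\<^sup>+x. ennreal (gs n x) \<partial>M)"
    by (rule Liminf_le_Limsup) simp
  also have "\<dots> \<le> ennreal C"
  proof (rule Limsup_bounded, intro always_eventually allI)
    show "(\<integral>\<^sup>+x. ennreal (gs n x) \<partial>M) \<le> ennreal C" for n
      using nn_integral_eq_integral[OF int, of n] nonneg bound by (simp add: ennreal_leI)
  qed
  finally have le: "(\<integral>\<^sup>+x. ennreal (g x) \<partial>M) \<le> ennreal C" .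
  then show i: "integrable M g"
    using meas g0 by (intro integrableI_nonneg) (auto intro: le_less_trans)
  then show "integral\<^sup>L M g \<le> C"
    using le g0 C by (simp add: nn_integral_eq_integral)
qed

section \<open>Representatives, order and lattice operations\<close>

lemma rep_L0_measurable [measurable, simp]: "rep_L0 f \<in> borel_measurable lebesgue"
  using Quotient_rep_reflp[OF Quotient_L0, of f] by simp

lemma abs_rep_L0 [simp]: "abs_L0 (rep_L0 f) = f"
  by (rule Quotient_abs_rep[OF Quotient_L0])

lemma rep_abs_L0: "f \<in> borel_measurable lebesgue \<Longrightarrow> AE x in lebesgue. rep_L0 (abs_L0 f) x = f x"
  using Quotient_rep_abs[OF Quotient_L0, of f] by simp

lemma abs_L0_cong:
  "f \<in> borel_measurable lebesgue \<Longrightarrow> g \<in> borel_measurable lebesgue \<Longrightarrow> AE x in lebesgue. f x = g x \<Longrightarrow>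
   abs_L0 f = abs_L0 g"
  using Quotient_rel_abs[OF Quotient_L0, of f g] by simp

lemma L0_eqI: "AE x in lebesgue. rep_L0 f x = rep_L0 g x \<Longrightarrow> f = g"
  using abs_L0_cong[of "rep_L0 f" "rep_L0 g"] by simp

lemma rep_add: "AE x in lebesgue. rep_L0 (f + g) x = rep_L0 f x + rep_L0 g x"
  unfolding plus_L0_def map_fun_def comp_def id_def by (rule rep_abs_L0) simp

lemma rep_diff: "AE x in lebesgue. rep_L0 (f - g) x = rep_L0 f x - rep_L0 g x"
  unfolding minus_L0_def map_fun_def comp_def id_def by (rule rep_abs_L0) simp

lemma rep_uminus: "AE x in lebesgue. rep_L0 (- f) x = - rep_L0 f x"
  unfolding uminus_L0_def map_fun_def comp_def id_def by (rule rep_abs_L0) simp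

lemma rep_scale: "AE x in lebesgue. rep_L0 (c *\<^sub>R f) x = c * rep_L0 f x"
  unfolding scaleR_L0_def map_fun_def comp_def id_def real_scaleR_def by (rule rep_abs_L0) simp

lemma rep_zero: "AE x in lebesgue. rep_L0 0 x = 0"
  unfolding zero_L0_def by (rule rep_abs_L0) simp

instantiation L0 :: (euclidean_space) "{lattice_ab_group_add_abs, ordered_real_vector}"
begin

definition "f \<le> g \<longleftrightarrow> (AE x in lebesgue. rep_L0 f x \<le> rep_L0 g x)"
definition "f < g \<longleftrightarrow> f \<le> g \<and> \<not> g \<le> (f :: 'a L0)"
definition "sup f g = abs_L0 (\<lambda>x. max (rep_L0 f x) (rep_L0 g x))"
definition "inf f g = abs_L0 (\<lambda>x. min (rep_L0 f x) (rep_L0 g x))"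
definition "\<bar>f\<bar> = sup f (- f :: 'a L0)"

lemma rep_sup: "AE x in lebesgue. rep_L0 (sup f g) x = max (rep_L0 f x) (rep_L0 g x)"
  unfolding sup_L0_def by (rule rep_abs_L0) simp

lemma rep_inf: "AE x in lebesgue. rep_L0 (inf f g) x = min (rep_L0 f x) (rep_L0 g x)"
  unfolding inf_L0_def by (rule rep_abs_L0) simp

instance
proof
  fix f g h :: "'a L0" and a b :: real
  show "f < g \<longleftrightarrow> f \<le> g \<and> \<not> g \<le> f" by (simp add: less_L0_def)
  show "f \<le> f" by (simp add: less_eq_L0_def)
  show "f \<le> h" if "f \<le> g" "g \<le> h"
    using that unfolding less_eq_L0_def by eventually_elim simp
  show "f = g" if "f \<le> g" "g \<le> f"
  proof (rule L0_eqI)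
    show "AE x in lebesgue. rep_L0 f x = rep_L0 g x"
      using that unfolding less_eq_L0_def by eventually_elim simp
  qed
  show "h + f \<le> h + g" if "f \<le> g"
    using that rep_add[of h f] rep_add[of h g] unfolding less_eq_L0_def by eventually_elim simp
  show "inf f g \<le> f" "inf f g \<le> g"
    using rep_inf[of f g] unfolding less_eq_L0_def by (eventually_elim, simp)+
  show "f \<le> inf g h" if "f \<le> g" "f \<le> h"
    using that rep_inf[of g h] unfolding less_eq_L0_def by eventually_elim simp
  show "f \<le> sup f g" "g \<le> sup f g"
    using rep_sup[of f g] unfolding less_eq_L0_def by (eventually_elim, simp)+
  show "sup g h \<le> f" if "g \<le> f" "h \<le> f"
    using that rep_sup[of g h] unfolding less_eq_L0_def by eventually_elim simp
  show "\<bar>f\<bar> = sup f (- f)" by (rule abs_L0_def)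
  show "a *\<^sub>R f \<le> a *\<^sub>R g" if "f \<le> g" "0 \<le> a"
    using that(1) rep_scale[of a f] rep_scale[of a g] unfolding less_eq_L0_def
    by eventually_elim (simp add: that(2) mult_left_mono)
  show "a *\<^sub>R f \<le> b *\<^sub>R f" if "a \<le> b" "0 \<le> f"
    using that(2) rep_scale[of a f] rep_scale[of b f] rep_zero unfolding less_eq_L0_def
    by eventually_elim (simp add: that(1) mult_right_mono)
qed

end

lemma rep_pprt: "AE x in lebesgue. rep_L0 (pprt f) x = max (rep_L0 f x) 0"
  unfolding pprt_def using rep_sup[of f 0] rep_zero by eventually_elim simp

lemma rep_abs: "AE x in lebesgue. rep_L0 \<bar>f\<bar> x = \<bar>rep_L0 f x\<bar>"
  unfolding abs_L0_def using rep_sup[of f "-f"] rep_uminus[of f] by eventually_elim auto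

section \<open>Square integrable functions and their completeness\<close>

definition L2 :: "'a::euclidean_space L0 set"
  where "L2 = {f. integrable lebesgue (\<lambda>x. (rep_L0 f x)\<^sup>2)}"

definition ip2 :: "'a::euclidean_space L0 \<Rightarrow> 'a L0 \<Rightarrow> real"
  where "ip2 f g = (LINT x|lebesgue. rep_L0 f x * rep_L0 g x)"

lemma integrable_mult_squares:
  fixes f g :: "'a \<Rightarrow> real"
  assumes [measurable]: "f \<in> borel_measurable M" "g \<in> borel_measurable M"
    and "integrable M (\<lambda>x. (f x)\<^sup>2)" "integrable M (\<lambda>x. (g x)\<^sup>2)"
  shows "integrable M (\<lambda>x. f x * g x)"
proof (rule Bochner_Integration.integrable_bound)
  show "integrable M (\<lambda>x. (f x)\<^sup>2 + (g x)\<^sup>2)" using assms by simp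
  have "\<bar>a * b\<bar> \<le> a\<^sup>2 + b\<^sup>2" for a b :: real
    using sum_squares_bound[of "\<bar>a\<bar>" "\<bar>b\<bar>"] mult_nonneg_nonneg[OF abs_ge_zero[of a] abs_ge_zero[of b]]
    by (simp add: abs_mult del: mult_nonneg_nonneg)
  then show "AE x in M. norm (f x * g x) \<le> norm ((f x)\<^sup>2 + (g x)\<^sup>2)" by simp
qed simp

lemma integrable_square_add:
  fixes f g :: "'a \<Rightarrow> real"
  assumes "f \<in> borel_measurable M" "g \<in> borel_measurable M"
    and "integrable M (\<lambda>x. (f x)\<^sup>2)" "integrable M (\<lambda>x. (g x)\<^sup>2)"
  shows "integrable M (\<lambda>x. (f x + g x)\<^sup>2)"
  unfolding power2_sum using assms integrable_mult_squares[OF assms] by (simp add: mult.assoc)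

lemma L2_mult: "f \<in> L2 \<Longrightarrow> g \<in> L2 \<Longrightarrow> integrable lebesgue (\<lambda>x. rep_L0 f x * rep_L0 g x)"
  by (rule integrable_mult_squares) (simp_all add: L2_def)

lemma L2_I:
  assumes [measurable]: "f \<in> borel_measurable lebesgue" and "integrable lebesgue (\<lambda>x. (f x)\<^sup>2)"
  shows "abs_L0 f \<in> L2"
  unfolding L2_def mem_Collect_eq
proof (rule integrable_cong_AE_imp[OF assms(2)])
  show "AE x in lebesgue. (f x)\<^sup>2 = (rep_L0 (abs_L0 f) x)\<^sup>2"
    using rep_abs_L0[OF assms(1)] by eventually_elim simp
qed simp

lemma subspace_L2: "subspace L2"
proof (rule subspaceI)
  show "0 \<in> L2"
    unfolding zero_L0_def by (rule L2_I) simp_all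
  show "f + g \<in> L2" if "f \<in> L2" "g \<in> L2" for f g :: "'a L0"
    unfolding plus_L0_def map_fun_def comp_def id_def using that
    by (intro L2_I integrable_square_add) (simp_all add: L2_def)
  show "c *\<^sub>R f \<in> L2" if "f \<in> L2" for c and f :: "'a L0"
    unfolding scaleR_L0_def map_fun_def comp_def id_def using that
    by (intro L2_I) (simp_all add: L2_def power_mult_distrib)
qed

lemma integral_L0_cong:
  assumes "AE x in lebesgue. f x = g x" and "f \<in> borel_measurable lebesgue" "g \<in> borel_measurable lebesgue"
  shows "(LINT x|lebesgue. f x) = (LINT x|lebesgue. (g x :: real))"
  using assms by (intro integral_cong_AE)

lemma ip2_commute: "ip2 f g = ip2 g f"
  by (simp add: ip2_def mult.commute)

lemma ip2_add: assumes "f \<in> L2" "g \<in> L2" "h \<in> L2" shows "ip2 (f + g) h = ip2 f h + ip2 g h"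
proof -
  have "ip2 (f + g) h = (LINT x|lebesgue. rep_L0 f x * rep_L0 h x + rep_L0 g x * rep_L0 h x)"
    unfolding ip2_def
    by (rule integral_L0_cong) (use rep_add[of f g] in \<open>eventually_elim, simp add: algebra_simps\<close>, simp_all)
  also have "\<dots> = ip2 f h + ip2 g h"
    using assms by (simp add: ip2_def L2_mult)
  finally show ?thesis .
qed

lemma ip2_scale: "ip2 (c *\<^sub>R f) h = c * ip2 f h"
proof -
  have "ip2 (c *\<^sub>R f) h = (LINT x|lebesgue. c * (rep_L0 f x * rep_L0 h x))"
    unfolding ip2_def
    by (rule integral_L0_cong) (use rep_scale[of c f] in \<open>eventually_elim, simp\<close>, simp_all)
  then show ?thesis by (simp add: ip2_def)
qed

lemma ip2_nonneg: "0 \<le> ip2 f f"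
  unfolding ip2_def by (rule integral_nonneg_AE) simp

lemma L2_definite:
  assumes "f \<in> L2" "ip2 f f = 0" shows "f = 0"
proof -
  have "AE x in lebesgue. rep_L0 f x * rep_L0 f x = 0"
    using integral_nonneg_eq_0_iff_AE[OF L2_mult[OF assms(1,1)]] assms(2) by (simp add: ip2_def)
  with rep_zero have "AE x in lebesgue. rep_L0 f x = rep_L0 0 x" by eventually_elim simp
  then show ?thesis by (rule L0_eqI)
qed

lemma ip2_diff_self:
  "ip2 (f - g) (f - g) = (LINT x|lebesgue. (rep_L0 f x - rep_L0 g x)\<^sup>2)"
  unfolding ip2_def
  by (rule integral_L0_cong)
     (use rep_diff[of f g] in \<open>eventually_elim, simp add: power2_eq_square\<close>, simp_all)

lemma L2_diff_integrable:
  assumes "f \<in> L2" "g \<in> L2" shows "integrable lebesgue (\<lambda>x. (rep_L0 f x - rep_L0 g x)\<^sup>2)"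
  using integrable_square_add[of "rep_L0 f" lebesgue "\<lambda>x. - rep_L0 g x"] assms by (simp add: L2_def)

text \<open>Weighted by \<open>2^n\<close>, the bounds \<open>(1/4)^n\<close> are still summable,
  and \<open>\<bar>a\<bar> \<le> 2^n * a\<^sup>2 + (1/2)^n\<close> turns the weighted squares into
  absolutely summable increments almost everywhere.\<close>

lemma fast_Cauchy_AE_convergent:
  fixes fs :: "nat \<Rightarrow> 'a \<Rightarrow> real"
  assumes [measurable]: "\<And>n. fs n \<in> borel_measurable M"
    and int: "\<And>n. integrable M (\<lambda>x. (fs (Suc n) x - fs n x)\<^sup>2)"
    and bound: "\<And>n. (LINT x|M. (fs (Suc n) x - fs n x)\<^sup>2) \<le> (1/4)^n"
  shows "AE x in M. convergent (\<lambda>n. fs n x)"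
proof -
  have "(\<integral>\<^sup>+x. (\<Sum>n. ennreal (2^n * (fs (Suc n) x - fs n x)\<^sup>2)) \<partial>M)
      = (\<Sum>n. \<integral>\<^sup>+x. ennreal (2^n * (fs (Suc n) x - fs n x)\<^sup>2) \<partial>M)"
    by (rule nn_integral_suminf) simp
  also have "\<dots> \<le> (\<Sum>n. ennreal ((1/2)^n))"
  proof (rule suminf_le)
    fix n
    have "(\<integral>\<^sup>+x. ennreal (2^n * (fs (Suc n) x - fs n x)\<^sup>2) \<partial>M) = ennreal (2^n * (LINT x|M. (fs (Suc n) x - fs n x)\<^sup>2))"
      using int[of n] by (subst nn_integral_eq_integral) simp_all
    also have "\<dots> \<le> ennreal (2^n * (1/4)^n)"
      by (intro ennreal_leI mult_left_mono bound) simp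
    also have "2^n * (1/4)^n = ((1/2)^n :: real)"
      by (simp flip: power_mult_distrib)
    finally show "(\<integral>\<^sup>+x. ennreal (2^n * (fs (Suc n) x - fs n x)\<^sup>2) \<partial>M) \<le> ennreal ((1/2)^n)" .
  qed simp_all
  also have "\<dots> = ennreal (\<Sum>n. (1/2)^n)"
    by (rule suminf_ennreal2) (simp_all add: summable_geometric)
  also have "\<dots> < \<infinity>" by simp
  finally have "AE x in M. (\<Sum>n. ennreal (2^n * (fs (Suc n) x - fs n x)\<^sup>2)) \<noteq> \<infinity>"
    by (intro nn_integral_PInf_AE) auto
  then show ?thesis
  proof eventually_elim
    case (elim x)
    have "summable (\<lambda>n. 2^n * (fs (Suc n) x - fs n x)\<^sup>2)"
      using elim by (intro summable_suminf_not_top) auto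
    then have s: "summable (\<lambda>n. 2^n * (fs (Suc n) x - fs n x)\<^sup>2 + (1/2)^n)"
      by (intro summable_add summable_geometric) simp_all
    have "summable (\<lambda>n. fs (Suc n) x - fs n x)"
    proof (rule summable_comparison_test'[OF s])
      fix n
      have "\<bar>a\<bar> \<le> 2^n * a\<^sup>2 + (1/2)^n" for a :: real
      proof -
        have "0 \<le> (2^n * \<bar>a\<bar> - 1)\<^sup>2" by simp
        then have "2 * (2^n * \<bar>a\<bar>) \<le> 2^n * (2^n * a\<^sup>2) + 1"
          by (simp add: power2_eq_square algebra_simps)
        then have "2^n * (2 * \<bar>a\<bar>) \<le> 2^n * (2^n * a\<^sup>2 + (1/2)^n)"
          by (simp add: algebra_simps flip: power_mult_distrib)
        then have "2 * \<bar>a\<bar> \<le> 2^n * a\<^sup>2 + (1/2)^n" by simp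
        then show ?thesis by linarith
      qed
      then show "norm (fs (Suc n) x - fs n x) \<le> 2^n * (fs (Suc n) x - fs n x)\<^sup>2 + (1/2)^n" by simp
    qed
    then have "convergent (\<lambda>n. \<Sum>k<n. fs (Suc k) x - fs k x)"
      by (simp add: summable_iff_convergent)
    then have "convergent (\<lambda>n. fs n x - fs 0 x)"
      using sum_lessThan_telescope[of "\<lambda>n. fs n x"] by simp
    then show ?case using convergent_add[OF _ convergent_const[of "fs 0 x"]] by fastforce
  qed
qed

lemma L2_complete:
  assumes L2: "\<And>n. xs n \<in> L2"
    and Cauchy: "\<And>\<epsilon>. \<epsilon> > 0 \<Longrightarrow> \<exists>N. \<forall>m\<ge>N. \<forall>n\<ge>N. ip2 (xs m - xs n) (xs m - xs n) < \<epsilon>"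
  shows "\<exists>f\<in>L2. (\<lambda>n. ip2 (xs n - f) (xs n - f)) \<longlonglongrightarrow> 0"
proof -
  have "\<exists>N. \<forall>n. \<forall>m\<ge>N n. \<forall>k\<ge>N n. ip2 (xs m - xs k) (xs m - xs k) < (1/4)^n"
    by (rule choice) (use Cauchy in simp)
  then obtain N where N: "\<And>n m k. N n \<le> m \<Longrightarrow> N n \<le> k \<Longrightarrow> ip2 (xs m - xs k) (xs m - xs k) < (1/4)^n"
    by blast
  define r where "r = rec_nat (N 0) (\<lambda>n k. max (Suc k) (N (Suc n)))"
  have r: "r n < r (Suc n)" "N n \<le> r n" for n
    by (auto simp: r_def) (cases n, auto)
  have rm: "strict_mono r" using r(1) by (simp add: strict_mono_Suc_iff)
  define fs where "fs n = rep_L0 (xs (r n))" for n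
  have [measurable]: "fs n \<in> borel_measurable lebesgue" for n by (simp add: fs_def)
  have "AE x in lebesgue. convergent (\<lambda>n. fs n x)"
  proof (rule fast_Cauchy_AE_convergent)
    show "integrable lebesgue (\<lambda>x. (fs (Suc n) x - fs n x)\<^sup>2)" for n
      unfolding fs_def by (rule L2_diff_integrable[OF L2 L2])
    show "(LINT x|lebesgue. (fs (Suc n) x - fs n x)\<^sup>2) \<le> (1/4)^n" for n
      using N[of n "r (Suc n)" "r n"] r[of n] by (simp add: fs_def flip: ip2_diff_self)
  qed simp
  then have conv: "AE x in lebesgue. (\<lambda>n. fs n x) \<longlonglongrightarrow> lim (\<lambda>n. fs n x)"
    by eventually_elim (simp add: convergent_LIMSEQ_iff)
  define f where "f = abs_L0 (\<lambda>x. lim (\<lambda>n. fs n x))"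
  have rep_f: "AE x in lebesgue. rep_L0 f x = lim (\<lambda>n. fs n x)"
    unfolding f_def by (rule rep_abs_L0) simp
  \<comment> \<open>Fatou's lemma along the fast subsequence; the shift by M keeps its indices
    beyond the Cauchy threshold.\<close>
  have key: "integrable lebesgue (\<lambda>x. (rep_L0 (xs m) x - rep_L0 f x)\<^sup>2) \<and> ip2 (xs m - f) (xs m - f) \<le> \<epsilon>"
    if m: "\<And>k. k \<ge> M \<Longrightarrow> ip2 (xs m - xs k) (xs m - xs k) < \<epsilon>" for m M \<epsilon>
  proof -
    have conv': "AE x in lebesgue. (\<lambda>n. (rep_L0 (xs m) x - fs (n + M) x)\<^sup>2) \<longlonglongrightarrow> (rep_L0 (xs m) x - rep_L0 f x)\<^sup>2"
      using conv rep_f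
    proof eventually_elim
      case (elim x)
      from LIMSEQ_ignore_initial_segment[OF elim(1), of M] show ?case
        unfolding elim(2) by (intro tendsto_power tendsto_diff tendsto_const)
    qed
    have le: "(LINT x|lebesgue. (rep_L0 (xs m) x - fs (n + M) x)\<^sup>2) \<le> \<epsilon>" for n
      using m[of "r (n + M)"] seq_suble[OF rm, of "n + M"] by (simp add: fs_def flip: ip2_diff_self)
    have int: "integrable lebesgue (\<lambda>x. (rep_L0 (xs m) x - fs (n + M) x)\<^sup>2)" for n
      unfolding fs_def by (rule L2_diff_integrable[OF L2 L2])
    show ?thesis
      using Fatou_bound[OF int _ _ conv' le] by (simp add: ip2_diff_self)
  qed
  obtain M0 where M0: "\<And>m k. m \<ge> M0 \<Longrightarrow> k \<ge> M0 \<Longrightarrow> ip2 (xs m - xs k) (xs m - xs k) < 1"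
    using Cauchy[of 1] by auto
  have fL2: "f \<in> L2"
  proof -
    have "integrable lebesgue (\<lambda>x. (rep_L0 (xs M0) x - rep_L0 f x)\<^sup>2)"
      using key[of M0 M0 1] M0 by blast
    moreover have "integrable lebesgue (\<lambda>x. (- rep_L0 (xs M0) x)\<^sup>2)" using L2 by (simp add: L2_def)
    ultimately have "integrable lebesgue (\<lambda>x. ((rep_L0 (xs M0) x - rep_L0 f x) + (- rep_L0 (xs M0) x))\<^sup>2)"
      by (intro integrable_square_add) simp_all
    then show ?thesis by (simp add: L2_def)
  qed
  moreover have "(\<lambda>n. ip2 (xs n - f) (xs n - f)) \<longlonglongrightarrow> 0"
  proof (rule LIMSEQ_I)
    fix \<epsilon> :: real assume e: "\<epsilon> > 0"
    obtain M where M: "\<And>m k. m \<ge> M \<Longrightarrow> k \<ge> M \<Longrightarrow> ip2 (xs m - xs k) (xs m - xs k) < \<epsilon> / 2"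
      using Cauchy[of "\<epsilon> / 2"] e by auto
    have "ip2 (xs n - f) (xs n - f) \<le> \<epsilon> / 2" if "n \<ge> M" for n
      using key[of M n "\<epsilon> / 2"] M that by blast
    then show "\<exists>M. \<forall>n\<ge>M. norm (ip2 (xs n - f) (xs n - f) - 0) < \<epsilon>"
    proof (intro exI[of _ M] allI impI)
      fix n assume "M \<le> n"
      then have "ip2 (xs n - f) (xs n - f) < \<epsilon>"
        using \<open>\<And>n. n \<ge> M \<Longrightarrow> ip2 (xs n - f) (xs n - f) \<le> \<epsilon> / 2\<close>[of n] e by linarith
      then show "norm (ip2 (xs n - f) (xs n - f) - 0) < \<epsilon>" using ip2_nonneg[of "xs n - f"] by simp
    qed
  qed
  ultimately show ?thesis by blast
qed

subsection \<open>Test functions\<close>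

lemma partial_derivI: "(f has_derivative f') (at x) \<Longrightarrow> partial_deriv i f x = f' i"
  unfolding partial_deriv_def by (simp flip: frechet_derivative_at)

lemma has_frechet:
  "f differentiable_on UNIV \<Longrightarrow> (f has_derivative frechet_derivative f (at x)) (at x)"
  by (simp add: differentiable_on_def flip: frechet_derivative_works)

lemma partial_deriv_add:
  assumes "f differentiable_on UNIV" "g differentiable_on UNIV"
  shows "partial_deriv i (\<lambda>x. f x + g x) = (\<lambda>x. partial_deriv i f x + partial_deriv i g x)"
  by (rule ext, rule partial_derivI[OF has_derivative_add[OF has_frechet has_frechet], OF assms, folded partial_deriv_def])

lemma partial_deriv_mult:
  assumes "f differentiable_on UNIV" "g differentiable_on UNIV"
  shows "partial_deriv i (\<lambda>x. f x * g x) = (\<lambda>x. partial_deriv i f x * g x + f x * partial_deriv i g x)"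
proof
  fix x
  have "((\<lambda>x. f x * g x) has_derivative
      (\<lambda>h. f x * frechet_derivative g (at x) h + frechet_derivative f (at x) h * g x)) (at x)"
    by (rule has_derivative_mult[OF has_frechet has_frechet]; fact)
  from partial_derivI[OF this]
  show "partial_deriv i (\<lambda>x. f x * g x) x = partial_deriv i f x * g x + f x * partial_deriv i g x"
    by (simp add: partial_deriv_def)
qed

lemma partial_deriv_const [simp]: "partial_deriv i (\<lambda>x. c) = (\<lambda>x. 0)"
  by (rule ext) (simp add: partial_derivI[OF has_derivative_const])

lemma partial_deriv_inner: "partial_deriv i (\<lambda>x. x \<bullet> j) = (\<lambda>x. i \<bullet> j)"
proof
  fix x :: 'a
  have "((\<lambda>x. x \<bullet> j) has_derivative (\<lambda>h. h \<bullet> j)) (at x)"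
    by (rule has_derivative_inner_left[OF has_derivative_ident])
  from partial_derivI[OF this] show "partial_deriv i (\<lambda>x. x \<bullet> j) x = i \<bullet> j" by simp
qed

lemma partial_deriv_comp:
  assumes "f differentiable_on UNIV" and "\<And>x. (g has_real_derivative g' (f x)) (at (f x))"
  shows "partial_deriv i (\<lambda>x. g (f x)) = (\<lambda>x. g' (f x) * partial_deriv i f x)"
    and "(\<lambda>x. g (f x)) differentiable_on UNIV"
proof -
  have "((\<lambda>x. g (f x)) has_derivative (\<lambda>h. g' (f x) * frechet_derivative f (at x) h)) (at x)" for x
    using has_derivative_compose[OF has_frechet[OF assms(1)] assms(2)[unfolded has_field_derivative_def]]
    by simp
  then show "partial_deriv i (\<lambda>x. g (f x)) = (\<lambda>x. g' (f x) * partial_deriv i f x)"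
      "(\<lambda>x. g (f x)) differentiable_on UNIV"
    by (auto simp: fun_eq_iff partial_deriv_def differentiable_on_def differentiable_def
        dest!: partial_derivI[unfolded partial_deriv_def])
qed

text \<open>The direction i is arbitrary, since the translation estimate differentiates along
  general vectors.\<close>

lemma DERIV_along:
  assumes "f differentiable_on UNIV"
  shows "((\<lambda>t. f (x + t *\<^sub>R i)) has_real_derivative partial_deriv i f (x + t *\<^sub>R i)) (at t)"
proof -
  have "((\<lambda>t. x + t *\<^sub>R i) has_derivative (\<lambda>s. s *\<^sub>R i)) (at t)"
    by (auto intro!: derivative_eq_intros)
  from has_derivative_compose[OF this has_frechet[OF assms]]
  have "((\<lambda>t. f (x + t *\<^sub>R i)) has_derivative
      (\<lambda>s. frechet_derivative f (at (x + t *\<^sub>R i)) (s *\<^sub>R i))) (at t)" .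
  moreover have "frechet_derivative f (at (x + t *\<^sub>R i)) (s *\<^sub>R i) = partial_deriv i f (x + t *\<^sub>R i) * s" for s
    using linear_frechet_derivative[of f "at (x + t *\<^sub>R i)"] assms
    by (simp add: differentiable_on_def linear_scale partial_deriv_def)
  ultimately show ?thesis by (simp add: has_field_derivative_def mult_commute_abs)
qed

section \<open>Smoothness classes and their closure properties\<close>

lemma Ck_Suc_D: "Ck (Suc k) f \<Longrightarrow> Ck k f"
proof (induction k arbitrary: f)
  case 0
  then show ?case by (simp add: differentiable_imp_continuous_on)
next
  case (Suc k)
  then show ?case by (metis Ck.simps(2))
qed

lemma Ck_const [simp]: "Ck k (\<lambda>x. c)"
  by (induction k arbitrary: c) simp_all

lemma Ck_add: "Ck k f \<Longrightarrow> Ck k g \<Longrightarrow> Ck k (\<lambda>x. f x + g x)"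
  by (induction k arbitrary: f g) (auto simp: partial_deriv_add intro: continuous_on_add differentiable_on_add)

lemma Ck_mult: "Ck k f \<Longrightarrow> Ck k g \<Longrightarrow> Ck k (\<lambda>x. f x * g x)"
proof (induction k arbitrary: f g)
  case 0
  then show ?case by (simp add: continuous_on_mult)
next
  case (Suc k)
  have "Ck k f" "Ck k g" using Suc.prems Ck_Suc_D by blast+
  then show ?case
    using Suc.prems by (auto simp: partial_deriv_mult intro!: Ck_add Suc.IH differentiable_on_mult)
qed

lemma Ck_cmult: "Ck k f \<Longrightarrow> Ck k (\<lambda>x. c * f x)"
  by (rule Ck_mult) simp_all

lemma Ck_diff: "Ck k f \<Longrightarrow> Ck k g \<Longrightarrow> Ck k (\<lambda>x. f x - g x)"
  using Ck_add[of k f "\<lambda>x. (-1) * g x"] Ck_cmult[of k g "-1"] by simp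

lemma Ck_prod: "(\<And>i. i \<in> I \<Longrightarrow> Ck k (f i)) \<Longrightarrow> Ck k (\<lambda>x. \<Prod>i\<in>I. f i x)"
  by (induction I rule: infinite_finite_induct) (simp_all add: Ck_mult)

lemma Ck_inner [simp]: "Ck k (\<lambda>x. x \<bullet> j)"
  by (cases k) (auto simp: partial_deriv_inner intro!: continuous_intros linear_imp_differentiable_on
      bounded_linear.linear bounded_linear_inner_left)

text \<open>The derivative of the reciprocal is written as a product of reciprocals, so that the
  induction hypothesis applies to it. Square roots are handled alike, through the reciprocal of the
  root.\<close>

lemma Ck_inverse: "Ck k f \<Longrightarrow> (\<And>x. f x > 0) \<Longrightarrow> Ck k (\<lambda>x. inverse (f x))"
proof (induction k)
  case 0
  then show ?case by (auto intro!: continuous_on_inverse simp: less_imp_neq[THEN not_sym])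
next
  case (Suc k)
  have f: "f differentiable_on UNIV" "Ck k f" using Suc.prems Ck_Suc_D by auto
  have d: "(inverse has_real_derivative (\<lambda>s. - (inverse s * inverse s)) (f x)) (at (f x))" for x
    using Suc.prems(2)[of x] by (auto intro!: derivative_eq_intros simp: power2_eq_square)
  show ?case
    using Suc.prems partial_deriv_comp[OF f(1) d] Suc.IH[OF f(2) Suc.prems(2)]
    by (auto intro!: Ck_mult Ck_cmult[of _ _ "-1", simplified])
qed

lemma Ck_sqrt: "Ck k f \<Longrightarrow> (\<And>x. f x > 0) \<Longrightarrow> Ck k (\<lambda>x. sqrt (f x))"
proof (induction k)
  case 0
  then show ?case by (auto intro!: continuous_on_real_sqrt)
next
  case (Suc k)
  have f: "f differentiable_on UNIV" "Ck k f" using Suc.prems Ck_Suc_D by auto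
  have d: "(sqrt has_real_derivative (\<lambda>s. inverse (sqrt s) * (1/2)) (f x)) (at (f x))" for x
    using Suc.prems(2)[of x] by (auto intro!: derivative_eq_intros)
  note pd = partial_deriv_comp[OF f(1) d]
  have "Ck k (partial_deriv i f)" if "i \<in> Basis" for i using Suc.prems(1) that by simp
  then show ?case
    unfolding Ck.simps pd(1)
    by (intro conjI ballI Ck_mult Ck_const Ck_inverse Suc.IH f pd(2)) (simp_all add: Suc.prems(2))
qed

text \<open>The family is closed under differentiation, which avoids closed forms for the higher
  derivatives of \<open>exp (- 1 / s)\<close>.\<close>

definition flat :: "nat \<Rightarrow> real \<Rightarrow> real"
  where "flat j s = (if s > 0 then exp (- inverse s) * inverse s ^ j else 0)"

lemma DERIV_flat: "(flat j has_real_derivative flat (j + 2) s - real j * flat (j + 1) s) (at s)"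
proof -
  consider "s > 0" | "s < 0" | "s = 0" by linarith
  then show ?thesis
  proof cases
    case 1
    have "((\<lambda>s. exp (- inverse s) * inverse s ^ j) has_real_derivative
        exp (- inverse s) * (inverse s * inverse s) * inverse s ^ j +
        exp (- inverse s) * (real j * (- (inverse s * inverse s)) * inverse s ^ (j - 1))) (at s)"
      using 1 by (auto intro!: derivative_eq_intros)
    also have "exp (- inverse s) * (inverse s * inverse s) * inverse s ^ j +
        exp (- inverse s) * (real j * (- (inverse s * inverse s)) * inverse s ^ (j - 1)) =
        flat (j + 2) s - real j * flat (j + 1) s"
      using 1 by (cases j) (simp_all add: flat_def algebra_simps)
    finally have "((\<lambda>s. exp (- inverse s) * inverse s ^ j) has_real_derivative
        flat (j + 2) s - real j * flat (j + 1) s) (at s)" .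
    then show ?thesis
      by (rule has_field_derivative_transform_within_open[of _ _ _ "{0<..}"]) (use 1 in \<open>auto simp: flat_def\<close>)
  next
    case 2
    have "((\<lambda>s. 0) has_real_derivative flat (j + 2) s - real j * flat (j + 1) s) (at s)"
      using 2 by (simp add: flat_def)
    then show ?thesis
      by (rule has_field_derivative_transform_within_open[of _ _ _ "{..<0}"]) (use 2 in \<open>auto simp: flat_def\<close>)
  next
    case 3
    \<comment> \<open>At 0 the difference quotient of \<open>flat j\<close> is
      \<open>flat (Suc j)\<close>, and the exponential beats every power of
      \<open>inverse t\<close>.\<close>
    have "((\<lambda>t. flat (Suc j) t) \<longlongrightarrow> 0) (at_right 0)"
    proof (rule Lim_transform_eventually)
      have "((\<lambda>t. inverse t ^ Suc j / exp (inverse t)) \<longlongrightarrow> (0::real)) (at_right 0)"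
        by (rule filterlim_compose[OF tendsto_power_div_exp_0 filterlim_inverse_at_top_right])
      then show "((\<lambda>t. inverse t ^ Suc j / exp (inverse t)) \<longlongrightarrow> (0::real)) (at_right 0)" .
      show "\<forall>\<^sub>F t in at_right 0. inverse t ^ Suc j / exp (inverse t) = flat (Suc j) t"
        by (rule eventually_at_rightI[of 0 1]) (auto simp: flat_def exp_minus divide_inverse mult.commute)
    qed
    moreover have "((\<lambda>t. flat (Suc j) t) \<longlongrightarrow> 0) (at_left 0)"
      by (rule Lim_transform_eventually[OF tendsto_const])
         (auto simp: flat_def intro!: eventually_at_leftI[of "-1"])
    ultimately have "((\<lambda>t. flat (Suc j) t) \<longlongrightarrow> 0) (at 0)"
      by (simp add: filterlim_at_split)
    then have "((\<lambda>t. (flat j t - flat j 0) / (t - 0)) \<longlongrightarrow> 0) (at 0)"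
      by (rule Lim_transform_eventually)
         (auto simp: flat_def field_simps intro!: always_eventually)
    then show ?thesis using 3 by (simp add: has_field_derivative_iff flat_def)
  qed
qed

lemma Ck_flat: "Ck k f \<Longrightarrow> Ck k (\<lambda>x. flat j (f x))"
proof (induction k arbitrary: j)
  case 0
  have "continuous_on UNIV (flat j)"
    using DERIV_flat by (auto intro: continuous_at_imp_continuous_on DERIV_isCont)
  then show ?case using 0 by (auto intro: continuous_on_compose2)
next
  case (Suc k)
  have f: "f differentiable_on UNIV" "Ck k f" using Suc.prems Ck_Suc_D by auto
  note d = partial_deriv_comp[OF f(1), where g = "flat j"
    and g' = "\<lambda>s. flat (j + 2) s - real j * flat (j + 1) s", OF DERIV_flat]
  show ?case
    using Suc.prems unfolding Ck.simps d(1)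
    by (auto intro!: Ck_mult Ck_diff Ck_cmult Suc.IH f d(2))
qed

lemma flat0_bounds: "0 \<le> flat 0 s" "flat 0 s \<le> 1"
  by (auto simp: flat_def)

lemma flat0_tendsto: "(\<lambda>n. flat 0 (real (Suc n) * s)) \<longlonglongrightarrow> indicator {0<..} s"
proof (cases "s > 0")
  case True
  have "(\<lambda>n. exp (- (inverse (real (Suc n)) * inverse s))) \<longlonglongrightarrow> exp (- (0 * inverse s))"
    by (intro tendsto_intros LIMSEQ_inverse_real_of_nat)
  then show ?thesis using True by (simp add: flat_def del: of_nat_Suc)
qed (simp add: flat_def zero_less_mult_iff del: of_nat_Suc)

section \<open>Calculus with compactly supported smooth functions\<close>

lemma test_Ck: "\<phi> \<in> test_functions \<Omega> \<Longrightarrow> Ck k \<phi>"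
  by (simp add: test_functions_def)

lemma test_differentiable: "\<phi> \<in> test_functions \<Omega> \<Longrightarrow> \<phi> differentiable_on UNIV"
  using test_Ck[of \<phi> \<Omega> 1] by simp

lemma test_continuous: "\<phi> \<in> test_functions \<Omega> \<Longrightarrow> continuous_on UNIV \<phi>"
  using test_Ck[of \<phi> \<Omega> 0] by simp

lemma test_measurable: "\<phi> \<in> test_functions \<Omega> \<Longrightarrow> \<phi> \<in> borel_measurable borel"
  by (rule borel_measurable_continuous_onI[OF test_continuous])

lemma test_zero_outside: "\<phi> \<in> test_functions \<Omega> \<Longrightarrow> x \<notin> \<Omega> \<Longrightarrow> \<phi> x = 0"
  using closure_subset[of "{x. \<phi> x \<noteq> 0}"] by (auto simp: test_functions_def)

lemma test_I:
  assumes "\<phi> \<in> test_functions \<Omega>" "\<And>k. Ck k f" "{x. f x \<noteq> 0} \<subseteq> closure {x. \<phi> x \<noteq> 0}"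
  shows "f \<in> test_functions \<Omega>"
proof -
  have "closure {x. f x \<noteq> 0} \<subseteq> closure {x. \<phi> x \<noteq> 0}"
    using closure_minimal[OF assms(3)] by simp
  then show ?thesis
    using assms bounded_subset[of "closure {x. \<phi> x \<noteq> 0}" "closure {x. f x \<noteq> 0}"]
    by (auto simp: test_functions_def compact_eq_bounded_closed)
qed

lemma partial_deriv_support:
  assumes "f differentiable_on UNIV"
  shows "{x. partial_deriv i f x \<noteq> 0} \<subseteq> closure {x. f x \<noteq> 0}"
proof
  fix x assume x: "x \<in> {x. partial_deriv i f x \<noteq> 0}"
  show "x \<in> closure {x. f x \<noteq> 0}"
  proof (rule ccontr)
    assume n: "x \<notin> closure {x. f x \<noteq> 0}"
    have "(f has_derivative (\<lambda>h. 0)) (at x)"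
      by (rule has_derivative_transform_within_open[where f = "\<lambda>x. 0" and s = "- closure {x. f x \<noteq> 0}"])
         (use n closure_subset[of "{x. f x \<noteq> 0}"] in auto)
    then have "partial_deriv i f x = 0" by (rule partial_derivI)
    then show False using x by simp
  qed
qed

lemma test_partial_deriv:
  assumes "\<phi> \<in> test_functions \<Omega>" "i \<in> Basis" shows "partial_deriv i \<phi> \<in> test_functions \<Omega>"
proof (rule test_I[OF assms(1)])
  show "Ck k (partial_deriv i \<phi>)" for k using test_Ck[OF assms(1), of "Suc k"] assms(2) by simp
qed (rule partial_deriv_support[OF test_differentiable[OF assms(1)]])

lemma test_mult:
  assumes "\<phi> \<in> test_functions \<Omega>" "\<And>k. Ck k f" shows "(\<lambda>x. f x * \<phi> x) \<in> test_functions \<Omega>"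
proof (rule test_I[OF assms(1)])
  show "Ck k (\<lambda>x. f x * \<phi> x)" for k by (rule Ck_mult[OF assms(2) test_Ck[OF assms(1)]])
  show "{x. f x * \<phi> x \<noteq> 0} \<subseteq> closure {x. \<phi> x \<noteq> 0}"
    using closure_subset[of "{x. \<phi> x \<noteq> 0}"] by auto
qed

lemma test_add:
  assumes "\<phi> \<in> test_functions \<Omega>" "\<theta> \<in> test_functions \<Omega>"
  shows "(\<lambda>x. \<phi> x + \<theta> x) \<in> test_functions \<Omega>"
proof -
  have "{x. \<phi> x + \<theta> x \<noteq> 0} \<subseteq> {x. \<phi> x \<noteq> 0} \<union> {x. \<theta> x \<noteq> 0}" by auto
  from closure_mono[OF this]
  have "closure {x. \<phi> x + \<theta> x \<noteq> 0} \<subseteq> closure {x. \<phi> x \<noteq> 0} \<union> closure {x. \<theta> x \<noteq> 0}"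
    by simp
  then show ?thesis
    using assms bounded_subset[of "closure {x. \<phi> x \<noteq> 0} \<union> closure {x. \<theta> x \<noteq> 0}" "closure {x. \<phi> x + \<theta> x \<noteq> 0}"]
    by (auto simp: test_functions_def compact_eq_bounded_closed intro!: Ck_add)
qed

lemma test_cmult: "\<phi> \<in> test_functions \<Omega> \<Longrightarrow> (\<lambda>x. c * \<phi> x) \<in> test_functions \<Omega>"
  by (rule test_mult) simp_all

lemma test_bounded: assumes "\<phi> \<in> test_functions \<Omega>" shows "\<exists>B>0. \<forall>x. \<bar>\<phi> x\<bar> \<le> B"
proof -
  have "compact (\<phi> ` closure {x. \<phi> x \<noteq> 0})"
    using assms by (intro compact_continuous_image continuous_on_subset[OF test_continuous])
      (auto simp: test_functions_def)
  from compact_imp_bounded[OF this]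
  obtain B where B: "B > 0" "\<And>x. x \<in> closure {x. \<phi> x \<noteq> 0} \<Longrightarrow> \<bar>\<phi> x\<bar> \<le> B"
    unfolding bounded_pos by auto
  have "\<bar>\<phi> x\<bar> \<le> B" for x
    using B(2)[of x] B(1) closure_subset[of "{x. \<phi> x \<noteq> 0}"] by (cases "\<phi> x = 0") auto
  then show ?thesis using B(1) by blast
qed

lemma test_support: assumes "\<phi> \<in> test_functions \<Omega>" shows "\<exists>R>0. \<forall>x. R < norm x \<longrightarrow> \<phi> x = 0"
proof -
  have "bounded (closure {x. \<phi> x \<noteq> 0})" using assms by (simp add: test_functions_def compact_imp_bounded)
  then obtain R where "R > 0" "\<And>x. x \<in> closure {x. \<phi> x \<noteq> 0} \<Longrightarrow> norm x \<le> R"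
    unfolding bounded_pos by blast
  then show ?thesis using closure_subset[of "{x. \<phi> x \<noteq> 0}"] by (intro exI[of _ R]) force
qed

lemma integrable_bounded_support:
  fixes f :: "'a::euclidean_space \<Rightarrow> real"
  assumes "f \<in> borel_measurable borel" "\<And>x. \<bar>f x\<bar> \<le> B" "\<And>x. R < norm x \<Longrightarrow> f x = 0"
  shows "integrable lborel f"
proof (rule integrableI_bounded_set[of "cball 0 R"])
  show "emeasure lborel (cball (0::'a) R) < \<infinity>"
    by (rule emeasure_lborel_cball_finite)
qed (use assms in auto)

lemma test_integrable_lborel: assumes "\<phi> \<in> test_functions \<Omega>" shows "integrable lborel \<phi>"
proof -
  obtain B R where "\<forall>x. \<bar>\<phi> x\<bar> \<le> B" "\<forall>x. R < norm x \<longrightarrow> \<phi> x = 0"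
    using test_bounded[OF assms] test_support[OF assms] by blast
  then show ?thesis by (intro integrable_bounded_support[OF test_measurable[OF assms]]) auto
qed

lemma test_lebesgue_measurable: "\<phi> \<in> test_functions \<Omega> \<Longrightarrow> \<phi> \<in> borel_measurable lebesgue"
  by (rule measurable_completion) (simp add: test_measurable)

lemma test_integrable: "\<phi> \<in> test_functions \<Omega> \<Longrightarrow> integrable lebesgue \<phi>"
  by (simp add: integrable_completion test_integrable_lborel test_measurable)

lemma lborel_integral_translate:
  fixes f :: "'a::euclidean_space \<Rightarrow> real"
  assumes "f \<in> borel_measurable borel"
  shows "(LINT x|lborel. f (x + c)) = (LINT x|lborel. f x)"
proof -
  have "(LINT x|lborel. f x) = (LINT x|distr lborel borel ((+) c). f x)" by (simp add: lborel_distr_plus)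
  also have "\<dots> = (LINT x|lborel. f (c + x))" by (rule integral_distr) (simp_all add: assms)
  finally show ?thesis by (simp add: add.commute)
qed

lemma integrable_translate:
  fixes f :: "'a::euclidean_space \<Rightarrow> real"
  assumes "integrable lborel f" shows "integrable lborel (\<lambda>x. f (x + c))"
proof -
  have "integrable (distr lborel borel ((+) c)) f" using assms by (simp add: lborel_distr_plus)
  then have "integrable lborel (\<lambda>x. f (c + x))" by (rule integrable_distr[rotated]) simp
  then show ?thesis by (simp add: add.commute)
qed

lemma test_increment:
  assumes "f differentiable_on UNIV" "\<And>x. \<bar>partial_deriv i f x\<bar> \<le> B"
  shows "\<bar>f (x + t *\<^sub>R i) - f x\<bar> \<le> B * \<bar>t\<bar>"
  using field_differentiable_bound[of UNIV "\<lambda>t. f (x + t *\<^sub>R i)" "\<lambda>t. partial_deriv i f (x + t *\<^sub>R i)" B 0 t]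
    DERIV_along[OF assms(1)] assms(2) by simp

text \<open>Difference quotients have integral zero by translation invariance of Lebesgue measure,
  and dominated convergence passes to the derivative. The dominating function lives on radius
  \<open>R + 1\<close> because the shifts have length at most 1.\<close>

lemma integral_partial_deriv:
  assumes \<phi>: "\<phi> \<in> test_functions \<Omega>" and i: "i \<in> Basis"
  shows "(LINT x|lebesgue. partial_deriv i \<phi> x) = 0"
proof -
  note \<phi>' = test_partial_deriv[OF \<phi> i]
  obtain B R where B: "B > 0" "\<And>x. \<bar>partial_deriv i \<phi> x\<bar> \<le> B" and R: "R > 0" "\<And>x. R < norm x \<Longrightarrow> \<phi> x = 0"
    using test_bounded[OF \<phi>'] test_support[OF \<phi>] by metis
  define h where "h n = inverse (real (Suc n))" for n
  have h: "0 < h n" "h n \<le> 1" for n by (auto simp: h_def field_simps)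
  define q where "q n x = (\<phi> (x + h n *\<^sub>R i) - \<phi> x) / h n" for n x
  have meas: "(\<lambda>x. \<phi> (x + c)) \<in> borel_measurable borel" for c
    by (intro borel_measurable_continuous_onI continuous_on_compose2[OF test_continuous[OF \<phi>]] continuous_intros) auto
  have "(\<lambda>n. LINT x|lborel. q n x) \<longlonglongrightarrow> (LINT x|lborel. partial_deriv i \<phi> x)"
  proof (rule integral_dominated_convergence[where w = "\<lambda>x. B * indicator (cball 0 (R + 1)) x"])
    show "partial_deriv i \<phi> \<in> borel_measurable lborel" using test_measurable[OF \<phi>'] by simp
    show "q n \<in> borel_measurable lborel" for n
      unfolding q_def using meas[of "h n *\<^sub>R i"] meas[of 0] by simp
    have "emeasure lborel (cball (0::'a) (R + 1)) < \<infinity>" by (rule emeasure_lborel_cball_finite)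
    then show "integrable lborel (\<lambda>x::'a. B * indicator (cball 0 (R + 1)) x)"
      by (intro integrable_mult_right integrable_real_indicator) auto
    show "AE x in lborel. (\<lambda>n. q n x) \<longlonglongrightarrow> partial_deriv i \<phi> x"
    proof (rule AE_I2)
      fix x
      have "((\<lambda>t. (\<phi> (x + t *\<^sub>R i) - \<phi> x) / t) \<longlongrightarrow> partial_deriv i \<phi> x) (at 0)"
        using DERIV_along[OF test_differentiable[OF \<phi>], of x i 0] by (simp add: has_field_derivative_iff)
      moreover have "filterlim h (at 0) sequentially"
        unfolding filterlim_at h_def using LIMSEQ_inverse_real_of_nat by simp
      ultimately show "(\<lambda>n. q n x) \<longlonglongrightarrow> partial_deriv i \<phi> x"
        unfolding q_def by (rule filterlim_compose)
    qed
    show "AE x in lborel. norm (q n x) \<le> B * indicator (cball 0 (R + 1)) x" for n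
    proof (rule AE_I2)
      fix x
      show "norm (q n x) \<le> B * indicator (cball 0 (R + 1)) x"
      proof (cases "norm x \<le> R + 1")
        case True
        then show ?thesis
          using test_increment[OF test_differentiable[OF \<phi>] B(2), of x "h n"] h[of n]
          by (simp add: q_def field_simps)
      next
        case False
        have "norm x \<le> norm (x + h n *\<^sub>R i) + norm (h n *\<^sub>R i)"
          using norm_triangle_ineq4[of "x + h n *\<^sub>R i" "h n *\<^sub>R i"] by simp
        with False h[of n] i have "R < norm (x + h n *\<^sub>R i)" by simp
        with R(2) False show ?thesis by (simp add: q_def)
      qed
    qed
  qed
  moreover have "(LINT x|lborel. q n x) = 0" for n
    unfolding q_def
    using lborel_integral_translate[OF test_measurable[OF \<phi>], of "h n *\<^sub>R i"]
      integrable_translate[OF test_integrable_lborel[OF \<phi>], of "h n *\<^sub>R i"] test_integrable_lborel[OF \<phi>]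
    by simp
  ultimately have "(LINT x|lborel. partial_deriv i \<phi> x) = 0"
    by (simp add: LIMSEQ_const_iff)
  then show ?thesis by (simp add: integral_completion test_measurable[OF \<phi>'])
qed

lemma test_product_integrable:
  "\<phi> \<in> test_functions \<Omega> \<Longrightarrow> \<theta> \<in> test_functions \<Omega>' \<Longrightarrow> integrable lebesgue (\<lambda>x. \<phi> x * \<theta> x)"
  by (rule test_integrable[OF test_mult[of \<theta> \<Omega>' \<phi>]]) (auto simp: test_Ck)

lemma integration_by_parts:
  assumes "\<phi> \<in> test_functions \<Omega>" "\<theta> \<in> test_functions \<Omega>'" "i \<in> Basis"
  shows "(LINT x|lebesgue. \<phi> x * partial_deriv i \<theta> x) = - (LINT x|lebesgue. partial_deriv i \<phi> x * \<theta> x)"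
proof -
  have "0 = (LINT x|lebesgue. partial_deriv i \<phi> x * \<theta> x + \<phi> x * partial_deriv i \<theta> x)"
    using integral_partial_deriv[OF test_mult[OF assms(2) test_Ck[OF assms(1)]] assms(3)]
    by (simp add: partial_deriv_mult test_differentiable[OF assms(1)] test_differentiable[OF assms(2)])
  also have "\<dots> = (LINT x|lebesgue. partial_deriv i \<phi> x * \<theta> x) + (LINT x|lebesgue. \<phi> x * partial_deriv i \<theta> x)"
    by (rule Bochner_Integration.integral_add[OF test_product_integrable[OF test_partial_deriv[OF assms(1,3)] assms(2)]
          test_product_integrable[OF assms(1) test_partial_deriv[OF assms(2,3)]]])
  finally show ?thesis by simp
qed

text \<open>One integration by parts with the coordinate function \<open>x \<bullet> i\<close>,
  which R bounds on the domain. Young's inequality leaves half of the left-hand side to be absorbed,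
  hence the constant \<open>4 * R\<^sup>2\<close>.\<close>

lemma test_Poincare:
  assumes \<phi>: "\<phi> \<in> test_functions \<Omega>" and i: "i \<in> Basis" and R: "\<And>x. x \<in> \<Omega> \<Longrightarrow> norm x \<le> R"
  shows "(LINT x|lebesgue. (\<phi> x)\<^sup>2) \<le> 4 * R\<^sup>2 * (LINT x|lebesgue. (partial_deriv i \<phi> x)\<^sup>2)"
proof -
  note \<phi>' = test_partial_deriv[OF \<phi> i]
  have x\<phi>: "(\<lambda>x. (x \<bullet> i) * \<phi> x) \<in> test_functions \<Omega>" by (rule test_mult[OF \<phi>]) simp
  have pd: "partial_deriv i (\<lambda>x. (x \<bullet> i) * \<phi> x) = (\<lambda>x. \<phi> x + (x \<bullet> i) * partial_deriv i \<phi> x)"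
    using i test_differentiable[OF \<phi>] Ck.simps(2)[of 0 "\<lambda>x. x \<bullet> i"] Ck_inner[of "Suc 0" i]
    by (subst partial_deriv_mult) (auto simp: partial_deriv_inner)
  have sq: "integrable lebesgue (\<lambda>x. (\<phi> x)\<^sup>2)" "integrable lebesgue (\<lambda>x. (partial_deriv i \<phi> x)\<^sup>2)"
    using test_product_integrable[OF \<phi> \<phi>] test_product_integrable[OF \<phi>' \<phi>'] by (simp_all add: power2_eq_square)
  have xx: "integrable lebesgue (\<lambda>x. ((x \<bullet> i) * \<phi> x) * partial_deriv i \<phi> x)"
    by (rule test_product_integrable[OF x\<phi> \<phi>'])
  have "(LINT x|lebesgue. ((x \<bullet> i) * \<phi> x) * partial_deriv i \<phi> x) =
      - (LINT x|lebesgue. (\<phi> x)\<^sup>2 + ((x \<bullet> i) * \<phi> x) * partial_deriv i \<phi> x)"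
    unfolding integration_by_parts[OF x\<phi> \<phi> i] pd by (simp add: power2_eq_square algebra_simps)
  also have "\<dots> = - (LINT x|lebesgue. (\<phi> x)\<^sup>2) - (LINT x|lebesgue. ((x \<bullet> i) * \<phi> x) * partial_deriv i \<phi> x)"
    using sq xx by simp
  finally have "(LINT x|lebesgue. (\<phi> x)\<^sup>2) = - 2 * (LINT x|lebesgue. ((x \<bullet> i) * \<phi> x) * partial_deriv i \<phi> x)"
    by simp
  also have "\<dots> = (LINT x|lebesgue. - 2 * (((x \<bullet> i) * \<phi> x) * partial_deriv i \<phi> x))" by simp
  also have "\<dots> \<le> (LINT x|lebesgue. (\<phi> x)\<^sup>2 / 2 + 2 * R\<^sup>2 * (partial_deriv i \<phi> x)\<^sup>2)"
  proof (rule integral_mono)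
    show "integrable lebesgue (\<lambda>x. - 2 * (((x \<bullet> i) * \<phi> x) * partial_deriv i \<phi> x))" using xx by simp
    show "integrable lebesgue (\<lambda>x. (\<phi> x)\<^sup>2 / 2 + 2 * R\<^sup>2 * (partial_deriv i \<phi> x)\<^sup>2)" using sq by simp
    fix x
    show "- 2 * (((x \<bullet> i) * \<phi> x) * partial_deriv i \<phi> x) \<le> (\<phi> x)\<^sup>2 / 2 + 2 * R\<^sup>2 * (partial_deriv i \<phi> x)\<^sup>2"
    proof (cases "x \<in> \<Omega>")
      case True
      have "\<bar>x \<bullet> i\<bar> \<le> R" using Basis_le_norm[OF i, of x] R[OF True] by simp
      then have "(x \<bullet> i)\<^sup>2 \<le> R\<^sup>2" using abs_le_square_iff[of "x \<bullet> i" R] by simp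
      then have "(x \<bullet> i)\<^sup>2 * (partial_deriv i \<phi> x)\<^sup>2 \<le> R\<^sup>2 * (partial_deriv i \<phi> x)\<^sup>2"
        by (rule mult_right_mono) simp
      moreover have "0 \<le> (\<phi> x + 2 * ((x \<bullet> i) * partial_deriv i \<phi> x))\<^sup>2" by simp
      ultimately show ?thesis
        by (simp add: power2_sum power_mult_distrib algebra_simps)
    next
      case False
      then show ?thesis using test_zero_outside[OF \<phi> False] by simp
    qed
  qed
  also have "\<dots> = (LINT x|lebesgue. (\<phi> x)\<^sup>2) / 2 + 2 * R\<^sup>2 * (LINT x|lebesgue. (partial_deriv i \<phi> x)\<^sup>2)"
    using sq by simp
  finally show ?thesis by simp
qed

subsection \<open>Square integrable functions on a domain\<close>

definition ipL2 :: "'a::euclidean_space L0 \<Rightarrow> 'a L0 \<Rightarrow> real"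
  where "ipL2 = (SOME ip. semi_inner ip \<and> (\<forall>x\<in>L2. \<forall>y\<in>L2. ip x y = ip2 x y))"

lemma ipL2: "semi_inner (ipL2 :: 'a::euclidean_space L0 \<Rightarrow> 'a L0 \<Rightarrow> real)"
    "x \<in> L2 \<Longrightarrow> y \<in> L2 \<Longrightarrow> ipL2 x y = ip2 x (y :: 'a L0)"
proof -
  have "\<exists>ip. semi_inner ip \<and> (\<forall>x\<in>L2. \<forall>y\<in>(L2 :: 'a L0 set). ip x y = ip2 x y)"
    by (rule ex_semi_inner[OF subspace_L2 ip2_commute])
       (simp_all add: ip2_add ip2_scale ip2_nonneg)
  from someI_ex[OF this] show "semi_inner (ipL2 :: 'a L0 \<Rightarrow> 'a L0 \<Rightarrow> real)"
    "x \<in> L2 \<Longrightarrow> y \<in> L2 \<Longrightarrow> ipL2 x y = ip2 x (y :: 'a L0)"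
    by (auto simp: ipL2_def)
qed

interpretation l2: semi_inner "ipL2 :: 'a::euclidean_space L0 \<Rightarrow> 'a L0 \<Rightarrow> real"
  by (rule ipL2(1))

lemma L2_add [simp]: "f \<in> L2 \<Longrightarrow> g \<in> L2 \<Longrightarrow> f + g \<in> L2"
  and L2_scale [simp]: "f \<in> L2 \<Longrightarrow> c *\<^sub>R f \<in> L2"
  and L2_diff [simp]: "f \<in> L2 \<Longrightarrow> g \<in> L2 \<Longrightarrow> f - g \<in> L2"
  and L2_zero [simp]: "0 \<in> L2"
  and L2_minus [simp]: "f \<in> L2 \<Longrightarrow> - f \<in> L2"
  by (simp_all add: subspace_0[OF subspace_L2] subspace_add[OF subspace_L2]
      subspace_scale[OF subspace_L2] subspace_diff[OF subspace_L2] subspace_neg[OF subspace_L2])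

interpretation l2: hilbert "ipL2 :: 'a::euclidean_space L0 \<Rightarrow> 'a L0 \<Rightarrow> real" L2
proof unfold_locales
  show "subspace (L2 :: 'a L0 set)" by (rule subspace_L2)
  show "x = 0" if "x \<in> L2" "ipL2 x x = 0" for x :: "'a L0"
    using that by (simp add: ipL2 L2_definite)
next
  fix xs :: "nat \<Rightarrow> 'a L0"
  assume L2: "\<And>n. xs n \<in> L2"
    and C: "\<And>\<epsilon>. \<epsilon> > 0 \<Longrightarrow> \<exists>N. \<forall>m\<ge>N. \<forall>n\<ge>N. l2.nr (xs m - xs n) < \<epsilon>"
  have "\<exists>f\<in>L2. (\<lambda>n. ip2 (xs n - f) (xs n - f)) \<longlonglongrightarrow> 0"
  proof (rule L2_complete[OF L2])
    fix \<epsilon> :: real assume e: "\<epsilon> > 0"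
    obtain N where N: "\<And>m n. m \<ge> N \<Longrightarrow> n \<ge> N \<Longrightarrow> l2.nr (xs m - xs n) < sqrt \<epsilon>"
      using C[of "sqrt \<epsilon>"] e by auto
    show "\<exists>N. \<forall>m\<ge>N. \<forall>n\<ge>N. ip2 (xs m - xs n) (xs m - xs n) < \<epsilon>"
      using N L2 by (intro exI[of _ N]) (simp add: l2.nr_def ipL2)
  qed
  then show "\<exists>x\<in>L2. l2.sconv xs x"
    using L2 by (auto simp: l2.sconv_def l2.nr_tendsto_0_iff ipL2)
qed

lemma L2_AE_subseq:
  fixes v :: "'a::euclidean_space L0"
  assumes "l2.sconv vs v" "\<And>n. vs n \<in> L2" "v \<in> L2"
  shows "\<exists>r. strict_mono r \<and> (AE x in lebesgue. (\<lambda>n. rep_L0 (vs (r n)) x) \<longlonglongrightarrow> rep_L0 v x)"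
proof -
  have "(\<lambda>n. ip2 (vs n - v) (vs n - v)) \<longlonglongrightarrow> 0"
    using assms by (simp add: l2.sconv_def l2.nr_tendsto_0_iff ipL2)
  then have "(\<lambda>n. LINT x|lebesgue. norm ((rep_L0 (vs n) x - rep_L0 v x)\<^sup>2)) \<longlonglongrightarrow> 0"
    by (simp add: ip2_diff_self)
  from tendsto_L1_AE_subseq[OF L2_diff_integrable[OF assms(2,3)] this]
  obtain r where r: "strict_mono r" "AE x in lebesgue. (\<lambda>n. (rep_L0 (vs (r n)) x - rep_L0 v x)\<^sup>2) \<longlonglongrightarrow> 0"
    by blast
  have "AE x in lebesgue. (\<lambda>n. rep_L0 (vs (r n)) x) \<longlonglongrightarrow> rep_L0 v x"
    using r(2)
  proof eventually_elim
    case (elim x)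
    then have "(\<lambda>n. sqrt ((rep_L0 (vs (r n)) x - rep_L0 v x)\<^sup>2)) \<longlonglongrightarrow> sqrt 0"
      by (intro tendsto_real_sqrt)
    then have "(\<lambda>n. rep_L0 (vs (r n)) x - rep_L0 v x) \<longlonglongrightarrow> 0" by (simp add: tendsto_rabs_zero_iff)
    then show ?case by (simp add: LIM_zero_iff)
  qed
  then show ?thesis using r(1) by blast
qed

text \<open>Boxes are an intersection-stable generator of the Borel sets, and the sets over which h
  integrates to zero form a Dynkin system; the total integral enters at complements.\<close>

lemma integral_boxes_zero:
  fixes h :: "'a::euclidean_space \<Rightarrow> real"
  assumes h: "integrable lborel h" and UNIV: "(LINT x|lborel. h x) = 0"
    and box: "\<And>a b. (LINT x|lborel. indicator (box a b) x * h x) = 0"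
  shows "AE x in lborel. h x = 0"
proof -
  have int: "integrable lborel (\<lambda>x. indicator A x * h x)" if "A \<in> sets borel" for A
    using integrable_mult_indicator[of A lborel h] that h by simp
  have zero: "(LINT x|lborel. indicator A x * h x) = 0" if A: "A \<in> sets borel" for A :: "'a set"
  proof -
    have mem: "A \<in> sigma_sets UNIV (range (\<lambda>(a, b). box a b))"
      using A unfolding borel_eq_box by (simp add: case_prod_unfold)
    have "Int_stable (range (\<lambda>(a, b). box a b :: 'a set))"
      by (auto intro!: Int_stableI simp: box_Int_box) (metis (no_types, lifting) case_prod_conv rangeI)
    moreover have "range (\<lambda>(a, b). box a b :: 'a set) \<subseteq> Pow UNIV" by simp
    ultimately show ?thesis using mem
    proof (induction rule: sigma_sets_induct_disjoint)
      show "(LINT x|lborel. indicator A x * h x) = 0" if "A \<in> range (\<lambda>(a, b). box a b)" for A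
        using that box by auto
      show "(LINT x|lborel. indicator {} x * h x) = 0" by simp
    next
      fix A assume A: "A \<in> sigma_sets UNIV (range (\<lambda>(a, b). box a b :: 'a set))"
        "(LINT x|lborel. indicator A x * h x) = 0"
      then have "A \<in> sets borel" unfolding borel_eq_box by (simp add: case_prod_unfold)
      from int[OF this] h have "(LINT x|lborel. h x - indicator A x * h x) = 0"
        using A(2) UNIV by simp
      moreover have "(\<lambda>x. h x - indicator A x * h x) = (\<lambda>x. indicator (UNIV - A) x * h x)"
        by (auto simp: indicator_def)
      ultimately show "(LINT x|lborel. indicator (UNIV - A) x * h x) = 0" by simp
    next
      fix A :: "nat \<Rightarrow> 'a set"
      assume A: "disjoint_family A" "range A \<subseteq> sigma_sets UNIV (range (\<lambda>(a, b). box a b))"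
        "\<And>i. (LINT x|lborel. indicator (A i) x * h x) = 0"
      have m: "A i \<in> sets borel" for i using A(2) unfolding borel_eq_box by (auto simp: case_prod_unfold)
      have "(LINT x:(\<Union>i. A i)|lborel. h x) = (\<Sum>i. LINT x:A i|lborel. h x)"
        using m A(1) h by (intro lebesgue_integral_countable_add)
          (auto simp: disjoint_family_on_def set_integrable_def intro!: int)
      then show "(LINT x|lborel. indicator (\<Union> (range A)) x * h x) = 0"
        using A(3) by (simp add: set_lebesgue_integral_def)
    qed
  qed
  have "AE x in lborel. h x = (\<lambda>_. 0) x"
    by (rule density_unique_real[OF h]) (use zero in \<open>simp_all add: set_lebesgue_integral_def\<close>)
  then show ?thesis by simp
qed

text \<open>A product of \<open>flat\<close> profiles in the distances to the faces is positive
  exactly on the open box; steepening the profiles lets it tend to 1 there.\<close>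

lemma bump_functions:
  assumes "cbox a b \<subseteq> \<Omega>"
  shows "\<exists>\<phi>. (\<forall>n. \<phi> n \<in> test_functions \<Omega>) \<and> (\<forall>n x. 0 \<le> \<phi> n x \<and> \<phi> n x \<le> 1) \<and>
    (\<forall>x. (\<lambda>n. \<phi> n x) \<longlonglongrightarrow> indicator (box a b) x)"
proof -
  define \<phi> where "\<phi> n x = (\<Prod>i\<in>Basis. flat 0 (real (Suc n) * (x \<bullet> i - a \<bullet> i)) * flat 0 (real (Suc n) * (b \<bullet> i - x \<bullet> i)))"
    for n and x :: 'a
  have "\<phi> n \<in> test_functions \<Omega>" for n
  proof -
    have "Ck k (\<phi> n)" for k
      unfolding \<phi>_def by (intro Ck_prod Ck_mult Ck_flat Ck_cmult Ck_diff Ck_inner Ck_const)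
    moreover have "{x. \<phi> n x \<noteq> 0} \<subseteq> cbox a b"
      by (auto simp: \<phi>_def mem_box flat_def zero_less_mult_iff split: if_splits simp del: of_nat_Suc)
         (blast intro: less_imp_le)+
    then have "closure {x. \<phi> n x \<noteq> 0} \<subseteq> cbox a b" by (rule closure_minimal) (rule closed_cbox)
    ultimately show ?thesis
      using assms bounded_subset[OF bounded_cbox, of "closure {x. \<phi> n x \<noteq> 0}" a b]
      by (auto simp: test_functions_def compact_eq_bounded_closed)
  qed
  moreover have "0 \<le> \<phi> n x" "\<phi> n x \<le> 1" for n x
    unfolding \<phi>_def by (auto intro!: prod_nonneg prod_le_1 mult_nonneg_nonneg mult_le_one flat0_bounds)
  moreover have "(\<lambda>n. \<phi> n x) \<longlonglongrightarrow> indicator (box a b) x" for x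
  proof -
    have "(\<lambda>n. \<phi> n x) \<longlonglongrightarrow> (\<Prod>i\<in>Basis. indicator {0<..} (x \<bullet> i - a \<bullet> i) * indicator {0<..} (b \<bullet> i - x \<bullet> i))"
      unfolding \<phi>_def by (intro tendsto_prod tendsto_mult flat0_tendsto)
    also have "(\<Prod>i\<in>Basis. indicator {0<..} (x \<bullet> i - a \<bullet> i) * indicator {0<..} (b \<bullet> i - x \<bullet> i)) = (indicator (box a b) x :: real)"
      by (auto simp: indicator_def mem_box prod_zero_iff)
    finally show ?thesis .
  qed
  ultimately show ?thesis by blast
qed

locale domain =
  fixes \<Omega> :: "'a::euclidean_space set"
  assumes open_\<Omega>: "open \<Omega>" and bounded_\<Omega>: "bounded \<Omega>" and nonempty_\<Omega>: "\<Omega> \<noteq> {}"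
begin

lemma \<Omega>_lmeasurable: "\<Omega> \<in> lmeasurable"
  by (rule lmeasurable_open[OF bounded_\<Omega> open_\<Omega>])

lemma \<Omega>_sets [measurable]: "\<Omega> \<in> sets lebesgue"
  by (rule fmeasurableD[OF \<Omega>_lmeasurable])

lemma AE_on_iff: "(AE x in lebesgue_on \<Omega>. Q x) \<longleftrightarrow> (AE x in lebesgue. x \<in> \<Omega> \<longrightarrow> Q x)"
  by (rule AE_restrict_space_iff) simp

lemma integral_on_eq:
  assumes "f \<in> borel_measurable lebesgue" "AE x in lebesgue. x \<notin> \<Omega> \<longrightarrow> f x = (0::real)"
  shows "(LINT x|lebesgue_on \<Omega>. f x) = (LINT x|lebesgue. f x)"
proof -
  have "(LINT x|lebesgue_on \<Omega>. f x) = (LINT x|lebesgue. indicator \<Omega> x *\<^sub>R f x)"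
    by (rule integral_restrict_space) simp
  also have "\<dots> = (LINT x|lebesgue. f x)"
    using assms(1)
    by (intro integral_cong_AE) (simp_all, use assms(2) in \<open>eventually_elim, auto simp: indicator_def\<close>)
  finally show ?thesis .
qed

lemma integrable_on_iff:
  assumes "f \<in> borel_measurable lebesgue" "AE x in lebesgue. x \<notin> \<Omega> \<longrightarrow> f x = (0::real)"
  shows "integrable (lebesgue_on \<Omega>) f \<longleftrightarrow> integrable lebesgue f"
proof -
  have "integrable (lebesgue_on \<Omega>) f \<longleftrightarrow> integrable lebesgue (\<lambda>x. indicator \<Omega> x *\<^sub>R f x)"
    by (rule integrable_restrict_space) simp
  also have "\<dots> \<longleftrightarrow> integrable lebesgue f"
    using assms(1)
    by (intro integrable_cong_AE) (simp_all, use assms(2) in \<open>eventually_elim, auto simp: indicator_def\<close>)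
  finally show ?thesis .
qed

definition vanishing :: "'a L0 \<Rightarrow> bool"
  where "vanishing f \<longleftrightarrow> (AE x in lebesgue. x \<notin> \<Omega> \<longrightarrow> rep_L0 f x = 0)"

lemma vanishingD: "vanishing f \<Longrightarrow> AE x in lebesgue. x \<notin> \<Omega> \<longrightarrow> rep_L0 f x = 0"
  by (simp add: vanishing_def)

definition L2\<Omega> :: "'a L0 set" where "L2\<Omega> = {f \<in> L2. vanishing f}"

lemma abs_powr_2: "\<bar>a\<bar> powr 2 = (a::real)\<^sup>2"
  by (cases "a = 0") (simp_all add: powr_numeral)

lemma pts_Lp2: "pts (Lp \<Omega> 2) = L2\<Omega>"
proof -
  have "integrable (lebesgue_on \<Omega>) (\<lambda>x. (rep_L0 f x)\<^sup>2) \<longleftrightarrow> integrable lebesgue (\<lambda>x. (rep_L0 f x)\<^sup>2)"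
    if "vanishing f" for f
    by (rule integrable_on_iff) (simp, use vanishingD[OF that] in \<open>eventually_elim, simp\<close>)
  then show ?thesis
    by (auto simp: Lp_def L2\<Omega>_def L2_def vanishing_def abs_powr_2)
qed

lemma L2\<Omega>_vanishing: "f \<in> L2\<Omega> \<Longrightarrow> AE x in lebesgue. x \<notin> \<Omega> \<longrightarrow> rep_L0 f x = 0"
  by (simp add: L2\<Omega>_def vanishing_def)

lemma L2\<Omega>_L2: "f \<in> L2\<Omega> \<Longrightarrow> f \<in> L2"
  by (simp add: L2\<Omega>_def)

lemma nrm_Lp2: assumes "f \<in> L2\<Omega>" shows "(nrm (Lp \<Omega> 2) f)\<^sup>2 = ip2 f f"
proof -
  have "(LINT x|lebesgue_on \<Omega>. (rep_L0 f x)\<^sup>2) = (LINT x|lebesgue. (rep_L0 f x)\<^sup>2)"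
    by (rule integral_on_eq) (simp, use L2\<Omega>_vanishing[OF assms] in \<open>eventually_elim, simp\<close>)
  also have "\<dots> = ip2 f f" by (simp add: ip2_def power2_eq_square)
  finally show ?thesis
    using ip2_nonneg[of f] by (simp add: Lp_def abs_powr_2 powr_half_sqrt)
qed

lemma vanishing_add: assumes "vanishing f" "vanishing g" shows "vanishing (f + g)"
  unfolding vanishing_def using vanishingD[OF assms(1)] vanishingD[OF assms(2)] rep_add[of f g]
  by eventually_elim simp

lemma vanishing_scale: assumes "vanishing f" shows "vanishing (c *\<^sub>R f)"
  unfolding vanishing_def using vanishingD[OF assms(1)] rep_scale[of c f] by eventually_elim simp

lemma vanishing_zero: "vanishing 0"
  unfolding vanishing_def using rep_zero by eventually_elim simp

lemma subspace_L2\<Omega>: "subspace L2\<Omega>"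
  by (rule subspaceI) (auto simp: L2\<Omega>_def vanishing_add vanishing_scale vanishing_zero)

lemma L2\<Omega>_add: "f \<in> L2\<Omega> \<Longrightarrow> g \<in> L2\<Omega> \<Longrightarrow> f + g \<in> L2\<Omega>"
  and L2\<Omega>_scale: "f \<in> L2\<Omega> \<Longrightarrow> c *\<^sub>R f \<in> L2\<Omega>"
  and L2\<Omega>_diff: "f \<in> L2\<Omega> \<Longrightarrow> g \<in> L2\<Omega> \<Longrightarrow> f - g \<in> L2\<Omega>"
  and L2\<Omega>_zero: "0 \<in> L2\<Omega>"
  using subspace_L2\<Omega> by (auto simp: subspace_0 subspace_add subspace_scale subspace_diff)

text \<open>Off the domain, f agrees up to sign with its difference from each \<open>fs n\<close>,
  so its square integral there is below every distance.\<close>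

lemma L2\<Omega>_closed:
  assumes fs: "\<And>n. fs n \<in> L2\<Omega>" and f: "f \<in> L2" and lim: "l2.sconv fs f"
  shows "f \<in> L2\<Omega>"
proof -
  define C where "C = - \<Omega>"
  have C: "C \<in> sets lebesgue" by (simp add: C_def Compl_in_sets_lebesgue)
  define g where "g x = indicator C x * rep_L0 f x" for x
  have [measurable]: "g \<in> borel_measurable lebesgue" using C by (simp add: g_def[abs_def])
  have g_sq: "integrable lebesgue (\<lambda>x. (g x)\<^sup>2)"
  proof (rule Bochner_Integration.integrable_bound)
    show "integrable lebesgue (\<lambda>x. (rep_L0 f x)\<^sup>2)" using f by (simp add: L2_def)
    show "(\<lambda>x. (g x)\<^sup>2) \<in> borel_measurable lebesgue" by simp
  qed (auto simp: g_def indicator_def)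
  have le: "(LINT x|lebesgue. (g x)\<^sup>2) \<le> ip2 (fs n - f) (fs n - f)" for n
    unfolding ip2_diff_self
  proof (rule integral_mono_AE[OF g_sq L2_diff_integrable])
    have "vanishing (fs n)" using fs by (simp add: L2\<Omega>_def)
    then show "AE x in lebesgue. (g x)\<^sup>2 \<le> (rep_L0 (fs n) x - rep_L0 f x)\<^sup>2"
      unfolding vanishing_def by eventually_elim (simp add: g_def C_def indicator_def)
  qed (use fs f L2\<Omega>_L2 in auto)
  have "(\<lambda>n. ip2 (fs n - f) (fs n - f)) \<longlonglongrightarrow> 0"
    using lim fs f L2\<Omega>_L2 by (simp add: l2.sconv_def l2.nr_tendsto_0_iff ipL2)
  from LIMSEQ_le_const[OF this] le have "(LINT x|lebesgue. (g x)\<^sup>2) \<le> 0" by blast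
  moreover have "0 \<le> (LINT x|lebesgue. (g x)\<^sup>2)" by (rule integral_nonneg_AE) simp
  ultimately have "(LINT x|lebesgue. (g x)\<^sup>2) = 0" by simp
  then have "AE x in lebesgue. (g x)\<^sup>2 = 0"
    using integral_nonneg_eq_0_iff_AE[OF g_sq] by simp
  then have "vanishing f"
    unfolding vanishing_def by eventually_elim (auto simp: g_def C_def)
  then show ?thesis using f by (simp add: L2\<Omega>_def)
qed

lemma L2\<Omega>_integrable: assumes "f \<in> L2\<Omega>" shows "integrable lebesgue (rep_L0 f)"
proof (rule Bochner_Integration.integrable_bound)
  show "integrable lebesgue (\<lambda>x. (rep_L0 f x)\<^sup>2 + indicator \<Omega> x)"
    using assms \<Omega>_lmeasurable by (auto simp: L2\<Omega>_def L2_def fmeasurable_def intro!: integrable_real_indicator)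
  have "AE x in lebesgue. x \<notin> \<Omega> \<longrightarrow> rep_L0 f x = 0"
    using assms by (simp add: L2\<Omega>_def vanishing_def)
  then show "AE x in lebesgue. norm (rep_L0 f x) \<le> norm ((rep_L0 f x)\<^sup>2 + indicator \<Omega> x)"
  proof eventually_elim
    case (elim x)
    have "\<bar>a\<bar> \<le> a\<^sup>2 + 1" for a :: real
      using zero_le_power2[of "\<bar>a\<bar> - 1"] by (simp add: power2_diff)
    then show ?case using elim by (cases "x \<in> \<Omega>") auto
  qed
qed simp

lemma test_rep: "\<phi> \<in> test_functions \<Omega> \<Longrightarrow> AE x in lebesgue. rep_L0 (abs_L0 \<phi>) x = \<phi> x"
  by (rule rep_abs_L0[OF test_lebesgue_measurable])

lemma test_L2\<Omega>: assumes "\<phi> \<in> test_functions \<Omega>" shows "abs_L0 \<phi> \<in> L2\<Omega>"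
  unfolding L2\<Omega>_def mem_Collect_eq
proof
  show "abs_L0 \<phi> \<in> L2"
    using test_product_integrable[OF assms assms]
    by (intro L2_I test_lebesgue_measurable[OF assms]) (simp add: power2_eq_square)
  show "vanishing (abs_L0 \<phi>)"
    unfolding vanishing_def using test_rep[OF assms]
    by eventually_elim (simp add: test_zero_outside[OF assms])
qed

lemma ip2_test:
  assumes "\<phi> \<in> test_functions \<Omega>"
  shows "ip2 f (abs_L0 \<phi>) = (LINT x|lebesgue. rep_L0 f x * \<phi> x)"
    and "ip2 f (abs_L0 \<phi>) = (LINT x|lebesgue_on \<Omega>. rep_L0 f x * \<phi> x)"
proof -
  note m = test_lebesgue_measurable[OF assms]
  have "AE x in lebesgue. rep_L0 f x * rep_L0 (abs_L0 \<phi>) x = rep_L0 f x * \<phi> x"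
    using test_rep[OF assms] by eventually_elim simp
  then show 1: "ip2 f (abs_L0 \<phi>) = (LINT x|lebesgue. rep_L0 f x * \<phi> x)"
    unfolding ip2_def by (rule integral_L0_cong) (intro borel_measurable_times rep_L0_measurable m)+
  show "ip2 f (abs_L0 \<phi>) = (LINT x|lebesgue_on \<Omega>. rep_L0 f x * \<phi> x)"
    unfolding 1
    by (rule integral_on_eq[symmetric], intro borel_measurable_times rep_L0_measurable m)
       (simp add: test_zero_outside[OF assms])
qed

lemma ip2_test_test:
  assumes "\<phi> \<in> test_functions \<Omega>" "\<theta> \<in> test_functions \<Omega>"
  shows "ip2 (abs_L0 \<phi>) (abs_L0 \<theta>) = (LINT x|lebesgue. \<phi> x * \<theta> x)"
  unfolding ip2_test(1)[OF assms(2)]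
  by (rule integral_L0_cong, use test_rep[OF assms(1)] in \<open>eventually_elim, simp\<close>)
     (intro borel_measurable_times rep_L0_measurable test_lebesgue_measurable[OF assms(1)]
        test_lebesgue_measurable[OF assms(2)])+

lemma abs_L0_add: "\<phi> \<in> test_functions \<Omega> \<Longrightarrow> \<theta> \<in> test_functions \<Omega> \<Longrightarrow> abs_L0 \<phi> + abs_L0 \<theta> = abs_L0 (\<lambda>x. \<phi> x + \<theta> x)"
  and abs_L0_scale: "\<phi> \<in> test_functions \<Omega> \<Longrightarrow> c *\<^sub>R abs_L0 \<phi> = abs_L0 (\<lambda>x. c * \<phi> x)"
  by (simp_all add: plus_L0.abs_eq scaleR_L0.abs_eq test_lebesgue_measurable eq_onp_def)

text \<open>The argument is local to boxes whose closure lies in the domain, since only there are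
  the bumps test functions; a countable subcover then reaches all of \<open>\<Omega>\<close>. It
  runs on a Borel representative, because boxes generate the Borel sets.\<close>

lemma fundamental_lemma:
  assumes g: "g \<in> L2\<Omega>" and zero: "\<And>\<phi>. \<phi> \<in> test_functions \<Omega> \<Longrightarrow> ip2 g (abs_L0 \<phi>) = 0"
  shows "g = 0"
proof -
  obtain g' where g': "g' \<in> borel_measurable lborel" "AE x in lborel. rep_L0 g x = g' x"
    using completion_ex_borel_measurable_real[OF rep_L0_measurable] by blast
  have gg': "AE x in lebesgue. rep_L0 g x = g' x" using g'(2) by (rule AE_completion)
  have g'm [measurable]: "g' \<in> borel_measurable lebesgue" using g'(1) by (rule measurable_completion)
  have intg: "integrable lborel g'"
  proof -
    have "integrable lebesgue g'" by (rule integrable_cong_AE_imp[OF L2\<Omega>_integrable[OF g]]) (use gg' in auto)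
    then show ?thesis using g'(1) by (simp add: integrable_completion)
  qed
  have box: "(LINT x|lborel. indicator (box a b) x * g' x) = 0" if ab: "cbox a b \<subseteq> \<Omega>" for a b
  proof -
    obtain \<phi> where \<phi>: "\<And>n. \<phi> n \<in> test_functions \<Omega>" "\<And>n x. 0 \<le> \<phi> n x \<and> \<phi> n x \<le> 1"
      "\<And>x. (\<lambda>n. \<phi> n x) \<longlonglongrightarrow> indicator (box a b) x"
      using bump_functions[OF ab] by blast
    have "(LINT x|lborel. \<phi> n x * g' x) = 0" for n
    proof -
      have "(LINT x|lborel. \<phi> n x * g' x) = (LINT x|lebesgue. \<phi> n x * g' x)"
        using g'(1) test_measurable[OF \<phi>(1)] by (intro integral_completion[symmetric]) simp
      also have "\<dots> = ip2 g (abs_L0 (\<phi> n))"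
        unfolding ip2_test(1)[OF \<phi>(1)]
        by (rule integral_L0_cong, use gg' in \<open>eventually_elim, simp\<close>)
           (intro borel_measurable_times rep_L0_measurable g'm test_lebesgue_measurable[OF \<phi>(1)])+
      finally show ?thesis using zero[OF \<phi>(1)] by simp
    qed
    moreover have "(\<lambda>n. LINT x|lborel. \<phi> n x * g' x) \<longlonglongrightarrow> (LINT x|lborel. indicator (box a b) x * g' x)"
    proof (rule integral_dominated_convergence[where w = "\<lambda>x. \<bar>g' x\<bar>"])
      show "(\<lambda>x. indicator (box a b) x * g' x) \<in> borel_measurable lborel" using g'(1) by simp
      show "(\<lambda>x. \<phi> n x * g' x) \<in> borel_measurable lborel" for n
        using g'(1) test_measurable[OF \<phi>(1)] by simp
      show "integrable lborel (\<lambda>x. \<bar>g' x\<bar>)" using intg by simp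
      show "AE x in lborel. (\<lambda>n. \<phi> n x * g' x) \<longlonglongrightarrow> indicator (box a b) x * g' x"
        by (intro AE_I2 tendsto_mult \<phi>(3) tendsto_const)
      show "AE x in lborel. norm (\<phi> n x * g' x) \<le> \<bar>g' x\<bar>" for n
        using \<phi>(2) by (intro AE_I2) (simp add: abs_mult mult_left_le_one_le)
    qed
    ultimately show ?thesis by (simp add: LIMSEQ_const_iff)
  qed
  have local: "AE x in lborel. x \<in> box c d \<longrightarrow> g' x = 0" if cd: "cbox c d \<subseteq> \<Omega>" for c d
  proof -
    have "AE x in lborel. indicator (box c d) x * g' x = 0"
    proof (rule integral_boxes_zero)
      show "integrable lborel (\<lambda>x. indicator (box c d) x * g' x)"
        using integrable_mult_indicator[of "box c d" lborel g'] intg by simp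
      show "(LINT x|lborel. indicator (box c d) x * g' x) = 0" by (rule box[OF cd])
      show "(LINT x|lborel. indicator (box a b) x * (indicator (box c d) x * g' x)) = 0" for a b
      proof (cases "box a b \<inter> box c d = {}")
        case True
        then have "(\<lambda>x. indicator (box a b) x * (indicator (box c d) x * g' x)) = (\<lambda>x. 0)"
          by (auto simp: indicator_def fun_eq_iff)
        then show ?thesis by (simp only: Bochner_Integration.integral_zero)
      next
        case False
        obtain e f where ef: "box a b \<inter> box c d = box e f" using box_Int_box by blast
        \<comment> \<open>A nonempty open box has the closed box as closure, which therefore stays
          inside \<open>\<Omega>\<close>.\<close>
        have "cbox e f = closure (box e f)" using False ef closure_box by auto
        also have "\<dots> \<subseteq> closure (cbox c d)" using ef box_subset_cbox[of c d] by (intro closure_mono) auto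
        finally have "cbox e f \<subseteq> \<Omega>" using cd by simp
        from box[OF this] show ?thesis
          by (simp add: ef[symmetric] indicator_inter_arith mult.assoc)
      qed
    qed
    then show ?thesis by eventually_elim (auto simp: indicator_def)
  qed
  define \<F> where "\<F> = {box c d | c d. cbox c d \<subseteq> \<Omega>}"
  obtain \<G> where \<G>: "\<G> \<subseteq> \<F>" "countable \<G>" "\<Union>\<G> = \<Union>\<F>"
    using Lindelof[of \<F>] by (auto simp: \<F>_def)
  have "AE x in lborel. \<forall>B\<in>\<G>. x \<in> B \<longrightarrow> g' x = 0"
    using \<G>(1,2) local by (subst AE_ball_countable) (auto simp: \<F>_def)
  moreover have "\<Omega> \<subseteq> \<Union>\<F>"
  proof
    fix x assume "x \<in> \<Omega>"
    then obtain a b where "cbox a b \<subseteq> \<Omega>" "x \<in> box a b"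
      using open_contains_cbox[of \<Omega> x] open_\<Omega> by metis
    then show "x \<in> \<Union>\<F>" by (auto simp: \<F>_def)
  qed
  ultimately have "AE x in lborel. x \<in> \<Omega> \<longrightarrow> g' x = 0"
    using \<G>(3) by (auto elim!: eventually_mono)
  then have "AE x in lebesgue. x \<in> \<Omega> \<longrightarrow> g' x = 0" by (rule AE_completion)
  moreover have "AE x in lebesgue. x \<notin> \<Omega> \<longrightarrow> rep_L0 g x = 0"
    using g by (simp add: L2\<Omega>_def vanishing_def)
  ultimately have "AE x in lebesgue. rep_L0 g x = rep_L0 0 x"
    using gg' rep_zero by eventually_elim auto
  then show ?thesis by (rule L0_eqI)
qed

subsection \<open>The Sobolev space\<close>

lemma Lp2_ereal: "pts (Lp \<Omega> (ereal 2)) = L2\<Omega>" "f \<in> L2\<Omega> \<Longrightarrow> (nrm (Lp \<Omega> (ereal 2)) f)\<^sup>2 = ip2 f f"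
  using pts_Lp2 nrm_Lp2[of f] by simp_all

lemma has_weak_deriv_iff:
  assumes i: "i \<in> Basis"
  shows "has_weak_deriv \<Omega> i v g \<longleftrightarrow> g \<in> L2\<Omega> \<and>
    (\<forall>\<phi>\<in>test_functions \<Omega>. ip2 v (abs_L0 (partial_deriv i \<phi>)) = - ip2 g (abs_L0 \<phi>))"
  unfolding has_weak_deriv_def pts_Lp2
  by (simp add: ip2_test(2)[symmetric] test_partial_deriv[OF _ i])

lemma weak_deriv_eq:
  assumes i: "i \<in> Basis" and g: "has_weak_deriv \<Omega> i v g"
  shows "weak_deriv \<Omega> i v = g"
  unfolding weak_deriv_def
proof (rule the_equality)
  show "has_weak_deriv \<Omega> i v g" by (rule g)
  fix g' assume g': "has_weak_deriv \<Omega> i v g'"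
  have "g' - g = 0"
  proof (rule fundamental_lemma)
    show "g' - g \<in> L2\<Omega>" using g g' by (simp add: has_weak_deriv_iff[OF i] L2\<Omega>_diff)
    fix \<phi> assume \<phi>: "\<phi> \<in> test_functions \<Omega>"
    have L2: "g \<in> L2" "g' \<in> L2" "abs_L0 \<phi> \<in> L2"
      using g g' test_L2\<Omega>[OF \<phi>] L2\<Omega>_L2 by (auto simp: has_weak_deriv_iff[OF i])
    have "ip2 g' (abs_L0 \<phi>) = ip2 g (abs_L0 \<phi>)"
      using g g' \<phi> unfolding has_weak_deriv_iff[OF i] by force
    with L2 show "ip2 (g' - g) (abs_L0 \<phi>) = 0"
      using l2.ip_diff_left[of g' g "abs_L0 \<phi>"] by (simp add: ipL2)
  qed
  then show "g' = g" by simp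
qed

definition wderiv :: "'a \<Rightarrow> 'a L0 \<Rightarrow> 'a L0" where "wderiv i v = weak_deriv \<Omega> i v"

definition H1s :: "'a L0 set" where "H1s = pts (H1 \<Omega>)"

definition Hs :: "'a L0 set" where "Hs = pts (H10 \<Omega>)"

lemma H1s_iff: "v \<in> H1s \<longleftrightarrow> v \<in> L2\<Omega> \<and> (\<forall>i\<in>Basis. \<exists>g. has_weak_deriv \<Omega> i v g)"
  by (auto simp: H1s_def H1_def Lp2_ereal)

lemma H1s_L2\<Omega>: "v \<in> H1s \<Longrightarrow> v \<in> L2\<Omega>"
  by (simp add: H1s_iff)

lemma wderiv_weak: assumes "v \<in> H1s" "i \<in> Basis" shows "has_weak_deriv \<Omega> i v (wderiv i v)"
proof -
  obtain g where "has_weak_deriv \<Omega> i v g" using assms by (auto simp: H1s_iff)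
  then show ?thesis using weak_deriv_eq[OF assms(2)] by (simp add: wderiv_def)
qed

lemma wderiv_L2\<Omega>: "v \<in> H1s \<Longrightarrow> i \<in> Basis \<Longrightarrow> wderiv i v \<in> L2\<Omega>"
  using wderiv_weak by (simp add: has_weak_deriv_iff)

lemma wderiv_L2: "v \<in> H1s \<Longrightarrow> i \<in> Basis \<Longrightarrow> wderiv i v \<in> L2"
  by (rule L2\<Omega>_L2[OF wderiv_L2\<Omega>])

lemma wderiv_test: "v \<in> H1s \<Longrightarrow> i \<in> Basis \<Longrightarrow> \<phi> \<in> test_functions \<Omega> \<Longrightarrow>
   ip2 v (abs_L0 (partial_deriv i \<phi>)) = - ip2 (wderiv i v) (abs_L0 \<phi>)"
  using wderiv_weak[of v i] by (simp add: has_weak_deriv_iff)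

lemma wderiv_I:
  assumes "v \<in> L2\<Omega>" and "\<And>i. i \<in> Basis \<Longrightarrow> g i \<in> L2\<Omega>"
    and "\<And>i \<phi>. i \<in> Basis \<Longrightarrow> \<phi> \<in> test_functions \<Omega> \<Longrightarrow> ip2 v (abs_L0 (partial_deriv i \<phi>)) = - ip2 (g i) (abs_L0 \<phi>)"
  shows "v \<in> H1s" "i \<in> Basis \<Longrightarrow> wderiv i v = g i"
proof -
  have "has_weak_deriv \<Omega> i v (g i)" if "i \<in> Basis" for i using assms that by (simp add: has_weak_deriv_iff)
  then show "v \<in> H1s" "i \<in> Basis \<Longrightarrow> wderiv i v = g i"
    using assms(1) weak_deriv_eq by (auto simp: H1s_iff wderiv_def)
qed

lemma test_L2: "\<phi> \<in> test_functions \<Omega> \<Longrightarrow> abs_L0 \<phi> \<in> L2"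
  by (rule L2\<Omega>_L2[OF test_L2\<Omega>])

lemma test_pd_L2: "\<phi> \<in> test_functions \<Omega> \<Longrightarrow> i \<in> Basis \<Longrightarrow> abs_L0 (partial_deriv i \<phi>) \<in> L2"
  by (rule test_L2[OF test_partial_deriv])

lemma test_H1s:
  assumes \<phi>: "\<phi> \<in> test_functions \<Omega>"
  shows "abs_L0 \<phi> \<in> H1s" "i \<in> Basis \<Longrightarrow> wderiv i (abs_L0 \<phi>) = abs_L0 (partial_deriv i \<phi>)"
  by (rule wderiv_I[where g = "\<lambda>i. abs_L0 (partial_deriv i \<phi>)"];
      simp add: ip2_test_test integration_by_parts[OF \<phi>] test_L2\<Omega>[OF \<phi>] test_L2\<Omega>[OF test_partial_deriv[OF \<phi>]]
        test_partial_deriv[OF \<phi>] test_partial_deriv \<phi>)+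

lemma wderiv_add:
  assumes "v \<in> H1s" "w \<in> H1s"
  shows "v + w \<in> H1s" "i \<in> Basis \<Longrightarrow> wderiv i (v + w) = wderiv i v + wderiv i w"
  using assms
  by (auto intro!: wderiv_I[where g = "\<lambda>i. wderiv i v + wderiv i w"] L2\<Omega>_add
      simp: H1s_L2\<Omega> wderiv_L2\<Omega> ip2_add L2\<Omega>_L2 wderiv_L2 test_L2 test_pd_L2 wderiv_test)

lemma wderiv_scale:
  assumes "v \<in> H1s"
  shows "c *\<^sub>R v \<in> H1s" "i \<in> Basis \<Longrightarrow> wderiv i (c *\<^sub>R v) = c *\<^sub>R wderiv i v"
  using assms
  by (auto intro!: wderiv_I[where g = "\<lambda>i. c *\<^sub>R wderiv i v"] L2\<Omega>_scale simp: H1s_L2\<Omega> wderiv_L2\<Omega> ip2_scale wderiv_test)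

lemma subspace_H1s: "subspace H1s"
proof (rule subspaceI)
  show "0 \<in> H1s"
    by (rule wderiv_I(1)[where g = "\<lambda>i. 0"]) (simp_all add: L2\<Omega>_zero test_L2 test_pd_L2 flip: ipL2)
qed (simp_all add: wderiv_add wderiv_scale)

lemma wderiv_diff:
  assumes "v \<in> H1s" "w \<in> H1s"
  shows "v - w \<in> H1s" "i \<in> Basis \<Longrightarrow> wderiv i (v - w) = wderiv i v - wderiv i w"
proof -
  show "v - w \<in> H1s" using subspace_diff[OF subspace_H1s] assms by blast
  show "wderiv i (v - w) = wderiv i v - wderiv i w" if "i \<in> Basis"
    using wderiv_add(2)[of v "(-1) *\<^sub>R w" i] wderiv_scale(1)[OF assms(2), of "-1"]
      wderiv_scale(2)[OF assms(2) that, of "-1"] assms that by simp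
qed

definition grad_ip :: "'a L0 \<Rightarrow> 'a L0 \<Rightarrow> real"
  where "grad_ip v w = (\<Sum>i\<in>Basis. ip2 (wderiv i v) (wderiv i w))"

lemma H10_inner_eq: assumes "v \<in> H1s" "w \<in> H1s" shows "H10_inner \<Omega> v w = grad_ip v w"
proof -
  have int: "integrable lebesgue (\<lambda>x. rep_L0 (wderiv i v) x * rep_L0 (wderiv i w) x)" if "i \<in> Basis" for i
    using assms that by (intro L2_mult wderiv_L2)
  have "AE x in lebesgue. \<forall>i\<in>Basis. x \<notin> \<Omega> \<longrightarrow> rep_L0 (wderiv i v) x = 0"
    using assms by (subst AE_ball_countable) (auto simp: countable_finite intro!: L2\<Omega>_vanishing wderiv_L2\<Omega>)
  then have "AE x in lebesgue. x \<notin> \<Omega> \<longrightarrow> (\<Sum>i\<in>Basis. rep_L0 (wderiv i v) x * rep_L0 (wderiv i w) x) = 0"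
    by eventually_elim auto
  then have "H10_inner \<Omega> v w = (LINT x|lebesgue. (\<Sum>i\<in>Basis. rep_L0 (wderiv i v) x * rep_L0 (wderiv i w) x))"
    unfolding H10_inner_def wderiv_def by (intro integral_on_eq) simp_all
  also have "\<dots> = grad_ip v w"
    unfolding grad_ip_def ip2_def using int by simp
  finally show ?thesis .
qed

text \<open>Convergence in \<open>H1 \<Omega>\<close> is split into convergence of the function and
  of each partial derivative, the form to which the Hilbert space facts about \<open>L2\<close>
  apply.\<close>

lemma Hs_iff:
  "v \<in> Hs \<longleftrightarrow> v \<in> H1s \<and> (\<exists>\<phi>. (\<forall>n. \<phi> n \<in> test_functions \<Omega>) \<and> l2.sconv (\<lambda>n. abs_L0 (\<phi> n)) v \<and>
     (\<forall>i\<in>Basis. l2.sconv (\<lambda>n. abs_L0 (partial_deriv i (\<phi> n))) (wderiv i v)))"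
proof -
  have eq: "strong_lim (H1 \<Omega>) (\<lambda>n. abs_L0 (\<phi> n)) v \<longleftrightarrow> l2.sconv (\<lambda>n. abs_L0 (\<phi> n)) v \<and>
     (\<forall>i\<in>Basis. l2.sconv (\<lambda>n. abs_L0 (partial_deriv i (\<phi> n))) (wderiv i v))"
    if v: "v \<in> H1s" and \<phi>: "\<And>n. \<phi> n \<in> test_functions \<Omega>" for \<phi>
  proof -
    define a where "a n = ip2 (abs_L0 (\<phi> n) - v) (abs_L0 (\<phi> n) - v)" for n
    define b where "b i n = ip2 (abs_L0 (partial_deriv i (\<phi> n)) - wderiv i v) (abs_L0 (partial_deriv i (\<phi> n)) - wderiv i v)" for i n
    have D: "weak_deriv \<Omega> i (abs_L0 (\<phi> n) - v) = abs_L0 (partial_deriv i (\<phi> n)) - wderiv i v" if "i \<in> Basis" for i n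
      using wderiv_diff(2)[OF test_H1s(1)[OF \<phi>] v that] test_H1s(2)[OF \<phi> that] by (simp add: wderiv_def)
    have nn: "0 \<le> a n" "0 \<le> b i n" for i n by (simp_all add: a_def b_def ip2_nonneg)
    have "nrm (H1 \<Omega>) (abs_L0 (\<phi> n) - v) = sqrt (a n + (\<Sum>i\<in>Basis. b i n))" for n
      unfolding H1_def normed_sp.simps a_def b_def
      using v \<phi> by (simp add: D Lp2_ereal L2\<Omega>_diff test_L2\<Omega> H1s_L2\<Omega> wderiv_L2\<Omega> test_partial_deriv)
    then have "strong_lim (H1 \<Omega>) (\<lambda>n. abs_L0 (\<phi> n)) v \<longleftrightarrow> (\<lambda>n. sqrt (a n + (\<Sum>i\<in>Basis. b i n))) \<longlonglongrightarrow> 0"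
      by (simp add: strong_lim_def)
    also have "\<dots> \<longleftrightarrow> (\<lambda>n. a n + (\<Sum>i\<in>Basis. b i n)) \<longlonglongrightarrow> 0"
    proof
      assume "(\<lambda>n. sqrt (a n + (\<Sum>i\<in>Basis. b i n))) \<longlonglongrightarrow> 0"
      from tendsto_power[OF this, of 2] show "(\<lambda>n. a n + (\<Sum>i\<in>Basis. b i n)) \<longlonglongrightarrow> 0"
        using nn by (simp add: sum_nonneg add_nonneg_nonneg)
    next
      assume "(\<lambda>n. a n + (\<Sum>i\<in>Basis. b i n)) \<longlonglongrightarrow> 0"
      from tendsto_real_sqrt[OF this] show "(\<lambda>n. sqrt (a n + (\<Sum>i\<in>Basis. b i n))) \<longlonglongrightarrow> 0" by simp
    qed
    also have "\<dots> \<longleftrightarrow> a \<longlonglongrightarrow> 0 \<and> (\<forall>i\<in>Basis. b i \<longlonglongrightarrow> 0)"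
    proof (intro iffI conjI ballI)
      assume l: "(\<lambda>n. a n + (\<Sum>i\<in>Basis. b i n)) \<longlonglongrightarrow> 0"
      show "a \<longlonglongrightarrow> 0"
        by (rule tendsto_sandwich[OF _ _ tendsto_const l]) (simp_all add: nn sum_nonneg)
      fix i :: 'a assume i: "i \<in> Basis"
      have "b i n \<le> a n + (\<Sum>i\<in>Basis. b i n)" for n
        using nn member_le_sum[OF i, of "\<lambda>i. b i n"] by (simp add: add_increasing)
      then show "b i \<longlonglongrightarrow> 0"
        by (intro tendsto_sandwich[OF _ _ tendsto_const l]) (simp_all add: nn)
    next
      assume l: "a \<longlonglongrightarrow> 0 \<and> (\<forall>i\<in>Basis. b i \<longlonglongrightarrow> 0)"
      have "(\<lambda>n. a n + (\<Sum>i\<in>Basis. b i n)) \<longlonglongrightarrow> 0 + (\<Sum>i\<in>(Basis::'a set). 0)"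
        by (intro tendsto_add tendsto_sum) (use l in auto)
      then show "(\<lambda>n. a n + (\<Sum>i\<in>Basis. b i n)) \<longlonglongrightarrow> 0" by simp
    qed
    also have "a \<longlonglongrightarrow> 0 \<longleftrightarrow> l2.sconv (\<lambda>n. abs_L0 (\<phi> n)) v"
      using v \<phi> by (simp add: l2.sconv_def l2.nr_tendsto_0_iff ipL2 test_L2 L2\<Omega>_L2 H1s_L2\<Omega> a_def[abs_def])
    also have "(\<forall>i\<in>Basis. b i \<longlonglongrightarrow> 0) \<longleftrightarrow> (\<forall>i\<in>Basis. l2.sconv (\<lambda>n. abs_L0 (partial_deriv i (\<phi> n))) (wderiv i v))"
      using v \<phi> by (intro ball_cong refl)
        (simp add: l2.sconv_def l2.nr_tendsto_0_iff ipL2 test_pd_L2 wderiv_L2 b_def[abs_def])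
    finally show ?thesis .
  qed
  show ?thesis unfolding Hs_def H10_def normed_sp.simps H1s_def[symmetric] using eq by blast
qed

lemma Hs_H1s: "v \<in> Hs \<Longrightarrow> v \<in> H1s"
  by (simp add: Hs_iff)

lemma l2_sconv_ip2:
  assumes "l2.sconv fs f" "\<And>n. fs n \<in> L2" "f \<in> L2" "g \<in> L2" shows "(\<lambda>n. ip2 (fs n) g) \<longlonglongrightarrow> ip2 f g"
  using l2.wconvD[OF l2.sconv_imp_wconv[OF assms(1,2,3)] assms(4)] assms by (simp add: ipL2)

text \<open>The weak gradient is a closed operator: integration by parts against a fixed test
  function is stable under limits in \<open>L2\<close>. The linear structure and the completeness of
  \<open>Hs\<close> both come from this.\<close>

lemma Hs_I:
  assumes \<phi>: "\<And>n. \<phi> n \<in> test_functions \<Omega>" and v: "v \<in> L2" "l2.sconv (\<lambda>n. abs_L0 (\<phi> n)) v"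
    and g: "\<And>i. i \<in> Basis \<Longrightarrow> g i \<in> L2" "\<And>i. i \<in> Basis \<Longrightarrow> l2.sconv (\<lambda>n. abs_L0 (partial_deriv i (\<phi> n))) (g i)"
  shows "v \<in> Hs" "i \<in> Basis \<Longrightarrow> wderiv i v = g i"
proof -
  have vO: "v \<in> L2\<Omega>" by (rule L2\<Omega>_closed[OF test_L2\<Omega>[OF \<phi>] v])
  have gO: "g i \<in> L2\<Omega>" if "i \<in> Basis" for i
    by (rule L2\<Omega>_closed[OF test_L2\<Omega>[OF test_partial_deriv[OF \<phi> that]] g[OF that]])
  have eq: "ip2 v (abs_L0 (partial_deriv i \<theta>)) = - ip2 (g i) (abs_L0 \<theta>)"
    if i: "i \<in> Basis" and \<theta>: "\<theta> \<in> test_functions \<Omega>" for i \<theta>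
  proof (rule LIMSEQ_unique)
    show "(\<lambda>n. ip2 (abs_L0 (\<phi> n)) (abs_L0 (partial_deriv i \<theta>))) \<longlonglongrightarrow> ip2 v (abs_L0 (partial_deriv i \<theta>))"
      using v \<phi> \<theta> i by (intro l2_sconv_ip2) (simp_all add: test_L2 test_pd_L2)
    have "(\<lambda>n. - ip2 (abs_L0 (partial_deriv i (\<phi> n))) (abs_L0 \<theta>)) \<longlonglongrightarrow> - ip2 (g i) (abs_L0 \<theta>)"
      using g i \<phi> \<theta> by (intro tendsto_minus l2_sconv_ip2) (simp_all add: test_L2 test_pd_L2)
    moreover have "ip2 (abs_L0 (\<phi> n)) (abs_L0 (partial_deriv i \<theta>)) = - ip2 (abs_L0 (partial_deriv i (\<phi> n))) (abs_L0 \<theta>)" for n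
      by (simp add: ip2_test_test \<phi> \<theta> i test_partial_deriv integration_by_parts[OF \<phi> \<theta> i])
    ultimately show "(\<lambda>n. ip2 (abs_L0 (\<phi> n)) (abs_L0 (partial_deriv i \<theta>))) \<longlonglongrightarrow> - ip2 (g i) (abs_L0 \<theta>)" by simp
  qed
  note D = wderiv_I[OF vO gO eq]
  show "i \<in> Basis \<Longrightarrow> wderiv i v = g i" by (rule D(2))
  show "v \<in> Hs" unfolding Hs_iff using D \<phi> v g by (auto intro!: exI[of _ \<phi>])
qed

lemma test_Hs: assumes "\<phi> \<in> test_functions \<Omega>" shows "abs_L0 \<phi> \<in> Hs"
  by (rule Hs_I(1)[of "\<lambda>n. \<phi>" _ "\<lambda>i. abs_L0 (partial_deriv i \<phi>)"])
     (simp_all add: assms test_L2 test_pd_L2 l2.sconv_const)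

lemma subspace_Hs: "subspace Hs"
proof (rule subspaceI)
  have "(\<lambda>x. 0) \<in> test_functions \<Omega>" by (simp add: test_functions_def)
  from test_Hs[OF this] show "0 \<in> Hs" by (simp add: zero_L0_def)
next
  fix v w assume "v \<in> Hs" "w \<in> Hs"
  then obtain \<phi> \<theta> where vw: "v \<in> H1s" "w \<in> H1s"
    and \<phi>: "\<And>n. \<phi> n \<in> test_functions \<Omega>" "l2.sconv (\<lambda>n. abs_L0 (\<phi> n)) v"
      "\<And>i. i \<in> Basis \<Longrightarrow> l2.sconv (\<lambda>n. abs_L0 (partial_deriv i (\<phi> n))) (wderiv i v)"
    and \<theta>: "\<And>n. \<theta> n \<in> test_functions \<Omega>" "l2.sconv (\<lambda>n. abs_L0 (\<theta> n)) w"
      "\<And>i. i \<in> Basis \<Longrightarrow> l2.sconv (\<lambda>n. abs_L0 (partial_deriv i (\<theta> n))) (wderiv i w)"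
    unfolding Hs_iff by blast
  show "v + w \<in> Hs"
  proof (rule Hs_I(1)[of "\<lambda>n x. \<phi> n x + \<theta> n x" _ "\<lambda>i. wderiv i v + wderiv i w"])
    show "(\<lambda>x. \<phi> n x + \<theta> n x) \<in> test_functions \<Omega>" for n by (rule test_add[OF \<phi>(1) \<theta>(1)])
    show "l2.sconv (\<lambda>n. abs_L0 (\<lambda>x. \<phi> n x + \<theta> n x)) (v + w)"
      using l2.sconv_add[OF \<phi>(2) \<theta>(2)] by (simp add: abs_L0_add[OF \<phi>(1) \<theta>(1)])
    show "l2.sconv (\<lambda>n. abs_L0 (partial_deriv i (\<lambda>x. \<phi> n x + \<theta> n x))) (wderiv i v + wderiv i w)" if i: "i \<in> Basis" for i
      using l2.sconv_add[OF \<phi>(3)[OF i] \<theta>(3)[OF i]]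
      by (simp add: abs_L0_add[OF test_partial_deriv[OF \<phi>(1) i] test_partial_deriv[OF \<theta>(1) i]]
          partial_deriv_add[OF test_differentiable[OF \<phi>(1)] test_differentiable[OF \<theta>(1)]])
  qed (use vw in \<open>simp_all add: H1s_L2\<Omega> L2\<Omega>_L2 wderiv_L2\<close>)
next
  fix c v assume "v \<in> Hs"
  then obtain \<phi> where v: "v \<in> H1s" and \<phi>: "\<And>n. \<phi> n \<in> test_functions \<Omega>" "l2.sconv (\<lambda>n. abs_L0 (\<phi> n)) v"
      "\<And>i. i \<in> Basis \<Longrightarrow> l2.sconv (\<lambda>n. abs_L0 (partial_deriv i (\<phi> n))) (wderiv i v)"
    unfolding Hs_iff by blast
  show "c *\<^sub>R v \<in> Hs"
  proof (rule Hs_I(1)[of "\<lambda>n x. c * \<phi> n x" _ "\<lambda>i. c *\<^sub>R wderiv i v"])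
    show "(\<lambda>x. c * \<phi> n x) \<in> test_functions \<Omega>" for n by (rule test_cmult[OF \<phi>(1)])
    show "l2.sconv (\<lambda>n. abs_L0 (\<lambda>x. c * \<phi> n x)) (c *\<^sub>R v)"
      using l2.sconv_scale[OF \<phi>(2)] by (simp add: abs_L0_scale[OF \<phi>(1)])
    show "l2.sconv (\<lambda>n. abs_L0 (partial_deriv i (\<lambda>x. c * \<phi> n x))) (c *\<^sub>R wderiv i v)" if i: "i \<in> Basis" for i
      using l2.sconv_scale[OF \<phi>(3)[OF i]]
      by (simp add: abs_L0_scale[OF test_partial_deriv[OF \<phi>(1) i]]
          partial_deriv_mult[OF _ test_differentiable[OF \<phi>(1)]])
  qed (use v in \<open>simp_all add: H1s_L2\<Omega> L2\<Omega>_L2 wderiv_L2\<close>)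
qed

lemma Hs_L2: "v \<in> Hs \<Longrightarrow> v \<in> L2" and Hs_wderiv_L2: "v \<in> Hs \<Longrightarrow> i \<in> Basis \<Longrightarrow> wderiv i v \<in> L2"
  by (simp_all add: Hs_H1s H1s_L2\<Omega> L2\<Omega>_L2 wderiv_L2)

lemma Poincare: "\<exists>C>0. \<forall>v\<in>Hs. ip2 v v \<le> C * grad_ip v v"
proof -
  obtain R where R: "R > 0" "\<And>x. x \<in> \<Omega> \<Longrightarrow> norm x \<le> R"
    using bounded_\<Omega> unfolding bounded_pos by blast
  have test: "ip2 (abs_L0 \<phi>) (abs_L0 \<phi>) \<le> 4 * R\<^sup>2 * (\<Sum>i\<in>Basis. ip2 (abs_L0 (partial_deriv i \<phi>)) (abs_L0 (partial_deriv i \<phi>)))"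
    if \<phi>: "\<phi> \<in> test_functions \<Omega>" for \<phi>
  proof -
    obtain i :: 'a where i: "i \<in> Basis" using nonempty_Basis by blast
    have "ip2 (abs_L0 \<phi>) (abs_L0 \<phi>) \<le> 4 * R\<^sup>2 * ip2 (abs_L0 (partial_deriv i \<phi>)) (abs_L0 (partial_deriv i \<phi>))"
      using test_Poincare[OF \<phi> i R(2)] \<phi> by (simp add: ip2_test_test test_partial_deriv i power2_eq_square)
    also have "\<dots> \<le> 4 * R\<^sup>2 * (\<Sum>i\<in>Basis. ip2 (abs_L0 (partial_deriv i \<phi>)) (abs_L0 (partial_deriv i \<phi>)))"
      by (intro mult_left_mono member_le_sum i) (simp_all add: ip2_nonneg)
    finally show ?thesis .
  qed
  have "ip2 v v \<le> 4 * R\<^sup>2 * grad_ip v v" if v: "v \<in> Hs" for v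
  proof -
    obtain \<phi> where \<phi>: "\<And>n. \<phi> n \<in> test_functions \<Omega>" "l2.sconv (\<lambda>n. abs_L0 (\<phi> n)) v"
      "\<And>i. i \<in> Basis \<Longrightarrow> l2.sconv (\<lambda>n. abs_L0 (partial_deriv i (\<phi> n))) (wderiv i v)"
      using v unfolding Hs_iff by blast
    have "(\<lambda>n. ip2 (abs_L0 (\<phi> n)) (abs_L0 (\<phi> n))) \<longlonglongrightarrow> ip2 v v"
      using l2.sconv_ip_self[OF \<phi>(2)] v by (simp add: ipL2 test_L2[OF \<phi>(1)] Hs_L2)
    moreover have "(\<lambda>n. 4 * R\<^sup>2 * (\<Sum>i\<in>Basis. ip2 (abs_L0 (partial_deriv i (\<phi> n))) (abs_L0 (partial_deriv i (\<phi> n)))))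
        \<longlonglongrightarrow> 4 * R\<^sup>2 * grad_ip v v"
      unfolding grad_ip_def
    proof (intro tendsto_mult tendsto_const tendsto_sum)
      fix i :: 'a assume i: "i \<in> Basis"
      show "(\<lambda>n. ip2 (abs_L0 (partial_deriv i (\<phi> n))) (abs_L0 (partial_deriv i (\<phi> n)))) \<longlonglongrightarrow> ip2 (wderiv i v) (wderiv i v)"
        using l2.sconv_ip_self[OF \<phi>(3)[OF i]] v i by (simp add: ipL2 test_pd_L2[OF \<phi>(1)] Hs_wderiv_L2)
    qed
    ultimately show ?thesis by (rule LIMSEQ_le) (use test[OF \<phi>(1)] in blast)
  qed
  then show ?thesis using R(1) by (intro exI[of _ "4 * R\<^sup>2"]) simp
qed

section \<open>The gradient inner product and completeness\<close>

definition ipH :: "'a L0 \<Rightarrow> 'a L0 \<Rightarrow> real"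
  where "ipH = (SOME ip. semi_inner ip \<and> (\<forall>x\<in>Hs. \<forall>y\<in>Hs. ip x y = grad_ip x y))"

lemma ipH: "semi_inner ipH" and ipH_eq: "x \<in> Hs \<Longrightarrow> y \<in> Hs \<Longrightarrow> ipH x y = grad_ip x y"
proof -
  have "\<exists>ip. semi_inner ip \<and> (\<forall>x\<in>Hs. \<forall>y\<in>Hs. ip x y = grad_ip x y)"
  proof (rule ex_semi_inner[OF subspace_Hs])
    show "grad_ip x y = grad_ip y x" for x y unfolding grad_ip_def by (simp add: ip2_commute)
    show "grad_ip (x + y) z = grad_ip x z + grad_ip y z" if "x \<in> Hs" "y \<in> Hs" "z \<in> Hs" for x y z
      using that unfolding grad_ip_def
      by (simp add: wderiv_add Hs_H1s ip2_add wderiv_L2 flip: sum.distrib)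
    show "grad_ip (c *\<^sub>R x) y = c * grad_ip x y" if "x \<in> Hs" "y \<in> Hs" for c x y
      using that unfolding grad_ip_def by (simp add: wderiv_scale Hs_H1s ip2_scale sum_distrib_left)
    show "0 \<le> grad_ip x x" for x unfolding grad_ip_def by (simp add: sum_nonneg ip2_nonneg)
  qed
  from someI_ex[OF this] show "semi_inner ipH" "x \<in> Hs \<Longrightarrow> y \<in> Hs \<Longrightarrow> ipH x y = grad_ip x y"
    by (auto simp: ipH_def)
qed

sublocale Hsp: semi_inner ipH by (rule ipH)

lemma Hs_add [simp]: "x \<in> Hs \<Longrightarrow> y \<in> Hs \<Longrightarrow> x + y \<in> Hs"
  and Hs_diff [simp]: "x \<in> Hs \<Longrightarrow> y \<in> Hs \<Longrightarrow> x - y \<in> Hs"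
  and Hs_scale [simp]: "x \<in> Hs \<Longrightarrow> c *\<^sub>R x \<in> Hs"
  using subspace_Hs by (auto simp: subspace_add subspace_diff subspace_scale)

lemma nr_L2_le: "\<exists>C>0. \<forall>v\<in>Hs. l2.nr v \<le> C * Hsp.nr v"
proof -
  obtain C where C: "C > 0" "\<And>v. v \<in> Hs \<Longrightarrow> ip2 v v \<le> C * grad_ip v v" using Poincare by blast
  have "l2.nr v \<le> sqrt C * Hsp.nr v" if "v \<in> Hs" for v
    using C(2)[OF that] that by (simp add: l2.nr_def Hsp.nr_def ipL2 Hs_L2 ipH_eq flip: real_sqrt_mult)
  then show ?thesis using C(1) by (intro exI[of _ "sqrt C"]) auto
qed

lemma wderiv_nr: "v \<in> Hs \<Longrightarrow> i \<in> Basis \<Longrightarrow> l2.nr (wderiv i v) \<le> Hsp.nr v"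
  by (auto simp: l2.nr_def Hsp.nr_def ipL2 Hs_wderiv_L2 ipH_eq grad_ip_def ip2_nonneg intro!: member_le_sum[where f = "\<lambda>i. ip2 (wderiv i v) (wderiv i v)"])

lemma Hs_approx:
  assumes v: "v \<in> Hs" and e: "\<epsilon> > 0"
  shows "\<exists>\<phi>\<in>test_functions \<Omega>. Hsp.nr (abs_L0 \<phi> - v) < \<epsilon>"
proof -
  obtain \<phi> where \<phi>: "\<And>n. \<phi> n \<in> test_functions \<Omega>"
    "\<And>i. i \<in> Basis \<Longrightarrow> l2.sconv (\<lambda>n. abs_L0 (partial_deriv i (\<phi> n))) (wderiv i v)"
    using v unfolding Hs_iff by blast
  have "(\<lambda>n. \<Sum>i\<in>Basis. ipL2 (abs_L0 (partial_deriv i (\<phi> n)) - wderiv i v) (abs_L0 (partial_deriv i (\<phi> n)) - wderiv i v)) \<longlonglongrightarrow> (\<Sum>i\<in>(Basis::'a set). 0)"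
    by (intro tendsto_sum) (use \<phi>(2) in \<open>simp add: l2.sconv_def l2.nr_tendsto_0_iff\<close>)
  moreover have "(\<Sum>i\<in>Basis. ipL2 (abs_L0 (partial_deriv i (\<phi> n)) - wderiv i v) (abs_L0 (partial_deriv i (\<phi> n)) - wderiv i v))
      = ipH (abs_L0 (\<phi> n) - v) (abs_L0 (\<phi> n) - v)" for n
    using v \<phi>(1)
    by (simp add: ipH_eq grad_ip_def ipL2 test_Hs wderiv_diff test_H1s Hs_H1s test_pd_L2 wderiv_L2)
  ultimately have "(\<lambda>n. ipH (abs_L0 (\<phi> n) - v) (abs_L0 (\<phi> n) - v)) \<longlonglongrightarrow> 0" by simp
  then have "(\<lambda>n. Hsp.nr (abs_L0 (\<phi> n) - v)) \<longlonglongrightarrow> 0" by (simp add: Hsp.nr_tendsto_0_iff)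
  from order_tendstoD(2)[OF this e] show ?thesis using \<phi>(1) by (auto simp: eventually_sequentially)
qed

text \<open>Members of a Cauchy sequence are replaced by test functions at distance below
  \<open>inverse (real (Suc n))\<close>. The Poincare inequality makes these Cauchy in
  \<open>L2\<close> together with their gradients, and the limits fit together by
  \<open>Hs_I\<close>.\<close>

sublocale Hsp: hilbert ipH Hs
proof unfold_locales
  show "subspace Hs" by (rule subspace_Hs)
  obtain C where C: "C > 0" "\<And>v. v \<in> Hs \<Longrightarrow> l2.nr v \<le> C * Hsp.nr v" using nr_L2_le by blast
  show "x = 0" if "x \<in> Hs" "ipH x x = 0" for x
  proof (rule l2.nr_eq_0D)
    show "x \<in> L2" using that Hs_L2 by blast
    show "l2.nr x = 0" using C(2)[OF that(1)] that l2.nr_nonneg[of x] by (simp add: Hsp.nr_def)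
  qed
  fix xs :: "nat \<Rightarrow> 'a L0" assume xs: "\<And>n. xs n \<in> Hs"
    and Cauchy: "\<And>\<epsilon>. \<epsilon> > 0 \<Longrightarrow> \<exists>N. \<forall>m\<ge>N. \<forall>n\<ge>N. Hsp.nr (xs m - xs n) < \<epsilon>"
  have "\<exists>\<phi>. \<forall>n. \<phi> n \<in> test_functions \<Omega> \<and> Hsp.nr (abs_L0 (\<phi> n) - xs n) < inverse (real (Suc n))"
    by (intro choice allI) (use Hs_approx[OF xs] in \<open>auto simp: Bex_def\<close>)
  then obtain \<phi> where \<phi>: "\<And>n. \<phi> n \<in> test_functions \<Omega>" "\<And>n. Hsp.nr (abs_L0 (\<phi> n) - xs n) < inverse (real (Suc n))"
    by blast
  have \<phi>_lim: "(\<lambda>n. Hsp.nr (abs_L0 (\<phi> n) - xs n)) \<longlonglongrightarrow> 0"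
    by (rule tendsto_sandwich[OF _ _ tendsto_const LIMSEQ_inverse_real_of_nat])
       (use \<phi>(2) in \<open>auto intro!: always_eventually less_imp_le\<close>)
  have Cauchy': "\<exists>N. \<forall>m\<ge>N. \<forall>n\<ge>N. Hsp.nr (abs_L0 (\<phi> m) - abs_L0 (\<phi> n)) < \<epsilon>" if e: "\<epsilon> > 0" for \<epsilon>
  proof -
    obtain N where N: "\<And>m n. m \<ge> N \<Longrightarrow> n \<ge> N \<Longrightarrow> Hsp.nr (xs m - xs n) < \<epsilon> / 3"
      using Cauchy[of "\<epsilon> / 3"] e by auto
    obtain M where M: "\<And>n. n \<ge> M \<Longrightarrow> Hsp.nr (abs_L0 (\<phi> n) - xs n) < \<epsilon> / 3"
      using order_tendstoD(2)[OF \<phi>_lim, of "\<epsilon> / 3"] e by (auto simp: eventually_sequentially)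
    have "Hsp.nr (abs_L0 (\<phi> m) - abs_L0 (\<phi> n)) < \<epsilon>" if "m \<ge> max M N" "n \<ge> max M N" for m n
      using Hsp.nr_diff_triangle[of "abs_L0 (\<phi> m)" "abs_L0 (\<phi> n)" "xs m"]
        Hsp.nr_diff_triangle[of "xs m" "abs_L0 (\<phi> n)" "xs n"] Hsp.nr_commute[of "xs n" "abs_L0 (\<phi> n)"]
        N[of m n] M[of m] M[of n] that by simp
    then show ?thesis by blast
  qed
  have "\<exists>v\<in>L2. l2.sconv (\<lambda>n. abs_L0 (\<phi> n)) v"
  proof (rule l2.H_complete[OF test_L2[OF \<phi>(1)]])
    fix \<epsilon> :: real assume e: "\<epsilon> > 0"
    obtain N where N: "\<And>m n. m \<ge> N \<Longrightarrow> n \<ge> N \<Longrightarrow> Hsp.nr (abs_L0 (\<phi> m) - abs_L0 (\<phi> n)) < \<epsilon> / C"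
      using Cauchy'[of "\<epsilon> / C"] e C(1) by auto
    have "l2.nr (abs_L0 (\<phi> m) - abs_L0 (\<phi> n)) < \<epsilon>" if "m \<ge> N" "n \<ge> N" for m n
      using N[OF that] C(2)[of "abs_L0 (\<phi> m) - abs_L0 (\<phi> n)"] C(1) test_Hs[OF \<phi>(1)]
      by (simp add: field_simps)
    then show "\<exists>N. \<forall>m\<ge>N. \<forall>n\<ge>N. l2.nr (abs_L0 (\<phi> m) - abs_L0 (\<phi> n)) < \<epsilon>" by blast
  qed
  then obtain v where v: "v \<in> L2" "l2.sconv (\<lambda>n. abs_L0 (\<phi> n)) v" by blast
  have "\<exists>g\<in>L2. l2.sconv (\<lambda>n. abs_L0 (partial_deriv i (\<phi> n))) g" if i: "i \<in> Basis" for i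
  proof (rule l2.H_complete[OF test_pd_L2[OF \<phi>(1) i]])
    fix \<epsilon> :: real assume e: "\<epsilon> > 0"
    obtain N where N: "\<And>m n. m \<ge> N \<Longrightarrow> n \<ge> N \<Longrightarrow> Hsp.nr (abs_L0 (\<phi> m) - abs_L0 (\<phi> n)) < \<epsilon>"
      using Cauchy'[OF e] by auto
    have "l2.nr (abs_L0 (partial_deriv i (\<phi> m)) - abs_L0 (partial_deriv i (\<phi> n))) < \<epsilon>" if "m \<ge> N" "n \<ge> N" for m n
      using N[OF that] wderiv_nr[of "abs_L0 (\<phi> m) - abs_L0 (\<phi> n)" i] i
      by (simp add: test_Hs[OF \<phi>(1)] wderiv_diff(2) test_H1s[OF \<phi>(1)])
    then show "\<exists>N. \<forall>m\<ge>N. \<forall>n\<ge>N. l2.nr (abs_L0 (partial_deriv i (\<phi> m)) - abs_L0 (partial_deriv i (\<phi> n))) < \<epsilon>" by blast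
  qed
  then obtain g where g: "\<And>i. i \<in> Basis \<Longrightarrow> g i \<in> L2" "\<And>i. i \<in> Basis \<Longrightarrow> l2.sconv (\<lambda>n. abs_L0 (partial_deriv i (\<phi> n))) (g i)"
    by metis
  note Dv = Hs_I[OF \<phi>(1) v g]
  have "(\<lambda>n. \<Sum>i\<in>Basis. ipL2 (abs_L0 (partial_deriv i (\<phi> n)) - wderiv i v) (abs_L0 (partial_deriv i (\<phi> n)) - wderiv i v)) \<longlonglongrightarrow> (\<Sum>i\<in>(Basis::'a set). 0)"
    by (intro tendsto_sum) (use g(2) Dv(2) in \<open>simp add: l2.sconv_def l2.nr_tendsto_0_iff\<close>)
  moreover have "(\<Sum>i\<in>Basis. ipL2 (abs_L0 (partial_deriv i (\<phi> n)) - wderiv i v) (abs_L0 (partial_deriv i (\<phi> n)) - wderiv i v))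
      = ipH (abs_L0 (\<phi> n) - v) (abs_L0 (\<phi> n) - v)" for n
    using Dv(1) \<phi>(1)
    by (simp add: ipH_eq grad_ip_def ipL2 test_Hs wderiv_diff test_H1s Hs_H1s test_pd_L2 wderiv_L2)
  ultimately have "(\<lambda>n. ipH (abs_L0 (\<phi> n) - v) (abs_L0 (\<phi> n) - v)) \<longlonglongrightarrow> 0" by simp
  then have lim: "(\<lambda>n. Hsp.nr (abs_L0 (\<phi> n) - v)) \<longlonglongrightarrow> 0" by (simp add: Hsp.nr_tendsto_0_iff)
  have "(\<lambda>n. Hsp.nr (xs n - v)) \<longlonglongrightarrow> 0"
  proof (rule tendsto_sandwich[OF _ _ tendsto_const tendsto_add_zero[OF \<phi>_lim lim]])
    have "Hsp.nr (xs n - v) \<le> Hsp.nr (abs_L0 (\<phi> n) - xs n) + Hsp.nr (abs_L0 (\<phi> n) - v)" for n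
      using Hsp.nr_diff_triangle[of "xs n" v "abs_L0 (\<phi> n)"] Hsp.nr_commute[of "xs n" "abs_L0 (\<phi> n)"] by simp
    then show "\<forall>\<^sub>F n in sequentially. Hsp.nr (xs n - v) \<le> Hsp.nr (abs_L0 (\<phi> n) - xs n) + Hsp.nr (abs_L0 (\<phi> n) - v)"
      by simp
  qed simp
  then show "\<exists>x\<in>Hs. Hsp.sconv xs x" using Dv(1) by (auto simp: Hsp.sconv_def)
qed

end

subsection \<open>Oscillation estimates\<close>

lemma partial_deriv_lincomb:
  assumes "f differentiable_on UNIV"
  shows "partial_deriv z f x = (\<Sum>i\<in>Basis. (z \<bullet> i) * partial_deriv i f x)"
proof -
  have lin: "linear (frechet_derivative f (at x))"
    using linear_frechet_derivative[of f "at x"] assms by (simp add: differentiable_on_def)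
  have "partial_deriv z f x = frechet_derivative f (at x) (\<Sum>i\<in>Basis. (z \<bullet> i) *\<^sub>R i)"
    by (simp add: partial_deriv_def euclidean_representation)
  also have "\<dots> = (\<Sum>i\<in>Basis. (z \<bullet> i) * partial_deriv i f x)"
    by (simp add: linear_sum[OF lin] linear_scale[OF lin] partial_deriv_def)
  finally show ?thesis .
qed

lemma norm_square_Basis: "(norm (z::'a::euclidean_space))\<^sup>2 = (\<Sum>i\<in>Basis. (z \<bullet> i)\<^sup>2)"
  unfolding power2_norm_eq_inner by (subst euclidean_inner) (simp add: power2_eq_square)

lemma partial_deriv_square_le:
  assumes "f differentiable_on UNIV"
  shows "(partial_deriv z f x)\<^sup>2 \<le> (norm z)\<^sup>2 * (\<Sum>i\<in>Basis. (partial_deriv i f x)\<^sup>2)"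
  unfolding norm_square_Basis by (subst partial_deriv_lincomb[OF assms]) (rule Cauchy_Schwarz_ineq_sum)

lemma test_partial_deriv_bounded:
  assumes "\<phi> \<in> test_functions \<Omega>" shows "\<exists>B>0. \<forall>x. \<bar>partial_deriv z \<phi> x\<bar> \<le> B"
proof -
  have "\<forall>i\<in>Basis. \<exists>B>0. \<forall>x. \<bar>partial_deriv i \<phi> x\<bar> \<le> B"
    using test_bounded[OF test_partial_deriv[OF assms]] by blast
  then obtain B where B: "\<And>i x. i \<in> Basis \<Longrightarrow> \<bar>partial_deriv i \<phi> x\<bar> \<le> B i"
    by metis
  have "\<bar>partial_deriv z \<phi> x\<bar> \<le> (\<Sum>i\<in>Basis. \<bar>z \<bullet> i\<bar> * B i)" for x
    by (subst partial_deriv_lincomb[OF test_differentiable[OF assms]], rule order_trans[OF sum_abs],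
        rule sum_mono) (simp add: abs_mult mult_left_mono B)
  then have "\<forall>x. \<bar>partial_deriv z \<phi> x\<bar> \<le> max 1 (\<Sum>i\<in>Basis. \<bar>z \<bullet> i\<bar> * B i)"
    by (simp add: le_max_iff_disj)
  then show ?thesis by (intro exI[of _ "max 1 (\<Sum>i\<in>Basis. \<bar>z \<bullet> i\<bar> * B i)"]) auto
qed

lemma test_translate_measurable:
  "\<phi> \<in> test_functions \<Omega> \<Longrightarrow> (\<lambda>x. \<phi> (x + c)) \<in> borel_measurable borel"
  by (rule borel_measurable_continuous_onI, rule continuous_on_compose2[OF test_continuous[of \<phi> \<Omega>], of UNIV "\<lambda>x. x + c"])
     (auto intro!: continuous_intros)

lemma translate_square_integrable:
  assumes \<phi>: "\<phi> \<in> test_functions \<Omega>"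
  shows "integrable lborel (\<lambda>x. (\<phi> (x + c) - \<phi> (x + e))\<^sup>2)"
proof -
  obtain B R where B: "\<And>x. \<bar>\<phi> x\<bar> \<le> B" and R: "\<And>x. R < norm x \<Longrightarrow> \<phi> x = 0"
    using test_bounded[OF \<phi>] test_support[OF \<phi>] by blast
  show ?thesis
  proof (rule integrable_bounded_support[where B = "(2 * B)\<^sup>2" and R = "R + max (norm c) (norm e)"])
    show "(\<lambda>x. (\<phi> (x + c) - \<phi> (x + e))\<^sup>2) \<in> borel_measurable borel"
      using test_translate_measurable[OF \<phi>, of c] test_translate_measurable[OF \<phi>, of e] by simp
    show "\<bar>(\<phi> (x + c) - \<phi> (x + e))\<^sup>2\<bar> \<le> (2 * B)\<^sup>2" for x
    proof -
      have "\<bar>\<phi> (x + c) - \<phi> (x + e)\<bar> \<le> \<bar>2 * B\<bar>"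
        using B[of "x + c"] B[of "x + e"] by linarith
      then show ?thesis using abs_le_square_iff[of "\<phi> (x + c) - \<phi> (x + e)" "2 * B"] by simp
    qed
    show "(\<phi> (x + c) - \<phi> (x + e))\<^sup>2 = 0" if "R + max (norm c) (norm e) < norm x" for x
    proof -
      have "norm x \<le> norm (x + c) + norm c" "norm x \<le> norm (x + e) + norm e"
        using norm_triangle_ineq4[of "x + c" c] norm_triangle_ineq4[of "x + e" e] by simp_all
      then have "R < norm (x + c)" "R < norm (x + e)" using that by auto
      then show ?thesis using R by simp
    qed
  qed
qed

text \<open>The segment from \<open>x\<close> to \<open>x + z\<close> is cut into \<open>n\<close> pieces, which contribute equally by
  translation invariance.\<close>

lemma translation_estimate:
  assumes \<phi>: "\<phi> \<in> test_functions \<Omega>"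
  shows "(LINT x|lborel. (\<phi> (x + z) - \<phi> x)\<^sup>2) \<le> (norm z)\<^sup>2 * (LINT x|lborel. (\<Sum>i\<in>Basis. (partial_deriv i \<phi> x)\<^sup>2))"
proof -
  define h where "h n = inverse (real (Suc n))" for n
  have h: "0 < h n" "h n \<le> 1" "real (Suc n) * h n = 1" for n by (auto simp: h_def field_simps)
  define q where "q n x = (\<phi> (x + h n *\<^sub>R z) - \<phi> x) / h n" for n x
  obtain B where B: "B > 0" "\<And>x. \<bar>partial_deriv z \<phi> x\<bar> \<le> B"
    using test_partial_deriv_bounded[OF \<phi>] by blast
  obtain R where R: "R > 0" "\<And>x. R < norm x \<Longrightarrow> \<phi> x = 0"
    using test_support[OF \<phi>] by blast
  \<comment> \<open>Squaring a sum of \<open>Suc n\<close> pieces costs a factor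
    \<open>Suc n\<close>, and there are \<open>Suc n\<close> equal integrals. The product is the
    square of \<open>1 / h n\<close>, which turns a piece into a difference quotient.\<close>
  have pieces: "(LINT x|lborel. (\<phi> (x + z) - \<phi> x)\<^sup>2) \<le> (LINT x|lborel. (q n x)\<^sup>2)" for n
  proof -
    define d where "d k x = \<phi> (x + (real (Suc k) * h n) *\<^sub>R z) - \<phi> (x + (real k * h n) *\<^sub>R z)" for k x
    have int: "integrable lborel (\<lambda>x. (d k x)\<^sup>2)" for k
      unfolding d_def by (rule translate_square_integrable[OF \<phi>])
    have tele: "(\<Sum>k<Suc n. d k x) = \<phi> (x + z) - \<phi> x" for x
      using sum_lessThan_telescope[of "\<lambda>k. \<phi> (x + (real k * h n) *\<^sub>R z)" "Suc n"] h(3)[of n]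
      unfolding d_def by (simp del: of_nat_Suc sum.lessThan_Suc)
    have dk: "(LINT x|lborel. (d k x)\<^sup>2) = (LINT x|lborel. (\<phi> (x + h n *\<^sub>R z) - \<phi> x)\<^sup>2)" for k
    proof -
      have "(LINT x|lborel. (\<phi> (x + h n *\<^sub>R z) - \<phi> x)\<^sup>2) =
          (LINT x|lborel. (\<phi> (x + (real k * h n) *\<^sub>R z + h n *\<^sub>R z) - \<phi> (x + (real k * h n) *\<^sub>R z))\<^sup>2)"
        by (rule lborel_integral_translate[symmetric, where f = "\<lambda>x. (\<phi> (x + h n *\<^sub>R z) - \<phi> x)\<^sup>2"])
          (use test_translate_measurable[OF \<phi>, of "h n *\<^sub>R z"] test_measurable[OF \<phi>] in simp)
      then show ?thesis by (simp add: d_def algebra_simps)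
    qed
    have "(LINT x|lborel. (\<phi> (x + z) - \<phi> x)\<^sup>2) \<le> (LINT x|lborel. (\<Sum>k<Suc n. (d k x)\<^sup>2) * real (Suc n))"
    proof (rule integral_mono)
      show "integrable lborel (\<lambda>x. (\<phi> (x + z) - \<phi> x)\<^sup>2)"
        using translate_square_integrable[OF \<phi>, of z 0] by simp
      show "integrable lborel (\<lambda>x. (\<Sum>k<Suc n. (d k x)\<^sup>2) * real (Suc n))"
        by (intro integrable_mult_left Bochner_Integration.integrable_sum int)
      show "(\<phi> (x + z) - \<phi> x)\<^sup>2 \<le> (\<Sum>k<Suc n. (d k x)\<^sup>2) * real (Suc n)" for x
        using sum_squared_le_sum_of_squares[of "\<lambda>k. d k x" "{..<Suc n}"] unfolding tele by simp
    qed
    also have "\<dots> = real (Suc n) * (\<Sum>k<Suc n. LINT x|lborel. (d k x)\<^sup>2)"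
      using int by (simp del: of_nat_Suc sum.lessThan_Suc)
    also have "\<dots> = (real (Suc n))\<^sup>2 * (LINT x|lborel. (\<phi> (x + h n *\<^sub>R z) - \<phi> x)\<^sup>2)"
      unfolding dk by (simp add: power2_eq_square del: of_nat_Suc)
    also have "\<dots> = (LINT x|lborel. (q n x)\<^sup>2)"
      by (simp add: q_def h_def power_mult_distrib divide_inverse power_inverse flip: integral_mult_right_zero del: of_nat_Suc)
        (simp add: mult.commute)
    finally show ?thesis .
  qed
  have "(\<lambda>n. LINT x|lborel. (q n x)\<^sup>2) \<longlonglongrightarrow> (LINT x|lborel. (partial_deriv z \<phi> x)\<^sup>2)"
  proof (rule integral_dominated_convergence[where w = "\<lambda>x. B\<^sup>2 * indicator (cball 0 (R + norm z)) x"])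
    have "partial_deriv z \<phi> = (\<lambda>x. \<Sum>i\<in>Basis. (z \<bullet> i) * partial_deriv i \<phi> x)"
      by (rule ext) (rule partial_deriv_lincomb[OF test_differentiable[OF \<phi>]])
    also have "\<dots> \<in> borel_measurable borel"
      by (intro borel_measurable_sum borel_measurable_times borel_measurable_const test_measurable[OF test_partial_deriv[OF \<phi>]])
    finally show "(\<lambda>x. (partial_deriv z \<phi> x)\<^sup>2) \<in> borel_measurable lborel" by simp
    show "(\<lambda>x. (q n x)\<^sup>2) \<in> borel_measurable lborel" for n
      unfolding q_def using test_translate_measurable[OF \<phi>, of "h n *\<^sub>R z"] test_measurable[OF \<phi>] by simp
    have "emeasure lborel (cball (0::'a) (R + norm z)) < \<infinity>" by (rule emeasure_lborel_cball_finite)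
    then show "integrable lborel (\<lambda>x::'a. B\<^sup>2 * indicator (cball 0 (R + norm z)) x)"
      by (intro integrable_mult_right integrable_real_indicator) auto
    show "AE x in lborel. (\<lambda>n. (q n x)\<^sup>2) \<longlonglongrightarrow> (partial_deriv z \<phi> x)\<^sup>2"
    proof (rule AE_I2)
      fix x
      have "((\<lambda>t. (\<phi> (x + t *\<^sub>R z) - \<phi> x) / t) \<longlongrightarrow> partial_deriv z \<phi> x) (at 0)"
        using DERIV_along[OF test_differentiable[OF \<phi>], of x z 0] by (simp add: has_field_derivative_iff)
      moreover have "filterlim h (at 0) sequentially"
        unfolding filterlim_at h_def using LIMSEQ_inverse_real_of_nat by simp
      ultimately have "(\<lambda>n. q n x) \<longlonglongrightarrow> partial_deriv z \<phi> x"
        unfolding q_def by (rule filterlim_compose)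
      then show "(\<lambda>n. (q n x)\<^sup>2) \<longlonglongrightarrow> (partial_deriv z \<phi> x)\<^sup>2" by (rule tendsto_power)
    qed
    show "AE x in lborel. norm ((q n x)\<^sup>2) \<le> B\<^sup>2 * indicator (cball 0 (R + norm z)) x" for n
    proof (rule AE_I2)
      fix x
      show "norm ((q n x)\<^sup>2) \<le> B\<^sup>2 * indicator (cball 0 (R + norm z)) x"
      proof (cases "norm x \<le> R + norm z")
        case True
        have "\<bar>q n x\<bar> \<le> \<bar>B\<bar>"
          using test_increment[OF test_differentiable[OF \<phi>] B(2), of x "h n"] h[of n] B(1)
          by (simp add: q_def field_simps)
        then have "(q n x)\<^sup>2 \<le> B\<^sup>2" by (simp only: abs_le_square_iff)
        then show ?thesis using True by simp
      next
        case False
        have "norm x \<le> norm (x + h n *\<^sub>R z) + norm (h n *\<^sub>R z)"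
          using norm_triangle_ineq4[of "x + h n *\<^sub>R z" "h n *\<^sub>R z"] by simp
        moreover have "norm (h n *\<^sub>R z) \<le> norm z"
          using h[of n] by (simp add: mult_left_le_one_le)
        ultimately have "R < norm (x + h n *\<^sub>R z)" using False by linarith
        moreover have "R < norm x" using False norm_ge_zero[of z] by linarith
        ultimately show ?thesis using R(2) False by (simp add: q_def)
      qed
    qed
  qed
  from LIMSEQ_le_const[OF this] pieces
  have "(LINT x|lborel. (\<phi> (x + z) - \<phi> x)\<^sup>2) \<le> (LINT x|lborel. (partial_deriv z \<phi> x)\<^sup>2)" by blast
  also have "\<dots> \<le> (LINT x|lborel. (norm z)\<^sup>2 * (\<Sum>i\<in>Basis. (partial_deriv i \<phi> x)\<^sup>2))"
  proof (rule integral_mono')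
    have "integrable lborel (\<lambda>x. (partial_deriv i \<phi> x)\<^sup>2)" if "i \<in> Basis" for i
      using test_integrable_lborel[OF test_mult[OF test_partial_deriv[OF \<phi> that] test_Ck[OF test_partial_deriv[OF \<phi> that]]]]
      by (simp add: power2_eq_square)
    then show "integrable lborel (\<lambda>x. (norm z)\<^sup>2 * (\<Sum>i\<in>Basis. (partial_deriv i \<phi> x)\<^sup>2))" by simp
    show "(partial_deriv z \<phi> x)\<^sup>2 \<le> (norm z)\<^sup>2 * (\<Sum>i\<in>Basis. (partial_deriv i \<phi> x)\<^sup>2)" for x
      by (rule partial_deriv_square_le[OF test_differentiable[OF \<phi>]])
  qed (simp add: sum_nonneg)
  finally show ?thesis by simp
qed

definition cube :: "real \<Rightarrow> 'a::euclidean_space set" where "cube r = cbox 0 (r *\<^sub>R One)"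

lemma One_inner: "b \<in> Basis \<Longrightarrow> (One :: 'a::euclidean_space) \<bullet> b = 1"
  by (simp add: inner_sum_left inner_Basis if_distrib cong: if_cong)

lemma emeasure_cube: "0 \<le> r \<Longrightarrow> emeasure lborel (cube r :: 'a::euclidean_space set) = ennreal (r ^ DIM('a))"
  by (simp add: cube_def emeasure_lborel_cbox_eq One_inner del: inner_sum_left)

lemma cube_sets [measurable]: "cube r \<in> sets borel"
  by (simp add: cube_def)

lemma cube_norm: assumes "z \<in> cube r" shows "(norm (z::'a::euclidean_space))\<^sup>2 \<le> real DIM('a) * r\<^sup>2"
proof -
  have "(z \<bullet> i)\<^sup>2 \<le> r\<^sup>2" if "i \<in> Basis" for i
    using assms that by (intro power_mono) (auto simp: cube_def mem_box)
  then have "(\<Sum>i\<in>Basis. (z \<bullet> i)\<^sup>2) \<le> (\<Sum>i\<in>(Basis::'a set). r\<^sup>2)" by (rule sum_mono)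
  then show ?thesis by (simp add: norm_square_Basis)
qed

text \<open>After exchanging the integrals, each shift z contributes at most its squared length
  times the energy, and \<open>cube_norm\<close> bounds the squared length uniformly over the
  cube.\<close>

lemma oscillation_estimate:
  fixes \<phi> :: "'a::euclidean_space \<Rightarrow> real"
  assumes \<phi>: "\<phi> \<in> test_functions \<Omega>" and r: "0 \<le> r"
    and E: "(LINT x|lborel. (\<Sum>i\<in>Basis. (partial_deriv i \<phi> x)\<^sup>2)) \<le> E"
  shows "(\<integral>\<^sup>+x. (\<integral>\<^sup>+z. ennreal ((\<phi> (x + z) - \<phi> x)\<^sup>2) * indicator (cube r) z \<partial>lborel) \<partial>lborel)
    \<le> ennreal (r ^ DIM('a) * (real DIM('a) * r\<^sup>2 * E))"
proof -
  have [measurable]: "\<phi> \<in> borel_measurable borel" by (rule test_measurable[OF \<phi>])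
  have E0: "0 \<le> (LINT x|lborel. (\<Sum>i\<in>Basis. (partial_deriv i \<phi> x)\<^sup>2))"
    by (rule integral_nonneg_AE) (simp add: sum_nonneg)
  have "(\<integral>\<^sup>+x. (\<integral>\<^sup>+z. ennreal ((\<phi> (x + z) - \<phi> x)\<^sup>2) * indicator (cube r) z \<partial>lborel) \<partial>lborel)
      = (\<integral>\<^sup>+z. (\<integral>\<^sup>+x. ennreal ((\<phi> (x + z) - \<phi> x)\<^sup>2) * indicator (cube r) z \<partial>lborel) \<partial>lborel)"
    by (rule lborel_pair.Fubini') measurable
  also have "\<dots> \<le> (\<integral>\<^sup>+z. ennreal (real DIM('a) * r\<^sup>2 * E) * indicator (cube r :: 'a set) z \<partial>lborel)"
  proof (rule nn_integral_mono)
    fix z :: 'a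
    show "(\<integral>\<^sup>+x. ennreal ((\<phi> (x + z) - \<phi> x)\<^sup>2) * indicator (cube r) z \<partial>lborel)
      \<le> ennreal (real DIM('a) * r\<^sup>2 * E) * indicator (cube r) z"
    proof (cases "z \<in> cube r")
      case True
      have "(\<integral>\<^sup>+x. ennreal ((\<phi> (x + z) - \<phi> x)\<^sup>2) \<partial>lborel) = ennreal (LINT x|lborel. (\<phi> (x + z) - \<phi> x)\<^sup>2)"
        using translate_square_integrable[OF \<phi>, of z 0] by (intro nn_integral_eq_integral) simp_all
      also have "\<dots> \<le> ennreal (real DIM('a) * r\<^sup>2 * E)"
        using cube_norm[OF True] E E0
        by (intro ennreal_leI order_trans[OF translation_estimate[OF \<phi>]] mult_mono) simp_all
      finally show ?thesis using True by simp
    qed simp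
  qed
  also have "\<dots> = ennreal (real DIM('a) * r\<^sup>2 * E) * ennreal (r ^ DIM('a))"
    using r by (simp add: nn_integral_cmult emeasure_cube)
  also have "\<dots> = ennreal (r ^ DIM('a) * (real DIM('a) * r\<^sup>2 * E))"
    using r E E0 by (simp add: ennreal_mult' mult.commute)
  finally show ?thesis .
qed

text \<open>A smooth approximation of the positive part. Subtracting \<open>\<epsilon>\<close> makes
  it vanish at 0, so that composition with it preserves compact supports.\<close>

definition smooth_pos :: "real \<Rightarrow> real \<Rightarrow> real"
  where "smooth_pos \<epsilon> s = (sqrt (s\<^sup>2 + \<epsilon>\<^sup>2) - \<epsilon> + s) / 2"

definition smooth_pos' :: "real \<Rightarrow> real \<Rightarrow> real"
  where "smooth_pos' \<epsilon> s = (s / sqrt (s\<^sup>2 + \<epsilon>\<^sup>2) + 1) / 2"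

lemma DERIV_smooth_pos:
  assumes "\<epsilon> > 0" shows "(smooth_pos \<epsilon> has_real_derivative smooth_pos' \<epsilon> s) (at s)"
proof -
  have "s\<^sup>2 + \<epsilon>\<^sup>2 > 0" using assms by (simp add: add_nonneg_pos)
  then have "((\<lambda>s. (sqrt (s\<^sup>2 + \<epsilon>\<^sup>2) - \<epsilon> + s) / 2) has_real_derivative
      (inverse (sqrt (s\<^sup>2 + \<epsilon>\<^sup>2)) / 2 * (2 * s) + 1) / 2) (at s)"
    by (auto intro!: derivative_eq_intros)
  moreover have "smooth_pos \<epsilon> = (\<lambda>s. (sqrt (s\<^sup>2 + \<epsilon>\<^sup>2) - \<epsilon> + s) / 2)"
    by (rule ext) (simp add: smooth_pos_def)
  moreover have "(s / R + 1) / 2 = (inverse R / 2 * (2 * s) + 1) / 2" for R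
    by (cases "R = 0") (simp_all add: field_simps)
  then have "smooth_pos' \<epsilon> s = (inverse (sqrt (s\<^sup>2 + \<epsilon>\<^sup>2)) / 2 * (2 * s) + 1) / 2"
    unfolding smooth_pos'_def by blast
  ultimately show ?thesis by (simp only:)
qed

lemma smooth_pos'_bounds: assumes "\<epsilon> > 0" shows "0 \<le> smooth_pos' \<epsilon> s" "smooth_pos' \<epsilon> s \<le> 1"
proof -
  have "sqrt (s\<^sup>2) \<le> sqrt (s\<^sup>2 + \<epsilon>\<^sup>2)" by (rule real_sqrt_le_mono) simp
  then have "\<bar>s\<bar> \<le> sqrt (s\<^sup>2 + \<epsilon>\<^sup>2)" by simp
  moreover have "0 < sqrt (s\<^sup>2 + \<epsilon>\<^sup>2)" using assms by (simp add: add_nonneg_pos)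
  ultimately have "\<bar>s / sqrt (s\<^sup>2 + \<epsilon>\<^sup>2)\<bar> \<le> 1" by (simp add: divide_le_eq)
  from abs_le_D1[OF this] abs_le_D2[OF this]
  show "0 \<le> smooth_pos' \<epsilon> s" "smooth_pos' \<epsilon> s \<le> 1"
    unfolding smooth_pos'_def by simp_all
qed

lemma smooth_pos_approx: assumes "\<epsilon> > 0" shows "\<bar>smooth_pos \<epsilon> s - max s 0\<bar> \<le> \<epsilon>"
proof -
  have "sqrt (s\<^sup>2) \<le> sqrt (s\<^sup>2 + \<epsilon>\<^sup>2)" by (rule real_sqrt_le_mono) simp
  moreover have "sqrt (s\<^sup>2 + \<epsilon>\<^sup>2) \<le> sqrt (s\<^sup>2) + sqrt (\<epsilon>\<^sup>2)" by (rule sqrt_add_le_add_sqrt) simp_all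
  moreover define Q where "Q = sqrt (s\<^sup>2 + \<epsilon>\<^sup>2)"
  ultimately have "\<bar>s\<bar> \<le> Q" "Q \<le> \<bar>s\<bar> + \<epsilon>" using assms by simp_all
  then show ?thesis using assms
    unfolding smooth_pos_def Q_def[symmetric] by (auto simp: max_def abs_le_iff abs_if field_simps split: if_splits)
qed

lemma smooth_pos_0 [simp]: "\<epsilon> > 0 \<Longrightarrow> smooth_pos \<epsilon> 0 = 0"
  by (simp add: smooth_pos_def)

lemma test_smooth_pos:
  assumes \<phi>: "\<phi> \<in> test_functions \<Omega>" and e: "\<epsilon> > 0"
  shows "(\<lambda>x. smooth_pos \<epsilon> (\<phi> x)) \<in> test_functions \<Omega>"
    and "partial_deriv i (\<lambda>x. smooth_pos \<epsilon> (\<phi> x)) = (\<lambda>x. smooth_pos' \<epsilon> (\<phi> x) * partial_deriv i \<phi> x)"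
proof -
  show "(\<lambda>x. smooth_pos \<epsilon> (\<phi> x)) \<in> test_functions \<Omega>"
  proof (rule test_I[OF \<phi>])
    have pos: "\<phi> x * \<phi> x + \<epsilon> * \<epsilon> > 0" for x using e by (simp add: add_nonneg_pos)
    have "Ck k (\<lambda>x. (1/2) * ((sqrt (\<phi> x * \<phi> x + \<epsilon> * \<epsilon>) - \<epsilon>) + \<phi> x))" for k
      by (intro Ck_cmult Ck_add Ck_diff Ck_sqrt Ck_mult Ck_const test_Ck[OF \<phi>] pos)
    then show "Ck k (\<lambda>x. smooth_pos \<epsilon> (\<phi> x))" for k
      by (simp add: smooth_pos_def power2_eq_square)
    show "{x. smooth_pos \<epsilon> (\<phi> x) \<noteq> 0} \<subseteq> closure {x. \<phi> x \<noteq> 0}"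
      using closure_subset[of "{x. \<phi> x \<noteq> 0}"] e by auto
  qed
  show "partial_deriv i (\<lambda>x. smooth_pos \<epsilon> (\<phi> x)) = (\<lambda>x. smooth_pos' \<epsilon> (\<phi> x) * partial_deriv i \<phi> x)"
    by (rule partial_deriv_comp(1)[OF test_differentiable[OF \<phi>] DERIV_smooth_pos[OF e]])
qed

lemma oscillation_integral:
  fixes \<phi> :: "'a::euclidean_space \<Rightarrow> real"
  assumes \<phi>: "\<phi> \<in> test_functions \<Omega>" and r: "0 \<le> r"
    and E: "(LINT x|lborel. (\<Sum>i\<in>Basis. (partial_deriv i \<phi> x)\<^sup>2)) \<le> E"
  defines "b \<equiv> \<lambda>x. LINT z|lborel. indicator (cube r) z * (\<phi> (x + z) - \<phi> x)\<^sup>2"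
  shows "integrable lborel b" and "(LINT x|lborel. b x) \<le> r ^ DIM('a) * (real DIM('a) * r\<^sup>2 * E)"
    and "\<And>x. integrable lborel (\<lambda>z. indicator (cube r) z * (\<phi> (x + z) - \<phi> x)\<^sup>2)" and "\<And>x. 0 \<le> b x"
proof -
  have [measurable]: "\<phi> \<in> borel_measurable borel" by (rule test_measurable[OF \<phi>])
  obtain B where B: "\<And>x. \<bar>\<phi> x\<bar> \<le> B" using test_bounded[OF \<phi>] by blast
  show int: "integrable lborel (\<lambda>z. indicator (cube r) z * (\<phi> (x + z) - \<phi> x)\<^sup>2)" for x
  proof (rule integrableI_bounded_set[of "cube r"])
    show "emeasure lborel (cube r :: 'a set) < \<infinity>" using r by (simp add: emeasure_cube)
    show "AE z in lborel. z \<in> cube r \<longrightarrow> norm (indicator (cube r) z * (\<phi> (x + z) - \<phi> x)\<^sup>2) \<le> (2 * B)\<^sup>2"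
    proof (intro AE_I2 impI)
      fix z assume "z \<in> (cube r :: 'a set)"
      have "\<bar>\<phi> (x + z) - \<phi> x\<bar> \<le> \<bar>2 * B\<bar>"
        using B[of "x + z"] B[of x] by linarith
      then show "norm (indicator (cube r) z * (\<phi> (x + z) - \<phi> x)\<^sup>2) \<le> (2 * B)\<^sup>2"
        using abs_le_square_iff[of "\<phi> (x + z) - \<phi> x" "2 * B"] \<open>z \<in> cube r\<close> by simp
    qed
  qed (auto simp: indicator_def)
  show nonneg: "0 \<le> b x" for x
    unfolding b_def by (rule integral_nonneg_AE) simp
  have "ennreal (b x) = (\<integral>\<^sup>+z. ennreal ((\<phi> (x + z) - \<phi> x)\<^sup>2) * indicator (cube r) z \<partial>lborel)" for x
  proof -
    have "ennreal (b x) = (\<integral>\<^sup>+z. ennreal (indicator (cube r) z * (\<phi> (x + z) - \<phi> x)\<^sup>2) \<partial>lborel)"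
      unfolding b_def using int[of x] by (intro nn_integral_eq_integral[symmetric]) simp_all
    also have "\<dots> = (\<integral>\<^sup>+z. ennreal ((\<phi> (x + z) - \<phi> x)\<^sup>2) * indicator (cube r) z \<partial>lborel)"
      by (intro nn_integral_cong) (simp add: indicator_def)
    finally show ?thesis .
  qed
  then have le: "(\<integral>\<^sup>+x. ennreal (b x) \<partial>lborel) \<le> ennreal (r ^ DIM('a) * (real DIM('a) * r\<^sup>2 * E))"
    using oscillation_estimate[OF \<phi> r E] by simp
  have bm: "b \<in> borel_measurable lborel" unfolding b_def by measurable
  then show i: "integrable lborel b"
    using nonneg le by (intro integrableI_nonneg) (auto intro: le_less_trans)
  have "0 \<le> (LINT x|lborel. (\<Sum>i\<in>Basis. (partial_deriv i \<phi> x)\<^sup>2))"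
    by (rule integral_nonneg_AE) (simp add: sum_nonneg)
  then have "0 \<le> r ^ DIM('a) * (real DIM('a) * r\<^sup>2 * E)" using E r by simp
  then show "(LINT x|lborel. b x) \<le> r ^ DIM('a) * (real DIM('a) * r\<^sup>2 * E)"
    using le nn_integral_eq_integral[OF i] nonneg by simp
qed

section \<open>Truncation and compactness in the Sobolev space\<close>

context domain
begin

lemma ipH_test:
  assumes "\<phi> \<in> test_functions \<Omega>" "\<theta> \<in> test_functions \<Omega>"
  shows "ipH (abs_L0 \<phi>) (abs_L0 \<theta>) = (\<Sum>i\<in>Basis. LINT x|lebesgue. partial_deriv i \<phi> x * partial_deriv i \<theta> x)"
  by (simp add: ipH_eq test_Hs assms grad_ip_def test_H1s ip2_test_test test_partial_deriv)

lemma test_energy: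
  assumes "\<phi> \<in> test_functions \<Omega>"
  shows "(LINT x|lborel. (\<Sum>i\<in>Basis. (partial_deriv i \<phi> x)\<^sup>2)) = (Hsp.nr (abs_L0 \<phi>))\<^sup>2"
proof -
  have sq: "integrable lborel (\<lambda>x. (partial_deriv i \<phi> x)\<^sup>2)"
    "(LINT x|lborel. (partial_deriv i \<phi> x)\<^sup>2) = (LINT x|lebesgue. partial_deriv i \<phi> x * partial_deriv i \<phi> x)"
    if "i \<in> Basis" for i
  proof -
    note t = test_partial_deriv[OF assms that]
    show "integrable lborel (\<lambda>x. (partial_deriv i \<phi> x)\<^sup>2)"
      using test_integrable_lborel[OF test_mult[OF t test_Ck[OF t]]] by (simp add: power2_eq_square)
    show "(LINT x|lborel. (partial_deriv i \<phi> x)\<^sup>2) = (LINT x|lebesgue. partial_deriv i \<phi> x * partial_deriv i \<phi> x)"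
      using test_measurable[OF t] by (subst integral_completion) (simp_all add: power2_eq_square)
  qed
  then show ?thesis by (simp add: Hsp.nr_square ipH_test assms)
qed

text \<open>Pairing with a square integrable function becomes an inner product with a vector of
  \<open>Hs\<close>. This transfers weak convergence to \<open>L2\<close> and yields
  \<open>mass\<close>, the vector used as \<open>\<eta>\<close>.\<close>

lemma L2_Riesz:
  assumes f: "f \<in> L2" shows "\<exists>y\<in>Hs. \<forall>v\<in>Hs. ip2 v f = ipH y v"
proof -
  obtain C where C: "C > 0" "\<And>v. v \<in> Hs \<Longrightarrow> l2.nr v \<le> C * Hsp.nr v" using nr_L2_le by blast
  show ?thesis
  proof (rule Hsp.Riesz)
    show "ip2 (v + w) f = ip2 v f + ip2 w f" if "v \<in> Hs" "w \<in> Hs" for v w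
      using that f by (simp add: ip2_add Hs_L2)
    show "ip2 (c *\<^sub>R v) f = c * ip2 v f" for c v by (rule ip2_scale)
    fix v assume v: "v \<in> Hs"
    have "\<bar>ip2 v f\<bar> \<le> l2.nr v * l2.nr f"
      using l2.Cauchy_Schwarz[of v f] v f by (simp add: ipL2 Hs_L2)
    also have "\<dots> \<le> (C * Hsp.nr v) * l2.nr f" by (intro mult_right_mono C v) simp
    finally show "\<bar>ip2 v f\<bar> \<le> (C * l2.nr f) * Hsp.nr v" by (simp add: mult_ac)
  qed
qed

lemma wconv_L2:
  assumes x: "Hsp.wconv xs x" and f: "f \<in> L2" shows "(\<lambda>n. ip2 (xs n) f) \<longlonglongrightarrow> ip2 x f"
proof -
  obtain y where y: "y \<in> Hs" "\<And>v. v \<in> Hs \<Longrightarrow> ip2 v f = ipH y v" using L2_Riesz[OF f] by blast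
  show ?thesis
    using Hsp.wconvD'[OF x y(1)] y(2)[OF Hsp.wconv_mem[OF x]] y(2)[OF Hsp.wconv_lim[OF x]] by simp
qed

lemma Hs_test_seq:
  assumes "\<And>n. xs n \<in> Hs"
  shows "\<exists>\<phi>. (\<forall>n. \<phi> n \<in> test_functions \<Omega>) \<and> (\<lambda>n. Hsp.nr (abs_L0 (\<phi> n) - xs n)) \<longlonglongrightarrow> 0"
proof -
  have "\<exists>\<phi>. \<forall>n. \<phi> n \<in> test_functions \<Omega> \<and> Hsp.nr (abs_L0 (\<phi> n) - xs n) < inverse (real (Suc n))"
    by (intro choice allI) (use Hs_approx[OF assms] in \<open>auto simp: Bex_def\<close>)
  then obtain \<phi> where \<phi>: "\<And>n. \<phi> n \<in> test_functions \<Omega>" "\<And>n. Hsp.nr (abs_L0 (\<phi> n) - xs n) < inverse (real (Suc n))"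
    by blast
  have "(\<lambda>n. Hsp.nr (abs_L0 (\<phi> n) - xs n)) \<longlonglongrightarrow> 0"
    by (rule tendsto_sandwich[OF _ _ tendsto_const LIMSEQ_inverse_real_of_nat])
       (use \<phi>(2) in \<open>auto intro!: always_eventually less_imp_le\<close>)
  with \<phi>(1) show ?thesis by blast
qed

lemma Hsp_sconv_l2:
  assumes "Hsp.sconv xs x" "\<And>n. xs n \<in> Hs" "x \<in> Hs" shows "l2.sconv xs x"
proof -
  obtain C where C: "C > 0" "\<And>v. v \<in> Hs \<Longrightarrow> l2.nr v \<le> C * Hsp.nr v" using nr_L2_le by blast
  show ?thesis
    unfolding l2.sconv_def
  proof (rule tendsto_sandwich[OF _ _ tendsto_const])
    show "(\<lambda>n. C * Hsp.nr (xs n - x)) \<longlonglongrightarrow> 0"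
      using assms(1) unfolding Hsp.sconv_def by (rule tendsto_mult_right_zero)
  qed (use C assms in auto)
qed

lemma Hs_L2\<Omega>: "v \<in> Hs \<Longrightarrow> v \<in> L2\<Omega>"
  by (simp add: Hs_H1s H1s_L2\<Omega>)

lemma integrable_\<Omega>: "integrable lebesgue (indicator \<Omega> :: 'a \<Rightarrow> real)"
  using \<Omega>_lmeasurable by (auto simp: fmeasurable_def intro!: integrable_real_indicator)

lemma pprt_L2: assumes "v \<in> L2" shows "pprt v \<in> L2"
  unfolding L2_def mem_Collect_eq
proof (rule Bochner_Integration.integrable_bound)
  show "integrable lebesgue (\<lambda>x. (rep_L0 v x)\<^sup>2)" using assms by (simp add: L2_def)
  show "AE x in lebesgue. norm ((rep_L0 (pprt v) x)\<^sup>2) \<le> norm ((rep_L0 v x)\<^sup>2)"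
    using rep_pprt[of v] by eventually_elim (simp add: max_def)
qed simp

text \<open>Smooth truncations of approximating test functions satisfy the energy inequality because
  \<open>smooth_pos'\<close> takes values between 0 and 1 and thus dominates its square. This bounds
  them in norm; a weak limit is identified with \<open>pprt v\<close> by convergence in
  \<open>L2\<close>, and the inequality survives by lower semicontinuity.\<close>

lemma pprt_Hs:
  assumes v: "v \<in> Hs" shows "pprt v \<in> Hs \<and> ipH (pprt v) (pprt v) \<le> ipH v (pprt v)"
proof -
  obtain \<phi> where \<phi>: "\<And>n. \<phi> n \<in> test_functions \<Omega>" and lim: "Hsp.sconv (\<lambda>n. abs_L0 (\<phi> n)) v"
    using Hs_test_seq[of "\<lambda>_. v"] v by (auto simp: Hsp.sconv_def)
  define h where "h n = inverse (real (Suc n))" for n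
  have h: "0 < h n" for n by (simp add: h_def)
  define \<psi> where "\<psi> n x = smooth_pos (h n) (\<phi> n x)" for n x
  have \<psi>: "\<psi> n \<in> test_functions \<Omega>" for n unfolding \<psi>_def by (rule test_smooth_pos(1)[OF \<phi> h])
  have ip_le: "ipH (abs_L0 (\<psi> n)) (abs_L0 (\<psi> n)) \<le> ipH (abs_L0 (\<phi> n)) (abs_L0 (\<psi> n))" for n
    unfolding ipH_test[OF \<psi> \<psi>] ipH_test[OF \<phi> \<psi>]
  proof (intro sum_mono integral_mono)
    fix i :: 'a assume i: "i \<in> Basis"
    show "integrable lebesgue (\<lambda>x. partial_deriv i (\<psi> n) x * partial_deriv i (\<psi> n) x)"
      "integrable lebesgue (\<lambda>x. partial_deriv i (\<phi> n) x * partial_deriv i (\<psi> n) x)"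
      by (rule test_product_integrable[OF test_partial_deriv test_partial_deriv]; rule \<phi> \<psi> i)+
    fix x
    define s where "s = smooth_pos' (h n) (\<phi> n x)"
    have s: "0 \<le> s" "s \<le> 1" unfolding s_def by (rule smooth_pos'_bounds[OF h])+
    have "partial_deriv i (\<psi> n) x = s * partial_deriv i (\<phi> n) x"
      using test_smooth_pos(2)[OF \<phi> h, of i n n] by (simp add: \<psi>_def[abs_def] s_def)
    moreover have "s * (s * (partial_deriv i (\<phi> n) x)\<^sup>2) \<le> 1 * (s * (partial_deriv i (\<phi> n) x)\<^sup>2)"
      using s by (intro mult_right_mono) auto
    ultimately show "partial_deriv i (\<psi> n) x * partial_deriv i (\<psi> n) x \<le> partial_deriv i (\<phi> n) x * partial_deriv i (\<psi> n) x"
      by (simp add: power2_eq_square mult_ac)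
  qed
  obtain C where C: "\<And>n. Hsp.nr (abs_L0 (\<phi> n)) \<le> C" using Hsp.sconv_bounded[OF lim] by blast
  have "Hsp.nr (abs_L0 (\<psi> n)) \<le> C" for n
    using Hsp.nr_le_if_ip_le[OF ip_le] C order_trans by blast
  from Hsp.weak_compactness[of "\<lambda>n. abs_L0 (\<psi> n)", OF test_Hs[OF \<psi>] this] obtain r w
    where r: "strict_mono r" and w: "Hsp.wconv (\<lambda>n. abs_L0 (\<psi> (r n))) w" by blast
  have vL2: "v \<in> L2" "pprt v \<in> L2" using v Hs_L2 pprt_L2 by blast+
  have v0: "AE x in lebesgue. x \<notin> \<Omega> \<longrightarrow> rep_L0 v x = 0" by (rule L2\<Omega>_vanishing[OF Hs_L2\<Omega>[OF v]])
  have le: "ip2 (abs_L0 (\<psi> n) - pprt v) (abs_L0 (\<psi> n) - pprt v) \<le>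
     2 * ip2 (abs_L0 (\<phi> n) - v) (abs_L0 (\<phi> n) - v) + 2 * (h n)\<^sup>2 * measure lebesgue \<Omega>" for n
  proof -
    have "ip2 (abs_L0 (\<psi> n) - pprt v) (abs_L0 (\<psi> n) - pprt v) \<le>
       (LINT x|lebesgue. 2 * (rep_L0 (abs_L0 (\<phi> n)) x - rep_L0 v x)\<^sup>2 + 2 * (h n)\<^sup>2 * indicator \<Omega> x)"
      unfolding ip2_diff_self
    proof (rule integral_mono_AE)
      show "integrable lebesgue (\<lambda>x. (rep_L0 (abs_L0 (\<psi> n)) x - rep_L0 (pprt v) x)\<^sup>2)"
        by (rule L2_diff_integrable[OF test_L2[OF \<psi>] vL2(2)])
      show "integrable lebesgue (\<lambda>x. 2 * (rep_L0 (abs_L0 (\<phi> n)) x - rep_L0 v x)\<^sup>2 + 2 * (h n)\<^sup>2 * indicator \<Omega> x)"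
        using L2_diff_integrable[OF test_L2[OF \<phi>[of n]] vL2(1)] integrable_\<Omega> by simp
      show "AE x in lebesgue. (rep_L0 (abs_L0 (\<psi> n)) x - rep_L0 (pprt v) x)\<^sup>2 \<le>
          2 * (rep_L0 (abs_L0 (\<phi> n)) x - rep_L0 v x)\<^sup>2 + 2 * (h n)\<^sup>2 * indicator \<Omega> x"
        using test_rep[OF \<psi>[of n]] test_rep[OF \<phi>[of n]] rep_pprt[of v] v0
      proof eventually_elim
        case (elim x)
        show ?case
        proof (cases "x \<in> \<Omega>")
          case True
          define a b where "a = \<phi> n x" and "b = rep_L0 v x"
          have "\<bar>smooth_pos (h n) a - max b 0\<bar> \<le> \<bar>a - b\<bar> + h n"
            using smooth_pos_approx[OF h[of n], of a] by (auto simp: max_def abs_if split: if_splits)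
          then have "(smooth_pos (h n) a - max b 0)\<^sup>2 \<le> (\<bar>a - b\<bar> + h n)\<^sup>2"
            using h[of n] by (subst abs_le_square_iff[symmetric]) simp
          also have "\<dots> \<le> 2 * (a - b)\<^sup>2 + 2 * (h n)\<^sup>2"
            using sum_squares_bound[of "\<bar>a - b\<bar>" "h n"] by (simp add: power2_sum)
          finally show ?thesis using elim True by (simp add: a_def b_def \<psi>_def)
        next
          case False
          then show ?thesis using elim test_zero_outside[OF \<phi> False] test_zero_outside[OF \<psi> False] by simp
        qed
      qed
    qed
    also have "\<dots> = 2 * ip2 (abs_L0 (\<phi> n) - v) (abs_L0 (\<phi> n) - v) + 2 * (h n)\<^sup>2 * measure lebesgue \<Omega>"
      using L2_diff_integrable[OF test_L2[OF \<phi>[of n]] vL2(1)] integrable_\<Omega> by (simp add: ip2_diff_self)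
    finally show ?thesis .
  qed
  have "(\<lambda>n. ip2 (abs_L0 (\<psi> n) - pprt v) (abs_L0 (\<psi> n) - pprt v)) \<longlonglongrightarrow> 0"
  proof (rule tendsto_sandwich[OF _ _ tendsto_const])
    have "(\<lambda>n. ip2 (abs_L0 (\<phi> n) - v) (abs_L0 (\<phi> n) - v)) \<longlonglongrightarrow> 0"
      using Hsp_sconv_l2[OF lim test_Hs[OF \<phi>] v] vL2
      by (simp add: l2.sconv_def l2.nr_tendsto_0_iff ipL2 test_L2[OF \<phi>])
    moreover have "h \<longlonglongrightarrow> 0" unfolding h_def[abs_def] by (rule LIMSEQ_inverse_real_of_nat)
    ultimately have "(\<lambda>n. 2 * ip2 (abs_L0 (\<phi> n) - v) (abs_L0 (\<phi> n) - v) + 2 * (h n)\<^sup>2 * measure lebesgue \<Omega>)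
        \<longlonglongrightarrow> 2 * 0 + 2 * 0\<^sup>2 * measure lebesgue \<Omega>"
      by (intro tendsto_intros)
    then show "(\<lambda>n. 2 * ip2 (abs_L0 (\<phi> n) - v) (abs_L0 (\<phi> n) - v) + 2 * (h n)\<^sup>2 * measure lebesgue \<Omega>) \<longlonglongrightarrow> 0"
      by simp
  qed (simp_all add: le ip2_nonneg)
  then have \<psi>_lim: "l2.sconv (\<lambda>n. abs_L0 (\<psi> n)) (pprt v)"
    using vL2 by (simp add: l2.sconv_def l2.nr_tendsto_0_iff ipL2 test_L2[OF \<psi>])
  have wH: "w \<in> Hs" and wL2: "w \<in> L2" using Hsp.wconv_lim[OF w] Hs_L2 by blast+
  have "ip2 w f = ip2 (pprt v) f" if f: "f \<in> L2" for f
    by (rule LIMSEQ_unique[OF wconv_L2[OF w f]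
          l2_sconv_ip2[OF l2.sconv_subseq[OF \<psi>_lim r] test_L2[OF \<psi>] vL2(2) f]])
  from this[of "w - pprt v"] have "ip2 (w - pprt v) (w - pprt v) = 0"
    using l2.ip_diff_left[of w "pprt v" "w - pprt v"] wL2 vL2 by (simp add: ipL2)
  then have eq: "w = pprt v" using L2_definite[of "w - pprt v"] wL2 vL2 by simp
  have "(\<lambda>n. ipH (abs_L0 (\<phi> (r n))) (abs_L0 (\<psi> (r n)))) \<longlonglongrightarrow> ipH v w"
    by (rule Hsp.sconv_wconv_ip[OF Hsp.sconv_subseq[OF lim r] v w])
  from Hsp.wconv_nr_le[OF w this ip_le] show ?thesis using wH eq by simp
qed

definition one\<Omega> :: "'a L0" where "one\<Omega> = abs_L0 (indicator \<Omega>)"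

lemma rep_one\<Omega>: "AE x in lebesgue. rep_L0 one\<Omega> x = indicator \<Omega> x"
  unfolding one\<Omega>_def by (rule rep_abs_L0) simp

lemma one\<Omega>_L2: "one\<Omega> \<in> L2"
  unfolding one\<Omega>_def by (rule L2_I) (use integrable_\<Omega> in \<open>simp_all add: power2_eq_square flip: indicator_inter_arith\<close>)

lemma ip2_one\<Omega>: assumes "f \<in> L2\<Omega>" shows "ip2 f one\<Omega> = (LINT x|lebesgue. rep_L0 f x)"
  unfolding ip2_def
proof (rule integral_L0_cong)
  show "AE x in lebesgue. rep_L0 f x * rep_L0 one\<Omega> x = rep_L0 f x"
    using rep_one\<Omega> L2\<Omega>_vanishing[OF assms] by eventually_elim (auto simp: indicator_def)
qed simp_all

lemma abs_L2\<Omega>: assumes "f \<in> L2\<Omega>" shows "\<bar>f\<bar> \<in> L2\<Omega>" "ip2 \<bar>f\<bar> \<bar>f\<bar> = ip2 f f"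
proof -
  have eq: "AE x in lebesgue. (rep_L0 f x)\<^sup>2 = (rep_L0 \<bar>f\<bar> x)\<^sup>2"
    using rep_abs[of f] by eventually_elim simp
  have "integrable lebesgue (\<lambda>x. (rep_L0 \<bar>f\<bar> x)\<^sup>2)"
    by (rule integrable_cong_AE_imp[OF _ _ eq]) (use assms in \<open>simp_all add: L2\<Omega>_def L2_def\<close>)
  moreover have "vanishing \<bar>f\<bar>"
    unfolding vanishing_def using rep_abs[of f] L2\<Omega>_vanishing[OF assms] by eventually_elim simp
  ultimately show "\<bar>f\<bar> \<in> L2\<Omega>" by (simp add: L2\<Omega>_def L2_def)
  show "ip2 \<bar>f\<bar> \<bar>f\<bar> = ip2 f f"
    unfolding ip2_def using eq by (intro integral_L0_cong) (auto simp: power2_eq_square)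
qed

lemma L1_le: assumes f: "f \<in> L2\<Omega>" shows "(LINT x|lebesgue. \<bar>rep_L0 f x\<bar>) \<le> l2.nr f * l2.nr one\<Omega>"
proof -
  have "(LINT x|lebesgue. \<bar>rep_L0 f x\<bar>) = (LINT x|lebesgue. rep_L0 \<bar>f\<bar> x)"
    by (rule integral_L0_cong) (use rep_abs[of f] in \<open>eventually_elim, simp\<close>, simp_all)
  also have "\<dots> = ipL2 \<bar>f\<bar> one\<Omega>"
    using ip2_one\<Omega>[OF abs_L2\<Omega>(1)[OF f]] by (simp add: ipL2 L2\<Omega>_L2[OF abs_L2\<Omega>(1)[OF f]] one\<Omega>_L2)
  also have "\<dots> \<le> l2.nr \<bar>f\<bar> * l2.nr one\<Omega>" by (rule l2.ip_le)
  also have "l2.nr \<bar>f\<bar> = l2.nr f"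
    using f by (simp add: l2.nr_def ipL2 L2\<Omega>_L2 abs_L2\<Omega>)
  finally show ?thesis .
qed

text \<open>At scale r a function differs from its cube averages by an oscillation that the energy
  controls uniformly in n. The averages are pairings with fixed elements of \<open>L2\<close>, so
  under weak convergence they tend to zero pointwise, with a constant bound on the bounded
  domain.\<close>

lemma compact_test:
  assumes \<phi>: "\<And>n. \<phi> n \<in> test_functions \<Omega>" and w: "Hsp.wconv (\<lambda>n. abs_L0 (\<phi> n)) 0"
  shows "(\<lambda>n. LINT x|lborel. \<bar>\<phi> n x\<bar>) \<longlonglongrightarrow> 0"
proof -
  obtain M where M: "\<And>n. Hsp.nr (abs_L0 (\<phi> n)) \<le> M" using Hsp.wconv_bdd[OF w] by blast
  have M0: "0 \<le> M" using M[of 0] Hsp.nr_nonneg order_trans by blast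
  obtain CP where CP: "CP > 0" "\<And>v. v \<in> Hs \<Longrightarrow> l2.nr v \<le> CP * Hsp.nr v" using nr_L2_le by blast
  define m where "m = measure lborel \<Omega>"
  have fin: "emeasure lborel \<Omega> < \<infinity>"
    using emeasure_bounded_finite[OF bounded_\<Omega>] by simp
  have \<Omega>m [measurable]: "\<Omega> \<in> sets borel" using open_\<Omega> by simp
  have [measurable]: "\<phi> n \<in> borel_measurable borel" for n by (rule test_measurable[OF \<phi>])
  \<comment> \<open>\<open>r * K\<close> is what remains for large n:
    \<open>\<bar>t\<bar> \<le> r + t\<^sup>2 / (4 * r)\<close> contributes r times the measure m
    through its first term, and through its second the integrated oscillation divided by
    \<open>4 * r\<close>.\<close>
  define K where "K = m + real DIM('a) * M\<^sup>2 / 4"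
  have K0: "0 \<le> K" by (simp add: K_def m_def)
  have main: "\<exists>A. A \<longlonglongrightarrow> 0 \<and> (\<forall>n. (LINT x|lborel. \<bar>\<phi> n x\<bar>) \<le> A n + r * K)" if r: "r > 0" for r
  proof -
    define a where "a n x = (LINT z|lborel. indicator (cube r) z * \<phi> n (x + z))" for n x
    define b where "b n x = (LINT z|lborel. indicator (cube r) z * (\<phi> n (x + z) - \<phi> n x)\<^sup>2)" for n x
    have E: "(LINT x|lborel. (\<Sum>i\<in>Basis. (partial_deriv i (\<phi> n) x)\<^sup>2)) \<le> M\<^sup>2" for n
      unfolding test_energy[OF \<phi>] using M by (intro power_mono) simp_all
    note osc = oscillation_integral[OF \<phi> less_imp_le[OF r] E, folded b_def]
    have bi: "integrable lborel (b n)" and bl: "(LINT x|lborel. b n x) \<le> r ^ DIM('a) * (real DIM('a) * r\<^sup>2 * M\<^sup>2)"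
      and bz: "integrable lborel (\<lambda>z. indicator (cube r) z * (\<phi> n (x + z) - \<phi> n x)\<^sup>2)" for n x
      using osc(1)[of n] osc(2)[of n] osc(3)[of n x] by (simp_all add: b_def[abs_def])
    have cube_int: "integrable lborel (indicator (cube r) :: 'a \<Rightarrow> real)"
      using r by (intro integrable_real_indicator) (simp_all add: emeasure_cube)
    have cube_val: "(LINT z|lborel. (indicator (cube r) (z::'a) :: real)) = r ^ DIM('a)"
      using r by (simp add: measure_def emeasure_cube)
    define f where "f x = abs_L0 (\<lambda>y. indicator (cube r) (y - x) :: real)" for x :: 'a
    have fm: "(\<lambda>y. indicator (cube r) (y - x) :: real) \<in> borel_measurable lebesgue" for x :: 'a
      by (rule measurable_completion) measurable
    have ftr: "integrable lborel (\<lambda>y::'a. indicator (cube r) (y - x) :: real)"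
      "(LINT y|lborel. (indicator (cube r) (y - x) :: real)) = r ^ DIM('a)" for x :: 'a
      using integrable_translate[OF cube_int, of "- x"] lborel_integral_translate[of "indicator (cube r)" "- x"] cube_val
      by simp_all
    have fL2: "f x \<in> L2" for x
      unfolding f_def
    proof (rule L2_I[OF fm])
      have "(\<lambda>y. indicator (cube r) (y - x) :: real) \<in> borel_measurable lborel" by measurable
      then have "integrable lebesgue (\<lambda>y. indicator (cube r) (y - x) :: real)"
        using ftr(1)[of x] by (simp only: integrable_completion)
      then show "integrable lebesgue (\<lambda>y. (indicator (cube r) (y - x) :: real)\<^sup>2)"
        by (simp add: power2_eq_square flip: indicator_inter_arith)
    qed
    have rep_f: "AE y in lebesgue. rep_L0 (f x) y = indicator (cube r) (y - x)" for x
      unfolding f_def by (rule rep_abs_L0[OF fm])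
    have ff: "l2.nr (f x) = sqrt (r ^ DIM('a))" for x
    proof -
      have "ip2 (f x) (f x) = (LINT y|lebesgue. indicator (cube r) (y - x))"
        unfolding ip2_def
        by (rule integral_L0_cong, use rep_f[of x] in \<open>eventually_elim, simp add: indicator_def\<close>) (simp_all add: fm)
      also have "\<dots> = (LINT y|lborel. indicator (cube r) (y - x))"
        by (rule integral_completion) measurable
      finally show ?thesis by (simp add: l2.nr_def ipL2 fL2 ftr(2))
    qed
    have a_eq: "a n x = ip2 (abs_L0 (\<phi> n)) (f x)" for n x
    proof -
      have "a n x = (LINT y|lborel. indicator (cube r) (y - x) * \<phi> n y)"
        unfolding a_def
        using lborel_integral_translate[of "\<lambda>y. indicator (cube r) (y - x) * \<phi> n y" x] by (simp add: add.commute)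
      also have "\<dots> = (LINT y|lebesgue. indicator (cube r) (y - x) * \<phi> n y)"
        by (rule integral_completion[symmetric]) measurable
      also have "\<dots> = ip2 (f x) (abs_L0 (\<phi> n))"
        unfolding ip2_test(1)[OF \<phi>]
        by (rule integral_L0_cong, use rep_f[of x] in \<open>eventually_elim, simp\<close>)
           (intro borel_measurable_times fm rep_L0_measurable test_lebesgue_measurable[OF \<phi>])+
      finally show ?thesis by (simp add: ip2_commute)
    qed
    have a_lim: "(\<lambda>n. a n x) \<longlonglongrightarrow> 0" for x
      using wconv_L2[OF w fL2[of x]] ip2_scale[of 0 "0 :: 'a L0" "f x"] by (simp add: a_eq)
    have a_bd: "\<bar>a n x\<bar> \<le> CP * M * sqrt (r ^ DIM('a))" for n x
    proof -
      have "\<bar>a n x\<bar> \<le> l2.nr (abs_L0 (\<phi> n)) * l2.nr (f x)"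
        using l2.Cauchy_Schwarz[of "abs_L0 (\<phi> n)" "f x"] by (simp add: a_eq ipL2 fL2 test_L2[OF \<phi>])
      also have "\<dots> \<le> (CP * M) * sqrt (r ^ DIM('a))"
        unfolding ff using order_trans[OF CP(2)[OF test_Hs[OF \<phi>]] mult_left_mono[OF M less_imp_le[OF CP(1)]]] r
        by (intro mult_right_mono) simp_all
      finally show ?thesis .
    qed
    have am [measurable]: "a n \<in> borel_measurable borel" for n
    proof -
      have "(\<lambda>x. LINT z|lborel. indicator (cube r) z * \<phi> n (x + z)) \<in> borel_measurable borel"
        by measurable
      then show ?thesis by (simp add: a_def[abs_def])
    qed
    have ind: "integrable lborel (indicator \<Omega> :: 'a \<Rightarrow> real)"
      using fin by (intro integrable_real_indicator) simp_all
    define A where "A n = (LINT x|lborel. indicator \<Omega> x * \<bar>a n x\<bar>) / r ^ DIM('a)" for n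
    have bnd: "integrable lborel (\<lambda>x. CP * M * sqrt (r ^ DIM('a)) * indicator \<Omega> x :: real)" using ind by simp
    have ai: "integrable lborel (\<lambda>x. indicator \<Omega> x * \<bar>a n x\<bar>)" for n
      by (rule Bochner_Integration.integrable_bound[OF bnd])
         (measurable, use a_bd[of n] in \<open>auto simp: indicator_def intro!: AE_I2 order_trans[OF _ abs_ge_self]\<close>)
    have "(\<lambda>n. LINT x|lborel. indicator \<Omega> x * \<bar>a n x\<bar>) \<longlonglongrightarrow> (LINT x|(lborel :: 'a measure). (0::real))"
      by (rule integral_dominated_convergence[of "\<lambda>x. 0" lborel "\<lambda>n x. indicator \<Omega> x * \<bar>a n x\<bar>", OF _ _ bnd])
         (simp_all, auto intro!: AE_I2 tendsto_mult_right_zero tendsto_rabs_zero a_lim a_bd simp: indicator_def)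
    then have A0: "A \<longlonglongrightarrow> 0"
      unfolding A_def[abs_def] using tendsto_divide_zero by auto
    have pt: "r ^ DIM('a) * \<bar>\<phi> n x\<bar> \<le> \<bar>a n x\<bar> + r * r ^ DIM('a) + b n x / (4 * r)" for n x
    proof -
      obtain B where B: "\<And>x. \<bar>\<phi> n x\<bar> \<le> B" using test_bounded[OF \<phi>[of n]] by blast
      have i1: "integrable lborel (\<lambda>z. indicator (cube r) z * \<phi> n (x + z))"
      proof (rule integrableI_bounded_set[of "cube r"])
        show "emeasure lborel (cube r :: 'a set) < \<infinity>" using r by (simp add: emeasure_cube)
        show "AE z in lborel. z \<in> cube r \<longrightarrow> norm (indicator (cube r) z * \<phi> n (x + z)) \<le> B"
          using B by (auto intro!: AE_I2)
      qed (auto simp: indicator_def)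
      have i2: "integrable lborel (\<lambda>z::'a. indicator (cube r) z * \<phi> n x)" using cube_int by simp
      have "r ^ DIM('a) * \<phi> n x - a n x = (LINT z|lborel. indicator (cube r) z * \<phi> n x - indicator (cube r) z * \<phi> n (x + z))"
        using i1 i2 cube_val by (simp add: a_def)
      also have "\<bar>\<dots>\<bar> \<le> (LINT z|lborel. r * indicator (cube r) z + indicator (cube r) z * (\<phi> n (x + z) - \<phi> n x)\<^sup>2 / (4 * r))"
      proof (rule integral_abs_bound[THEN order_trans], rule integral_mono)
        show "integrable lborel (\<lambda>z. \<bar>indicator (cube r) z * \<phi> n x - indicator (cube r) z * \<phi> n (x + z)\<bar>)"
          using i1 i2 by simp
        show "integrable lborel (\<lambda>z. r * indicator (cube r) z + indicator (cube r) z * (\<phi> n (x + z) - \<phi> n x)\<^sup>2 / (4 * r))"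
          using cube_int bz by simp
        fix z
        have "\<bar>t\<bar> \<le> r + t\<^sup>2 / (4 * r)" for t :: real
        proof -
          have "0 \<le> (\<bar>t\<bar> - 2 * r)\<^sup>2" by simp
          then have "4 * r * \<bar>t\<bar> \<le> t\<^sup>2 + 4 * r\<^sup>2" by (simp add: power2_diff algebra_simps)
          then show ?thesis using r by (simp add: field_simps power2_eq_square)
        qed
        from this[of "\<phi> n x - \<phi> n (x + z)"]
        show "\<bar>indicator (cube r) z * \<phi> n x - indicator (cube r) z * \<phi> n (x + z)\<bar>
           \<le> r * indicator (cube r) z + indicator (cube r) z * (\<phi> n (x + z) - \<phi> n x)\<^sup>2 / (4 * r)"
          by (auto simp: indicator_def power2_commute)
      qed
      also have "\<dots> = r * r ^ DIM('a) + b n x / (4 * r)"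
        using cube_int bz cube_val by (simp add: b_def)
      finally have "\<bar>r ^ DIM('a) * \<phi> n x - a n x\<bar> \<le> r * r ^ DIM('a) + b n x / (4 * r)" .
      moreover have "r ^ DIM('a) * \<bar>\<phi> n x\<bar> = \<bar>r ^ DIM('a) * \<phi> n x\<bar>" using r by (simp add: abs_mult)
      ultimately show ?thesis by linarith
    qed
    have "(LINT x|lborel. \<bar>\<phi> n x\<bar>) \<le> A n + r * K" for n
    proof -
      have "r ^ DIM('a) * (LINT x|lborel. \<bar>\<phi> n x\<bar>) = (LINT x|lborel. r ^ DIM('a) * \<bar>\<phi> n x\<bar>)" by simp
      also have "\<dots> \<le> (LINT x|lborel. indicator \<Omega> x * \<bar>a n x\<bar> + r * r ^ DIM('a) * indicator \<Omega> x + b n x / (4 * r))"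
      proof (rule integral_mono)
        show "integrable lborel (\<lambda>x. r ^ DIM('a) * \<bar>\<phi> n x\<bar>)" using test_integrable_lborel[OF \<phi>] by simp
        show "integrable lborel (\<lambda>x. indicator \<Omega> x * \<bar>a n x\<bar> + r * r ^ DIM('a) * indicator \<Omega> x + b n x / (4 * r))"
          using ai ind bi by simp
        show "r ^ DIM('a) * \<bar>\<phi> n x\<bar> \<le> indicator \<Omega> x * \<bar>a n x\<bar> + r * r ^ DIM('a) * indicator \<Omega> x + b n x / (4 * r)" for x
          using pt[of n x] test_zero_outside[OF \<phi>, of x n] osc(4)[of n x] r
          by (cases "x \<in> \<Omega>") (simp_all add: b_def)
      qed
      also have "\<dots> = (LINT x|lborel. indicator \<Omega> x * \<bar>a n x\<bar>) + r * r ^ DIM('a) * m + (LINT x|lborel. b n x) / (4 * r)"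
        using ai ind bi by (simp add: m_def)
      also have "\<dots> \<le> (LINT x|lborel. indicator \<Omega> x * \<bar>a n x\<bar>) + r * r ^ DIM('a) * m
          + (r ^ DIM('a) * (real DIM('a) * r\<^sup>2 * M\<^sup>2)) / (4 * r)"
        using bl[of n] r by (intro add_left_mono divide_right_mono) simp_all
      also have "\<dots> = r ^ DIM('a) * (A n + r * K)"
        using r by (simp add: A_def K_def field_simps power2_eq_square)
      finally show ?thesis using r by simp
    qed
    then show ?thesis using A0 by blast
  qed
  show ?thesis
  proof (rule order_tendstoI)
    fix e :: real assume e: "e < 0"
    have "e < (LINT x|lborel. \<bar>\<phi> n x\<bar>)" for n
      by (rule less_le_trans[OF e], rule integral_nonneg_AE) simp
    then show "\<forall>\<^sub>F n in sequentially. e < (LINT x|lborel. \<bar>\<phi> n x\<bar>)" by simp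
  next
    fix e :: real assume e: "0 < e"
    define r where "r = e / (2 * (K + 1))"
    have r: "r > 0" "r * K < e / 2" using e K0 by (simp_all add: r_def field_simps)
    obtain A where A: "A \<longlonglongrightarrow> 0" "\<And>n. (LINT x|lborel. \<bar>\<phi> n x\<bar>) \<le> A n + r * K" using main[OF r(1)] by blast
    have "\<forall>\<^sub>F n in sequentially. A n < e / 2" by (rule order_tendstoD(2)[OF A(1)]) (simp add: e)
    then show "\<forall>\<^sub>F n in sequentially. (LINT x|lborel. \<bar>\<phi> n x\<bar>) < e"
    proof eventually_elim
      case (elim n)
      then show ?case using A(2)[of n] r(2) by linarith
    qed
  qed
qed

lemma compact_L1:
  assumes w: "Hsp.wconv xs 0"
  shows "(\<lambda>n. LINT x|lebesgue. \<bar>rep_L0 (xs n) x\<bar>) \<longlonglongrightarrow> 0"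
proof -
  have xs: "xs n \<in> Hs" for n by (rule Hsp.wconv_mem[OF w])
  obtain \<phi> where \<phi>: "\<And>n. \<phi> n \<in> test_functions \<Omega>" and lim: "(\<lambda>n. Hsp.nr (abs_L0 (\<phi> n) - xs n)) \<longlonglongrightarrow> 0"
    using Hs_test_seq[of xs] xs by blast
  have \<phi>H: "abs_L0 (\<phi> n) \<in> Hs" for n by (rule test_Hs[OF \<phi>])
  have "Hsp.wconv (\<lambda>n. abs_L0 (\<phi> n) - xs n) 0"
    by (rule Hsp.sconv_imp_wconv) (simp_all add: Hsp.sconv_def lim xs \<phi>H)
  from Hsp.wconv_add[OF this w] have "Hsp.wconv (\<lambda>n. abs_L0 (\<phi> n)) 0" by simp
  from compact_test[OF \<phi> this] have lim1: "(\<lambda>n. LINT x|lborel. \<bar>\<phi> n x\<bar>) \<longlonglongrightarrow> 0" .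
  obtain C where C: "C > 0" "\<And>v. v \<in> Hs \<Longrightarrow> l2.nr v \<le> C * Hsp.nr v" using nr_L2_le by blast
  define C' where "C' = C * l2.nr one\<Omega>"
  have le: "(LINT x|lebesgue. \<bar>rep_L0 (xs n) x\<bar>) \<le> (LINT x|lborel. \<bar>\<phi> n x\<bar>) + C' * Hsp.nr (abs_L0 (\<phi> n) - xs n)" for n
  proof -
    have dO: "abs_L0 (\<phi> n) - xs n \<in> L2\<Omega>" by (intro Hs_L2\<Omega>) (simp add: \<phi>H xs)
    have i: "integrable lebesgue (\<lambda>x. \<bar>\<phi> n x\<bar>)" "integrable lebesgue (\<lambda>x. \<bar>rep_L0 (abs_L0 (\<phi> n) - xs n) x\<bar>)"
      using test_integrable[OF \<phi>] L2\<Omega>_integrable[OF dO] by simp_all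
    have "(LINT x|lebesgue. \<bar>rep_L0 (xs n) x\<bar>) \<le> (LINT x|lebesgue. \<bar>\<phi> n x\<bar> + \<bar>rep_L0 (abs_L0 (\<phi> n) - xs n) x\<bar>)"
    proof (rule integral_mono_AE)
      show "integrable lebesgue (\<lambda>x. \<bar>rep_L0 (xs n) x\<bar>)" using L2\<Omega>_integrable[OF Hs_L2\<Omega>[OF xs]] by simp
      show "AE x in lebesgue. \<bar>rep_L0 (xs n) x\<bar> \<le> \<bar>\<phi> n x\<bar> + \<bar>rep_L0 (abs_L0 (\<phi> n) - xs n) x\<bar>"
        using test_rep[OF \<phi>[of n]] rep_diff[of "abs_L0 (\<phi> n)" "xs n"] by eventually_elim linarith
    qed (use i in simp)
    also have "\<dots> = (LINT x|lebesgue. \<bar>\<phi> n x\<bar>) + (LINT x|lebesgue. \<bar>rep_L0 (abs_L0 (\<phi> n) - xs n) x\<bar>)"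
      using i by simp
    also have "(LINT x|lebesgue. \<bar>\<phi> n x\<bar>) = (LINT x|lborel. \<bar>\<phi> n x\<bar>)"
      using test_measurable[OF \<phi>] by (intro integral_completion) simp
    also have "(LINT x|lebesgue. \<bar>rep_L0 (abs_L0 (\<phi> n) - xs n) x\<bar>) \<le> C' * Hsp.nr (abs_L0 (\<phi> n) - xs n)"
      using order_trans[OF L1_le[OF dO] mult_right_mono[OF C(2)]] \<phi>H xs by (simp add: C'_def mult_ac)
    finally show ?thesis by simp
  qed
  show ?thesis
  proof (rule tendsto_sandwich[OF _ _ tendsto_const])
    show "(\<lambda>n. (LINT x|lborel. \<bar>\<phi> n x\<bar>) + C' * Hsp.nr (abs_L0 (\<phi> n) - xs n)) \<longlonglongrightarrow> 0"
      by (intro tendsto_add_zero lim1 tendsto_mult_right_zero lim)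
    have "0 \<le> (LINT x|lebesgue. \<bar>rep_L0 (xs n) x\<bar>)" for n by (rule integral_nonneg_AE) simp
    then show "\<forall>\<^sub>F n in sequentially. 0 \<le> (LINT x|lebesgue. \<bar>rep_L0 (xs n) x\<bar>)" by simp
  qed (use le in simp)
qed

end

subsection \<open>Subcritical Sobolev embeddings\<close>

lemma le_split_powr:
  fixes a q t :: real
  assumes "0 < a" "1 \<le> q" "0 \<le> t" shows "t \<le> a + a powr (1 - q) * t powr q"
proof (cases "t \<le> a")
  case True
  have "0 \<le> a powr (1 - q) * t powr q" by simp
  with True show ?thesis by linarith
next
  case False
  then have t: "a < t" "0 < t" using assms by auto
  have "t = a powr (1 - q) * (a powr (q - 1) * t)"
    using assms(1) by (simp add: powr_add[symmetric] flip: mult.assoc)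
  also have "\<dots> \<le> a powr (1 - q) * (t powr (q - 1) * t)"
    using t assms by (intro mult_left_mono mult_right_mono powr_mono2) auto
  also have "t powr (q - 1) * t = t powr q"
    using t powr_add[of t "q - 1" 1] by simp
  finally show ?thesis using assms(1) by simp
qed

context domain
begin

lemma test_powr_integrable:
  assumes \<phi>: "\<phi> \<in> test_functions \<Omega>" and s: "0 < s"
  shows "integrable lborel (\<lambda>x. \<bar>\<phi> x\<bar> powr s)"
proof -
  obtain B R where B: "\<And>x. \<bar>\<phi> x\<bar> \<le> B" and R: "\<And>x. R < norm x \<Longrightarrow> \<phi> x = 0"
    using test_bounded[OF \<phi>] test_support[OF \<phi>] by blast
  show ?thesis
  proof (rule integrable_bounded_support)
    show "(\<lambda>x. \<bar>\<phi> x\<bar> powr s) \<in> borel_measurable borel" using test_measurable[OF \<phi>] by simp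
    show "\<bar>\<bar>\<phi> x\<bar> powr s\<bar> \<le> B powr s" for x
      using powr_mono2[of s "\<bar>\<phi> x\<bar>" B] s B[of x] by simp
  qed (use R s in simp)
qed

text \<open>Powers are bounded on the unit ball, which suits the level set argument; homogeneous
  norm bounds are recovered by scaling.\<close>

definition embeds :: "real \<Rightarrow> bool"
  where "embeds q \<longleftrightarrow> (\<exists>C>0. \<forall>\<phi>\<in>test_functions \<Omega>. Hsp.nr (abs_L0 \<phi>) \<le> 1 \<longrightarrow> (LINT x|lborel. \<bar>\<phi> x\<bar> powr q) \<le> C)"

lemma embeds_2: "embeds 2"
proof -
  obtain C where C: "C > 0" "\<And>v. v \<in> Hs \<Longrightarrow> l2.nr v \<le> C * Hsp.nr v" using nr_L2_le by blast
  have "(LINT x|lborel. \<bar>\<phi> x\<bar> powr 2) \<le> C\<^sup>2" if \<phi>: "\<phi> \<in> test_functions \<Omega>" "Hsp.nr (abs_L0 \<phi>) \<le> 1" for \<phi>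
  proof -
    have "(LINT x|lborel. \<bar>\<phi> x\<bar> powr 2) = (LINT x|lebesgue. \<phi> x * \<phi> x)"
      using test_measurable[OF \<phi>(1)] by (subst integral_completion) (simp_all add: abs_powr_2 power2_eq_square)
    also have "\<dots> = (l2.nr (abs_L0 \<phi>))\<^sup>2"
      by (simp add: l2.nr_square ipL2 test_L2 \<phi> ip2_test_test)
    also have "\<dots> \<le> C\<^sup>2"
      using order_trans[OF C(2)[OF test_Hs[OF \<phi>(1)]] mult_left_le[OF \<phi>(2)]] C(1)
      by (intro power_mono) simp_all
    finally show ?thesis .
  qed
  then show ?thesis unfolding embeds_def using C(1) by (intro exI[of _ "C\<^sup>2"]) auto
qed

text \<open>At level \<open>l\<close> the side of the cubes is chosen such that averages of \<open>\<phi>\<close> are at most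
  \<open>l / 2\<close>. On the superlevel set \<open>\<phi>\<close> then oscillates by \<open>l / 2\<close>.\<close>

lemma level_set_estimate:
  assumes \<phi>: "\<phi> \<in> test_functions \<Omega>" "Hsp.nr (abs_L0 \<phi>) \<le> 1" and q: "2 \<le> q"
    and C: "0 < C" "(LINT x|lborel. \<bar>\<phi> x\<bar> powr q) \<le> C" and l: "0 < l"
  shows "emeasure lborel {x. l \<le> \<bar>\<phi> x\<bar>} \<le>
    ennreal (4 * real DIM('a) * (((l / 4) powr (- q) * C) powr (2 / real DIM('a))) / l\<^sup>2)"
proof -
  let ?d = "real DIM('a)"
  have d: "0 < ?d" by simp
  \<comment> \<open>The volume of the cube, chosen such that \<open>(l / 4) powr (1 - q) * C\<close>
    equals \<open>(l / 4) * \<rho>\<close>: values of \<open>\<bar>\<phi>\<bar>\<close> above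
    \<open>l / 4\<close> then contribute at most \<open>l / 4\<close> to the average.\<close>
  define \<rho> where "\<rho> = (l / 4) powr (- q) * C"
  have \<rho>: "0 < \<rho>" using C l by (simp add: \<rho>_def)
  define r where "r = \<rho> powr (1 / ?d)"
  have r: "0 < r" using \<rho> by (simp add: r_def)
  have rd: "r ^ DIM('a) = \<rho>"
    using \<rho> r by (simp add: r_def powr_powr flip: powr_realpow)
  have r2: "r\<^sup>2 = \<rho> powr (2 / ?d)"
    using \<rho> r by (simp add: r_def powr_powr powr_numeral flip: powr_realpow)
  have [measurable]: "\<phi> \<in> borel_measurable borel" by (rule test_measurable[OF \<phi>(1)])
  define b where "b x = (LINT z|lborel. indicator (cube r) z * (\<phi> (x + z) - \<phi> x)\<^sup>2)" for x
  have E: "(LINT x|lborel. (\<Sum>i\<in>Basis. (partial_deriv i \<phi> x)\<^sup>2)) \<le> 1"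
    unfolding test_energy[OF \<phi>(1)] using \<phi>(2) by (simp add: power_le_one)
  note osc = oscillation_integral[OF \<phi>(1) less_imp_le[OF r] E]
  have bi: "integrable lborel b" and bl: "(LINT x|lborel. b x) \<le> r ^ DIM('a) * (?d * r\<^sup>2)"
    and b0: "0 \<le> b x"
    and bz: "integrable lborel (\<lambda>z. indicator (cube r) z * (\<phi> (x + z) - \<phi> x)\<^sup>2)" for x
    using osc(1,2) osc(3,4)[of x] by (simp_all add: b_def[abs_def])
  have cube_int: "integrable lborel (indicator (cube r) :: 'a \<Rightarrow> real)"
    using r by (intro integrable_real_indicator) (simp_all add: emeasure_cube)
  have cube_val: "(LINT z|lborel. (indicator (cube r) (z::'a) :: real)) = \<rho>"
    using r \<rho> by (simp add: measure_def emeasure_cube rd)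
  have low: "\<rho> * l\<^sup>2 / 4 \<le> b x" if x: "l \<le> \<bar>\<phi> x\<bar>" for x
  proof -
    have pi: "integrable lborel (\<lambda>z. \<bar>\<phi> (x + z)\<bar> powr q)"
      using integrable_translate[OF test_powr_integrable[OF \<phi>(1)], of q x] q by (simp add: add.commute)
    have pv: "(LINT z|lborel. \<bar>\<phi> (x + z)\<bar> powr q) \<le> C"
      using lborel_integral_translate[of "\<lambda>z. \<bar>\<phi> z\<bar> powr q" x] C(2) by (simp add: add.commute)
    have "\<rho> * l \<le> \<rho> * \<bar>\<phi> x\<bar>" using x \<rho> by simp
    also have "\<dots> = (LINT z|lborel. \<bar>\<phi> x\<bar> * indicator (cube r :: 'a set) z)"
      using cube_val by simp
    \<comment> \<open>One quarter of l comes from splitting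
      \<open>\<bar>\<phi> (x + z)\<bar>\<close> at level \<open>l / 4\<close>, one from Young's
      inequality for the oscillation, and one from the choice of \<open>\<rho>\<close>; the last
      quarter has to be supplied by b.\<close>
    also have "\<dots> \<le> (LINT z|lborel. (l / 2) * indicator (cube r) z + (l / 4) powr (1 - q) * \<bar>\<phi> (x + z)\<bar> powr q
        + (indicator (cube r) z * (\<phi> (x + z) - \<phi> x)\<^sup>2) / l)"
    proof (rule integral_mono)
      show "integrable lborel (\<lambda>z::'a. \<bar>\<phi> x\<bar> * indicator (cube r) z)" using cube_int by simp
      show "integrable lborel (\<lambda>z. (l / 2) * indicator (cube r) z + (l / 4) powr (1 - q) * \<bar>\<phi> (x + z)\<bar> powr q
        + (indicator (cube r) z * (\<phi> (x + z) - \<phi> x)\<^sup>2) / l)"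
        using cube_int pi bz by simp
      fix z :: 'a
      have "\<bar>t\<bar> \<le> l / 4 + t\<^sup>2 / l" for t :: real
      proof -
        have "0 \<le> (2 * \<bar>t\<bar> - l)\<^sup>2" by simp
        then have "4 * l * \<bar>t\<bar> \<le> 4 * t\<^sup>2 + l\<^sup>2" by (simp add: power2_diff algebra_simps power_mult_distrib)
        then show ?thesis using l by (simp add: field_simps power2_eq_square)
      qed
      from this[of "\<phi> (x + z) - \<phi> x"]
        le_split_powr[of "l / 4" q "\<bar>\<phi> (x + z)\<bar>"] l q
      have "\<bar>\<phi> x\<bar> \<le> l / 2 + (l / 4) powr (1 - q) * \<bar>\<phi> (x + z)\<bar> powr q + (\<phi> (x + z) - \<phi> x)\<^sup>2 / l"
        by linarith
      then show "\<bar>\<phi> x\<bar> * indicator (cube r) z \<le> (l / 2) * indicator (cube r) z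
          + (l / 4) powr (1 - q) * \<bar>\<phi> (x + z)\<bar> powr q + (indicator (cube r) z * (\<phi> (x + z) - \<phi> x)\<^sup>2) / l"
        by (simp add: indicator_def)
    qed
    also have "\<dots> = (l / 2) * \<rho> + (l / 4) powr (1 - q) * (LINT z|lborel. \<bar>\<phi> (x + z)\<bar> powr q) + b x / l"
      using cube_int pi bz cube_val by (simp add: b_def)
    also have "\<dots> \<le> (l / 2) * \<rho> + (l / 4) powr (1 - q) * C + b x / l"
      using pv l \<rho> by (intro add_mono mult_left_mono) simp_all
    also have "(l / 4) powr (1 - q) * C = (l / 4) * \<rho>"
      using l powr_add[of "l / 4" 1 "- q"] by (simp add: \<rho>_def)
    finally have "\<rho> * l \<le> (l / 2) * \<rho> + (l / 4) * \<rho> + b x / l" .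
    moreover have "(l / 2) * \<rho> = \<rho> * l / 2" "(l / 4) * \<rho> = \<rho> * l / 4" by simp_all
    ultimately have "\<rho> * l / 4 \<le> b x / l" by linarith
    then show ?thesis using l by (simp add: field_simps power2_eq_square)
  qed
  have "ennreal (\<rho> * l\<^sup>2 / 4) * emeasure lborel {x. l \<le> \<bar>\<phi> x\<bar>} =
      (\<integral>\<^sup>+x. ennreal (\<rho> * l\<^sup>2 / 4) * indicator {x. l \<le> \<bar>\<phi> x\<bar>} x \<partial>lborel)"
    by (rule nn_integral_cmult_indicator[symmetric]) measurable
  also have "\<dots> \<le> (\<integral>\<^sup>+x. ennreal (b x) \<partial>lborel)"
    using low by (intro nn_integral_mono) (auto simp: indicator_def intro!: ennreal_leI)
  also have "\<dots> = ennreal (LINT x|lborel. b x)" using bi b0 by (simp add: nn_integral_eq_integral)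
  also have "\<dots> \<le> ennreal (\<rho> * (?d * r\<^sup>2))" using bl by (intro ennreal_leI) (simp add: rd)
  finally have le: "ennreal (\<rho> * l\<^sup>2 / 4) * emeasure lborel {x. l \<le> \<bar>\<phi> x\<bar>} \<le> ennreal (\<rho> * (?d * r\<^sup>2))" .
  have c: "0 < \<rho> * l\<^sup>2 / 4" using \<rho> l by simp
  have "emeasure lborel {x. l \<le> \<bar>\<phi> x\<bar>} = ennreal (1 / (\<rho> * l\<^sup>2 / 4)) * (ennreal (\<rho> * l\<^sup>2 / 4) * emeasure lborel {x. l \<le> \<bar>\<phi> x\<bar>})"
    using c l \<rho> by (simp add: ennreal_mult[symmetric] flip: mult.assoc)
  also have "\<dots> \<le> ennreal (1 / (\<rho> * l\<^sup>2 / 4)) * ennreal (\<rho> * (?d * r\<^sup>2))"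
    by (rule mult_left_mono[OF le]) simp
  also have "\<dots> = ennreal (1 / (\<rho> * l\<^sup>2 / 4) * (\<rho> * (?d * r\<^sup>2)))"
    by (rule ennreal_mult'[symmetric]) (use c in simp)
  also have "1 / (\<rho> * l\<^sup>2 / 4) * (\<rho> * (?d * r\<^sup>2)) = 4 * ?d * \<rho> powr (2 / ?d) / l\<^sup>2"
    using \<rho> l by (simp add: r2)
  finally show ?thesis by (simp add: \<rho>_def)
qed

lemma embeds_step:
  assumes q: "2 \<le> q" "embeds q" and s: "0 < s" "s < 2 + 2 * q / real DIM('a)"
  shows "embeds s"
proof -
  let ?d = "real DIM('a)"
  obtain C where C: "C > 0" "\<And>\<phi>. \<phi> \<in> test_functions \<Omega> \<Longrightarrow> Hsp.nr (abs_L0 \<phi>) \<le> 1 \<Longrightarrow> (LINT x|lborel. \<bar>\<phi> x\<bar> powr q) \<le> C"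
    using q(2) unfolding embeds_def by blast
  define K where "K = 4 * ?d * C powr (2 / ?d) * 4 powr (2 * q / ?d)"
  have K: "0 \<le> K" by (simp add: K_def)
  define \<theta> where "\<theta> = 2 powr (s - 2 - 2 * q / ?d)"
  have \<theta>: "0 < \<theta>" "\<theta> < 1"
    using s(2) powr_less_mono[of "s - 2 - 2 * q / ?d" 0 2] by (simp_all add: \<theta>_def)
  define m where "m = measure lborel \<Omega>"
  have m: "emeasure lborel \<Omega> = ennreal m"
    using emeasure_bounded_finite[OF bounded_\<Omega>] by (simp add: m_def emeasure_eq_ennreal_measure)
  define D where "D = m + 2 powr s * K * (1 / (1 - \<theta>)) + 1"
  have D: "D > 0" using K \<theta> by (simp add: D_def m_def add_nonneg_pos)
  have \<Omega>m [measurable]: "\<Omega> \<in> sets borel" using open_\<Omega> by simp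
  have "(LINT x|lborel. \<bar>\<phi> x\<bar> powr s) \<le> D" if \<phi>: "\<phi> \<in> test_functions \<Omega>" "Hsp.nr (abs_L0 \<phi>) \<le> 1" for \<phi>
  proof -
    have [measurable]: "\<phi> \<in> borel_measurable borel" by (rule test_measurable[OF \<phi>(1)])
    define L where "L k = {x. 2 powr real k \<le> \<bar>\<phi> x\<bar>}" for k :: nat
    have Lm [measurable]: "L k \<in> sets borel" for k unfolding L_def by measurable
    \<comment> \<open>The weight carries \<open>Suc k\<close> because on the k-th dyadic layer the
      values reach up to the next power of 2; this is the source of the factor
      \<open>2 powr s\<close>.\<close>
    have Lk: "ennreal (2 powr (real (Suc k) * s)) * emeasure lborel (L k) \<le> ennreal (2 powr s * K * \<theta> ^ k)" for k
    proof -
      define l where "l = (2::real) powr real k"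
      have l: "l > 0" by (simp add: l_def)
      have p: "((l / 4) powr (- q) * C) powr (2 / ?d) = l powr (- (2 * q / ?d)) * (4 powr (2 * q / ?d) * C powr (2 / ?d))"
      proof -
        have "(l / 4) powr (- q) = l powr (- q) * 4 powr q"
          using l by (simp add: powr_divide powr_minus_divide)
        then show ?thesis using l C(1) by (simp add: powr_mult powr_powr mult_ac)
      qed
      have "4 * ?d * (((l / 4) powr (- q) * C) powr (2 / ?d)) / l\<^sup>2 = K * (l powr (- (2 * q / ?d)) * l powr (- 2))"
      proof -
        have "l powr (- 2) = 1 / l\<^sup>2" using l by (simp add: powr_minus_divide powr_numeral)
        then show ?thesis unfolding p by (simp add: K_def)
      qed
      also have "l powr (- (2 * q / ?d)) * l powr (- 2) = 2 powr (real k * (- (2 * q / ?d) - 2))"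
        using l by (simp add: l_def powr_powr flip: powr_add) (simp add: algebra_simps)
      finally have e: "emeasure lborel (L k) \<le> ennreal (K * 2 powr (real k * (- (2 * q / ?d) - 2)))"
        using level_set_estimate[OF \<phi> q(1) C(1) C(2)[OF \<phi>] l] by (simp add: L_def l_def)
      have "ennreal (2 powr (real (Suc k) * s)) * emeasure lborel (L k)
          \<le> ennreal (2 powr (real (Suc k) * s)) * ennreal (K * 2 powr (real k * (- (2 * q / ?d) - 2)))"
        by (rule mult_left_mono[OF e]) simp
      also have "\<dots> = ennreal (2 powr (real (Suc k) * s) * (K * 2 powr (real k * (- (2 * q / ?d) - 2))))"
        using K by (simp add: ennreal_mult')
      also have "2 powr (real (Suc k) * s) * (K * 2 powr (real k * (- (2 * q / ?d) - 2))) = 2 powr s * K * \<theta> ^ k"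
      proof -
        have "\<theta> ^ k = 2 powr (real k * (s - 2 - 2 * q / ?d))"
          using \<theta>(1) by (simp add: \<theta>_def powr_powr mult.commute flip: powr_realpow)
        moreover have "real (Suc k) * s + real k * (- (2 * q / ?d) - 2) = s + real k * (s - 2 - 2 * q / ?d)"
          by (simp add: algebra_simps)
        then have "(2::real) powr (real (Suc k) * s) * 2 powr (real k * (- (2 * q / ?d) - 2)) =
            2 powr s * 2 powr (real k * (s - 2 - 2 * q / ?d))"
          unfolding powr_add[symmetric] by (rule arg_cong)
        ultimately show ?thesis by (simp add: mult_ac)
      qed
      finally show ?thesis .
    qed
    have pt: "ennreal (\<bar>\<phi> x\<bar> powr s) \<le> indicator \<Omega> x + (\<Sum>k. ennreal (2 powr (real (Suc k) * s)) * indicator (L k) x)" for x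
    proof (cases "x \<in> \<Omega>")
      case False
      then show ?thesis using test_zero_outside[OF \<phi>(1) False] by simp
    next
      case True
      show ?thesis
      proof (cases "\<bar>\<phi> x\<bar> \<le> 1")
        case le: True
        have "\<bar>\<phi> x\<bar> powr s \<le> 1" using le s(1) by (simp add: powr_le1)
        then have "ennreal (\<bar>\<phi> x\<bar> powr s) \<le> indicator \<Omega> x" using True by (simp add: ennreal_le_1)
        then show ?thesis by (rule order_trans) simp
      next
        case gt: False
        define k where "k = nat \<lfloor>log 2 \<bar>\<phi> x\<bar>\<rfloor>"
        have lg: "0 < log 2 \<bar>\<phi> x\<bar>" using gt by simp
        then have k: "real k \<le> log 2 \<bar>\<phi> x\<bar>" "log 2 \<bar>\<phi> x\<bar> \<le> real (Suc k)"
          by (simp_all add: k_def) linarith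
        have "2 powr real k \<le> \<bar>\<phi> x\<bar>" using k(1) gt by (simp add: le_log_iff)
        then have xk: "x \<in> L k" by (simp add: L_def)
        have "\<bar>\<phi> x\<bar> \<le> 2 powr real (Suc k)" using k(2) gt by (simp add: log_le_iff del: of_nat_Suc)
        then have "\<bar>\<phi> x\<bar> powr s \<le> (2 powr real (Suc k)) powr s" using s(1) by (intro powr_mono2) simp_all
        then have "ennreal (\<bar>\<phi> x\<bar> powr s) \<le> ennreal (2 powr (real (Suc k) * s)) * indicator (L k) x"
          using xk by (simp add: powr_powr ennreal_leI del: of_nat_Suc)
        also have "\<dots> = (\<Sum>j\<in>{k}. ennreal (2 powr (real (Suc j) * s)) * indicator (L j) x)"
          by (subst sum.insert) simp_all
        also have "\<dots> \<le> (\<Sum>k. ennreal (2 powr (real (Suc k) * s)) * indicator (L k) x)"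
          by (rule sum_le_suminf) simp_all
        finally show ?thesis by (rule order_trans) simp
      qed
    qed
    have "(\<integral>\<^sup>+x. ennreal (\<bar>\<phi> x\<bar> powr s) \<partial>lborel) \<le>
        (\<integral>\<^sup>+x. indicator \<Omega> x + (\<Sum>k. ennreal (2 powr (real (Suc k) * s)) * indicator (L k) x) \<partial>lborel)"
      by (rule nn_integral_mono) (rule pt)
    also have "\<dots> = (\<integral>\<^sup>+x. indicator \<Omega> x \<partial>lborel) + (\<integral>\<^sup>+x. (\<Sum>k. ennreal (2 powr (real (Suc k) * s)) * indicator (L k) x) \<partial>lborel)"
      by (rule nn_integral_add) measurable
    also have "(\<integral>\<^sup>+x. (\<Sum>k. ennreal (2 powr (real (Suc k) * s)) * indicator (L k) x) \<partial>lborel)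
        = (\<Sum>k. \<integral>\<^sup>+x. ennreal (2 powr (real (Suc k) * s)) * indicator (L k) x \<partial>lborel)"
      by (rule nn_integral_suminf) measurable
    also have "\<dots> \<le> (\<Sum>k. ennreal (2 powr s * K * \<theta> ^ k))"
      by (rule suminf_le) (simp_all add: nn_integral_cmult Lk del: of_nat_Suc)
    also have "(\<Sum>k. ennreal (2 powr s * K * \<theta> ^ k)) = ennreal (\<Sum>k. 2 powr s * K * \<theta> ^ k)"
      using K \<theta> by (intro suminf_ennreal2) (auto intro!: summable_mult summable_geometric)
    also have "(\<Sum>k. 2 powr s * K * \<theta> ^ k) = 2 powr s * K * (1 / (1 - \<theta>))"
      using \<theta> by (subst suminf_mult) (auto simp: suminf_geometric intro!: summable_geometric)
    also have "(\<integral>\<^sup>+x. indicator \<Omega> x \<partial>lborel) + ennreal (2 powr s * K * (1 / (1 - \<theta>))) \<le> ennreal D"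
      using K \<theta> m by (simp add: D_def m_def flip: ennreal_plus)
    finally have "(\<integral>\<^sup>+x. ennreal (\<bar>\<phi> x\<bar> powr s) \<partial>lborel) \<le> ennreal D" by simp
    then show ?thesis
      using nn_integral_eq_integral[OF test_powr_integrable[OF \<phi>(1) s(1)]] D by simp
  qed
  then show ?thesis unfolding embeds_def using D by blast
qed

text \<open>With d the dimension, one step lifts an exponent q' to any value below
  \<open>2 + 2 * q' / d\<close>, whose fixed point for d > 2 is the critical exponent 2d/(d - 2).
  Below a subcritical q the gain has a positive lower bound, so finitely many steps from 2 reach
  q.\<close>

theorem subcritical_embedding:
  assumes q: "2 \<le> q" "q * (1 - 2 / real DIM('a)) < 2"
  shows "embeds q"
proof -
  let ?d = "real DIM('a)"
  \<comment> \<open>Half the distance from 2 of \<open>max 0 (q * (1 - 2 / ?d))\<close>; the minimum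
    with 2 covers the dimensions in which the factor is not positive.\<close>
  define \<delta> where "\<delta> = min 2 (2 - q * (1 - 2 / ?d)) / 2"
  have \<delta>: "0 < \<delta>" using q by (simp add: \<delta>_def)
  have gap: "q' + \<delta> < 2 + 2 * q' / ?d" if q': "2 \<le> q'" "q' \<le> q" for q'
  proof -
    have "q' * (1 - 2 / ?d) \<le> max 0 (q * (1 - 2 / ?d))"
    proof (cases "0 \<le> 1 - 2 / ?d")
      case True
      then have "q' * (1 - 2 / ?d) \<le> q * (1 - 2 / ?d)" using q' by (intro mult_right_mono)
      then show ?thesis by simp
    next
      case False
      then show ?thesis using q' by (simp add: mult_nonneg_nonpos max.coboundedI1)
    qed
    then have "q' - q' * (2 / ?d) \<le> 2 - 2 * \<delta>" by (auto simp: \<delta>_def min_def max_def algebra_simps split: if_splits)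
    moreover have "q' * (2 / ?d) = 2 * q' / ?d" by simp
    ultimately show ?thesis using \<delta> by linarith
  qed
  have "embeds (min q (2 + real k * \<delta>))" for k
  proof (induction k)
    case 0
    then show ?case using embeds_2 q by simp
  next
    case (Suc k)
    let ?q = "min q (2 + real k * \<delta>)"
    have q2: "2 \<le> ?q" "?q \<le> q" using q \<delta> by simp_all
    show ?case
    proof (rule embeds_step[OF q2(1) Suc.IH])
      show "0 < min q (2 + real (Suc k) * \<delta>)" using q \<delta> by (simp add: add_pos_nonneg)
      have "min q (2 + real (Suc k) * \<delta>) \<le> ?q + \<delta>" using \<delta> by (auto simp: min_def algebra_simps)
      also have "\<dots> < 2 + 2 * ?q / ?d" by (rule gap[OF q2])
      finally show "min q (2 + real (Suc k) * \<delta>) < 2 + 2 * ?q / ?d" .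
    qed
  qed
  moreover obtain k :: nat where "q < real k * \<delta>" using reals_Archimedean3[OF \<delta>] by blast
  then have "min q (2 + real k * \<delta>) = q" by simp
  ultimately show ?thesis by metis
qed

text \<open>Density of test functions, an almost everywhere convergent subsequence and Fatou's
  lemma. The strict bound on the norm leaves room for approximating test functions of norm at most
  1.\<close>

lemma embeds_Hs:
  assumes q: "1 \<le> q" "embeds q"
  shows "\<exists>C\<ge>0. \<forall>v\<in>Hs. Hsp.nr v < 1 \<longrightarrow> integrable lebesgue (\<lambda>x. \<bar>rep_L0 v x\<bar> powr q) \<and> (LINT x|lebesgue. \<bar>rep_L0 v x\<bar> powr q) \<le> C"
proof -
  obtain C where C: "C > 0" "\<And>\<phi>. \<phi> \<in> test_functions \<Omega> \<Longrightarrow> Hsp.nr (abs_L0 \<phi>) \<le> 1 \<Longrightarrow> (LINT x|lborel. \<bar>\<phi> x\<bar> powr q) \<le> C"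
    using q(2) unfolding embeds_def by blast
  have "integrable lebesgue (\<lambda>x. \<bar>rep_L0 v x\<bar> powr q) \<and> (LINT x|lebesgue. \<bar>rep_L0 v x\<bar> powr q) \<le> C"
    if v: "v \<in> Hs" "Hsp.nr v < 1" for v
  proof -
    obtain \<phi>0 where \<phi>0: "\<And>n. \<phi>0 n \<in> test_functions \<Omega>" and lim0: "Hsp.sconv (\<lambda>n. abs_L0 (\<phi>0 n)) v"
      using Hs_test_seq[of "\<lambda>_. v"] v by (auto simp: Hsp.sconv_def)
    obtain N where N: "\<And>n. n \<ge> N \<Longrightarrow> Hsp.nr (abs_L0 (\<phi>0 n)) < 1"
      using order_tendstoD(2)[OF Hsp.sconv_nr[OF lim0] v(2)] by (auto simp: eventually_sequentially)
    define \<phi> where "\<phi> n = \<phi>0 (n + N)" for n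
    have \<phi>: "\<phi> n \<in> test_functions \<Omega>" "Hsp.nr (abs_L0 (\<phi> n)) \<le> 1" for n
      using \<phi>0 N[of "n + N"] by (simp_all add: \<phi>_def less_imp_le)
    have lim: "Hsp.sconv (\<lambda>n. abs_L0 (\<phi> n)) v"
      using LIMSEQ_ignore_initial_segment[OF lim0[unfolded Hsp.sconv_def], of N]
      by (simp add: Hsp.sconv_def \<phi>_def)
    obtain r where r: "strict_mono r" "AE x in lebesgue. (\<lambda>n. rep_L0 (abs_L0 (\<phi> (r n))) x) \<longlonglongrightarrow> rep_L0 v x"
      using L2_AE_subseq[OF Hsp_sconv_l2[OF lim test_Hs[OF \<phi>(1)] v(1)] test_L2[OF \<phi>(1)] Hs_L2[OF v(1)]] by blast
    have "AE x in lebesgue. \<forall>n. rep_L0 (abs_L0 (\<phi> n)) x = \<phi> n x"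
      unfolding AE_all_countable using test_rep[OF \<phi>(1)] by blast
    with r(2) have "AE x in lebesgue. (\<lambda>n. \<bar>\<phi> (r n) x\<bar> powr q) \<longlonglongrightarrow> \<bar>rep_L0 v x\<bar> powr q"
    proof eventually_elim
      case (elim x)
      from elim have "(\<lambda>n. \<phi> (r n) x) \<longlonglongrightarrow> rep_L0 v x" by simp
      then show ?case using q(1) by (intro tendsto_powr' tendsto_rabs tendsto_const) auto
    qed
    moreover have "integrable lebesgue (\<lambda>x. \<bar>\<phi> (r n) x\<bar> powr q)" and
      "(LINT x|lebesgue. \<bar>\<phi> (r n) x\<bar> powr q) \<le> C" for n
    proof -
      have m: "(\<lambda>x. \<bar>\<phi> (r n) x\<bar> powr q) \<in> borel_measurable lborel" using test_measurable[OF \<phi>(1)] by simp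
      show "integrable lebesgue (\<lambda>x. \<bar>\<phi> (r n) x\<bar> powr q)"
        using test_powr_integrable[OF \<phi>(1), of q] q by (simp add: integrable_completion[OF m])
      show "(LINT x|lebesgue. \<bar>\<phi> (r n) x\<bar> powr q) \<le> C"
        using C(2)[OF \<phi>] by (simp add: integral_completion[OF m])
    qed
    ultimately show ?thesis
      using Fatou_bound[of lebesgue "\<lambda>n x. \<bar>\<phi> (r n) x\<bar> powr q" "\<lambda>x. \<bar>rep_L0 v x\<bar> powr q" C] by simp
  qed
  then show ?thesis using C(1) by (intro exI[of _ C]) auto
qed

lemma powr_interpolation:
  assumes "1 \<le> q" "q < s" "0 < M" "0 \<le> t"
  shows "t powr q \<le> M powr (q - s) * t powr s + M powr (q - 1) * (t::real)"
proof (cases "t \<le> M")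
  case True
  have "t powr q = t powr (q - 1) * t"
    using assms powr_add[of t "q - 1" 1] by (cases "t = 0") simp_all
  also have "\<dots> \<le> M powr (q - 1) * t" using True assms by (intro mult_right_mono powr_mono2) simp_all
  finally show ?thesis by (simp add: add_increasing)
next
  case False
  have "t powr q = t powr (q - s) * t powr s" using False assms by (simp flip: powr_add)
  also have "\<dots> \<le> M powr (q - s) * t powr s" using False assms by (intro mult_right_mono powr_mono2') simp_all
  finally show ?thesis using assms by (simp add: add_increasing2)
qed

lemma Hs_L1_bound: "\<exists>C\<ge>0. \<forall>v\<in>Hs. (LINT x|lebesgue. \<bar>rep_L0 v x\<bar>) \<le> C * Hsp.nr v"
proof -
  obtain C where C: "C > 0" "\<And>v. v \<in> Hs \<Longrightarrow> l2.nr v \<le> C * Hsp.nr v" using nr_L2_le by blast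
  have "(LINT x|lebesgue. \<bar>rep_L0 v x\<bar>) \<le> (C * l2.nr one\<Omega>) * Hsp.nr v" if "v \<in> Hs" for v
    using order_trans[OF L1_le[OF Hs_L2\<Omega>[OF that]] mult_right_mono[OF C(2)[OF that] l2.nr_nonneg]]
    by (simp add: mult_ac)
  then show ?thesis using C(1) by (intro exI[of _ "C * l2.nr one\<Omega>"]) simp
qed

text \<open>Interpolation between exponent 1, where weakly null sequences converge strongly, and a
  larger exponent s, where they stay bounded; such an s exists because the subcritical condition is
  open. The cut-off M is made large first, then n.\<close>

lemma compact_embedding:
  assumes q: "1 \<le> q" "q * (1 - 2 / real DIM('a)) < 2"
  shows "\<exists>C\<ge>0. \<forall>v\<in>Hs. Hsp.nr v < 1 \<longrightarrow> integrable lebesgue (\<lambda>x. \<bar>rep_L0 v x\<bar> powr q) \<and> (LINT x|lebesgue. \<bar>rep_L0 v x\<bar> powr q) \<le> C"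
    and "Hsp.wconv xs 0 \<Longrightarrow> (\<And>n. Hsp.nr (xs n) < 1) \<Longrightarrow> (\<lambda>n. LINT x|lebesgue. \<bar>rep_L0 (xs n) x\<bar> powr q) \<longlonglongrightarrow> 0"
proof -
  let ?d = "real DIM('a)"
  obtain s where s: "q < s" "2 \<le> s" "s * (1 - 2 / ?d) < 2"
  proof (cases "0 < 1 - 2 / ?d")
    case False
    show ?thesis
    proof
      show "q < max q 2 + 1" "2 \<le> max q 2 + 1" by simp_all
      show "(max q 2 + 1) * (1 - 2 / ?d) < 2"
        using mult_nonneg_nonpos[of "max q 2 + 1" "1 - 2 / ?d"] False by simp
    qed
  next
    case True
    have "2 * (1 - 2 / ?d) < 2" by simp
    with q(2) have "max q 2 * (1 - 2 / ?d) < 2" unfolding max_def by (simp split: if_splits)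
    with True have "max q 2 < 2 / (1 - 2 / ?d)" by (simp only: less_divide_eq if_True)
    then obtain s where "max q 2 < s" "s < 2 / (1 - 2 / ?d)" using dense by blast
    then show ?thesis using True by (intro that[of s]) (simp_all add: less_divide_eq)
  qed
  obtain C where C: "C \<ge> 0" "\<And>v. v \<in> Hs \<Longrightarrow> Hsp.nr v < 1 \<Longrightarrow> integrable lebesgue (\<lambda>x. \<bar>rep_L0 v x\<bar> powr s)"
    "\<And>v. v \<in> Hs \<Longrightarrow> Hsp.nr v < 1 \<Longrightarrow> (LINT x|lebesgue. \<bar>rep_L0 v x\<bar> powr s) \<le> C"
    using embeds_Hs[OF _ subcritical_embedding[OF s(2,3)]] s(2) by auto
  have est: "integrable lebesgue (\<lambda>x. \<bar>rep_L0 v x\<bar> powr q) \<and>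
      (LINT x|lebesgue. \<bar>rep_L0 v x\<bar> powr q) \<le> M powr (q - s) * C + M powr (q - 1) * (LINT x|lebesgue. \<bar>rep_L0 v x\<bar>)"
    if v: "v \<in> Hs" "Hsp.nr v < 1" and M: "M > 0" for v M
  proof -
    have i1: "integrable lebesgue (\<lambda>x. \<bar>rep_L0 v x\<bar>)" using L2\<Omega>_integrable[OF Hs_L2\<Omega>[OF v(1)]] by simp
    have i: "integrable lebesgue (\<lambda>x. M powr (q - s) * \<bar>rep_L0 v x\<bar> powr s + M powr (q - 1) * \<bar>rep_L0 v x\<bar>)"
      using C(2)[OF v] i1 by simp
    have le: "\<bar>rep_L0 v x\<bar> powr q \<le> M powr (q - s) * \<bar>rep_L0 v x\<bar> powr s + M powr (q - 1) * \<bar>rep_L0 v x\<bar>" for x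
      by (rule powr_interpolation[OF q(1) s(1) M]) simp
    have iq: "integrable lebesgue (\<lambda>x. \<bar>rep_L0 v x\<bar> powr q)"
      by (rule Bochner_Integration.integrable_bound[OF i]) (use le in \<open>auto intro!: order_trans[OF le] AE_I2\<close>)
    have "(LINT x|lebesgue. \<bar>rep_L0 v x\<bar> powr q) \<le>
        (LINT x|lebesgue. M powr (q - s) * \<bar>rep_L0 v x\<bar> powr s + M powr (q - 1) * \<bar>rep_L0 v x\<bar>)"
      by (rule integral_mono[OF iq i le])
    also have "\<dots> = M powr (q - s) * (LINT x|lebesgue. \<bar>rep_L0 v x\<bar> powr s) + M powr (q - 1) * (LINT x|lebesgue. \<bar>rep_L0 v x\<bar>)"
      using C(2)[OF v] i1 by simp
    also have "\<dots> \<le> M powr (q - s) * C + M powr (q - 1) * (LINT x|lebesgue. \<bar>rep_L0 v x\<bar>)"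
      using C(3)[OF v] by (intro add_right_mono mult_left_mono) simp_all
    finally show ?thesis using iq by blast
  qed
  obtain C1 where C1: "C1 \<ge> 0" "\<And>v. v \<in> Hs \<Longrightarrow> (LINT x|lebesgue. \<bar>rep_L0 v x\<bar>) \<le> C1 * Hsp.nr v"
    using Hs_L1_bound by blast
  have "integrable lebesgue (\<lambda>x. \<bar>rep_L0 v x\<bar> powr q) \<and> (LINT x|lebesgue. \<bar>rep_L0 v x\<bar> powr q) \<le> C + C1"
    if v: "v \<in> Hs" "Hsp.nr v < 1" for v
  proof -
    have "C1 * Hsp.nr v \<le> C1 * 1" using C1(1) v(2) by (intro mult_left_mono) simp_all
    then show ?thesis using est[OF v, of 1] C1(2)[OF v(1)] by simp
  qed
  then show "\<exists>C\<ge>0. \<forall>v\<in>Hs. Hsp.nr v < 1 \<longrightarrow> integrable lebesgue (\<lambda>x. \<bar>rep_L0 v x\<bar> powr q) \<and> (LINT x|lebesgue. \<bar>rep_L0 v x\<bar> powr q) \<le> C"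
    using C(1) C1(1) by (intro exI[of _ "C + C1"]) auto
  assume w: "Hsp.wconv xs 0" and xs1: "\<And>n. Hsp.nr (xs n) < 1"
  have xs: "xs n \<in> Hs" for n by (rule Hsp.wconv_mem[OF w])
  show "(\<lambda>n. LINT x|lebesgue. \<bar>rep_L0 (xs n) x\<bar> powr q) \<longlonglongrightarrow> 0"
  proof (rule order_tendstoI)
    fix e :: real assume e: "e < 0"
    have "e < (LINT x|lebesgue. \<bar>rep_L0 (xs n) x\<bar> powr q)" for n
      by (rule less_le_trans[OF e], rule integral_nonneg_AE) simp
    then show "\<forall>\<^sub>F n in sequentially. e < (LINT x|lebesgue. \<bar>rep_L0 (xs n) x\<bar> powr q)" by simp
  next
    fix e :: real assume e: "0 < e"
    have "((\<lambda>M. M powr (q - s) * C) \<longlongrightarrow> 0) at_top"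
      using s(1) by (intro tendsto_mult_left_zero tendsto_neg_powr filterlim_ident) simp
    then have "\<forall>\<^sub>F M in at_top. M powr (q - s) * C < e / 2"
      by (rule order_tendstoD) (use e in simp)
    then have "\<forall>\<^sub>F M in at_top. M powr (q - s) * C < e / 2 \<and> 0 < (M::real)"
      using eventually_gt_at_top[of 0] by eventually_elim simp
    then obtain M where M: "M powr (q - s) * C < e / 2" "0 < M"
      using eventually_happens trivial_limit_at_top_linorder by blast
    have "(\<lambda>n. M powr (q - 1) * (LINT x|lebesgue. \<bar>rep_L0 (xs n) x\<bar>)) \<longlonglongrightarrow> 0"
      by (intro tendsto_mult_right_zero compact_L1 w)
    then have "\<forall>\<^sub>F n in sequentially. M powr (q - 1) * (LINT x|lebesgue. \<bar>rep_L0 (xs n) x\<bar>) < e / 2"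
      by (rule order_tendstoD) (use e in simp)
    then show "\<forall>\<^sub>F n in sequentially. (LINT x|lebesgue. \<bar>rep_L0 (xs n) x\<bar> powr q) < e"
    proof eventually_elim
      case (elim n)
      then show ?case using est[OF xs xs1 M(2), of n] M(1) by auto
    qed
  qed
qed

end

subsection \<open>The pairing with Lebesgue spaces\<close>

lemma Hoelder:
  fixes f g :: "'a \<Rightarrow> real"
  assumes [measurable]: "f \<in> borel_measurable M" "g \<in> borel_measurable M"
    and pq: "1 < p" "1 < q" "1 / p + 1 / q = 1"
    and f: "integrable M (\<lambda>x. \<bar>f x\<bar> powr p)" and g: "integrable M (\<lambda>x. \<bar>g x\<bar> powr q)"
  shows "integrable M (\<lambda>x. f x * g x)"
    and "\<bar>LINT x|M. f x * g x\<bar> \<le> (LINT x|M. \<bar>f x\<bar> powr p) powr (1 / p) * (LINT x|M. \<bar>g x\<bar> powr q) powr (1 / q)"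
proof -
  have Young: "\<bar>a * b\<bar> \<le> \<bar>a\<bar> powr p / p + \<bar>b\<bar> powr q / q" for a b
    using Youngs_inequality[of p q "\<bar>a\<bar>" "\<bar>b\<bar>"] pq by (simp add: abs_mult)
  show int: "integrable M (\<lambda>x. f x * g x)"
  proof (rule Bochner_Integration.integrable_bound)
    show "integrable M (\<lambda>x. \<bar>f x\<bar> powr p / p + \<bar>g x\<bar> powr q / q)" using f g by simp
    show "AE x in M. norm (f x * g x) \<le> norm (\<bar>f x\<bar> powr p / p + \<bar>g x\<bar> powr q / q)"
      by (intro AE_I2) (metis Young abs_ge_self order_trans real_norm_def)
  qed simp
  define I J where "I = (LINT x|M. \<bar>f x\<bar> powr p)" and "J = (LINT x|M. \<bar>g x\<bar> powr q)"
  have IJ: "0 \<le> I" "0 \<le> J" unfolding I_def J_def by (rule integral_nonneg_AE, simp)+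
  have zero: "(LINT x|M. f x * g x) = 0" if "AE x in M. \<bar>f x\<bar> powr p = 0 \<or> \<bar>g x\<bar> powr q = 0"
  proof -
    have "AE x in M. f x * g x = 0" using that by eventually_elim (use pq in auto)
    then show ?thesis by (rule integral_eq_zero_AE)
  qed
  show "\<bar>LINT x|M. f x * g x\<bar> \<le> I powr (1 / p) * J powr (1 / q)"
  proof (cases "I = 0 \<or> J = 0")
    case True
    then have "(AE x in M. \<bar>f x\<bar> powr p = 0) \<or> (AE x in M. \<bar>g x\<bar> powr q = 0)"
      using integral_nonneg_eq_0_iff_AE[OF f] integral_nonneg_eq_0_iff_AE[OF g] unfolding I_def J_def by auto
    then have "AE x in M. \<bar>f x\<bar> powr p = 0 \<or> \<bar>g x\<bar> powr q = 0"
      by (auto elim!: eventually_mono simp del: powr_eq_0_iff)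
    then show ?thesis using zero by simp
  next
    case False
    define A B where "A = I powr (1 / p)" and "B = J powr (1 / q)"
    have AB: "A > 0" "B > 0" "A powr p = I" "B powr q = J"
      using False IJ pq by (simp_all add: A_def B_def powr_powr)
    have "\<bar>LINT x|M. f x * g x\<bar> \<le> (LINT x|M. A * B * (\<bar>f x\<bar> powr p / (p * I) + \<bar>g x\<bar> powr q / (q * J)))"
    proof (rule integral_abs_bound[THEN order_trans], rule integral_mono)
      show "integrable M (\<lambda>x. \<bar>f x * g x\<bar>)" using int by simp
      show "integrable M (\<lambda>x. A * B * (\<bar>f x\<bar> powr p / (p * I) + \<bar>g x\<bar> powr q / (q * J)))"
        using f g by simp
      fix x
      have "\<bar>f x * g x\<bar> = A * B * \<bar>(f x / A) * (g x / B)\<bar>"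
        using AB by (simp add: abs_mult)
      also have "\<dots> \<le> A * B * (\<bar>f x / A\<bar> powr p / p + \<bar>g x / B\<bar> powr q / q)"
        using AB by (intro mult_left_mono Young) simp
      also have "\<dots> = A * B * (\<bar>f x\<bar> powr p / (p * I) + \<bar>g x\<bar> powr q / (q * J))"
        using AB by (simp add: powr_divide mult.commute)
      finally show "\<bar>f x * g x\<bar> \<le> A * B * (\<bar>f x\<bar> powr p / (p * I) + \<bar>g x\<bar> powr q / (q * J))" .
    qed
    also have "\<dots> = A * B * (I / (p * I) + J / (q * J))"
      using f g by (simp add: I_def J_def)
    also have "\<dots> = A * B" using False pq by simp
    finally show ?thesis by (simp add: A_def B_def)
  qed
qed

context domain
begin

text \<open>The bounds are given on the open unit ball, so vectors are scaled to norm 1/2; hence the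
  factor 2.\<close>

lemma nr_rescale:
  assumes N: "\<And>c v. N (c *\<^sub>R v) = \<bar>c\<bar> * N v" and C: "\<And>v. v \<in> Hs \<Longrightarrow> Hsp.nr v < 1 \<Longrightarrow> N v \<le> C" and v: "v \<in> Hs"
  shows "N v \<le> (2 * C) * Hsp.nr v"
proof (cases "Hsp.nr v = 0")
  case True
  then have "v = 0" using Hsp.nr_eq_0D v by blast
  then have "N v = 0" using N[of 0 0] by simp
  then show ?thesis using True by simp
next
  case False
  then have p: "Hsp.nr v > 0" using Hsp.nr_nonneg[of v] by linarith
  define c where "c = 1 / (2 * Hsp.nr v)"
  have c: "c > 0" "c * Hsp.nr v = 1 / 2" using p by (simp_all add: c_def)
  have "N (c *\<^sub>R v) \<le> C" using v c by (intro C) (simp_all add: Hsp.nr_scale)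
  then have "c * N v \<le> C" using c by (simp add: N)
  then show ?thesis using p by (simp add: c_def field_simps)
qed

lemma null_rescale:
  assumes N: "\<And>c v. N (c *\<^sub>R v) = \<bar>c\<bar> * N v"
    and lim: "\<And>xs. Hsp.wconv xs 0 \<Longrightarrow> (\<And>n. Hsp.nr (xs n) < 1) \<Longrightarrow> (\<lambda>n. N (xs n)) \<longlonglongrightarrow> 0"
    and w: "Hsp.wconv xs 0"
  shows "(\<lambda>n. N (xs n)) \<longlonglongrightarrow> 0"
proof -
  obtain M where M: "\<And>n. Hsp.nr (xs n) \<le> M" using Hsp.wconv_bdd[OF w] by blast
  have M0: "0 \<le> M" using M[of 0] Hsp.nr_nonneg order_trans by blast
  define c where "c = 1 / (M + 1)"
  have c: "c > 0" using M0 by (simp add: c_def)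
  have "Hsp.nr (c *\<^sub>R xs n) < 1" for n
    using M[of n] M0 by (simp add: Hsp.nr_scale c_def field_simps)
  then have "(\<lambda>n. N (c *\<^sub>R xs n)) \<longlonglongrightarrow> 0"
    using Hsp.wconv_scale[OF w, of c] by (intro lim) simp_all
  then have "(\<lambda>n. (1 / c) * (c * N (xs n))) \<longlonglongrightarrow> 0"
    using c by (intro tendsto_mult_right_zero) (simp add: N)
  then show ?thesis using c by simp
qed

definition admissible :: "ereal \<Rightarrow> bool"
  where "admissible p \<longleftrightarrow> max 1 (ereal (2 * real DIM('a) / (real DIM('a) + 2))) < p"

lemma admissible_cases:
  assumes "admissible p"
  obtains "p = \<infinity>" | P where "p = ereal P" "1 < P" "2 * real DIM('a) / (real DIM('a) + 2) < P"
  using assms by (cases p) (auto simp: admissible_def one_ereal_def)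

lemma integral_pair_on:
  assumes "v \<in> Hs"
  shows "(LINT x|lebesgue_on \<Omega>. rep_L0 f x * rep_L0 v x) = ip2 f v"
  unfolding ip2_def
  by (rule integral_on_eq) (simp, use L2\<Omega>_vanishing[OF Hs_L2\<Omega>[OF assms]] in \<open>eventually_elim, simp\<close>)

text \<open>N is the norm of the conjugate Lebesgue space, with exponent 1 for infinite p. By
  duality, its convergence to zero along weakly null sequences expresses the compactness of the
  embedding of \<open>Lp \<Omega> p\<close> into the dual space. Keeping only these properties of N
  lets finite and infinite p be treated together afterwards.\<close>

lemma Lp_pairing:
  assumes "admissible p"
  shows "\<exists>N. (\<forall>f\<in>pts (Lp \<Omega> p). \<forall>v\<in>Hs. integrable lebesgue (\<lambda>x. rep_L0 f x * rep_L0 v x) \<and>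
        \<bar>ip2 f v\<bar> \<le> nrm (Lp \<Omega> p) f * N v) \<and>
      (\<exists>C. \<forall>v\<in>Hs. N v \<le> C * Hsp.nr v) \<and> (\<forall>xs. Hsp.wconv xs 0 \<longrightarrow> (\<lambda>n. N (xs n)) \<longlonglongrightarrow> 0)"
  using assms
proof (cases rule: admissible_cases)
  case 1
  define N where "N v = (LINT x|lebesgue. \<bar>rep_L0 v x\<bar>)" for v :: "'a L0"
  have "integrable lebesgue (\<lambda>x. rep_L0 f x * rep_L0 v x) \<and> \<bar>ip2 f v\<bar> \<le> nrm (Lp \<Omega> p) f * N v"
    if f: "f \<in> pts (Lp \<Omega> p)" and v: "v \<in> Hs" for f v
  proof -
    define c where "c = nrm (Lp \<Omega> p) f"
    define s where "s = esssup (lebesgue_on \<Omega>) (\<lambda>x. ereal \<bar>rep_L0 f x\<bar>)"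
    have cs: "c = real_of_ereal s" using 1 by (simp add: c_def s_def Lp_def)
    obtain B where B: "AE x in lebesgue_on \<Omega>. \<bar>rep_L0 f x\<bar> \<le> B" using f 1 by (auto simp: Lp_def)
    have "rep_L0 f \<in> borel_measurable (lebesgue_on \<Omega>)" by (rule measurable_restrict_space1) simp
    then have m: "(\<lambda>x. ereal \<bar>rep_L0 f x\<bar>) \<in> borel_measurable (lebesgue_on \<Omega>)" by simp
    have "s \<le> ereal B" unfolding s_def using B by (intro esssup_I[OF m]) simp
    then have sfin: "s \<noteq> \<infinity>" by auto
    have "AE x in lebesgue_on \<Omega>. ereal \<bar>rep_L0 f x\<bar> \<le> s"
      unfolding s_def by (rule esssup_AE)
    then have "AE x in lebesgue_on \<Omega>. \<bar>rep_L0 f x\<bar> \<le> c"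
    proof eventually_elim
      case (elim x)
      then show ?case using sfin unfolding cs by (cases s) auto
    qed
    then have le: "AE x in lebesgue. x \<in> \<Omega> \<longrightarrow> \<bar>rep_L0 f x\<bar> \<le> c" by (simp add: AE_on_iff)
    have b: "AE x in lebesgue. \<bar>rep_L0 f x * rep_L0 v x\<bar> \<le> c * \<bar>rep_L0 v x\<bar>"
      using le L2\<Omega>_vanishing[OF Hs_L2\<Omega>[OF v]]
    proof eventually_elim
      case (elim x)
      then show ?case by (cases "x \<in> \<Omega>") (auto simp: abs_mult mult_right_mono)
    qed
    have vi: "integrable lebesgue (\<lambda>x. c * \<bar>rep_L0 v x\<bar>)" using L2\<Omega>_integrable[OF Hs_L2\<Omega>[OF v]] by simp
    have i: "integrable lebesgue (\<lambda>x. rep_L0 f x * rep_L0 v x)"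
    proof (rule Bochner_Integration.integrable_bound[OF vi])
      show "AE x in lebesgue. norm (rep_L0 f x * rep_L0 v x) \<le> norm (c * \<bar>rep_L0 v x\<bar>)"
        using b unfolding real_norm_def
      proof eventually_elim
        case (elim x)
        then show ?case by (rule order_trans) (rule abs_ge_self)
      qed
    qed simp
    have "\<bar>ip2 f v\<bar> \<le> (LINT x|lebesgue. c * \<bar>rep_L0 v x\<bar>)"
      unfolding ip2_def
      by (rule integral_abs_bound[THEN order_trans], rule integral_mono_AE[OF _ vi b]) (use i in simp)
    then show ?thesis using i by (simp add: N_def c_def)
  qed
  moreover have "\<exists>C. \<forall>v\<in>Hs. N v \<le> C * Hsp.nr v" using Hs_L1_bound by (auto simp: N_def)
  moreover have "(\<lambda>n. N (xs n)) \<longlonglongrightarrow> 0" if "Hsp.wconv xs 0" for xs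
    unfolding N_def by (rule compact_L1[OF that])
  ultimately show ?thesis by blast
next
  case (2 P)
  let ?d = "real DIM('a)"
  define q where "q = P / (P - 1)"
  have q: "1 < q" "1 / P + 1 / q = 1" using 2 by (simp_all add: q_def field_simps)
  \<comment> \<open>For the conjugate exponent the subcritical condition is the lower bound on P in
    another form.\<close>
  have sub: "q * (1 - 2 / ?d) < 2"
  proof -
    have "2 * ?d < P * (?d + 2)" using 2(3) by (simp add: divide_less_eq)
    then have "P * (?d - 2) < 2 * (?d * (P - 1))" by (simp add: algebra_simps)
    moreover have "0 < ?d * (P - 1)" using 2(2) by simp
    ultimately have "P * (?d - 2) / (?d * (P - 1)) < 2" by (simp add: divide_less_eq)
    moreover have "q * (1 - 2 / ?d) = P * (?d - 2) / (?d * (P - 1))"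
      using 2(2) by (simp add: q_def field_simps)
    ultimately show ?thesis by simp
  qed
  define N where "N v = (LINT x|lebesgue. \<bar>rep_L0 v x\<bar> powr q) powr (1 / q)" for v :: "'a L0"
  have N_scale: "N (c *\<^sub>R v) = \<bar>c\<bar> * N v" for c v
  proof -
    have "(LINT x|lebesgue. \<bar>rep_L0 (c *\<^sub>R v) x\<bar> powr q) = (LINT x|lebesgue. \<bar>c\<bar> powr q * \<bar>rep_L0 v x\<bar> powr q)"
      by (rule integral_L0_cong, use rep_scale[of c v] in \<open>eventually_elim, simp add: abs_mult powr_mult\<close>) simp_all
    then have "N (c *\<^sub>R v) = (\<bar>c\<bar> powr q * (LINT x|lebesgue. \<bar>rep_L0 v x\<bar> powr q)) powr (1 / q)"
      by (simp add: N_def)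
    also have "\<dots> = (\<bar>c\<bar> powr q) powr (1 / q) * N v"
      unfolding N_def by (rule powr_mult)
    also have "(\<bar>c\<bar> powr q) powr (1 / q) = \<bar>c\<bar>" using q by (simp add: powr_powr)
    finally show ?thesis .
  qed
  note emb = compact_embedding[OF less_imp_le[OF q(1)] sub]
  obtain C where C: "C \<ge> 0" "\<And>v. v \<in> Hs \<Longrightarrow> Hsp.nr v < 1 \<Longrightarrow> integrable lebesgue (\<lambda>x. \<bar>rep_L0 v x\<bar> powr q)"
    "\<And>v. v \<in> Hs \<Longrightarrow> Hsp.nr v < 1 \<Longrightarrow> (LINT x|lebesgue. \<bar>rep_L0 v x\<bar> powr q) \<le> C"
    using emb(1) by auto
  have vint: "integrable lebesgue (\<lambda>x. \<bar>rep_L0 v x\<bar> powr q)" if v: "v \<in> Hs" for v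
  proof -
    define c where "c = 1 / (Hsp.nr v + 1)"
    have c: "c > 0" using Hsp.nr_nonneg[of v] by (simp add: c_def add_nonneg_pos)
    have "Hsp.nr (c *\<^sub>R v) < 1" using Hsp.nr_nonneg[of v]
      by (simp add: Hsp.nr_scale c_def divide_less_eq add_nonneg_pos)
    from C(2)[OF _ this] v have "integrable lebesgue (\<lambda>x. \<bar>rep_L0 (c *\<^sub>R v) x\<bar> powr q)" by simp
    then have "integrable lebesgue (\<lambda>x. (1 / c) powr q * \<bar>rep_L0 (c *\<^sub>R v) x\<bar> powr q)" by simp
    then show ?thesis
    proof (rule integrable_cong_AE_imp)
      show "AE x in lebesgue. (1 / c) powr q * \<bar>rep_L0 (c *\<^sub>R v) x\<bar> powr q = \<bar>rep_L0 v x\<bar> powr q"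
        using rep_scale[of c v]
      proof eventually_elim
        case (elim x)
        have "(1 / c) powr q * \<bar>c * rep_L0 v x\<bar> powr q = ((1 / c) * \<bar>c * rep_L0 v x\<bar>) powr q"
          by (rule powr_mult[symmetric])
        then show ?case using elim c by (simp add: abs_mult)
      qed
    qed simp
  qed
  have "N v \<le> C powr (1 / q)" if "v \<in> Hs" "Hsp.nr v < 1" for v
    unfolding N_def using C(3)[OF that] q by (intro powr_mono2 integral_nonneg_AE) simp_all
  from nr_rescale[OF N_scale this] have b: "\<exists>C. \<forall>v\<in>Hs. N v \<le> C * Hsp.nr v" by blast
  have l: "(\<lambda>n. N (xs n)) \<longlonglongrightarrow> 0" if "Hsp.wconv xs 0" for xs
  proof (rule null_rescale[OF N_scale _ that])
    fix ys assume "Hsp.wconv ys 0" "\<And>n. Hsp.nr (ys n) < 1"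
    from emb(2)[OF this] have "(\<lambda>n. (LINT x|lebesgue. \<bar>rep_L0 (ys n) x\<bar> powr q) powr (1 / q)) \<longlonglongrightarrow> 0 powr (1 / q)"
      using q by (intro tendsto_powr' tendsto_const) (auto intro!: always_eventually integral_nonneg_AE)
    then show "(\<lambda>n. N (ys n)) \<longlonglongrightarrow> 0" using q by (simp add: N_def)
  qed
  have "integrable lebesgue (\<lambda>x. rep_L0 f x * rep_L0 v x) \<and> \<bar>ip2 f v\<bar> \<le> nrm (Lp \<Omega> p) f * N v"
    if f: "f \<in> pts (Lp \<Omega> p)" and v: "v \<in> Hs" for f v
  proof -
    have van: "AE x in lebesgue. x \<notin> \<Omega> \<longrightarrow> \<bar>rep_L0 f x\<bar> powr P = 0"
    proof -
      have "AE x in lebesgue. x \<notin> \<Omega> \<longrightarrow> rep_L0 f x = 0" using f by (simp add: Lp_def)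
      then show ?thesis by eventually_elim simp
    qed
    have fi: "integrable lebesgue (\<lambda>x. \<bar>rep_L0 f x\<bar> powr P)"
      using f 2(1) integrable_on_iff[OF _ van] by (simp add: Lp_def)
    have fn: "nrm (Lp \<Omega> p) f = (LINT x|lebesgue. \<bar>rep_L0 f x\<bar> powr P) powr (1 / P)"
      using 2(1) integral_on_eq[OF _ van] by (simp add: Lp_def)
    show ?thesis
      using Hoelder[OF rep_L0_measurable rep_L0_measurable 2(2) q fi vint[OF v]] by (simp add: ip2_def fn N_def)
  qed
  then show ?thesis using b l by blast
qed

lemma Lp_add:
  assumes p: "admissible p" and f: "f \<in> pts (Lp \<Omega> p)" and g: "g \<in> pts (Lp \<Omega> p)"
  shows "f + g \<in> pts (Lp \<Omega> p)"
proof -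
  have van: "vanishing (f + g)"
    by (rule vanishing_add) (use f g in \<open>simp_all add: Lp_def vanishing_def\<close>)
  have add: "AE x in lebesgue_on \<Omega>. rep_L0 (f + g) x = rep_L0 f x + rep_L0 g x"
    unfolding AE_on_iff using rep_add[of f g] by eventually_elim simp
  have m: "rep_L0 h \<in> borel_measurable (lebesgue_on \<Omega>)" for h by (rule measurable_restrict_space1) simp
  show ?thesis using p
  proof (cases rule: admissible_cases)
    case 1
    obtain A B where "AE x in lebesgue_on \<Omega>. \<bar>rep_L0 f x\<bar> \<le> A" "AE x in lebesgue_on \<Omega>. \<bar>rep_L0 g x\<bar> \<le> B"
      using f g 1 by (auto simp: Lp_def)
    with add have "AE x in lebesgue_on \<Omega>. \<bar>rep_L0 (f + g) x\<bar> \<le> A + B" by eventually_elim linarith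
    then show ?thesis using van 1 by (auto simp: Lp_def vanishing_def)
  next
    case (2 P)
    have fg: "integrable (lebesgue_on \<Omega>) (\<lambda>x. 2 powr P * (\<bar>rep_L0 f x\<bar> powr P + \<bar>rep_L0 g x\<bar> powr P))"
      using f g 2 by (simp add: Lp_def)
    have "integrable (lebesgue_on \<Omega>) (\<lambda>x. \<bar>rep_L0 (f + g) x\<bar> powr P)"
    proof (rule Bochner_Integration.integrable_bound[OF fg])
      show "(\<lambda>x. \<bar>rep_L0 (f + g) x\<bar> powr P) \<in> borel_measurable (lebesgue_on \<Omega>)" using m[of "f + g"] by simp
      show "AE x in lebesgue_on \<Omega>. norm (\<bar>rep_L0 (f + g) x\<bar> powr P) \<le> norm (2 powr P * (\<bar>rep_L0 f x\<bar> powr P + \<bar>rep_L0 g x\<bar> powr P))"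
        using add
      proof eventually_elim
        case (elim x)
        define a b where "a = \<bar>rep_L0 f x\<bar>" and "b = \<bar>rep_L0 g x\<bar>"
        have "\<bar>rep_L0 f x + rep_L0 g x\<bar> powr P \<le> (2 * max a b) powr P"
          using 2(2) unfolding a_def b_def by (intro powr_mono2) auto
        also have "\<dots> = 2 powr P * (max a b) powr P" by (rule powr_mult)
        also have "(max a b) powr P \<le> a powr P + b powr P" by (auto simp: max_def)
        finally show ?case by (simp add: elim a_def b_def)
      qed
    qed
    then show ?thesis using van 2(1) by (simp add: Lp_def vanishing_def)
  qed
qed

lemma Lp_scale:
  assumes p: "admissible p" and f: "f \<in> pts (Lp \<Omega> p)"
  shows "c *\<^sub>R f \<in> pts (Lp \<Omega> p)"
proof -
  have van: "vanishing (c *\<^sub>R f)"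
    by (rule vanishing_scale) (use f in \<open>simp_all add: Lp_def vanishing_def\<close>)
  have sc: "AE x in lebesgue_on \<Omega>. rep_L0 (c *\<^sub>R f) x = c * rep_L0 f x"
    unfolding AE_on_iff using rep_scale[of c f] by eventually_elim simp
  have m: "rep_L0 h \<in> borel_measurable (lebesgue_on \<Omega>)" for h by (rule measurable_restrict_space1) simp
  show ?thesis using p
  proof (cases rule: admissible_cases)
    case 1
    obtain A where "AE x in lebesgue_on \<Omega>. \<bar>rep_L0 f x\<bar> \<le> A" using f 1 by (auto simp: Lp_def)
    with sc have "AE x in lebesgue_on \<Omega>. \<bar>rep_L0 (c *\<^sub>R f) x\<bar> \<le> \<bar>c\<bar> * A"
      by eventually_elim (simp add: abs_mult mult_left_mono)
    then show ?thesis using van 1 by (auto simp: Lp_def vanishing_def)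
  next
    case (2 P)
    have "integrable (lebesgue_on \<Omega>) (\<lambda>x. \<bar>c\<bar> powr P * \<bar>rep_L0 f x\<bar> powr P)"
      using f 2 by (simp add: Lp_def)
    then have "integrable (lebesgue_on \<Omega>) (\<lambda>x. \<bar>rep_L0 (c *\<^sub>R f) x\<bar> powr P)"
    proof (rule integrable_cong_AE_imp)
      show "(\<lambda>x. \<bar>rep_L0 (c *\<^sub>R f) x\<bar> powr P) \<in> borel_measurable (lebesgue_on \<Omega>)" using m[of "c *\<^sub>R f"] by simp
      show "AE x in lebesgue_on \<Omega>. \<bar>c\<bar> powr P * \<bar>rep_L0 f x\<bar> powr P = \<bar>rep_L0 (c *\<^sub>R f) x\<bar> powr P"
        using sc by eventually_elim (simp add: abs_mult powr_mult)
    qed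
    then show ?thesis using van 2(1) by (simp add: Lp_def vanishing_def)
  qed
qed

lemma ip2_add_integrable:
  assumes "integrable lebesgue (\<lambda>x. rep_L0 f x * rep_L0 v x)" "integrable lebesgue (\<lambda>x. rep_L0 g x * rep_L0 v x)"
  shows "ip2 (f + g) v = ip2 f v + ip2 g v"
proof -
  have "ip2 (f + g) v = (LINT x|lebesgue. rep_L0 f x * rep_L0 v x + rep_L0 g x * rep_L0 v x)"
    unfolding ip2_def
    by (rule integral_L0_cong) (use rep_add[of f g] in \<open>eventually_elim, simp add: algebra_simps\<close>, simp_all)
  also have "\<dots> = ip2 f v + ip2 g v" using assms by (simp add: ip2_def)
  finally show ?thesis .
qed

end

subsection \<open>The obstacle problem on a domain\<close>

locale obstacle_problem = domain \<Omega> for \<Omega> :: "'a::euclidean_space set" +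
  fixes \<psi> :: "'a \<Rightarrow> ereal"
  assumes K_nonempty: "obstacle_set \<Omega> \<psi> \<noteq> {}"
begin

definition K :: "'a L0 set" where "K = obstacle_set \<Omega> \<psi>"

lemma K_iff: "v \<in> K \<longleftrightarrow> v \<in> Hs \<and> (AE x in lebesgue. x \<in> \<Omega> \<longrightarrow> \<psi> x \<le> ereal (rep_L0 v x))"
  by (simp add: K_def obstacle_set_def Hs_def AE_on_iff)

text \<open>The weak solution of the Poisson equation with right-hand side one: the inner product
  with it is integration, as the abstract vector \<open>\<eta>\<close> demands.\<close>

definition mass :: "'a L0" where "mass = (SOME y. y \<in> Hs \<and> (\<forall>v\<in>Hs. ip2 v one\<Omega> = ipH y v))"

lemma mass: "mass \<in> Hs" "v \<in> Hs \<Longrightarrow> ipH mass v = (LINT x|lebesgue. rep_L0 v x)"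
proof -
  have "\<exists>y. y \<in> Hs \<and> (\<forall>v\<in>Hs. ip2 v one\<Omega> = ipH y v)" using L2_Riesz[OF one\<Omega>_L2] by blast
  from someI_ex[OF this] show "mass \<in> Hs" "v \<in> Hs \<Longrightarrow> ipH mass v = (LINT x|lebesgue. rep_L0 v x)"
    unfolding mass_def[symmetric] using ip2_one\<Omega>[OF Hs_L2\<Omega>] by auto
qed

sublocale obs: obstacle_hilbert ipH Hs mass K
proof unfold_locales
  show "pprt v \<in> Hs" "ipH (pprt v) (pprt v) \<le> ipH v (pprt v)" if "v \<in> Hs" for v
    using pprt_Hs[OF that] by auto
  show "mass \<in> Hs" by (rule mass)
  show "0 \<le> ipH mass v" if "v \<in> Hs" "0 \<le> v" for v
  proof -
    have "AE x in lebesgue. 0 \<le> rep_L0 v x"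
      using that(2) rep_zero unfolding less_eq_L0_def by eventually_elim simp
    then show ?thesis unfolding mass(2)[OF that(1)] by (rule integral_nonneg_AE)
  qed
  show "v = 0" if v: "v \<in> Hs" "0 \<le> v" "ipH mass v = 0" for v
  proof -
    have "AE x in lebesgue. 0 \<le> rep_L0 v x"
      using v(2) rep_zero unfolding less_eq_L0_def by eventually_elim simp
    then have "AE x in lebesgue. rep_L0 v x = 0"
      using v(3) integral_nonneg_eq_0_iff_AE[OF L2\<Omega>_integrable[OF Hs_L2\<Omega>[OF v(1)]]] by (simp add: mass(2)[OF v(1)])
    with rep_zero have "AE x in lebesgue. rep_L0 v x = rep_L0 0 x" by eventually_elim simp
    then show ?thesis by (rule L0_eqI)
  qed
  show "(\<lambda>n. ipH mass \<bar>xs n\<bar>) \<longlonglongrightarrow> 0" if w: "Hsp.wconv xs 0" for xs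
  proof -
    have "ipH mass \<bar>xs n\<bar> = (LINT x|lebesgue. \<bar>rep_L0 (xs n) x\<bar>)" for n
    proof -
      have x: "xs n \<in> Hs" by (rule Hsp.wconv_mem[OF w])
      have "\<bar>xs n\<bar> \<in> Hs" unfolding abs_pprt
        using pprt_Hs[OF x] pprt_Hs[of "- xs n"] x subspace_neg[OF subspace_Hs x] by simp
      then have "ipH mass \<bar>xs n\<bar> = (LINT x|lebesgue. rep_L0 \<bar>xs n\<bar> x)" by (rule mass(2))
      also have "\<dots> = (LINT x|lebesgue. \<bar>rep_L0 (xs n) x\<bar>)"
        by (rule integral_L0_cong) (use rep_abs[of "xs n"] in simp_all)
      finally show ?thesis .
    qed
    then show ?thesis using compact_L1[OF w] by simp
  qed
  show "K \<subseteq> Hs" by (auto simp: K_iff)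
  show "K \<noteq> {}" using K_nonempty by (simp add: K_def)
  show "convex K"
  proof (rule convexI)
    fix v w s t assume a: "v \<in> K" "w \<in> K" "0 \<le> s" "0 \<le> t" "s + t = (1::real)"
    have "AE x in lebesgue. x \<in> \<Omega> \<longrightarrow> \<psi> x \<le> ereal (rep_L0 v x)" "AE x in lebesgue. x \<in> \<Omega> \<longrightarrow> \<psi> x \<le> ereal (rep_L0 w x)"
      using a by (simp_all add: K_iff)
    with rep_add[of "s *\<^sub>R v" "t *\<^sub>R w"] rep_scale[of s v] rep_scale[of t w]
    have "AE x in lebesgue. x \<in> \<Omega> \<longrightarrow> \<psi> x \<le> ereal (rep_L0 (s *\<^sub>R v + t *\<^sub>R w) x)"
    proof eventually_elim
      case (elim x)
      have "min (rep_L0 v x) (rep_L0 w x) = s * min (rep_L0 v x) (rep_L0 w x) + t * min (rep_L0 v x) (rep_L0 w x)"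
        using a(5) by (simp flip: distrib_right)
      also have "\<dots> \<le> s * rep_L0 v x + t * rep_L0 w x"
        using a by (intro add_mono mult_left_mono) simp_all
      finally have m: "ereal (min (rep_L0 v x) (rep_L0 w x)) \<le> ereal (s * rep_L0 v x + t * rep_L0 w x)" by (simp only: ereal_less_eq)
      show ?case
      proof
        assume "x \<in> \<Omega>"
        then have "\<psi> x \<le> ereal (min (rep_L0 v x) (rep_L0 w x))" using elim by (simp add: min_def del: ereal_min)
        then show "\<psi> x \<le> ereal (rep_L0 (s *\<^sub>R v + t *\<^sub>R w) x)"
          using order_trans[OF _ m] elim by (simp del: ereal_min)
      qed
    qed
    then show "s *\<^sub>R v + t *\<^sub>R w \<in> K" using a by (simp add: K_iff)
  qed
  \<comment> \<open>Norm convergence gives an almost everywhere convergent subsequence, along which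
    the obstacle condition passes to the limit pointwise.\<close>
  show "Hsp.sclosed K"
    unfolding Hsp.sclosed_def
  proof (intro allI impI)
    fix vs v assume vs: "\<forall>n. vs n \<in> K" and v: "v \<in> Hs" "Hsp.sconv vs v"
    have vsH: "vs n \<in> Hs" for n using vs by (simp add: K_iff)
    obtain r where r: "strict_mono r" "AE x in lebesgue. (\<lambda>n. rep_L0 (vs (r n)) x) \<longlonglongrightarrow> rep_L0 v x"
      using L2_AE_subseq[OF Hsp_sconv_l2[OF v(2) vsH v(1)] Hs_L2[OF vsH] Hs_L2[OF v(1)]] by blast
    have "AE x in lebesgue. \<forall>n. x \<in> \<Omega> \<longrightarrow> \<psi> x \<le> ereal (rep_L0 (vs n) x)"
      unfolding AE_all_countable using vs by (simp add: K_iff)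
    with r(2) have "AE x in lebesgue. x \<in> \<Omega> \<longrightarrow> \<psi> x \<le> ereal (rep_L0 v x)"
    proof eventually_elim
      case (elim x)
      show ?case
      proof
        assume "x \<in> \<Omega>"
        then show "\<psi> x \<le> ereal (rep_L0 v x)"
          using elim by (intro LIMSEQ_le_const[OF tendsto_ereal[OF elim(1)]]) auto
      qed
    qed
    then show "v \<in> K" using v by (simp add: K_iff)
  qed
  show "w \<in> K" if "v \<in> K" "w \<in> Hs" "v \<le> w" for v w
  proof -
    have "AE x in lebesgue. x \<in> \<Omega> \<longrightarrow> \<psi> x \<le> ereal (rep_L0 v x)" using that by (simp add: K_iff)
    moreover have "AE x in lebesgue. rep_L0 v x \<le> rep_L0 w x" using that by (simp add: less_eq_L0_def)
    ultimately have "AE x in lebesgue. x \<in> \<Omega> \<longrightarrow> \<psi> x \<le> ereal (rep_L0 w x)"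
      by eventually_elim (auto intro: order_trans)
    then show ?thesis using that by (simp add: K_iff)
  qed
  show "inf v w \<in> K" if "v \<in> K" "w \<in> K" for v w
  proof -
    have "AE x in lebesgue. x \<in> \<Omega> \<longrightarrow> \<psi> x \<le> ereal (rep_L0 v x)" "AE x in lebesgue. x \<in> \<Omega> \<longrightarrow> \<psi> x \<le> ereal (rep_L0 w x)"
      using that by (simp_all add: K_iff)
    with rep_inf[of v w] have "AE x in lebesgue. x \<in> \<Omega> \<longrightarrow> \<psi> x \<le> ereal (rep_L0 (inf v w) x)"
      by eventually_elim (auto simp: min_def)
    moreover have "inf v w \<in> Hs"
      unfolding inf_pprt using that pprt_Hs[of "v - w"] by (simp add: K_iff)
    ultimately show ?thesis by (simp add: K_iff)
  qed
qed

section \<open>Transfer to the dual space through the Riesz isomorphism\<close>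

abbreviation "X \<equiv> Hm1 \<Omega>"
abbreviation "Y \<equiv> H10 \<Omega>"
abbreviation "L \<equiv> neg_Laplace \<Omega>"
abbreviation "S \<equiv> obstacle_S \<Omega> \<psi>"

lemma pts_Y: "pts Y = Hs" by (simp add: Hs_def)

lemma nrm_Y: "v \<in> Hs \<Longrightarrow> nrm Y v = Hsp.nr v"
  by (simp add: H10_def H10_inner_eq Hs_H1s Hsp.nr_def ipH_eq)

lemma L_apply: assumes "w \<in> Hs" shows "L w v = (if v \<in> Hs then ipH w v else 0)"
  using assms by (simp add: neg_Laplace_def zero_ext_def pts_Y H10_inner_eq Hs_H1s ipH_eq)

lemma L_add: "v \<in> Hs \<Longrightarrow> w \<in> Hs \<Longrightarrow> L v + L w = L (v + w)"
  and L_diff: "v \<in> Hs \<Longrightarrow> w \<in> Hs \<Longrightarrow> L v - L w = L (v - w)"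
  and L_scale: "v \<in> Hs \<Longrightarrow> c *\<^sub>R L v = L (c *\<^sub>R v)"
  by (auto simp: fun_eq_iff L_apply scaleR_fun_def Hsp.ip_simps)

lemma L_inj: assumes "v \<in> Hs" "w \<in> Hs" "L v = L w" shows "v = w"
proof (rule Hsp.eqI_nr[OF assms(1,2)])
  have "ipH v (v - w) = ipH w (v - w)"
    using fun_cong[OF assms(3), of "v - w"] assms(1,2) by (simp add: L_apply)
  then show "ipH (v - w) (v - w) \<le> 0" by (simp add: Hsp.ip_diff_left)
qed

lemma pts_X: "u \<in> pts X \<longleftrightarrow> (\<exists>w\<in>Hs. u = L w)"
proof
  assume "u \<in> pts X"
  then have add: "\<And>v w. v \<in> Hs \<Longrightarrow> w \<in> Hs \<Longrightarrow> u (v + w) = u v + u w"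
    and sc: "\<And>c v. v \<in> Hs \<Longrightarrow> u (c *\<^sub>R v) = c * u v"
    and z: "\<And>v. v \<notin> Hs \<Longrightarrow> u v = 0" and b: "\<exists>C. \<forall>v\<in>Hs. \<bar>u v\<bar> \<le> C * nrm Y v"
    by (auto simp: Hm1_def dual_sp_def bounded_ops_def real_sp_def pts_Y)
  from b obtain C where "\<And>v. v \<in> Hs \<Longrightarrow> \<bar>u v\<bar> \<le> C * Hsp.nr v" using nrm_Y by force
  from Hsp.Riesz[OF add sc this] obtain y where "y \<in> Hs" "\<And>v. v \<in> Hs \<Longrightarrow> u v = ipH y v" by blast
  then show "\<exists>w\<in>Hs. u = L w" using z by (intro bexI[of _ y]) (auto simp: fun_eq_iff L_apply)
next
  assume "\<exists>w\<in>Hs. u = L w"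
  then obtain w where w: "w \<in> Hs" "u = L w" by blast
  have "\<bar>ipH w v\<bar> \<le> Hsp.nr w * nrm Y v" if "v \<in> Hs" for v
    using Hsp.Cauchy_Schwarz[of w v] nrm_Y[OF that] by simp
  then show "u \<in> pts X"
    using w(1) unfolding w(2) by (auto simp: Hm1_def dual_sp_def bounded_ops_def real_sp_def pts_Y L_apply Hsp.ip_simps
        intro!: exI[of _ "Hsp.nr w"])
qed

lemma L_pts: "w \<in> Hs \<Longrightarrow> L w \<in> pts X"
  by (auto simp: pts_X)

lemma nrm_X: assumes w: "w \<in> Hs" shows "nrm X (L w) = Hsp.nr w"
proof -
  have "nrm X (L w) = Sup {\<bar>L w x\<bar> |x. x \<in> Hs \<and> nrm Y x \<le> 1}"
    by (simp add: Hm1_def dual_sp_def op_norm_def real_sp_def pts_Y)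
  also have "{\<bar>L w x\<bar> |x. x \<in> Hs \<and> nrm Y x \<le> 1} = {\<bar>ipH w x\<bar> |x. x \<in> Hs \<and> Hsp.nr x \<le> 1}"
    using w nrm_Y by (auto simp: L_apply)
  also have "Sup \<dots> = Hsp.nr w"
  proof (rule cSup_eq_maximum)
    show "Hsp.nr w \<in> {\<bar>ipH w x\<bar> |x. x \<in> Hs \<and> Hsp.nr x \<le> 1}"
    proof (cases "Hsp.nr w = 0")
      case True
      then show ?thesis by (auto intro!: exI[of _ 0])
    next
      case False
      then have p: "0 < Hsp.nr w" using Hsp.nr_nonneg[of w] by linarith
      have "ipH w ((1 / Hsp.nr w) *\<^sub>R w) = Hsp.nr w"
        using p by (simp add: Hsp.ip_scale_right power2_eq_square flip: Hsp.nr_square)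
      then show ?thesis using w p
        by (auto intro!: exI[of _ "(1 / Hsp.nr w) *\<^sub>R w"] simp: Hsp.nr_scale)
    qed
    show "a \<le> Hsp.nr w" if "a \<in> {\<bar>ipH w x\<bar> |x. x \<in> Hs \<and> Hsp.nr x \<le> 1}" for a
      using that order_trans[OF Hsp.Cauchy_Schwarz mult_left_le[OF _ Hsp.nr_nonneg]] by blast
  qed
  finally show ?thesis .
qed

lemma S_L: assumes w: "w \<in> Hs" shows "S (L w) = obs.P w"
proof -
  have "obstacle_VI \<Omega> \<psi> (L w) y \<longleftrightarrow> obs.solves w y" for y
  proof (cases "y \<in> K")
    case True
    then have y: "y \<in> Hs" by (simp add: K_iff)
    have "(L y - L w) (v - y) = ipH (y - w) (v - y)" if "v \<in> K" for v
      using that y w by (simp add: L_diff L_apply K_iff)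
    then show ?thesis using True by (simp add: obstacle_VI_def obs.solves_def flip: K_def)
  next
    case False
    then show ?thesis by (simp add: obstacle_VI_def obs.solves_def flip: K_def)
  qed
  then show ?thesis by (simp add: obstacle_S_def obs.P_def)
qed

text \<open>The projection onto the critical cone is the limit along every null sequence of step
  sizes, hence along the filter; uniqueness of limits gives the converse.\<close>

lemma dir_deriv_iff:
  assumes u: "u \<in> Hs" and h: "h \<in> Hs"
  shows "has_dir_deriv X Y S (L u) (L h) d \<longleftrightarrow> obs.has_deriv u h d"
proof -
  define Q where "Q t = (1 / t) *\<^sub>R (obs.P (u + t *\<^sub>R h) - obs.P u)" for t
  have QH: "Q t \<in> Hs" for t by (simp add: Q_def)
  have S: "S (L u + t *\<^sub>R L h) = obs.P (u + t *\<^sub>R h)" for t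
    using u h by (simp add: L_scale L_add S_L)
  have hd: "has_dir_deriv X Y S (L u) (L h) d \<longleftrightarrow> d \<in> Hs \<and> ((\<lambda>t. Hsp.nr (Q t - d)) \<longlongrightarrow> 0) (at_right 0)" for d
    unfolding has_dir_deriv_def S S_L[OF u] pts_Y
    by (auto simp: Q_def[symmetric] nrm_Y QH)
  have lim: "has_dir_deriv X Y S (L u) (L h) d" if d: "obs.has_deriv u h d" for d
    unfolding hd
  proof
    show "d \<in> Hs" by (rule obs.has_deriv_H[OF d])
    show "((\<lambda>t. Hsp.nr (Q t - d)) \<longlongrightarrow> 0) (at_right 0)"
    proof (rule tendsto_at_right_sequentially[of 0 1])
      fix s :: "nat \<Rightarrow> real" assume s: "\<And>n. 0 < s n" "s \<longlonglongrightarrow> 0"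
      from obs.quotient_sconv[OF d u h h Hsp.sconv_const s]
      show "(\<lambda>n. Hsp.nr (Q (s n) - d)) \<longlonglongrightarrow> 0" by (simp add: Hsp.sconv_def Q_def)
    qed simp
  qed
  obtain d' where d': "obs.has_deriv u h d'" using obs.has_deriv_exists[OF u h] by blast
  have "d = d'" if "has_dir_deriv X Y S (L u) (L h) d"
  proof -
    have H: "d \<in> Hs" "d' \<in> Hs" using that lim[OF d'] by (auto simp: hd)
    have "((\<lambda>t. Hsp.nr (Q t - d) + Hsp.nr (Q t - d')) \<longlongrightarrow> 0) (at_right 0)"
      using that lim[OF d'] by (intro tendsto_add_zero) (auto simp: hd)
    moreover have "Hsp.nr (d - d') \<le> Hsp.nr (Q t - d) + Hsp.nr (Q t - d')" for t
      using Hsp.nr_diff_triangle[of d d' "Q t"] Hsp.nr_commute[of d "Q t"] by simp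
    ultimately have "Hsp.nr (d - d') \<le> 0"
      by (intro tendsto_lowerbound) (auto intro!: always_eventually)
    then have "Hsp.nr (d - d') = 0" using Hsp.nr_nonneg[of "d - d'"] by linarith
    then show ?thesis using Hsp.nr_eq_0D[of "d - d'"] H by simp
  qed
  then show ?thesis using lim d' by blast
qed

lemma dir_deriv_eq:
  assumes "u \<in> Hs" "h \<in> Hs" "obs.has_deriv u h d" shows "dir_deriv X Y S (L u) (L h) = d"
  unfolding dir_deriv_def dir_deriv_iff[OF assms(1,2)]
  by (rule the_equality, rule assms(3)) (rule obs.has_deriv_unique[OF _ assms(3)])

lemma gateaux_deriv_eq:
  assumes "u \<in> Hs" "h \<in> Hs" "obs.has_deriv u h d" shows "gateaux_deriv X Y S (L u) (L h) = d"
  using dir_deriv_eq[OF assms] assms by (simp add: gateaux_deriv_def zero_ext_def L_pts)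

lemma gateaux_has_deriv:
  assumes u: "u \<in> Hs" and h: "h \<in> Hs"
  shows "obs.has_deriv u h (gateaux_deriv X Y S (L u) (L h))"
proof -
  obtain d where "obs.has_deriv u h d" using obs.has_deriv_exists[OF u h] by blast
  with gateaux_deriv_eq[OF u h this] show ?thesis by simp
qed

text \<open>Along the points \<open>u - c n *\<^sub>R \<mu>\<close> the Gateaux derivative is one
  and the same operator, so the required weak limit is that of a constant sequence.\<close>

lemma bouligand_nonempty:
  assumes u: "u \<in> Hs" shows "bouligand_sw X Y S (L u) \<noteq> {}"
proof -
  obtain \<mu> G where mu: "\<mu> \<in> Hs" and G: "\<And>c h. c > 0 \<Longrightarrow> h \<in> Hs \<Longrightarrow> obs.has_deriv (u - c *\<^sub>R \<mu>) h (G h)"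
    "\<And>h k. h \<in> Hs \<Longrightarrow> k \<in> Hs \<Longrightarrow> G (h + k) = G h + G k" "\<And>c h. h \<in> Hs \<Longrightarrow> G (c *\<^sub>R h) = c *\<^sub>R G h"
    using obs.regular_points[OF u] by blast
  define c where "c n = inverse (real (Suc n))" for n
  have c: "0 < c n" for n by (simp add: c_def)
  define us where "us n = u - c n *\<^sub>R \<mu>" for n
  have us: "us n \<in> Hs" for n using u mu by (simp add: us_def)
  have GH: "G h \<in> Hs" if "h \<in> Hs" for h using obs.has_deriv_H[OF G(1)[OF c that]] .
  define D where "D = gateaux_deriv X Y S (L (us 0))"
  have D: "gateaux_deriv X Y S (L (us n)) (L h) = G h" if "h \<in> Hs" for n h
    using gateaux_deriv_eq[OF us that, of n] G(1)[OF c that, of n] by (simp add: us_def)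
  have D_out: "gateaux_deriv X Y S (L (us n)) x = 0" if "x \<notin> pts X" for n x
    using that by (simp add: gateaux_deriv_def zero_ext_def)
  have ops: "gateaux_deriv X Y S (L (us n)) \<in> bounded_ops X Y" for n
    unfolding bounded_ops_def mem_Collect_eq
  proof (intro conjI ballI allI impI)
    show "gateaux_deriv X Y S (L (us n)) x \<in> pts Y" if "x \<in> pts X" for x
      using that D GH by (auto simp: pts_X pts_Y)
    show "gateaux_deriv X Y S (L (us n)) (x + y) = gateaux_deriv X Y S (L (us n)) x + gateaux_deriv X Y S (L (us n)) y"
      if "x \<in> pts X" "y \<in> pts X" for x y
      using that D G(2) by (auto simp: pts_X L_add)
    show "gateaux_deriv X Y S (L (us n)) (a *\<^sub>R x) = a *\<^sub>R gateaux_deriv X Y S (L (us n)) x" if "x \<in> pts X" for a x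
      using that D G(3) by (auto simp: pts_X L_scale)
    show "\<exists>C. \<forall>x\<in>pts X. nrm Y (gateaux_deriv X Y S (L (us n)) x) \<le> C * nrm X x"
      using obs.has_deriv_nr[OF G(1)[OF c]] GH D by (intro exI[of _ 1]) (auto simp: pts_X nrm_X nrm_Y)
  qed (rule D_out)
  have gp: "L (us n) \<in> gateaux_points X Y S" for n
    unfolding gateaux_points_def mem_Collect_eq
  proof (intro conjI ballI ops L_pts us)
    fix h assume "h \<in> pts X"
    then obtain k where k: "k \<in> Hs" "h = L k" unfolding pts_X by blast
    then show "\<exists>d. has_dir_deriv X Y S (L (us n)) h d"
      using dir_deriv_iff[OF us k(1)] obs.has_deriv_exists[OF us k(1)] by blast
  qed
  have "strong_lim X (\<lambda>n. L (us n)) (L u)"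
  proof -
    have "nrm X (L (us n) - L u) = c n * Hsp.nr \<mu>" for n
      using us u c[of n] mu by (simp add: L_diff nrm_X us_def Hsp.nr_scale)
    moreover have "(\<lambda>n. c n * Hsp.nr \<mu>) \<longlonglongrightarrow> 0"
      unfolding c_def by (rule tendsto_mult_left_zero[OF LIMSEQ_inverse_real_of_nat])
    ultimately show ?thesis by (simp add: strong_lim_def)
  qed
  moreover have "weak_lim Y (\<lambda>n. gateaux_deriv X Y S (L (us n)) h) (D h)" if "h \<in> pts X" for h
  proof -
    obtain k where k: "k \<in> Hs" "h = L k" using \<open>h \<in> pts X\<close> unfolding pts_X by blast
    show ?thesis unfolding weak_lim_def D_def k(2) by (simp add: D[OF k(1)])
  qed
  ultimately have "D \<in> bouligand_sw X Y S (L u)"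
    unfolding bouligand_sw_def using ops[of 0] gp by (auto simp: D_def intro!: exI[of _ "\<lambda>n. L (us n)"])
  then show ?thesis by blast
qed

text \<open>Testing with the functionals \<open>L w\<close> turns the weak limits of the definition
  into \<open>wconv\<close>, with boundedness from \<open>has_deriv_nr\<close>, so that
  \<open>Bouligand_limit\<close> applies.\<close>

lemma bouligand_properties:
  assumes u: "u \<in> Hs" and G: "G \<in> bouligand_sw X Y S (L u)"
  shows "z \<in> Hs \<Longrightarrow> G (L (z - u)) \<le> obs.P z - obs.P u"
    and "h \<in> Hs \<Longrightarrow> ipH (G (L h)) (G (L h)) \<le> ipH h (G (L h))"
    and "h \<in> Hs \<Longrightarrow> G (L h) \<in> Hs"
proof -
  obtain xs where xs: "\<And>n. xs n \<in> gateaux_points X Y S" "strong_lim X xs (L u)"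
    "\<And>h. h \<in> pts X \<Longrightarrow> weak_lim Y (\<lambda>n. gateaux_deriv X Y S (xs n) h) (G h)"
    and Gb: "G \<in> bounded_ops X Y"
    using G unfolding bouligand_sw_def by blast
  have "\<exists>w. w \<in> Hs \<and> xs n = L w" for n using xs(1)[of n] by (auto simp: gateaux_points_def pts_X)
  then obtain ws where ws: "\<And>n. ws n \<in> Hs" "\<And>n. xs n = L (ws n)" by metis
  show GH: "G (L h) \<in> Hs" if "h \<in> Hs" for h
    using Gb L_pts[OF that] by (auto simp: bounded_ops_def pts_Y)
  define Gs where "Gs n h = gateaux_deriv X Y S (L (ws n)) (L h)" for n h
  have Gs: "obs.has_deriv (ws n) h (Gs n h)" if "h \<in> Hs" for n h
    unfolding Gs_def by (rule gateaux_has_deriv[OF ws(1) that])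
  have Gs_add: "Gs n (h + k) = Gs n h + Gs n k" if "h \<in> Hs" "k \<in> Hs" for n h k
  proof -
    have "gateaux_deriv X Y S (L (ws n)) \<in> bounded_ops X Y"
      using xs(1)[of n] by (simp add: gateaux_points_def ws)
    then show ?thesis
      using L_pts[OF that(1)] L_pts[OF that(2)] by (simp add: bounded_ops_def Gs_def that flip: L_add)
  qed
  have sc: "Hsp.sconv ws u"
    using xs(2) by (simp add: strong_lim_def Hsp.sconv_def ws L_diff u nrm_X)
  have wl: "Hsp.wconv (\<lambda>n. Gs n h) (G (L h))" if h: "h \<in> Hs" for h
    unfolding Hsp.wconv_def
  proof (intro conjI allI ballI)
    show GsH: "Gs n h \<in> Hs" for n by (rule obs.has_deriv_H[OF Gs[OF h]])
    show "G (L h) \<in> Hs" by (rule GH[OF h])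
    show "\<exists>C. \<forall>n. Hsp.nr (Gs n h) \<le> C" using obs.has_deriv_nr[OF Gs[OF h]] by blast
    fix w assume w: "w \<in> Hs"
    have "L w \<in> pts (dual_sp Y)" using L_pts[OF w] by (simp add: Hm1_def)
    then have "(\<lambda>n. L w (gateaux_deriv X Y S (xs n) (L h))) \<longlonglongrightarrow> L w (G (L h))"
      using xs(3)[OF L_pts[OF h]] by (simp add: weak_lim_def)
    then show "(\<lambda>n. ipH (Gs n h) w) \<longlonglongrightarrow> ipH (G (L h)) w"
      using GsH GH[OF h] w by (simp add: L_apply ws Hsp.ip_commute[of _ w] flip: Gs_def)
  qed
  note B = obs.Bouligand_limit[OF ws(1) sc u Gs Gs_add wl]
  show "z \<in> Hs \<Longrightarrow> G (L (z - u)) \<le> obs.P z - obs.P u" by (rule B(1))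
  show "h \<in> Hs \<Longrightarrow> ipH (G (L h)) (G (L h)) \<le> ipH h (G (L h))" by (rule B(2))
qed

lemma bouligand_op:
  assumes "G \<in> bouligand_sw X Y S x"
  shows "h \<in> Hs \<Longrightarrow> k \<in> Hs \<Longrightarrow> G (L (h + k)) = G (L h) + G (L k)"
    and "h \<in> Hs \<Longrightarrow> G (L (c *\<^sub>R h)) = c *\<^sub>R G (L h)"
  using assms L_pts by (auto simp: bouligand_sw_def bounded_ops_def simp flip: L_add L_scale)

section \<open>Newton differentiability on Lebesgue spaces\<close>

definition J :: "'a L0 \<Rightarrow> 'a L0" where "J f = (SOME w. w \<in> Hs \<and> Lp_embed \<Omega> f = L w)"

lemma newton_differentiable_Lp:
  assumes p: "admissible p"
  shows "newton_differentiable (Lp \<Omega> p) (H10 \<Omega>) (obstacle_S_Lp \<Omega> \<psi>) (obstacle_DS \<Omega> \<psi> p)"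
proof -
  define Z where "Z = Lp \<Omega> p"
  obtain N C where NC: "\<And>f v. f \<in> pts Z \<Longrightarrow> v \<in> Hs \<Longrightarrow> integrable lebesgue (\<lambda>x. rep_L0 f x * rep_L0 v x)"
    "\<And>f v. f \<in> pts Z \<Longrightarrow> v \<in> Hs \<Longrightarrow> \<bar>ip2 f v\<bar> \<le> nrm Z f * N v"
    and C: "\<And>v. v \<in> Hs \<Longrightarrow> N v \<le> C * Hsp.nr v"
    and N0: "\<And>xs. Hsp.wconv xs 0 \<Longrightarrow> (\<lambda>n. N (xs n)) \<longlonglongrightarrow> 0"
    using Lp_pairing[OF p] unfolding Z_def by blast
  have Z_nonneg: "0 \<le> nrm Z f" if "f \<in> pts Z" for f
  using p
  proof (cases rule: admissible_cases)
    case 1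
    \<comment> \<open>The essential supremum of an absolute value can be negative only over a null
      set, which a nonempty open set is not.\<close>
    let ?e = "esssup (lebesgue_on \<Omega>) (\<lambda>x. ereal \<bar>rep_L0 f x\<bar>)"
    have "0 \<le> ?e"
    proof (rule ccontr)
      assume neg: "\<not> 0 \<le> ?e"
      have "AE x in lebesgue_on \<Omega>. ereal \<bar>rep_L0 f x\<bar> \<le> ?e" by (rule esssup_AE)
      then have "AE x in lebesgue_on \<Omega>. False"
      proof eventually_elim
        case (elim x)
        have "(0::ereal) \<le> ereal \<bar>rep_L0 f x\<bar>" by simp
        with elim neg show False by (meson order_trans)
      qed
      then have "AE x in lebesgue. x \<notin> \<Omega>" by (simp add: AE_on_iff)
      then have "negligible \<Omega>"
        using AE_iff_null_sets[of \<Omega> lebesgue] open_\<Omega> by (simp add: negligible_iff_null_sets)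
      then show False using open_not_negligible[OF open_\<Omega> nonempty_\<Omega>] by blast
    qed
    then show ?thesis using 1 by (simp add: Z_def Lp_def real_of_ereal_pos)
  next
    case 2
    then show ?thesis by (simp add: Z_def Lp_def)
  qed
  have emb: "Lp_embed \<Omega> f v = (if v \<in> Hs then ip2 f v else 0)" for f v
    by (simp add: Lp_embed_def zero_ext_def pts_Y integral_pair_on)
  have J: "J f \<in> Hs" "Lp_embed \<Omega> f = L (J f)" if f: "f \<in> pts Z" for f
  proof -
    have "\<exists>w\<in>Hs. \<forall>v\<in>Hs. ip2 f v = ipH w v"
    proof (rule Hsp.Riesz)
      show "ip2 f (v + w) = ip2 f v + ip2 f w" if "v \<in> Hs" "w \<in> Hs" for v w
      proof -
        have "ip2 (v + w) f = ip2 v f + ip2 w f"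
          by (rule ip2_add_integrable) (use NC(1)[OF f that(1)] NC(1)[OF f that(2)] in \<open>simp_all add: mult.commute\<close>)
        then show ?thesis by (simp add: ip2_commute[of f])
      qed
      show "ip2 f (c *\<^sub>R v) = c * ip2 f v" for c v
        using ip2_scale[of c v f] by (simp add: ip2_commute[of f])
      fix v assume v: "v \<in> Hs"
      have "nrm Z f * N v \<le> nrm Z f * (C * Hsp.nr v)"
        by (rule mult_left_mono[OF C[OF v] Z_nonneg[OF f]])
      then show "\<bar>ip2 f v\<bar> \<le> (nrm Z f * C) * Hsp.nr v" using NC(2)[OF f v] by (simp add: mult_ac)
    qed
    then obtain w where "w \<in> Hs" "\<And>v. v \<in> Hs \<Longrightarrow> ip2 f v = ipH w v" by blast
    then have "\<exists>w. w \<in> Hs \<and> Lp_embed \<Omega> f = L w"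
      by (intro exI[of _ w]) (auto simp: fun_eq_iff emb L_apply)
    from someI_ex[OF this] show "J f \<in> Hs" "Lp_embed \<Omega> f = L (J f)" by (auto simp: J_def)
  qed
  have J_ip: "ipH (J f) v = ip2 f v" if "f \<in> pts Z" "v \<in> Hs" for f v
    using fun_cong[OF J(2)[OF that(1)], of v] J(1)[OF that(1)] that(2) by (simp add: emb L_apply)
  have Z_add: "f + g \<in> pts Z" if "f \<in> pts Z" "g \<in> pts Z" for f g
    using Lp_add[OF p] that by (simp add: Z_def)
  have Z_scale: "c *\<^sub>R f \<in> pts Z" if "f \<in> pts Z" for c f
    using Lp_scale[OF p] that by (simp add: Z_def)
  have J_eqI: "J f = w" if "f \<in> pts Z" "w \<in> Hs" "\<And>v. v \<in> Hs \<Longrightarrow> ip2 f v = ipH w v" for f w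
    by (rule L_inj[OF J(1)[OF that(1)] that(2)])
       (auto simp: fun_eq_iff L_apply J(1)[OF that(1)] that J_ip[OF that(1)])
  have J_add: "J (f + g) = J f + J g" if "f \<in> pts Z" "g \<in> pts Z" for f g
    by (rule J_eqI) (use that in \<open>simp_all add: Z_add J ip2_add_integrable NC(1) Hsp.ip_add_left J_ip\<close>)
  have J_scale: "J (c *\<^sub>R f) = c *\<^sub>R J f" if "f \<in> pts Z" for c f
    by (rule J_eqI) (use that in \<open>simp_all add: Z_scale J ip2_scale Hsp.ip_scale_left J_ip\<close>)
  have J_nr: "Hsp.nr (J f) \<le> nrm Z f * \<bar>C\<bar>" if f: "f \<in> pts Z" for f
  proof (cases "Hsp.nr (J f) = 0")
    case True
    then show ?thesis using Z_nonneg[OF f] by simp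
  next
    case False
    then have pos: "0 < Hsp.nr (J f)" using Hsp.nr_nonneg[of "J f"] by linarith
    have "Hsp.nr (J f) * Hsp.nr (J f) = ip2 f (J f)"
      using J_ip[OF f J(1)[OF f]] Hsp.nr_square[of "J f"] by (simp add: power2_eq_square)
    also have "\<dots> \<le> nrm Z f * N (J f)" using NC(2)[OF f J(1)[OF f]] by linarith
    also have "\<dots> \<le> nrm Z f * (\<bar>C\<bar> * Hsp.nr (J f))"
      using order_trans[OF C[OF J(1)[OF f]] mult_right_mono[OF abs_ge_self Hsp.nr_nonneg]]
      by (intro mult_left_mono Z_nonneg f)
    finally show ?thesis using pos by (simp add: mult.assoc[symmetric])
  qed
  have F: "obstacle_S_Lp \<Omega> \<psi> f = obs.P (J f)" if "f \<in> pts Z" for f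
    by (simp add: obstacle_S_Lp_def J[OF that] S_L)
  have DS: "obstacle_DS \<Omega> \<psi> p f = (\<lambda>G. zero_ext Z (\<lambda>h. G (Lp_embed \<Omega> h))) ` bouligand_sw X Y S (L (J f))"
    if "f \<in> pts Z" for f
    by (simp add: obstacle_DS_def J(2)[OF that] Z_def)
  have ops: "zero_ext Z (\<lambda>h. G (Lp_embed \<Omega> h)) \<in> bounded_ops Z Y"
    if f: "f \<in> pts Z" and G: "G \<in> bouligand_sw X Y S (L (J f))" for f G
  proof -
    note bp = bouligand_properties[OF J(1)[OF f] G] and bo = bouligand_op[OF G]
    have "nrm Y (G (L (J h))) \<le> \<bar>C\<bar> * nrm Z h" if h: "h \<in> pts Z" for h
      using order_trans[OF Hsp.nr_le_if_ip_le[OF bp(2)[OF J(1)[OF h]]] J_nr[OF h]] bp(3)[OF J(1)[OF h]]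
      by (simp add: nrm_Y mult.commute)
    then show ?thesis
      unfolding bounded_ops_def zero_ext_def
      by (auto simp: J Z_add Z_scale J_add J_scale bo pts_Y bp(3) intro!: exI[of _ "\<bar>C\<bar>"])
  qed
  \<comment> \<open>Compactness provides subsequences only, hence the argument by contradiction: a
    quotient staying above \<open>\<epsilon>\<close> along increments tending to zero would do so
    along a subsequence whose normalised directions converge strongly.\<close>
  have key: "\<exists>\<delta>>0. \<forall>h\<in>pts Z. 0 < nrm Z h \<longrightarrow> nrm Z h < \<delta> \<longrightarrow>
      (\<forall>G\<in>bouligand_sw X Y S (L (J (x + h))).
        Hsp.nr (obs.P (J (x + h)) - obs.P (J x) - G (L (J h))) / nrm Z h \<le> \<epsilon>)"
    if x: "x \<in> pts Z" and e: "\<epsilon> > 0" for x \<epsilon>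
  proof (rule ccontr)
    assume "\<not> ?thesis"
    then have neg: "\<forall>\<delta>>0. \<exists>h\<in>pts Z. 0 < nrm Z h \<and> nrm Z h < \<delta> \<and> (\<exists>G\<in>bouligand_sw X Y S (L (J (x + h))).
        \<epsilon> < Hsp.nr (obs.P (J (x + h)) - obs.P (J x) - G (L (J h))) / nrm Z h)"
      by (meson not_le)
    have "\<forall>n. \<exists>h G. h \<in> pts Z \<and> 0 < nrm Z h \<and> nrm Z h < inverse (real (Suc n)) \<and> G \<in> bouligand_sw X Y S (L (J (x + h))) \<and>
        \<epsilon> < Hsp.nr (obs.P (J (x + h)) - obs.P (J x) - G (L (J h))) / nrm Z h"
    proof
      fix n
      have "0 < inverse (real (Suc n))" by simp
      with neg show "\<exists>h G. h \<in> pts Z \<and> 0 < nrm Z h \<and> nrm Z h < inverse (real (Suc n)) \<and> G \<in> bouligand_sw X Y S (L (J (x + h))) \<and>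
        \<epsilon> < Hsp.nr (obs.P (J (x + h)) - obs.P (J x) - G (L (J h))) / nrm Z h" by blast
    qed
    then obtain hs Gs where h: "\<And>n. hs n \<in> pts Z" "\<And>n. 0 < nrm Z (hs n)" "\<And>n. nrm Z (hs n) < inverse (real (Suc n))"
      and Gs: "\<And>n. Gs n \<in> bouligand_sw X Y S (L (J (x + hs n)))"
      and big: "\<And>n. \<epsilon> < Hsp.nr (obs.P (J (x + hs n)) - obs.P (J x) - Gs n (L (J (hs n)))) / nrm Z (hs n)"
      by metis
    define t where "t n = nrm Z (hs n)" for n
    have t: "0 < t n" for n by (simp add: t_def h)
    have t0: "t \<longlonglongrightarrow> 0"
      by (rule tendsto_sandwich[OF _ _ tendsto_const LIMSEQ_inverse_real_of_nat])
         (use h t in \<open>auto simp: t_def intro!: always_eventually less_imp_le\<close>)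
    define ks where "ks n = (1 / t n) *\<^sub>R J (hs n)" for n
    have JH: "J (hs n) \<in> Hs" "J x \<in> Hs" for n using J(1) h(1) x by blast+
    have ksH: "ks n \<in> Hs" for n using JH by (simp add: ks_def)
    have "Hsp.nr (ks n) \<le> \<bar>C\<bar>" for n
      using J_nr[OF h(1)[of n]] t[of n] by (simp add: ks_def Hsp.nr_scale t_def divide_le_eq mult.commute)
    from Hsp.weak_compactness[of ks, OF ksH this] obtain r k
      where r: "strict_mono r" and w: "Hsp.wconv (\<lambda>n. ks (r n)) k" by blast
    have kH: "k \<in> Hs" by (rule Hsp.wconv_lim[OF w])
    have w0: "Hsp.wconv (\<lambda>n. ks (r n) - k) 0" using Hsp.wconv_diff[OF w Hsp.wconv_const[OF kH]] by simp
    \<comment> \<open>Because the increments are normalised in \<open>Lp \<Omega> p\<close>, the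
      pairing of \<open>ks n\<close> with a vector v is at most \<open>N v\<close>. With v the
      difference from the weak limit, the compactness property of N upgrades weak to strong
      convergence.\<close>
    have "(\<lambda>n. ipH (ks (r n) - k) (ks (r n) - k)) \<longlonglongrightarrow> 0"
    proof (rule tendsto_sandwich[OF _ _ tendsto_const])
      have "(\<lambda>n. N (ks (r n) - k) - ipH k (ks (r n) - k)) \<longlonglongrightarrow> 0 - ipH k 0"
        by (intro tendsto_diff N0[OF w0] Hsp.wconvD'[OF w0 kH])
      then show "(\<lambda>n. N (ks (r n) - k) - ipH k (ks (r n) - k)) \<longlonglongrightarrow> 0" by simp
      have "ipH (ks n) (ks n - k) \<le> N (ks n - k)" for n
      proof -
        have "ipH (ks n) (ks n - k) = (1 / t n) * ip2 (hs n) (ks n - k)"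
          using J_ip[OF h(1)[of n], of "ks n - k"] ksH kH by (simp add: ks_def Hsp.ip_scale_left)
        also have "\<dots> \<le> (1 / t n) * (t n * N (ks n - k))"
          using NC(2)[OF h(1)[of n], of "ks n - k"] ksH kH t[of n]
          by (intro mult_left_mono) (simp_all add: t_def abs_le_iff)
        also have "\<dots> = N (ks n - k)" using t[of n] by simp
        finally show ?thesis .
      qed
      then show "\<forall>\<^sub>F n in sequentially. ipH (ks (r n) - k) (ks (r n) - k) \<le> N (ks (r n) - k) - ipH k (ks (r n) - k)"
        by (simp add: Hsp.ip_diff_left[of _ k])
    qed (simp add: Hsp.ip_nonneg)
    then have ks: "Hsp.sconv (\<lambda>n. ks (r n)) k" by (simp add: Hsp.sconv_def Hsp.nr_tendsto_0_iff)
    define g where "g n = Gs n (L (J (hs n)))" for n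
    have Jxh: "J (x + hs n) = J x + J (hs n)" for n using J_add[OF x h(1)] .
    have bp: "\<And>z. z \<in> Hs \<Longrightarrow> Gs n (L (z - (J x + J (hs n)))) \<le> obs.P z - obs.P (J x + J (hs n))"
      "\<And>k. k \<in> Hs \<Longrightarrow> ipH (Gs n (L k)) (Gs n (L k)) \<le> ipH k (Gs n (L k))"
      "\<And>k. k \<in> Hs \<Longrightarrow> Gs n (L k) \<in> Hs" for n
      using bouligand_properties[OF _ Gs[of n]] JH by (simp_all add: Jxh)
    have "(\<lambda>n. Hsp.nr (obs.P (J x + J (hs (r n))) - obs.P (J x) - g (r n)) / t (r n)) \<longlonglongrightarrow> 0"
    proof (rule obs.Newton_remainder[OF JH(2) JH(1) kH])
      show "Hsp.sconv (\<lambda>n. (1 / t (r n)) *\<^sub>R J (hs (r n))) k" using ks by (simp add: ks_def)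
      show "0 < t (r n)" for n by (rule t)
      show "(\<lambda>n. t (r n)) \<longlonglongrightarrow> 0" using LIMSEQ_subseq_LIMSEQ[OF t0 r] by (simp add: o_def)
      show "g (r n) \<in> Hs" for n using bp(3)[OF JH(1)] by (simp add: g_def)
      show "ipH (g (r n)) (g (r n)) \<le> ipH (J (hs (r n))) (g (r n))" for n using bp(2)[OF JH(1)] by (simp add: g_def)
      \<comment> \<open>The minorant of \<open>obs.P\<close> at \<open>J x + J (hs m)\<close> is
        evaluated at \<open>J x\<close>, where the increment is \<open>- J (hs m)\<close> and
        linearity reverses the inequality, and at the point with doubled increment.\<close>
      have neg: "Gs m (L (- J (hs m))) = - g m" for m
        using bouligand_op(2)[OF Gs[of m] JH(1)[of m], where c = "-1"] by (simp add: g_def)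
      show "obs.P (J x + J (hs (r n))) - obs.P (J x) \<le> g (r n)" for n
        using bp(1)[OF JH(2), of "r n"] neg[of "r n"] by (simp add: algebra_simps)
      show "g (r n) \<le> obs.P (J x + 2 *\<^sub>R J (hs (r n))) - obs.P (J x + J (hs (r n)))" for n
        using bp(1)[of "J x + 2 *\<^sub>R J (hs (r n))" "r n"] JH by (simp add: g_def scaleR_2 algebra_simps)
    qed
    from order_tendstoD(2)[OF this e] obtain n where
      "Hsp.nr (obs.P (J x + J (hs (r n))) - obs.P (J x) - g (r n)) / t (r n) < \<epsilon>"
      by (auto simp: eventually_sequentially)
    with big[of "r n"] show False by (simp add: g_def t_def Jxh)
  qed
  show ?thesis
    unfolding newton_differentiable_def Z_def[symmetric]
  proof (intro conjI ballI)
    show "obstacle_S_Lp \<Omega> \<psi> x \<in> pts Y" if "x \<in> pts Z" for x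
      by (simp add: F[OF that] pts_Y)
    show "obstacle_DS \<Omega> \<psi> p x \<noteq> {}" if "x \<in> pts Z" for x
      using bouligand_nonempty[OF J(1)[OF that]] by (simp add: DS[OF that])
    show "obstacle_DS \<Omega> \<psi> p x \<subseteq> bounded_ops Z Y" if "x \<in> pts Z" for x
      using ops[OF that] by (auto simp: DS[OF that])
    fix x assume x: "x \<in> pts Z"
    define R where "R h = (SUP G\<in>obstacle_DS \<Omega> \<psi> p (x + h). ereal (nrm Y (obstacle_S_Lp \<Omega> \<psi> (x + h) - obstacle_S_Lp \<Omega> \<psi> x - G h) / nrm Z h))" for h
    have R_eq: "R h = (SUP G\<in>bouligand_sw X Y S (L (J (x + h))). ereal (Hsp.nr (obs.P (J (x + h)) - obs.P (J x) - G (L (J h))) / nrm Z h))"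
      if h: "h \<in> pts Z" for h
      unfolding R_def DS[OF Z_add[OF x h]] image_image
    proof (rule SUP_cong[OF refl])
      fix G assume G: "G \<in> bouligand_sw X Y S (L (J (x + h)))"
      have "G (L (J h)) \<in> Hs" by (rule bouligand_properties(3)[OF J(1)[OF Z_add[OF x h]] G J(1)[OF h]])
      then show "ereal (nrm Y (obstacle_S_Lp \<Omega> \<psi> (x + h) - obstacle_S_Lp \<Omega> \<psi> x - zero_ext Z (\<lambda>h. G (Lp_embed \<Omega> h)) h) / nrm Z h) =
         ereal (Hsp.nr (obs.P (J (x + h)) - obs.P (J x) - G (L (J h))) / nrm Z h)"
        using h by (simp add: F[OF x] F[OF Z_add[OF x h]] zero_ext_def J(2) nrm_Y)
    qed
    have ev: "\<forall>\<^sub>F h in inf (filtercomap (nrm Z) (at_right 0)) (principal (pts Z)). 0 \<le> R h \<and> R h \<le> ereal \<epsilon>"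
      if e: "\<epsilon> > 0" for \<epsilon>
    proof -
      obtain \<delta> where d: "\<delta> > 0" "\<And>h G. h \<in> pts Z \<Longrightarrow> 0 < nrm Z h \<Longrightarrow> nrm Z h < \<delta> \<Longrightarrow> G \<in> bouligand_sw X Y S (L (J (x + h))) \<Longrightarrow>
          Hsp.nr (obs.P (J (x + h)) - obs.P (J x) - G (L (J h))) / nrm Z h \<le> \<epsilon>"
        using key[OF x e] by blast
      have "\<forall>\<^sub>F s in at_right 0. 0 < s \<and> s < \<delta>"
        using d(1) by (auto simp: eventually_at_right_field)
      then have "\<forall>\<^sub>F h in filtercomap (nrm Z) (at_right 0). 0 < nrm Z h \<and> nrm Z h < \<delta>"
        by (rule eventually_filtercomapI)
      then show ?thesis
        unfolding eventually_inf_principal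
      proof (rule eventually_mono, intro impI)
        fix h assume a: "0 < nrm Z h \<and> nrm Z h < \<delta>" and h: "h \<in> pts Z"
        \<comment> \<open>A member of the Bouligand differential keeps the supremum nonnegative;
          over an empty set it would be minus infinity.\<close>
        obtain G where G: "G \<in> bouligand_sw X Y S (L (J (x + h)))"
          using bouligand_nonempty[OF J(1)[OF Z_add[OF x h]]] by blast
        have "0 \<le> ereal (Hsp.nr (obs.P (J (x + h)) - obs.P (J x) - G (L (J h))) / nrm Z h)" using a by simp
        also have "\<dots> \<le> R h" unfolding R_eq[OF h] by (rule SUP_upper[OF G])
        finally have "0 \<le> R h" .
        moreover have "R h \<le> ereal \<epsilon>" unfolding R_eq[OF h]
          using d(2)[OF h] a by (intro SUP_least) simp
        ultimately show "0 \<le> R h \<and> R h \<le> ereal \<epsilon>" ..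
      qed
    qed
    have "(R \<longlongrightarrow> 0) (inf (filtercomap (nrm Z) (at_right 0)) (principal (pts Z)))"
    proof (rule order_tendstoI)
      fix a :: ereal assume "a < 0"
      then show "\<forall>\<^sub>F h in inf (filtercomap (nrm Z) (at_right 0)) (principal (pts Z)). a < R h"
        using ev[OF zero_less_one] by (auto elim!: eventually_mono intro: less_le_trans)
    next
      fix a :: ereal assume "0 < a"
      then obtain \<epsilon> where "0 < ereal \<epsilon>" "ereal \<epsilon> < a" using ereal_dense2 by blast
      then show "\<forall>\<^sub>F h in inf (filtercomap (nrm Z) (at_right 0)) (principal (pts Z)). R h < a"
        using ev[of \<epsilon>] by (auto elim!: eventually_mono intro: le_less_trans)
    qed
    then show "((\<lambda>h. SUP G\<in>obstacle_DS \<Omega> \<psi> p (x + h). ereal (nrm Y (obstacle_S_Lp \<Omega> \<psi> (x + h) - obstacle_S_Lp \<Omega> \<psi> x - G h) / nrm Z h)) \<longlongrightarrow> 0)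
          (inf (filtercomap (nrm Z) (at_right 0)) (principal (pts Z)))"
      by (simp add: R_def[abs_def])
  qed
qed

end

theorem theorem4p4:
  fixes \<Omega> :: "'a::euclidean_space set" and \<psi> :: "'a \<Rightarrow> ereal" and p :: ereal
  assumes "\<Omega> \<noteq> {}" and "open \<Omega>" and "bounded \<Omega>"
    and "\<psi> \<in> borel_measurable (lebesgue_on \<Omega>)"
    and "obstacle_set \<Omega> \<psi> \<noteq> {}"
    and "max 1 (ereal (2 * real DIM('a) / (real DIM('a) + 2))) < p"
  shows "newton_differentiable (Lp \<Omega> p) (H10 \<Omega>) (obstacle_S_Lp \<Omega> \<psi>) (obstacle_DS \<Omega> \<psi> p)"
proof -
  interpret obstacle_problem \<Omega> \<psi>
    using assms by unfold_locales
  show ?thesis by (rule newton_differentiable_Lp) (use assms(6) in \<open>simp add: admissible_def\<close>)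
qed

end
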